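(* For $\varepsilon>0$ small and $\mu>0$ with $\mu\varepsilon^{-3/2}$ small there holds, for all $(A_1,A_2)\in\mathbf T^1\times\mathbf T^{n-1}$, $$\widetilde G_\mu(A_1,A_2)=\mathrm{Const}+\big(\mu\Gamma_0(A_2)+R_0(\varepsilon,\mu,A_2)\big)+2\,\mathrm{Re}\Big[\big(\mu\Gamma_1(A_2)+R_1(\varepsilon,\mu,A_2)\big)e^{iA_1}\Big]+O\big(\mu\varepsilon^{-1/2}\|f\|e^{-\pi/\sqrt\varepsilon}\big),$$ where $$R_0(\varepsilon,\mu,A_2)=O\big(\mu^2\|f\|^2\big),\qquad R_1(\varepsilon,\mu,A_2)=O\Big(\frac{\mu^2\|f\|^2}{\varepsilon^2}e^{-\frac{\pi}{2\sqrt\varepsilon}}\Big),$$ the constants in the $O$'s being independent of $\varepsilon,\mu,A_1,A_2$. Here $\Gamma_0,\Gamma_1$ (which depend on $\varepsilon$) are the Fourier coefficients with respect to $A_1$, of index $0$ and $1$, of the Poincaré–Melnikov primitive $\Gamma$.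
   Context: Let $n\ge2$, $a\ge0$, $\beta=(\beta_2,\dots,\beta_n)\in\mathbf R^{n-1}$ fixed ($\beta=1$ if $n=2$), and $$\mathcal H=\frac{I_1}{\sqrt\varepsilon}+\varepsilon^a\beta\cdot I_2+\frac{p^2}2+(\cos q-1)+\mu(\cos q-1)f(\varphi_1,\varphi_2),\qquad I_1\in\mathbf R,\ I_2\in\mathbf R^{n-1},$$ i.e. the frequency vector is $\omega=\omega_\varepsilon=(\frac1{\sqrt\varepsilon},\varepsilon^a\beta)$. Here $\mathbf T^m=\mathbf R^m/2\pi\mathbf Z^m$, and $f:\mathbf T^n\to\mathbf R$ is analytic with respect to $\varphi_2$: $f$ extends analytically (in $\varphi_2$) to $D=\mathbf R\times(\mathbf R+i[-a_2,a_2])\times\dots\times(\mathbf R+i[-a_n,a_n])$ with $a_i>0$ for $i\ge2$, and $a_i>|\beta_i|\pi/2$ for $i\geq 2$ if $a=0$ (so "$a_1=0$"), with Fourier coefficients satisfying, for all $s\in\mathbf N$, $|f_k|\le\frac{C_s}{|k|^s}\exp(-\sum_{i\ge2}a_i|k_i|)$ for $k\ne0$. Set $\|f\|=\sup_D|f|$. The associated forced pendulum Lagrangian is $$\mathcal L_\mu(q,\dot q,t)=\frac{\dot q^2}2+(1-\cos q)+\mu(1-\cos q)f(\omega_\varepsilon t+A).$$ Let $q_\theta(t)=4\arctan(e^{t-\theta})$, $\psi_0(t)=\cosh^2(t)/(1+\cosh t)^3$, $\psi_\theta(t)=\psi_0(t-\theta)$. For $\mu$ small and all $A\in\mathbf T^n,\theta\in\mathbf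 R$ there are a unique function $Q^\mu_{A,\theta}$ near $q_\theta$ (tending to $0$ as $t\to-\infty$ and to $2\pi$ as $t\to+\infty$) and a constant $\alpha^\mu_{A,\theta}$ such that $$-\ddot Q^\mu_{A,\theta}+\sin Q^\mu_{A,\theta}=-\mu\sin Q^\mu_{A,\theta}\,f(\omega_\varepsilon t+A)+\alpha^\mu_{A,\theta}\psi_\theta(t),\qquad\int_{\mathbf R}\big(Q^\mu_{A,\theta}-q_\theta\big)\psi_\theta\,dt=0.$$ Set $\widetilde G_\mu(A)=\int_{\mathbf R}\mathcal L_\mu(Q^\mu_{A,0},\dot Q^\mu_{A,0},t)\,dt$. The Poincaré–Melnikov primitive is $\Gamma(A)=\int_{\mathbf R}(1-\cos q_0(t))f(\omega_\varepsilon t+A)\,dt$, and for $A=(A_1,A_2)\in\mathbf T^1\times\mathbf T^{n-1}$ one writes $\Gamma(A)=\sum_{k_1\in\mathbf Z}\Gamma_{k_1}(A_2)e^{ik_1A_1}$. *)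

theory Defs
  imports "HOL-Analysis.Analysis"
begin

text \<open>
  The index type \<open>'m\<close> enumerates the coordinates \<open>2, ..., n\<close>, so that \<open>n = CARD('m) + 1 \<ge> 2\<close> and
  \<open>\<real>\<^sup>n = \<real> \<times> \<real>\<^sup>n\<^sup>-\<^sup>1\<close> is the type \<open>real \<times> (real ^ 'm)\<close>.  Functions on the torus are
  functions on the covering space that are \<open>2\<pi>\<close>-periodic in every coordinate.
\<close>

definition torus_periodic :: "('v::euclidean_space \<Rightarrow> 'b) \<Rightarrow> bool" where
  "torus_periodic g \<longleftrightarrow> (\<forall>x. \<forall>b\<in>Basis. g (x + (2 * pi) *\<^sub>R b) = g x)"

definition fourier_coeff ::
  "(real \<times> (real ^ 'm) \<Rightarrow> real) \<Rightarrow> int \<Rightarrow> int ^ 'm \<Rightarrow> complex" where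
  "fourier_coeff f k1 k2 =
     (LINT \<phi>:cbox (0, 0) (2 * pi, \<chi> i. 2 * pi)|lborel.
        complex_of_real (f \<phi>) *
        cis (- (of_int k1 * fst \<phi> + (\<Sum>i\<in>UNIV. of_int (k2 $ i) * (snd \<phi>) $ i))))
     / (2 * pi) ^ (CARD('m) + 1)"

definition strip :: "real ^ 'm \<Rightarrow> (complex ^ 'm) set" where
  "strip w = {z. \<forall>i. \<bar>Im (z $ i)\<bar> \<le> w $ i}"

definition D_dom :: "real ^ 'm \<Rightarrow> (real \<times> (complex ^ 'm)) set" where
  "D_dom w = UNIV \<times> strip w"

definition sup_norm_D :: "real ^ 'm \<Rightarrow> (real \<times> (complex ^ 'm) \<Rightarrow> complex) \<Rightarrow> real" where
  "sup_norm_D w F = (SUP p\<in>D_dom w. cmod (F p))"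

text \<open>Holomorphy in several variables: the Frechet derivative exists and is complex-linear.\<close>

definition holomorphic_vec_on :: "(complex ^ 'm \<Rightarrow> complex) \<Rightarrow> (complex ^ 'm) set \<Rightarrow> bool" where
  "holomorphic_vec_on g U \<longleftrightarrow>
     (\<forall>z\<in>U. \<exists>L. (g has_derivative L) (at z) \<and> (\<forall>c v. L (c *s v) = c * L v))"

text \<open>
  \<open>F\<close> is the extension of \<open>f\<close> to \<open>D\<close>.  As \<open>D\<close> is closed in the \<open>\<phi>\<^sub>2\<close> directions, only holomorphy
  in the interior of the strip and continuity up to its boundary are required; this is implied by
  analyticity in a neighbourhood of \<open>D\<close>.
\<close>

definition analytic_extension ::
  "real ^ 'm \<Rightarrow> (real \<times> (real ^ 'm) \<Rightarrow> real) \<Rightarrow> (real \<times> (complex ^ 'm) \<Rightarrow> complex) \<Rightarrow> bool" where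
  "analytic_extension w f F \<longleftrightarrow>
     (\<forall>x y. F (x, \<chi> i. complex_of_real (y $ i)) = complex_of_real (f (x, y))) \<and>
     continuous_on (D_dom w) F \<and>
     (\<forall>x. holomorphic_vec_on (\<lambda>z. F (x, z)) (interior (strip w)))"

text \<open>Here \<open>|k|\<close> is the \<open>l\<^sup>1\<close>-norm; another norm only changes the constants \<open>C\<^sub>s\<close>.\<close>

definition fourier_decay :: "real ^ 'm \<Rightarrow> (real \<times> (real ^ 'm) \<Rightarrow> real) \<Rightarrow> bool" where
  "fourier_decay w f \<longleftrightarrow>
     (\<forall>s::nat. \<exists>C::real. \<forall>k1 k2. (k1, k2) \<noteq> (0, 0) \<longrightarrow>
        cmod (fourier_coeff f k1 k2)
          \<le> C / (\<bar>of_int k1\<bar> + (\<Sum>i\<in>UNIV. \<bar>of_int (k2 $ i)\<bar>)) ^ s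
             * exp (- (\<Sum>i\<in>UNIV. w $ i * \<bar>of_int (k2 $ i)\<bar>)))"

definition omega :: "real \<Rightarrow> real ^ 'm \<Rightarrow> real \<Rightarrow> real \<times> (real ^ 'm)" where
  "omega a \<beta> \<epsilon> = (1 / sqrt \<epsilon>, (\<epsilon> powr a) *\<^sub>R \<beta>)"

definition q_sep :: "real \<Rightarrow> real \<Rightarrow> real" where
  "q_sep \<theta> t = 4 * arctan (exp (t - \<theta>))"

definition psi0 :: "real \<Rightarrow> real" where
  "psi0 t = (cosh t)\<^sup>2 / (1 + cosh t) ^ 3"

definition psi :: "real \<Rightarrow> real \<Rightarrow> real" where
  "psi \<theta> t = psi0 (t - \<theta>)"

definition lagrangian ::
  "(real \<times> (real ^ 'm) \<Rightarrow> real) \<Rightarrow> real \<times> (real ^ 'm) \<Rightarrow> real \<Rightarrow> real \<times> (real ^ 'm)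
    \<Rightarrow> real \<Rightarrow> real \<Rightarrow> real \<Rightarrow> real" where
  "lagrangian f \<omega> \<mu> A q v t =
     v\<^sup>2 / 2 + (1 - cos q) + \<mu> * (1 - cos q) * f (t *\<^sub>R \<omega> + A)"

text \<open>
  The pair \<open>(Q, \<alpha>)\<close> solves the modified boundary value problem, where \<open>Q\<close> near \<open>q\<^sub>\<theta>\<close>
  means uniform distance at most \<open>r\<close>.
\<close>

definition perturbed_separatrix ::
  "real \<Rightarrow> (real \<times> (real ^ 'm) \<Rightarrow> real) \<Rightarrow> real \<times> (real ^ 'm) \<Rightarrow> real \<Rightarrow> real \<times> (real ^ 'm) \<Rightarrow> real
    \<Rightarrow> (real \<Rightarrow> real) \<times> real \<Rightarrow> bool" where
  "perturbed_separatrix r f \<omega> \<mu> A \<theta> = (\<lambda>(Q, \<alpha>).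
     (\<forall>t. Q field_differentiable (at t) \<and> deriv Q field_differentiable (at t) \<and>
        - deriv (deriv Q) t + sin (Q t)
          = - \<mu> * sin (Q t) * f (t *\<^sub>R \<omega> + A) + \<alpha> * psi \<theta> t) \<and>
     (Q \<longlongrightarrow> 0) at_bot \<and> (Q \<longlongrightarrow> 2 * pi) at_top \<and>
     (\<forall>t. \<bar>Q t - q_sep \<theta> t\<bar> \<le> r) \<and>
     (LINT t|lborel. (Q t - q_sep \<theta> t) * psi \<theta> t) = 0)"

definition Q_pert ::
  "real \<Rightarrow> (real \<times> (real ^ 'm) \<Rightarrow> real) \<Rightarrow> real \<times> (real ^ 'm) \<Rightarrow> real \<Rightarrow> real \<times> (real ^ 'm) \<Rightarrow> real
    \<Rightarrow> real \<Rightarrow> real" where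
  "Q_pert r f \<omega> \<mu> A \<theta> = fst (THE p. perturbed_separatrix r f \<omega> \<mu> A \<theta> p)"

definition G_tilde ::
  "real \<Rightarrow> (real \<times> (real ^ 'm) \<Rightarrow> real) \<Rightarrow> real \<times> (real ^ 'm) \<Rightarrow> real \<Rightarrow> real \<times> (real ^ 'm) \<Rightarrow> real" where
  "G_tilde r f \<omega> \<mu> A =
     (LINT t|lborel. lagrangian f \<omega> \<mu> A (Q_pert r f \<omega> \<mu> A 0 t) (deriv (Q_pert r f \<omega> \<mu> A 0) t) t)"

definition melnikov ::
  "(real \<times> (real ^ 'm) \<Rightarrow> real) \<Rightarrow> real \<times> (real ^ 'm) \<Rightarrow> real \<times> (real ^ 'm) \<Rightarrow> real" where
  "melnikov f \<omega> A = (LINT t|lborel. (1 - cos (q_sep 0 t)) * f (t *\<^sub>R \<omega> + A))"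

definition melnikov_coeff ::
  "(real \<times> (real ^ 'm) \<Rightarrow> real) \<Rightarrow> real \<times> (real ^ 'm) \<Rightarrow> int \<Rightarrow> real ^ 'm \<Rightarrow> complex" where
  "melnikov_coeff f \<omega> k A2 =
     (LINT x:{0..2 * pi}|lborel. complex_of_real (melnikov f \<omega> (x, A2)) * cis (- (of_int k * x)))
     / (2 * pi)"

end

theory Submission
  imports Defs "HOL-Complex_Analysis.Complex_Analysis"
begin

text \<open>
  Fix \<open>A\<^sub>2\<close>. As a function of \<open>A\<^sub>1\<close>, \<open>G - 8\<close> is \<open>2\<pi>\<close>-periodic, and it extends holomorphically to
  the strip \<open>|Im A\<^sub>1| < \<pi> / (2 \<surd>\<epsilon>) - 8\<close>, although \<open>f\<close> need not be analytic in its first angle. A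
  periodic function that is bounded by \<open>B\<close> at the heights \<open>\<plusminus>\<sigma>\<close> has a first Fourier coefficient of
  size \<open>B exp (- \<sigma>)\<close>, and the sum of all its harmonics of index at least two is \<open>O(B exp (- 2 \<sigma>))\<close>
  (\<open>fourier_strip_remainder\<close>). With \<open>\<sigma> = \<pi> / (2 \<surd>\<epsilon>) - 9\<close> this turns the bound
  \<open>G - 8 = O(\<mu> \<parallel>f\<parallel> / \<surd>\<epsilon>)\<close> at these heights into the error term, and the bound
  \<open>G - 8 - \<mu> \<Gamma> = O(\<mu>\<^sup>2 \<parallel>f\<parallel>\<^sup>2 / \<epsilon>\<^sup>2)\<close> into the estimate of \<open>R\<^sub>1\<close>. On the real axis the latter bound
  holds without the power of \<open>\<epsilon>\<close>, which gives \<open>R\<^sub>0\<close>. The constant is \<open>8\<close>, the action of the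
  unperturbed separatrix.

  The extension exists because a time shift by \<open>x\<close> trades the phase \<open>A\<^sub>1 + x / \<surd>\<epsilon>\<close> of the forcing
  against the centre of the separatrix: \<open>G\<close> at \<open>(A\<^sub>1 + x / \<surd>\<epsilon>, A\<^sub>2)\<close> is the action of the solution
  centred at \<open>x\<close> for the forcing \<open>F(t / \<surd>\<epsilon> + A\<^sub>1, A\<^sub>2 + \<epsilon>\<^sup>a \<beta> (t - x))\<close>. Here \<open>x\<close> enters only the
  slow angles, in which \<open>F\<close> is holomorphic, and so \<open>x\<close> can be replaced by a complex centre \<open>\<eta>\<close>
  with \<open>|Im \<eta>|\<close> close to \<open>\<pi> / 2\<close>, the height of the poles of the separatrix. Write
  \<open>\<kappa> = cos (Im \<eta>)\<close>; it is comparable to the distance from the poles, and \<open>\<kappa> \<ge> 5 \<surd>\<epsilon>\<close> on the strip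
  that is used.

  At a complex centre the solution is sought as \<open>Q(t) = q(t - \<eta> + s) + w(t)\<close> with a scalar shift
  \<open>s\<close> and a profile \<open>w\<close> with \<open>w(0) = 0\<close>. Solving the linearised equation by reduction of order,
  with the multiplier \<open>\<alpha>\<close> fixed by the solvability condition, and correcting \<open>s\<close> by a Newton step
  for the orthogonality condition, gives a map on pairs \<open>(s, w)\<close>. In weighted sup norms adapted to
  the poles it sends a ball of radius \<open>O(\<mu> \<parallel>f\<parallel> / \<kappa>\<^sup>2)\<close> into the ball of an eighth of that radius
  as soon as \<open>\<mu> \<parallel>f\<parallel> / \<kappa>\<^sup>3\<close> is small; this is the smallness of \<open>\<mu> \<epsilon>\<^sup>-\<^sup>3\<^sup>/\<^sup>2\<close>. Being holomorphic
  along complex lines it is then a contraction (\<open>earle_hamilton_iteration\<close>), and the iterates,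
  hence the solution and its action, depend holomorphically on \<open>\<eta>\<close> (\<open>action_holomorphic\<close>). In the
  Lagrangian of \<open>q + w\<close> the terms linear in \<open>w\<close> form a total derivative up to a factor \<open>\<mu>\<close>, which
  gives both bounds on the action (\<open>action_expansion\<close>).

  For a real centre the construction yields a solution of the original problem (\<open>action_real\<close>). It
  is the only one near the separatrix: the difference of two solutions satisfies the linearised
  equation with a small right-hand side, and the linearised problem has a bounded inverse
  (\<open>linearized_bound\<close>, \<open>perturbed_separatrix_unique\<close>).
\<close>

section \<open>Holomorphic dependence and integrals over the line\<close>

text \<open>
  Schwarz's lemma for \<open>(f - f z0) / (2 B + e)\<close>; the slack \<open>e > 0\<close>, which tends to zero in the end,
  gives the strict bound that the lemma asks for and covers \<open>B = 0\<close>.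
\<close>

lemma holomorphic_bounded_lipschitz:
  fixes f :: "complex \<Rightarrow> complex"
  assumes hol: "f holomorphic_on ball z0 \<rho>" and bd: "\<And>z. z \<in> ball z0 \<rho> \<Longrightarrow> cmod (f z) \<le> B"
    and z: "z \<in> ball z0 \<rho>"
  shows "cmod (f z - f z0) \<le> 2 * B / \<rho> * cmod (z - z0)"
proof -
  have \<rho>: "\<rho> > 0" using z by (metis dist_not_less_zero mem_ball order_le_less_trans zero_le_dist)
  have B: "B \<ge> 0" using bd[of z0] \<rho> by (meson centre_in_ball norm_ge_zero order_trans)
  define \<xi> where "\<xi> = (z - z0) / of_real \<rho>"
  have \<xi>: "cmod \<xi> < 1" using z \<rho> by (simp add: \<xi>_def norm_divide dist_norm norm_minus_commute)
  have inb: "z0 + of_real \<rho> * x \<in> ball z0 \<rho>" if "cmod x < 1" for x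
    using that \<rho> by (simp add: dist_norm norm_mult)
  have E: "cmod (f z - f z0) \<le> (2 * B + e) * cmod \<xi>" if "e > 0" for e
  proof -
    define g where "g x = (f (z0 + of_real \<rho> * x) - f z0) / of_real (2 * B + e)" for x
    have holg: "g holomorphic_on ball 0 1"
      unfolding g_def
      by (intro holomorphic_intros holomorphic_on_compose_gen[OF _ hol, unfolded o_def])
         (use that B inb in \<open>auto simp: complex_eq_iff\<close>)
    have no: "cmod (g x) < 1" if "cmod x < 1" for x
    proof -
      have "cmod (f (z0 + of_real \<rho> * x) - f z0) \<le> B + B"
        using bd[OF inb[OF that]] bd[of z0] \<rho> by (intro order_trans[OF norm_triangle_ineq4] add_mono) auto
      thus ?thesis using \<open>e > 0\<close> B by (simp add: g_def norm_divide del: of_real_add of_real_mult)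
    qed
    have "cmod (g \<xi>) \<le> cmod \<xi>"
      by (rule Schwarz_Lemma(1)[OF holg _ no \<xi>]) (auto simp: g_def)
    moreover have "z0 + of_real \<rho> * \<xi> = z" using \<rho> by (simp add: \<xi>_def)
    ultimately have "cmod ((f z - f z0) / of_real (2 * B + e)) \<le> cmod \<xi>" by (simp only: g_def)
    moreover have pos: "2 * B + e > 0" using that B by simp
    ultimately have "cmod (f z - f z0) / (2 * B + e) \<le> cmod \<xi>"
      by (simp only: norm_divide norm_of_real abs_of_pos)
    thus ?thesis using pos by (metis pos_divide_le_eq mult.commute)
  qed
  have "cmod (f z - f z0) \<le> 2 * B * cmod \<xi> + e" if "e > 0" for e
  proof -
    have "cmod (f z - f z0) \<le> (2 * B + e) * cmod \<xi>" by (rule E[OF that])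
    also have "\<dots> \<le> 2 * B * cmod \<xi> + e" using \<xi> that by (simp add: algebra_simps mult_left_le)
    finally show ?thesis .
  qed
  hence "cmod (f z - f z0) \<le> 2 * B * cmod \<xi>" by (rule field_le_epsilon)
  thus ?thesis using \<rho> by (simp add: \<xi>_def norm_divide)
qed

text \<open>
  The integrable bound \<open>m\<close> on \<open>k\<close> alone already dominates the difference quotients, by the
  preceding Lipschitz estimate, so dominated convergence applies to them.
\<close>

lemma holomorphic_on_lebesgue_integral:
  fixes k :: "complex \<Rightarrow> 'a \<Rightarrow> complex"
  assumes "open U"
    and hol: "\<And>t. (\<lambda>\<zeta>. k \<zeta> t) holomorphic_on U"
    and meas: "\<And>\<zeta>. \<zeta> \<in> U \<Longrightarrow> k \<zeta> \<in> borel_measurable M"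
    and bd: "\<And>\<zeta> t. \<zeta> \<in> U \<Longrightarrow> cmod (k \<zeta> t) \<le> m t"
    and m: "integrable M m"
  shows "(\<lambda>\<zeta>. \<integral>t. k \<zeta> t \<partial>M) holomorphic_on U"
proof (rule holomorphic_onI)
  fix \<zeta>0 assume z0: "\<zeta>0 \<in> U"
  obtain \<rho> where \<rho>: "\<rho> > 0" "ball \<zeta>0 \<rho> \<subseteq> U" using z0 \<open>open U\<close> by (auto simp: open_contains_ball)
  define D where "D \<zeta> t = (if \<zeta> \<in> ball \<zeta>0 \<rho> \<and> \<zeta> \<noteq> \<zeta>0 then (k \<zeta> t - k \<zeta>0 t) / (\<zeta> - \<zeta>0) else 0)" for \<zeta> t
  define d where "d t = deriv (\<lambda>\<zeta>. k \<zeta> t) \<zeta>0" for t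
  have Dlim: "((\<lambda>\<zeta>. D \<zeta> t) \<longlongrightarrow> d t) (at \<zeta>0)" for t
  proof -
    have "((\<lambda>\<zeta>. k \<zeta> t) has_field_derivative d t) (at \<zeta>0)"
      unfolding d_def using hol \<open>open U\<close> z0 by (rule holomorphic_derivI)
    hence *: "((\<lambda>\<zeta>. (k \<zeta> t - k \<zeta>0 t) / (\<zeta> - \<zeta>0)) \<longlongrightarrow> d t) (at \<zeta>0)"
      by (simp add: has_field_derivative_iff)
    have "\<forall>\<^sub>F \<zeta> in at \<zeta>0. (k \<zeta> t - k \<zeta>0 t) / (\<zeta> - \<zeta>0) = D \<zeta> t"
      using \<rho>(1) by (auto simp: eventually_at D_def dist_commute intro!: exI[of _ \<rho>])
    from Lim_transform_eventually[OF * this] show ?thesis .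
  qed
  have intk: "integrable M (k \<zeta>)" if "\<zeta> \<in> U" for \<zeta>
    by (rule Bochner_Integration.integrable_bound[OF m meas[OF that]])
       (use bd[OF that] in \<open>auto intro: order_trans[OF _ abs_ge_self]\<close>)
  have Dm: "D \<zeta> \<in> borel_measurable M" for \<zeta>
    using meas[of \<zeta>] meas[OF z0] \<rho>(2) by (cases "\<zeta> \<in> ball \<zeta>0 \<rho> \<and> \<zeta> \<noteq> \<zeta>0") (auto simp: D_def[abs_def])
  have Db: "cmod (D \<zeta> t) \<le> 2 * m t / \<rho>" for \<zeta> t
  proof (cases "\<zeta> \<in> ball \<zeta>0 \<rho> \<and> \<zeta> \<noteq> \<zeta>0")
    case True
    have "cmod (k \<zeta> t - k \<zeta>0 t) \<le> 2 * m t / \<rho> * cmod (\<zeta> - \<zeta>0)"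
      by (rule holomorphic_bounded_lipschitz[of "\<lambda>\<zeta>. k \<zeta> t"])
         (use True \<rho> bd holomorphic_on_subset[OF hol] in auto)
    thus ?thesis using True by (simp add: D_def norm_divide divide_le_eq)
  next
    case False
    have "0 \<le> m t" using bd[OF z0, of t] norm_ge_zero order_trans by blast
    thus ?thesis using False \<rho> by (auto simp: D_def)
  qed
  have "((\<lambda>\<zeta>. \<integral>t. D \<zeta> t \<partial>M) \<longlongrightarrow> (\<integral>t. d t \<partial>M)) (at \<zeta>0)"
  proof (subst LIMSEQ_SEQ_conv[symmetric], intro allI impI)
    fix S :: "nat \<Rightarrow> complex" assume S: "(\<forall>n. S n \<noteq> \<zeta>0) \<and> S \<longlonglongrightarrow> \<zeta>0"
    have lim: "(\<lambda>n. D (S n) t) \<longlonglongrightarrow> d t" for t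
      using Dlim[of t] S by (subst (asm) LIMSEQ_SEQ_conv[symmetric]) auto
    have dm: "d \<in> borel_measurable M"
      by (rule borel_measurable_LIMSEQ_metric[OF Dm lim])
    show "(\<lambda>n. \<integral>t. D (S n) t \<partial>M) \<longlonglongrightarrow> (\<integral>t. d t \<partial>M)"
      by (rule integral_dominated_convergence[where w = "\<lambda>t. 2 * m t / \<rho>"])
         (use dm Dm lim Db m in auto)
  qed
  moreover have "\<forall>\<^sub>F \<zeta> in at \<zeta>0. (\<integral>t. D \<zeta> t \<partial>M) =
      ((\<integral>t. k \<zeta> t \<partial>M) - (\<integral>t. k \<zeta>0 t \<partial>M)) / (\<zeta> - \<zeta>0)"
  proof -
    have "(\<integral>t. D \<zeta> t \<partial>M) = ((\<integral>t. k \<zeta> t \<partial>M) - (\<integral>t. k \<zeta>0 t \<partial>M)) / (\<zeta> - \<zeta>0)"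
      if "\<zeta> \<in> ball \<zeta>0 \<rho>" "\<zeta> \<noteq> \<zeta>0" for \<zeta>
      using that \<rho>(2) intk[of \<zeta>] intk[OF z0] by (auto simp: D_def Bochner_Integration.integral_diff)
    thus ?thesis using \<rho>(1) by (auto simp: eventually_at dist_commute intro!: exI[of _ \<rho>])
  qed
  ultimately have "((\<lambda>\<zeta>. ((\<integral>t. k \<zeta> t \<partial>M) - (\<integral>t. k \<zeta>0 t \<partial>M)) / (\<zeta> - \<zeta>0)) \<longlongrightarrow> (\<integral>t. d t \<partial>M)) (at \<zeta>0)"
    by (rule Lim_transform_eventually)
  hence "((\<lambda>\<zeta>. \<integral>t. k \<zeta> t \<partial>M) has_field_derivative (\<integral>t. d t \<partial>M)) (at \<zeta>0)"
    by (simp add: has_field_derivative_iff)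
  thus "(\<lambda>\<zeta>. \<integral>t. k \<zeta> t \<partial>M) field_differentiable (at \<zeta>0 within U)"
    using field_differentiable_at_within field_differentiable_def by blast
qed

lemma has_vector_derivative_integral_atMost:
  fixes k :: "real \<Rightarrow> 'a::euclidean_space"
  assumes cont: "continuous_on UNIV k" and int: "integrable lborel k"
  shows "((\<lambda>t. LINT s:{..t}|lborel. k s) has_vector_derivative k t) (at t)"
proof -
  let ?a = "t - 1" and ?b = "t + 1"
  have seti: "set_integrable lborel A k" if "A \<in> sets lborel" for A
    using integrable_mult_indicator[OF that int] by (simp add: set_integrable_def)
  have eq: "(LINT s:{..u}|lborel. k s) = (LINT s:{..?a}|lborel. k s) + integral {?a..u} k" if "u \<in> {?a<..<?b}" for u
  proof -
    have "{..u} = {..?a} \<union> {?a<..u}" using that by auto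
    hence "(LINT s:{..u}|lborel. k s) = (LINT s:{..?a}|lborel. k s) + (LINT s:{?a<..u}|lborel. k s)"
      by (simp only:) (rule set_integral_Un, auto intro: seti)
    also have "(LINT s:{?a<..u}|lborel. k s) = (LINT s:{?a..u}|lborel. k s)"
      using interval_integral_Ioc[of ?a u k] interval_integral_Icc[of ?a u k] that by simp
    also have "\<dots> = integral {?a..u} k"
      by (rule set_borel_integral_eq_integral(2)[OF seti]) auto
    finally show ?thesis .
  qed
  have "((\<lambda>u. integral {?a..u} k) has_vector_derivative k t) (at t within {?a..?b})"
    by (rule integral_has_vector_derivative) (auto intro: continuous_on_subset[OF cont])
  hence "((\<lambda>u. integral {?a..u} k) has_vector_derivative k t) (at t within {?a<..<?b})"
    by (rule has_vector_derivative_within_subset) auto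
  hence "((\<lambda>u. integral {?a..u} k) has_vector_derivative k t) (at t)"
    by (simp add: at_within_open[of t "{?a<..<?b}"])
  hence "((\<lambda>u. (LINT s:{..?a}|lborel. k s) + integral {?a..u} k) has_vector_derivative k t) (at t)"
    by (auto intro!: derivative_eq_intros)
  thus ?thesis
    by (rule has_vector_derivative_transform_within_open[of _ _ _ "{?a<..<?b}"]) (use eq in auto)
qed

lemma integral_real_line_FTC:
  fixes k :: "real \<Rightarrow> 'a::euclidean_space"
  assumes der: "\<And>t. (K has_vector_derivative k t) (at t)"
    and cont: "continuous_on UNIV k" and int: "integrable lborel k"
    and A: "(K \<longlongrightarrow> A) at_bot" and B: "(K \<longlongrightarrow> B) at_top"
  shows "(\<integral>t. k t \<partial>lborel) = B - A"
proof -
  have "(LBINT t=-\<infinity>..\<infinity>. k t) = B - A"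
  proof (rule interval_integral_FTC_integrable)
    show "((K \<circ> real_of_ereal) \<longlongrightarrow> A) (at_right (-\<infinity>))"
      using A by (simp add: ereal_tendsto_simps)
    show "((K \<circ> real_of_ereal) \<longlongrightarrow> B) (at_left \<infinity>)"
      using B by (simp add: ereal_tendsto_simps)
  qed (use der cont int in \<open>auto simp: set_integrable_def continuous_on_eq_continuous_at einterval_eq\<close>)
  thus ?thesis by (simp add: interval_lebesgue_integral_def einterval_eq set_lebesgue_integral_def)
qed

text \<open>
  A majorant \<open>m\<close> is integrated by exhibiting a decreasing \<open>Z\<close> that vanishes at infinity and falls
  at least as fast as \<open>m\<close>.
\<close>

lemma tail_integral_bound:
  fixes k :: "real \<Rightarrow> complex" and m Z :: "real \<Rightarrow> real"
  assumes k: "k \<in> borel_measurable borel" and bd: "\<And>s. s \<ge> t \<Longrightarrow> cmod (k s) \<le> G * m s" and G: "G \<ge> 0"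
    and Z: "\<And>s. s \<ge> t \<Longrightarrow> (Z has_real_derivative - z s) (at s)" and zm: "\<And>s. s \<ge> t \<Longrightarrow> m s \<le> z s"
    and m0: "\<And>s. s \<ge> t \<Longrightarrow> 0 \<le> m s"
    and zb: "z \<in> borel_measurable borel" and Z0: "(Z \<longlongrightarrow> 0) at_top"
  shows "set_integrable lborel {t..} k" "cmod (LINT s:{t..}|lborel. k s) \<le> G * Z t"
proof -
  have z0: "0 \<le> z s" if "s \<ge> t" for s using m0[OF that] zm[OF that] by linarith
  have dZ: "((\<lambda>s. - Z s) has_real_derivative z s) (at s)" if "s \<ge> t" for s
    using DERIV_minus[OF Z[OF that]] by simp
  have nn: "(\<integral>\<^sup>+s. ennreal (z s) * indicator {t..} s \<partial>lborel) = ennreal (Z t)"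
    using nn_integral_FTC_atLeast[of z t "\<lambda>s. - Z s" 0] zb dZ z0 tendsto_minus[OF Z0]
    by simp
  have eqi: "ennreal (z s) * indicator {t..} s = ennreal (z s * indicator {t..} s)" for s
    by (auto simp: indicator_def)
  have Zt: "0 \<le> Z t"
  proof (rule ccontr)
    assume neg: "\<not> 0 \<le> Z t"
    have "\<forall>\<^sub>F s in at_top. Z t / 2 < Z s" using neg Z0 by (intro order_tendstoD) auto
    then obtain s where s: "s \<ge> t" "Z t / 2 < Z s"
      by (metis eventually_at_top_linorder nle_le)
    have "Z s \<le> Z t" by (rule DERIV_nonpos_imp_nonincreasing[OF s(1)]) (meson Z z0 neg_le_0_iff_le)
    thus False using s neg by linarith
  qed
  have intz: "integrable lborel (\<lambda>s. z s * indicator {t..} s)"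
    by (rule integrableI_nonneg) (use zb nn[unfolded eqi] z0 in \<open>auto intro!: AE_I2 mult_nonneg_nonneg simp: indicator_def split: if_splits\<close>)
  have vz: "(\<integral>s. z s * indicator {t..} s \<partial>lborel) = Z t"
  proof -
    have nn0: "0 \<le> z s * indicator {t..} s" for s using z0 by (auto simp: indicator_def)
    have "ennreal (\<integral>s. z s * indicator {t..} s \<partial>lborel) = ennreal (Z t)"
      using nn_integral_eq_integral[OF intz] nn[unfolded eqi] nn0 by simp
    thus ?thesis using Zt nn0 by (subst (asm) ennreal_inj) (auto intro!: integral_nonneg_AE)
  qed
  have b: "cmod (indicator {t..} s *\<^sub>R k s) \<le> G * (z s * indicator {t..} s)" for s
  proof (cases "s \<ge> t")
    case True
    have "cmod (k s) \<le> G * z s" using bd[OF True] mult_left_mono[OF zm[OF True] G] by linarith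
    thus ?thesis using True by simp
  qed auto
  show si: "set_integrable lborel {t..} k"
    unfolding set_integrable_def
    by (rule Bochner_Integration.integrable_bound[OF integrable_mult_right[OF intz, of G]])
       (use k in measurable, use b order_trans[OF b abs_ge_self] in \<open>auto intro!: AE_I2 simp del: norm_scaleR\<close>)
  have "cmod (LINT s:{t..}|lborel. k s) \<le> (\<integral>s. G * (z s * indicator {t..} s) \<partial>lborel)"
    unfolding set_lebesgue_integral_def
    by (rule Bochner_Integration.integral_norm_bound_integral) (use si intz b in \<open>auto simp: set_integrable_def\<close>)
  also have "\<dots> = G * Z t" by (simp add: vz)
  finally show "cmod (LINT s:{t..}|lborel. k s) \<le> G * Z t" .
qed

section \<open>Weights near the poles of the separatrix\<close>

lemma norm_cosh_squared: "(cmod (cosh z))\<^sup>2 = (sinh (Re z))\<^sup>2 + (cos (Im z))\<^sup>2"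
  by (simp add: cosh_conv_cos norm_cos_squared sinh_field_def exp_minus power_divide)

lemma norm_sinh_squared: "(cmod (sinh z))\<^sup>2 = (sinh (Re z))\<^sup>2 + (sin (Im z))\<^sup>2"
proof -
  have "(cmod (sinh z))\<^sup>2 = (exp (2 * Re z) + exp (- (2 * Re z)) - 2 * cos (2 * Im z)) / 4"
    by (simp add: sinh_conv_sin norm_mult norm_sin_squared exp_minus)
  also have "exp (2 * Re z) + exp (- (2 * Re z)) = 4 * (sinh (Re z))\<^sup>2 + 2"
    by (simp add: sinh_field_def power2_eq_square field_simps flip: exp_add)
  finally show ?thesis by (simp add: cos_double_sin)
qed

lemma cosh_exp_bounds: "exp \<bar>x::real\<bar> \<le> 2 * cosh x" "cosh x \<le> exp \<bar>x\<bar>"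
proof -
  have c: "2 * cosh y = exp y + exp (- y)" for y :: real by (simp add: cosh_field_def)
  have *: "exp y \<le> 2 * cosh y" for y :: real
    unfolding c by simp
  have **: "cosh y \<le> exp y" if "y \<ge> 0" for y :: real
  proof -
    have "exp (- y) \<le> exp y" using that by simp
    thus ?thesis using c[of y] by linarith
  qed
  show "exp \<bar>x\<bar> \<le> 2 * cosh x" "cosh x \<le> exp \<bar>x\<bar>" using *[of "\<bar>x\<bar>"] **[of "\<bar>x\<bar>"] by simp_all
qed

text \<open>
  Since \<open>|cosh (x + i y)|\<^sup>2 = sinh\<^sup>2 x + cos\<^sup>2 y\<close>, the modulus of \<open>cosh\<close> on the line at height \<open>y\<close>
  is comparable to this function with \<open>\<kappa> = cos y\<close>: it is of order \<open>\<kappa> + |t|\<close> near the pole of the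
  separatrix and of order \<open>exp |t|\<close> far from it.
\<close>

definition cosh_size :: "real \<Rightarrow> real \<Rightarrow> real" where
  "cosh_size \<kappa> t = exp \<bar>t\<bar> - 1 + \<kappa>"

lemma cosh_size_bounds:
  assumes "0 < \<kappa>" "\<kappa> \<le> 1"
  shows "\<kappa> \<le> cosh_size \<kappa> t" "cosh_size \<kappa> t \<le> exp \<bar>t\<bar>" "\<kappa> * exp \<bar>t\<bar> \<le> cosh_size \<kappa> t" "0 < cosh_size \<kappa> t"
proof -
  show 1: "\<kappa> \<le> cosh_size \<kappa> t" by (simp add: cosh_size_def)
  show "cosh_size \<kappa> t \<le> exp \<bar>t\<bar>" using assms by (simp add: cosh_size_def)
  have "0 \<le> (exp \<bar>t\<bar> - 1) * (1 - \<kappa>)" using assms by (intro mult_nonneg_nonneg) auto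
  thus "\<kappa> * exp \<bar>t\<bar> \<le> cosh_size \<kappa> t" by (simp add: cosh_size_def algebra_simps)
  show "0 < cosh_size \<kappa> t" using 1 assms by linarith
qed

lemma cosh_size_comparable:
  fixes z :: complex
  assumes \<kappa>: "0 < \<kappa>" "\<kappa> \<le> 1" and re: "\<bar>Re z - t\<bar> \<le> \<kappa>" and im: "\<bar>cos (Im z) - \<kappa>\<bar> \<le> \<kappa> / 8"
  shows "cosh_size \<kappa> t / 9 \<le> cmod (cosh z)" "cmod (cosh z) \<le> 5 * cosh_size \<kappa> t"
    "cmod (cosh z) \<le> 3 * exp \<bar>t\<bar>" "cmod (sinh z) \<le> 3 * exp \<bar>t\<bar>"
proof -
  define x where "x = Re z"
  define c where "c = cos (Im z)"
  have c: "7/8 * \<kappa> \<le> c" "c \<le> 9/8 * \<kappa>" using im \<kappa> unfolding c_def by linarith+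
  hence c0: "c > 0" using \<kappa> by linarith
  have e1: "exp \<kappa> \<le> 1 + 2 * \<kappa>"
  proof -
    have "exp \<kappa> \<le> 1 + \<kappa> + \<kappa>\<^sup>2" using exp_bound[of \<kappa>] \<kappa> by simp
    moreover have "\<kappa>\<^sup>2 \<le> \<kappa>" using \<kappa> by (simp add: power2_eq_square mult_left_le)
    ultimately show ?thesis by simp
  qed
  have sx: "\<bar>sinh x\<bar> \<le> exp \<bar>x\<bar> - 1" "exp \<bar>x\<bar> - 1 \<le> 2 * \<bar>sinh x\<bar>"
  proof -
    have p: "\<bar>sinh x\<bar> = (exp \<bar>x\<bar> - exp (- \<bar>x\<bar>)) / 2"
      unfolding sinh_real_abs[symmetric] by (simp add: sinh_field_def)
    have q: "exp (-\<bar>x\<bar>) \<le> 1" by simp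
    have "0 \<le> (exp \<bar>x\<bar> - 1)\<^sup>2" by simp
    hence "2 * exp \<bar>x\<bar> \<le> exp \<bar>x\<bar> * exp \<bar>x\<bar> + 1" by (simp add: power2_eq_square algebra_simps)
    hence "2 * exp \<bar>x\<bar> * exp (-\<bar>x\<bar>) \<le> (exp \<bar>x\<bar> * exp \<bar>x\<bar> + 1) * exp (-\<bar>x\<bar>)" by (intro mult_right_mono) auto
    hence "2 \<le> exp \<bar>x\<bar> + exp (-\<bar>x\<bar>)" by (simp add: exp_minus field_simps)
    thus "\<bar>sinh x\<bar> \<le> exp \<bar>x\<bar> - 1" unfolding p by simp
    show "exp \<bar>x\<bar> - 1 \<le> 2 * \<bar>sinh x\<bar>" unfolding p using q by simp
  qed
  have xt: "exp \<bar>x\<bar> \<le> exp \<bar>t\<bar> * (1 + 2 * \<kappa>)" "exp \<bar>t\<bar> \<le> exp \<bar>x\<bar> * (1 + 2 * \<kappa>)"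
  proof -
    have "exp \<bar>x\<bar> \<le> exp (\<bar>t\<bar> + \<kappa>)" "exp \<bar>t\<bar> \<le> exp (\<bar>x\<bar> + \<kappa>)" using re by (auto simp: x_def)
    thus "exp \<bar>x\<bar> \<le> exp \<bar>t\<bar> * (1 + 2 * \<kappa>)" "exp \<bar>t\<bar> \<le> exp \<bar>x\<bar> * (1 + 2 * \<kappa>)"
      using e1 by (auto simp: exp_add intro: order_trans mult_left_mono)
  qed
  note lb = cosh_size_bounds[OF \<kappa>, of t]
  have C2: "(cmod (cosh z))\<^sup>2 = \<bar>sinh x\<bar>\<^sup>2 + c\<^sup>2" by (simp add: norm_cosh_squared x_def c_def)
  have "(cmod (cosh z))\<^sup>2 \<le> (\<bar>sinh x\<bar> + c)\<^sup>2" unfolding C2 using c0 by (simp add: power2_sum)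
  hence Cu: "cmod (cosh z) \<le> \<bar>sinh x\<bar> + c" by (rule power2_le_imp_le) (use c0 in auto)
  have "exp \<bar>x\<bar> - 1 \<le> 3 * cosh_size \<kappa> t"
    using xt(1) lb(3) by (simp add: cosh_size_def algebra_simps) (use lb(3) \<kappa> in \<open>simp add: cosh_size_def\<close>)
  thus "cmod (cosh z) \<le> 5 * cosh_size \<kappa> t" using Cu sx(1) c lb(1) by linarith
  have ex3: "exp \<bar>x\<bar> \<le> 3 * exp \<bar>t\<bar>"
  proof -
    have "exp \<bar>t\<bar> * (1 + 2 * \<kappa>) \<le> exp \<bar>t\<bar> * 3" using \<kappa> by (intro mult_left_mono) auto
    thus ?thesis using xt(1) by linarith
  qed
  have ch: "cosh x \<le> exp \<bar>x\<bar>" by (rule cosh_exp_bounds)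
  have "(cmod (cosh z))\<^sup>2 \<le> (cosh x)\<^sup>2"
    unfolding norm_cosh_squared using cosh_square_eq[of x] by (simp add: x_def abs_square_le_1)
  hence "cmod (cosh z) \<le> cosh x" by (rule power2_le_imp_le) auto
  thus "cmod (cosh z) \<le> 3 * exp \<bar>t\<bar>" using ch ex3 by linarith
  have "(cmod (sinh z))\<^sup>2 \<le> (cosh x)\<^sup>2"
    unfolding norm_sinh_squared using cosh_square_eq[of x] by (simp add: x_def abs_square_le_1)
  hence "cmod (sinh z) \<le> cosh x" by (rule power2_le_imp_le) auto
  thus "cmod (sinh z) \<le> 3 * exp \<bar>t\<bar>" using ch ex3 by linarith
  have "cosh_size \<kappa> t \<le> 6 * \<bar>sinh x\<bar> + 4 * c"
  proof -
    have "cosh_size \<kappa> t \<le> exp \<bar>x\<bar> * (1 + 2 * \<kappa>) - 1 + \<kappa>" using xt(2) by (simp add: cosh_size_def)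
    also have "\<dots> = (exp \<bar>x\<bar> - 1) * (1 + 2 * \<kappa>) + 3 * \<kappa>" by (simp add: algebra_simps)
    also have "\<dots> \<le> (exp \<bar>x\<bar> - 1) * 3 + 4 * c"
      using \<kappa> c by (intro add_mono mult_left_mono) auto
    also have "\<dots> \<le> 6 * \<bar>sinh x\<bar> + 4 * c" using sx(2) by simp
    finally show ?thesis .
  qed
  hence "(cosh_size \<kappa> t)\<^sup>2 \<le> (6 * \<bar>sinh x\<bar> + 4 * c)\<^sup>2" using lb(4) by (intro power_mono) auto
  also have "\<dots> \<le> (9 * cmod (cosh z))\<^sup>2"
  proof -
    have q: "(6 * S + 4 * c)\<^sup>2 \<le> 81 * (S\<^sup>2 + c\<^sup>2)" for S
      using zero_le_power2[of "4 * S - 6 * c"] zero_le_power2[of S] zero_le_power2[of c]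
      by (simp add: power2_eq_square algebra_simps del: zero_le_square)
    from q[of "\<bar>sinh x\<bar>"] show ?thesis unfolding power_mult_distrib[of 9] C2 by simp
  qed
  finally have "cosh_size \<kappa> t \<le> 9 * cmod (cosh z)" by (rule power2_le_imp_le) auto
  thus "cosh_size \<kappa> t / 9 \<le> cmod (cosh z)" by simp
qed

text \<open>
  The times \<open>t - \<eta> + s\<close> with real \<open>t\<close> stay at a distance comparable to \<open>cos (Im \<eta>)\<close> from the poles
  \<open>\<plusminus> i \<pi> / 2\<close>. The two bounds are what \<open>cosh_size_comparable\<close> needs: \<open>4/5 + 1/8 \<le> 1\<close> controls the
  real part, and \<open>1/8\<close> the change of \<open>cos\<close> of the imaginary part.
\<close>

definition near_axis :: "complex \<Rightarrow> complex \<Rightarrow> bool" where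
  "near_axis \<eta> s \<longleftrightarrow> \<bar>Im \<eta>\<bar> < pi / 2 \<and> \<bar>Re \<eta>\<bar> \<le> 4/5 * cos (Im \<eta>) \<and> cmod s \<le> cos (Im \<eta>) / 8"

lemma near_axis_kappa:
  assumes "near_axis \<eta> s" shows "0 < cos (Im \<eta>)" "cos (Im \<eta>) \<le> 1"
  using assms by (auto simp: near_axis_def intro!: cos_gt_zero_pi)

lemma near_axis_cosh:
  assumes "near_axis \<eta> s"
  defines "\<kappa> \<equiv> cos (Im \<eta>)"
  shows "cosh_size \<kappa> t / 9 \<le> cmod (cosh (of_real t - \<eta> + s))" "cmod (cosh (of_real t - \<eta> + s)) \<le> 5 * cosh_size \<kappa> t"
    "cmod (cosh (of_real t - \<eta> + s)) \<le> 3 * exp \<bar>t\<bar>" "cmod (sinh (of_real t - \<eta> + s)) \<le> 3 * exp \<bar>t\<bar>"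
    "cosh (of_real t - \<eta> + s) \<noteq> 0"
proof -
  have k: "0 < \<kappa>" "\<kappa> \<le> 1" using near_axis_kappa[OF assms(1)] by (auto simp: \<kappa>_def)
  have s: "\<bar>Re s\<bar> \<le> \<kappa> / 8" "\<bar>Im s\<bar> \<le> \<kappa> / 8"
    using assms(1) abs_Re_le_cmod[of s] abs_Im_le_cmod[of s] by (auto simp: near_axis_def \<kappa>_def)
  have re: "\<bar>Re (of_real t - \<eta> + s) - t\<bar> \<le> \<kappa>"
    using assms(1) s k by (auto simp: near_axis_def \<kappa>_def[symmetric])
  have "\<bar>cos (Im s - Im \<eta>) - cos (- Im \<eta>)\<bar> \<le> \<bar>Im s\<bar>"
  proof -
    have "norm (cos (Im s - Im \<eta>) - cos (- Im \<eta>)) \<le> 1 * norm ((Im s - Im \<eta>) - (- Im \<eta>))"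
      by (rule field_differentiable_bound[of UNIV cos "\<lambda>x. - sin x"]) (auto intro!: derivative_eq_intros)
    thus ?thesis by simp
  qed
  hence im: "\<bar>cos (Im (of_real t - \<eta> + s)) - \<kappa>\<bar> \<le> \<kappa> / 8" using s by (simp add: \<kappa>_def)
  note * = cosh_size_comparable[OF k re im]
  show "cosh_size \<kappa> t / 9 \<le> cmod (cosh (of_real t - \<eta> + s))" "cmod (cosh (of_real t - \<eta> + s)) \<le> 5 * cosh_size \<kappa> t"
    "cmod (cosh (of_real t - \<eta> + s)) \<le> 3 * exp \<bar>t\<bar>" "cmod (sinh (of_real t - \<eta> + s)) \<le> 3 * exp \<bar>t\<bar>"
    by (fact *)+
  show "cosh (of_real t - \<eta> + s) \<noteq> 0" using *(1) cosh_size_bounds(4)[OF k, of t] by auto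
qed

definition cpsi :: "complex \<Rightarrow> complex" where
  "cpsi z = (cosh z)\<^sup>2 / (1 + cosh z) ^ 3"

lemma near_axis_zero: "near_axis \<eta> s \<Longrightarrow> near_axis \<eta> 0"
  using near_axis_kappa[of \<eta> s] by (simp add: near_axis_def)

text \<open>
  The poles of \<open>psi0\<close> lie at height \<open>\<pi>\<close>, twice as far away as those of the separatrix; therefore
  no negative power of \<open>\<kappa>\<close> appears here, and there is even a gain where \<open>cosh\<close> is small.
\<close>

lemma cpsi_bound:
  assumes "near_axis \<eta> 0"
  defines "\<kappa> \<equiv> cos (Im \<eta>)"
  shows "cmod (cpsi (of_real t - \<eta>)) \<le> 5400 * (cosh_size \<kappa> t)\<^sup>2 / (exp \<bar>t\<bar>) ^ 3" "1 + cosh (of_real t - \<eta>) \<noteq> 0"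
proof -
  note na = near_axis_cosh[OF assms(1), of t, folded \<kappa>_def, simplified]
  note k = near_axis_kappa[OF assms(1), folded \<kappa>_def]
  define x where "x = Re (of_real t - \<eta>)"
  define z where "z = of_real t - \<eta>"
  have imz: "Im z = - Im \<eta>" by (simp add: z_def)
  define y where "y = z / 2"
  have y: "1 + cosh z = 2 * (cosh y)\<^sup>2" using cosh_double_cosh[of y] by (simp add: y_def)
  have "(cos (Im y))\<^sup>2 \<ge> 1/2"
  proof -
    have "cos (Im z) = 2 * (cos (Im y))\<^sup>2 - 1" using cos_double_cos[of "Im y"] by (simp add: y_def)
    moreover have "cos (Im z) > 0" using k by (simp add: \<kappa>_def imz)
    ultimately show ?thesis by simp
  qed
  hence "(cmod (cosh y))\<^sup>2 \<ge> (sinh (Re y))\<^sup>2 + 1/2" by (simp add: norm_cosh_squared)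
  moreover have "cosh (Re z) = 2 * (sinh (Re y))\<^sup>2 + 1"
    using cosh_double_cosh[of "Re y"] cosh_square_eq[of "Re y"] by (simp add: y_def)
  ultimately have "cosh (Re z) \<le> 2 * (cmod (cosh y))\<^sup>2" by simp
  also have "\<dots> = cmod (1 + cosh z)" by (simp add: y norm_mult norm_power)
  finally have 1: "cosh (Re z) \<le> cmod (1 + cosh z)" .
  have "exp \<bar>t\<bar> \<le> exp (\<bar>Re z\<bar> + 1)"
  proof -
    have "\<bar>Re \<eta>\<bar> \<le> 4/5 * \<kappa>" using assms(1) by (simp add: near_axis_def \<kappa>_def)
    hence "\<bar>t\<bar> \<le> \<bar>t - Re \<eta>\<bar> + 1" using k by linarith
    thus ?thesis by (simp add: z_def)
  qed
  also have "\<dots> \<le> exp \<bar>Re z\<bar> * 3" using exp_le by (simp add: exp_add)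
  also have "\<dots> \<le> 2 * cosh (Re z) * 3"
    using cosh_exp_bounds(1)[of "Re z"] by simp
  finally have 2: "exp \<bar>t\<bar> / 6 \<le> cmod (1 + cosh z)" using 1 by simp
  hence nz: "cmod (1 + cosh z) > 0" using exp_gt_zero[of "\<bar>t\<bar>"] by linarith
  thus "1 + cosh (of_real t - \<eta>) \<noteq> 0" by (auto simp: z_def)
  have "cmod (cpsi z) = (cmod (cosh z))\<^sup>2 / cmod (1 + cosh z) ^ 3" by (simp add: cpsi_def norm_divide norm_power)
  also have "\<dots> \<le> (5 * cosh_size \<kappa> t)\<^sup>2 / (exp \<bar>t\<bar> / 6) ^ 3"
    using na(2) 2 nz by (intro frac_le power_mono) (auto simp: z_def)
  also have "\<dots> = 5400 * (cosh_size \<kappa> t)\<^sup>2 / (exp \<bar>t\<bar>) ^ 3" by (simp add: power_divide power_mult_distrib)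
  finally show "cmod (cpsi (of_real t - \<eta>)) \<le> 5400 * (cosh_size \<kappa> t)\<^sup>2 / (exp \<bar>t\<bar>) ^ 3" by (simp add: z_def)
qed

text \<open>
  The weights decay like half-integer powers of \<open>exp |t|\<close>; in terms of the square root all
  exponents are natural numbers.
\<close>

definition half_exp :: "real \<Rightarrow> real" where "half_exp t = exp (\<bar>t\<bar> / 2)"

lemma half_exp_ge1: "1 \<le> half_exp t" and half_exp_sq: "(half_exp t)\<^sup>2 = exp \<bar>t\<bar>" and half_exp_pos: "0 < half_exp t"
  by (auto simp: half_exp_def power2_eq_square simp flip: exp_add)

text \<open>
  The weight for sources of the linearised equation after division by \<open>cosh\<close>. It reaches \<open>1 / \<kappa>\<close>
  for \<open>|t|\<close> of order \<open>\<kappa>\<close> only, so its integral is bounded uniformly in \<open>\<kappa>\<close>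
  (\<open>src_weight_integral\<close>).
\<close>

definition src_weight :: "real \<Rightarrow> real \<Rightarrow> real" where
  "src_weight \<kappa> t = \<kappa>\<^sup>2 * half_exp t ^ 3 / cosh_size \<kappa> t ^ 3 + 1 / half_exp t ^ 3"

text \<open>
  The weight for the profile \<open>w\<close>. The factor \<open>\<kappa>\<^sup>2\<close> that it gains at \<open>t = 0\<close> compensates the double
  poles of \<open>sin q\<close> and \<open>cos q\<close> in the nonlinear terms; at infinity it is \<open>exp (- |t| / 2)\<close>.
\<close>

definition prof_weight :: "real \<Rightarrow> real \<Rightarrow> real" where
  "prof_weight \<kappa> t = (cosh_size \<kappa> t)\<^sup>2 / half_exp t ^ 5"

lemma src_weight_nonneg: "0 < \<kappa> \<Longrightarrow> \<kappa> \<le> 1 \<Longrightarrow> 0 \<le> src_weight \<kappa> t"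
  using cosh_size_bounds(4)[of \<kappa> t] half_exp_pos[of t] by (simp add: src_weight_def)

lemma continuous_on_weights [continuous_intros]:
  "continuous_on A (cosh_size \<kappa>)" "continuous_on A half_exp"
  by (auto simp: cosh_size_def[abs_def] half_exp_def[abs_def] intro!: continuous_intros)

lemma continuous_on_src_weight: "0 < \<kappa> \<Longrightarrow> \<kappa> \<le> 1 \<Longrightarrow> continuous_on A (src_weight \<kappa>)"
  unfolding src_weight_def[abs_def]
  by (intro continuous_intros; use cosh_size_bounds(4)[of \<kappa>] half_exp_pos in \<open>auto simp: less_le\<close>)

lemma exp_neg_tendsto_0: "c > 0 \<Longrightarrow> ((\<lambda>s::real. exp (- (c * s))) \<longlongrightarrow> 0) at_top"
  by (intro filterlim_compose[OF exp_at_bot] filterlim_compose[OF filterlim_uminus_at_bot_at_top]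
       filterlim_tendsto_pos_mult_at_top[OF tendsto_const]) (auto simp: filterlim_ident)

lemma even_weight_integral:
  fixes k :: "real \<Rightarrow> complex" and m z Z :: "real \<Rightarrow> real"
  assumes k: "k \<in> borel_measurable borel" and G: "G \<ge> 0"
    and bd: "\<And>s. cmod (k s) \<le> G * m \<bar>s\<bar>"
    and Z: "\<And>s. s \<ge> 0 \<Longrightarrow> (Z has_real_derivative - z s) (at s)" and mz: "\<And>s. s \<ge> 0 \<Longrightarrow> m s \<le> z s"
    and m0: "\<And>s. s \<ge> 0 \<Longrightarrow> 0 \<le> m s"
    and zb: "z \<in> borel_measurable borel" and Z0: "(Z \<longlongrightarrow> 0) at_top"
  shows "integrable lborel k" "cmod (\<integral>s. k s \<partial>lborel) \<le> 2 * G * Z 0"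
    and "t \<ge> 0 \<Longrightarrow> cmod (LINT s:{t..}|lborel. k s) \<le> G * Z t"
    and "t \<le> 0 \<Longrightarrow> cmod (LINT s:{..t}|lborel. k s) \<le> G * Z (- t)"
proof -
  let ?k = "\<lambda>s. k (- s)"
  have k': "?k \<in> borel_measurable borel" using k by measurable
  have R: "set_integrable lborel {t..} k" "cmod (LINT s:{t..}|lborel. k s) \<le> G * Z t"
    and L: "set_integrable lborel {t..} ?k" "cmod (LINT s:{t..}|lborel. ?k s) \<le> G * Z t" if "t \<ge> 0" for t
  proof -
    have b: "cmod (k s) \<le> G * m s" "cmod (?k s) \<le> G * m s" if "s \<ge> t" for s
      using bd[of s] bd[of "-s"] that \<open>t \<ge> 0\<close> by auto
    show "set_integrable lborel {t..} k" "cmod (LINT s:{t..}|lborel. k s) \<le> G * Z t"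
      by (rule tail_integral_bound[where m = m and Z = Z and z = z, OF k b(1) G Z mz m0 zb Z0]; use that in simp)+
    show "set_integrable lborel {t..} ?k" "cmod (LINT s:{t..}|lborel. ?k s) \<le> G * Z t"
      by (rule tail_integral_bound[where m = m and Z = Z and z = z, OF k' b(2) G Z mz m0 zb Z0]; use that in simp)+
  qed
  have refl: "(LINT s:{..t}|lborel. k s) = (LINT s:{-t..}|lborel. ?k s)" for t
    using lborel_integral_real_affine[of "-1" "\<lambda>s. indicator {..t} s *\<^sub>R k s" 0]
    by (simp add: set_lebesgue_integral_def indicator_def minus_le_iff)
  have int: "set_integrable lborel {..t} k \<longleftrightarrow> set_integrable lborel {-t..} ?k" for t
  proof -
    have "(\<lambda>s. indicat_real {..t} (- s) *\<^sub>R k (- s)) = (\<lambda>s. indicat_real {- t..} s *\<^sub>R k (- s))"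
      by (auto simp: indicator_def fun_eq_iff)
    thus ?thesis using lborel_integrable_real_affine_iff[of "-1" "\<lambda>s. indicator {..t} s *\<^sub>R k s" 0]
      by (simp add: set_integrable_def)
  qed
  show "t \<ge> 0 \<Longrightarrow> cmod (LINT s:{t..}|lborel. k s) \<le> G * Z t" by (rule R(2))
  show "t \<le> 0 \<Longrightarrow> cmod (LINT s:{..t}|lborel. k s) \<le> G * Z (- t)"
    using L(2)[of "-t"] unfolding refl by simp
  have si: "set_integrable lborel {..0} k" "set_integrable lborel {0..} k"
    using L(1)[of 0] R(1)[of 0] int[of 0] by auto
  hence si': "set_integrable lborel {0<..} k" by (rule_tac set_integrable_subset[OF si(2)]) auto
  have U: "{..0} \<union> {0<..} = (UNIV::real set)" by auto
  show "integrable lborel k"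
    using set_integrable_Un[OF si(1) si'] unfolding U by (simp add: set_integrable_def)
  have "(\<integral>s. k s \<partial>lborel) = (LINT s:{..0}|lborel. k s) + (LINT s:{0<..}|lborel. k s)"
  proof -
    have "{..0} \<inter> {0<..} = ({}::real set)" by auto
    from set_integral_Un[OF this si(1) si'] show ?thesis unfolding U by (simp add: set_lebesgue_integral_def)
  qed
  also have "(LINT s:{0<..}|lborel. k s) = (LINT s:{0..}|lborel. k s)"
    by (rule set_integral_cong_set)
       (use si si' AE_lborel_singleton[of 0] in \<open>auto simp: set_borel_measurable_def set_integrable_def elim!: eventually_mono\<close>)
  finally show "cmod (\<integral>s. k s \<partial>lborel) \<le> 2 * G * Z 0"
    using R(2)[of 0] L(2)[of 0] refl[of 0] norm_triangle_ineq[of "LINT s:{..0}|lborel. k s" "LINT s:{0..}|lborel. k s"]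
    by simp
qed

text \<open>
  The tail of the weight is at most \<open>\<kappa>\<^sup>2 b / \<lambda>\<^sup>2 + 1 / b\<^sup>3\<close> where \<open>b\<close> is \<open>half_exp t\<close> and \<open>\<lambda>\<close> is
  \<open>cosh_size \<kappa> t\<close>, and this is at most \<open>2 / b\<^sup>3\<close> because \<open>\<lambda> \<ge> \<kappa> b\<^sup>2\<close>.
\<close>

lemma src_weight_integral:
  fixes k :: "real \<Rightarrow> complex"
  assumes \<kappa>: "0 < \<kappa>" "\<kappa> \<le> 1" and k: "k \<in> borel_measurable borel" and G: "G \<ge> 0"
    and bd: "\<And>s. cmod (k s) \<le> G * src_weight \<kappa> s"
  shows "integrable lborel k" "cmod (\<integral>s. k s \<partial>lborel) \<le> 4 * G"
    and "t \<ge> 0 \<Longrightarrow> cmod (LINT s:{t..}|lborel. k s) \<le> 2 * G / half_exp t ^ 3"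
    and "t \<le> 0 \<Longrightarrow> cmod (LINT s:{..t}|lborel. k s) \<le> 2 * G / half_exp t ^ 3"
proof -
  define L where "L s = exp s - 1 + \<kappa>" for s :: real
  define Z where "Z s = \<kappa>\<^sup>2 * exp (s/2) / (L s)\<^sup>2 + exp (- (3/2 * s))" for s :: real
  define z where "z s = - (\<kappa>\<^sup>2 * (exp (s/2) / 2 / (L s)\<^sup>2 - 2 * exp (s/2) * exp s / L s ^ 3) - 3/2 * exp (- (3/2 * s)))" for s :: real
  have L0: "L s > 0" "L s = cosh_size \<kappa> s" "L s \<le> exp s" "\<kappa> * exp s \<le> L s" if "s \<ge> 0" for s
    using cosh_size_bounds[OF \<kappa>, of s] that by (auto simp: L_def cosh_size_def)
  have dZ: "(Z has_real_derivative - z s) (at s)" if "s \<ge> 0" for s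
  proof -
    have "L s \<noteq> 0" using L0(1)[of s] that by simp
    moreover have dL: "(L has_real_derivative exp s) (at s)"
      unfolding L_def by (auto intro!: derivative_eq_intros)
    ultimately show ?thesis unfolding Z_def[abs_def] z_def
      by (auto intro!: derivative_eq_intros dL) (simp add: field_simps eval_nat_numeral)
  qed
  have ee: "exp (s/2) ^ 3 = exp (s/2) * exp s" for s :: real
    by (simp add: power3_eq_cube flip: exp_add)
  have e3: "exp (- (3/2 * s)) = 1 / exp (s/2) ^ 3" for s :: real
    by (simp add: exp_minus field_simps power3_eq_cube flip: exp_add)
  have mz: "src_weight \<kappa> s \<le> z s" if "s \<ge> 0" for s
  proof -
    have s0: "s \<ge> 0" using that by simp
    note l = L0[OF s0]
    have "\<kappa>\<^sup>2 * exp (s/2) ^ 3 / L s ^ 3 \<le> \<kappa>\<^sup>2 * (2 * exp (s/2) * exp s / L s ^ 3 - exp (s/2) / 2 / (L s)\<^sup>2)"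
    proof -
      have "exp (s/2) / 2 / (L s)\<^sup>2 = exp (s/2) * (L s / 2) / L s ^ 3"
        using l(1) by (simp add: field_simps power2_eq_square power3_eq_cube)
      also have "\<dots> \<le> exp (s/2) * exp s / L s ^ 3"
        using l by (intro divide_right_mono mult_left_mono) auto
      finally have "exp (s/2) ^ 3 / L s ^ 3 \<le> 2 * exp (s/2) * exp s / L s ^ 3 - exp (s/2) / 2 / (L s)\<^sup>2"
        unfolding ee by simp
      from mult_left_mono[OF this, of "\<kappa>\<^sup>2"] show ?thesis by simp
    qed
    moreover have "half_exp s = exp (s/2)" using s0 by (simp add: half_exp_def)
    moreover have "1 / exp (s/2) ^ 3 \<le> 3/2 * exp (- (3/2 * s))" unfolding e3 by (simp add: divide_simps)
    ultimately show ?thesis unfolding src_weight_def z_def l(2)[symmetric] by (simp add: right_diff_distrib)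
  qed
  have zb: "z \<in> borel_measurable borel" unfolding z_def L_def by measurable
  have Zb: "Z s \<le> 2 * exp (- (3/2 * s))" if "s \<ge> 0" for s
  proof -
    note l = L0[OF that]
    have "(\<kappa> * exp s)\<^sup>2 \<le> (L s)\<^sup>2" using l \<kappa> by (intro power_mono) auto
    hence "\<kappa>\<^sup>2 / (L s)\<^sup>2 \<le> 1 / (exp s)\<^sup>2" using l by (simp add: field_simps power_mult_distrib)
    hence "exp (s/2) * (\<kappa>\<^sup>2 / (L s)\<^sup>2) \<le> exp (s/2) * (1 / (exp s)\<^sup>2)" by (intro mult_left_mono) auto
    also have "exp (s/2) * (1 / (exp s)\<^sup>2) = exp (- (3/2 * s))"
      by (simp add: power2_eq_square field_simps exp_minus flip: exp_add)
    finally show ?thesis by (simp add: Z_def mult.commute)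
  qed
  have Z0: "(Z \<longlongrightarrow> 0) at_top"
  proof (rule tendsto_sandwich[OF _ _ tendsto_const])
    show "\<forall>\<^sub>F s in at_top. 0 \<le> Z s"
      using eventually_ge_at_top[of 0] by eventually_elim (auto simp: Z_def intro!: add_nonneg_nonneg)
    show "\<forall>\<^sub>F s in at_top. Z s \<le> 2 * exp (- (3/2 * s))"
      using eventually_ge_at_top[of 0] by eventually_elim (use Zb in auto)
    show "((\<lambda>s::real. 2 * exp (- (3/2 * s))) \<longlongrightarrow> 0) at_top"
      using tendsto_mult[OF tendsto_const[of 2] exp_neg_tendsto_0[of "3/2"]] by simp
  qed
  have bd': "cmod (k s) \<le> G * src_weight \<kappa> \<bar>s\<bar>" for s using bd[of s] by (simp add: src_weight_def half_exp_def cosh_size_def)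
  note T = even_weight_integral[where m = "src_weight \<kappa>" and Z = Z and z = z, OF k G bd' dZ mz src_weight_nonneg[OF \<kappa>] zb Z0]
  have Zb': "G * Z r \<le> 2 * G / half_exp r ^ 3" if "r \<ge> 0" for r
  proof -
    have "G * Z r \<le> G * (2 * exp (- (3/2 * r)))" using G Zb[OF that] by (rule mult_left_mono[rotated])
    also have "\<dots> = 2 * G / half_exp r ^ 3" using that e3[of r] by (simp add: half_exp_def)
    finally show ?thesis .
  qed
  show "integrable lborel k" by (rule T(1))
  have "G * Z 0 \<le> 2 * G" using Zb'[of 0] by (simp add: half_exp_def)
  with T(2) show "cmod (\<integral>s. k s \<partial>lborel) \<le> 4 * G" by simp
  show "t \<ge> 0 \<Longrightarrow> cmod (LINT s:{t..}|lborel. k s) \<le> 2 * G / half_exp t ^ 3"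
    using T(3)[of t] Zb'[of t] by linarith
  show "t \<le> 0 \<Longrightarrow> cmod (LINT s:{..t}|lborel. k s) \<le> 2 * G / half_exp t ^ 3"
    using T(4)[of t] Zb'[of "- t"] by (simp add: half_exp_def)
qed

section \<open>The separatrix at complex times\<close>

lemma complex_sin_cos_bounds:
  assumes "cmod w \<le> 1"
  shows "cmod (cos w - 1) \<le> 3 * (cmod w)\<^sup>2" "cmod (sin w - w) \<le> 3 * (cmod w)\<^sup>2" "cmod (sin w) \<le> 3 * cmod w"
proof -
  have e: "exp \<bar>Im w\<bar> \<le> 3"
  proof -
    have "exp \<bar>Im w\<bar> \<le> exp 1" using abs_Im_le_cmod[of w] assms by simp
    thus ?thesis using exp_le by linarith
  qed
  have "cmod (cos w - 1) \<le> exp \<bar>Im w\<bar> * (cmod w)\<^sup>2"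
    using Taylor_cos[of w 1] by (simp add: cos_coeff_def numeral_2_eq_2)
  also have "\<dots> \<le> 3 * (cmod w)\<^sup>2" using e by (intro mult_right_mono) auto
  finally show "cmod (cos w - 1) \<le> 3 * (cmod w)\<^sup>2" .
  have "cmod (sin w - w) \<le> exp \<bar>Im w\<bar> * (cmod w)\<^sup>2"
    using Taylor_sin[of w 1] by (simp add: sin_coeff_def numeral_2_eq_2)
  also have "\<dots> \<le> 3 * (cmod w)\<^sup>2" using e by (intro mult_right_mono) auto
  finally show "cmod (sin w - w) \<le> 3 * (cmod w)\<^sup>2" .
  have "cmod (sin w) \<le> exp \<bar>Im w\<bar> * cmod w"
    using Taylor_sin[of w 0] by (simp add: sin_coeff_def)
  also have "\<dots> \<le> 3 * cmod w" using e by (intro mult_right_mono) auto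
  finally show "cmod (sin w) \<le> 3 * cmod w" .
qed

text \<open>
  Sine and cosine of the separatrix \<open>4 arctan (exp z)\<close> as meromorphic functions, and the
  separatrix itself on the strip \<open>|Im z| < \<pi> / 2\<close>, which avoids the branch cuts of
  \<open>Arctan (exp z)\<close>.
\<close>

definition sin_sep :: "complex \<Rightarrow> complex" where "sin_sep z = - 2 * sinh z / (cosh z)\<^sup>2"
definition cos_sep :: "complex \<Rightarrow> complex" where "cos_sep z = 1 - 2 / (cosh z)\<^sup>2"
definition csep :: "complex \<Rightarrow> complex" where "csep z = 4 * Arctan (exp z)"

lemma csep_deriv:
  assumes "\<bar>Im z\<bar> < pi / 2" shows "(csep has_field_derivative 2 / cosh z) (at z)"
proof -
  have c: "cos (Im z) > 0" using assms by (intro cos_gt_zero_pi) auto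
  hence re: "Re (exp z) > 0" by (simp add: Re_exp)
  have d: "(Arctan has_field_derivative inverse (1 + (exp z)\<^sup>2)) (at (exp z))"
    using re by (intro has_field_derivative_Arctan) auto
  have "(cosh z) \<noteq> 0"
  proof
    assume "cosh z = 0"
    hence "(cmod (cosh z))\<^sup>2 = 0" by simp
    thus False using c unfolding norm_cosh_squared by (simp add: sum_power2_eq_zero_iff)
  qed
  moreover have "1 + (exp z)\<^sup>2 = 2 * exp z * cosh z"
    by (simp add: cosh_field_def exp_minus power2_eq_square field_simps)
  ultimately have "4 * (inverse (1 + (exp z)\<^sup>2) * exp z) = 2 / cosh z" by (simp add: field_simps)
  with DERIV_cmult[OF DERIV_chain[OF d DERIV_exp], of 4] show ?thesis
    by (simp add: csep_def[abs_def] o_def)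
qed

lemma near_axis_Im:
  assumes "near_axis \<eta> s" shows "\<bar>Im (of_real t - \<eta> + s)\<bar> < pi / 2"
proof -
  have "cos (Im \<eta>) = sin (pi / 2 - \<bar>Im \<eta>\<bar>)" by (simp add: sin_diff)
  also have "\<dots> \<le> pi / 2 - \<bar>Im \<eta>\<bar>" using assms by (intro sin_x_le_x) (simp add: near_axis_def)
  finally have "cos (Im \<eta>) \<le> pi / 2 - \<bar>Im \<eta>\<bar>" .
  moreover have "\<bar>Im s\<bar> \<le> cos (Im \<eta>) / 8" using assms abs_Im_le_cmod[of s] by (simp add: near_axis_def)
  moreover have "cos (Im \<eta>) > 0" using near_axis_kappa[OF assms] by simp
  moreover have "\<bar>Im (of_real t - \<eta> + s)\<bar> \<le> \<bar>Im \<eta>\<bar> + \<bar>Im s\<bar>" by simp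
  ultimately show ?thesis by linarith
qed

lemma near_axis_mono: "near_axis \<eta> s \<Longrightarrow> cmod s' \<le> cmod s \<Longrightarrow> near_axis \<eta> s'"
  by (auto simp: near_axis_def)

lemma weights_arith:
  fixes b L \<kappa> :: real
  assumes "1 \<le> b" "0 < \<kappa>" "\<kappa> \<le> L" "L \<le> b\<^sup>2" "\<kappa> \<le> 1"
  shows "L / b ^ 6 \<le> 1 / b ^ 4" "1 / b ^ 4 \<le> 1 / b ^ 3" "b\<^sup>2 / L ^ 3 \<le> b ^ 3 / L ^ 3" "1 / (b * L) \<le> b ^ 3 / L ^ 3"
    "L\<^sup>2 / b ^ 5 \<le> 1 / b" "1 / b \<le> 1" "1 / b ^ 5 \<le> 1 / b ^ 3" "L\<^sup>2 / b ^ 4 \<le> 1"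
proof -
  have b: "b > 0" and L: "L > 0" using assms by auto
  have LL: "L\<^sup>2 \<le> b ^ 4" using power_mono[OF assms(4), of 2] L by (simp flip: power_mult)
  have p: "b ^ 6 = b\<^sup>2 * b ^ 4" "b ^ 5 = b ^ 4 * b" "L ^ 3 = L\<^sup>2 * L" "b ^ 4 = b ^ 3 * b"
    by (simp_all add: power_add[symmetric] power_Suc2[symmetric])
  have "L / b ^ 6 \<le> b\<^sup>2 / b ^ 6" using assms(4) b by (intro divide_right_mono) auto
  also have "\<dots> = 1 / b ^ 4" unfolding p(1) by (rule nonzero_divide_mult_cancel_left) (use b in simp)
  finally show "L / b ^ 6 \<le> 1 / b ^ 4" .
  show "1 / b ^ 4 \<le> 1 / b ^ 3" "1 / b ^ 5 \<le> 1 / b ^ 3"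
    using assms(1) b by (auto intro!: divide_left_mono power_increasing)
  show "b\<^sup>2 / L ^ 3 \<le> b ^ 3 / L ^ 3" using assms(1) L by (intro divide_right_mono power_increasing) auto
  have "1 / (b * L) = L\<^sup>2 / (b * L ^ 3)" using b L unfolding p(3) by simp
  also have "\<dots> \<le> b ^ 4 / (b * L ^ 3)" using LL b L by (intro divide_right_mono) auto
  also have "\<dots> = b ^ 3 / L ^ 3" using b L unfolding p(4) by simp
  finally show "1 / (b * L) \<le> b ^ 3 / L ^ 3" .
  have "L\<^sup>2 / b ^ 5 \<le> b ^ 4 / b ^ 5" using LL b by (intro divide_right_mono) auto
  thus "L\<^sup>2 / b ^ 5 \<le> 1 / b" using b unfolding p(2) by simp
  show "L\<^sup>2 / b ^ 4 \<le> 1" using LL b by simp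
  show "1 / b \<le> 1" using assms(1) by simp
qed

lemma trig_bounds:
  assumes "near_axis \<eta> s"
  defines "\<kappa> \<equiv> cos (Im \<eta>)"
  shows "cmod (1 / cosh (of_real t - \<eta> + s)) \<le> 9 / cosh_size \<kappa> t"
    "cmod (sin_sep (of_real t - \<eta> + s)) \<le> 500 * (half_exp t)\<^sup>2 / (cosh_size \<kappa> t)\<^sup>2"
    "cmod (cos_sep (of_real t - \<eta> + s)) \<le> 200 * half_exp t ^ 4 / (cosh_size \<kappa> t)\<^sup>2"
    "cmod (sinh (of_real t - \<eta> + s) / (cosh (of_real t - \<eta> + s))\<^sup>2) \<le> 243 * (half_exp t)\<^sup>2 / (cosh_size \<kappa> t)\<^sup>2"
proof -
  define z where "z = of_real t - \<eta> + s"
  note k = near_axis_kappa[OF assms(1), folded \<kappa>_def]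
  note l = cosh_size_bounds[OF k, of t]
  note na = near_axis_cosh[OF assms(1), of t, folded \<kappa>_def z_def]
  have Lb: "cosh_size \<kappa> t \<le> (half_exp t)\<^sup>2" using l by (simp add: half_exp_sq)
  have iC: "cmod (1 / cosh z) \<le> 9 / cosh_size \<kappa> t"
    using na(1,5) l(4) by (simp add: norm_divide field_simps)
  thus "cmod (1 / cosh (of_real t - \<eta> + s)) \<le> 9 / cosh_size \<kappa> t" by (simp add: z_def)
  have iC2: "cmod (1 / (cosh z)\<^sup>2) \<le> 81 / (cosh_size \<kappa> t)\<^sup>2"
    using power_mono[OF iC, of 2] by (simp add: power_divide norm_divide norm_power)
  have "cmod (sinh z / (cosh z)\<^sup>2) = cmod (sinh z) * cmod (1 / (cosh z)\<^sup>2)" by (simp add: norm_divide)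
  also have "\<dots> \<le> (3 * (half_exp t)\<^sup>2) * (81 / (cosh_size \<kappa> t)\<^sup>2)"
    using na(4) iC2 by (intro mult_mono) (auto simp: half_exp_sq)
  finally have S: "cmod (sinh z / (cosh z)\<^sup>2) \<le> 243 * (half_exp t)\<^sup>2 / (cosh_size \<kappa> t)\<^sup>2" by simp
  thus "cmod (sinh (of_real t - \<eta> + s) / (cosh (of_real t - \<eta> + s))\<^sup>2) \<le> 243 * (half_exp t)\<^sup>2 / (cosh_size \<kappa> t)\<^sup>2" by (simp add: z_def)
  have "cmod (sin_sep z) = 2 * cmod (sinh z / (cosh z)\<^sup>2)" by (simp add: sin_sep_def norm_divide norm_mult)
  also have "\<dots> \<le> 500 * (half_exp t)\<^sup>2 / (cosh_size \<kappa> t)\<^sup>2"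
  proof -
    have "0 \<le> (half_exp t)\<^sup>2 / (cosh_size \<kappa> t)\<^sup>2" by simp
    moreover have "2 * cmod (sinh z / (cosh z)\<^sup>2) \<le> 486 * ((half_exp t)\<^sup>2 / (cosh_size \<kappa> t)\<^sup>2)" using S by simp
    ultimately show ?thesis unfolding times_divide_eq_right[symmetric] by linarith
  qed
  finally show "cmod (sin_sep (of_real t - \<eta> + s)) \<le> 500 * (half_exp t)\<^sup>2 / (cosh_size \<kappa> t)\<^sup>2" by (simp add: z_def)
  have "(cosh_size \<kappa> t)\<^sup>2 \<le> half_exp t ^ 4" using power_mono[OF Lb, of 2] l by (simp flip: power_mult)
  hence 1: "1 \<le> half_exp t ^ 4 / (cosh_size \<kappa> t)\<^sup>2" using l by simp
  have b4: "1 \<le> half_exp t ^ 4" using half_exp_ge1 by simp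
  have "cmod (cos_sep z) \<le> 1 + 2 * cmod (1 / (cosh z)\<^sup>2)"
    unfolding cos_sep_def using norm_triangle_ineq4[of 1 "2 / (cosh z)\<^sup>2"] by (simp add: norm_divide)
  also have "\<dots> \<le> 1 + 162 * (half_exp t ^ 4 / (cosh_size \<kappa> t)\<^sup>2)"
    using iC2 divide_right_mono[OF b4, of "(cosh_size \<kappa> t)\<^sup>2"] by simp
  also have "\<dots> \<le> 200 * half_exp t ^ 4 / (cosh_size \<kappa> t)\<^sup>2" using 1 by simp
  finally show "cmod (cos_sep (of_real t - \<eta> + s)) \<le> 200 * half_exp t ^ 4 / (cosh_size \<kappa> t)\<^sup>2" by (simp add: z_def)
qed

text \<open>
  The whole segment from \<open>0\<close> to \<open>s\<close> consists of admissible shifts, so the mean value inequality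
  applies along it.
\<close>

lemma near_axis_chain:
  assumes "near_axis \<eta> s"
    and f: "\<And>z. \<bar>Im z\<bar> < pi / 2 \<Longrightarrow> cosh z \<noteq> 0 \<Longrightarrow> (f has_field_derivative f' z) (at z)"
    and bd: "\<And>s'. cmod s' \<le> cmod s \<Longrightarrow> cmod (f' (of_real t - \<eta> + s')) \<le> B"
  shows "cmod (f (of_real t - \<eta> + s) - f (of_real t - \<eta>)) \<le> B * cmod s"
proof -
  define S where "S = (\<lambda>s'. of_real t - \<eta> + s') ` cball 0 (cmod s)"
  have cv: "convex S" unfolding S_def by (rule convex_translation) (rule convex_cball)
  have inS: "\<exists>s'. z = of_real t - \<eta> + s' \<and> cmod s' \<le> cmod s" if "z \<in> S" for z using that unfolding S_def by (metis (no_types, lifting) imageE mem_cball_0)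
  have "cmod (f (of_real t - \<eta> + s) - f (of_real t - \<eta>)) \<le> B * cmod ((of_real t - \<eta> + s) - (of_real t - \<eta>))"
  proof (rule field_differentiable_bound[OF cv, of f f'])
    fix z assume "z \<in> S"
    then obtain s' where s': "z = of_real t - \<eta> + s'" "cmod s' \<le> cmod s" using inS by blast
    note n = near_axis_mono[OF assms(1) s'(2)]
    show "(f has_field_derivative f' z) (at z within S)"
      using f[of z] near_axis_Im[OF n, of t] near_axis_cosh(5)[OF n, of t] s'(1) by (auto intro: has_field_derivative_at_within)
    show "cmod (f' z) \<le> B" using bd s' by simp
  next
    show "of_real t - \<eta> \<in> S" unfolding S_def by (rule image_eqI[of _ _ 0]) auto
    show "of_real t - \<eta> + s \<in> S" unfolding S_def by (rule image_eqI[of _ _ s]) auto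
  qed
  thus ?thesis by simp
qed

lemma sech_shift:
  assumes "near_axis \<eta> s"
  shows "cmod (1 / cosh (of_real t - \<eta> + s) - 1 / cosh (of_real t - \<eta>))
    \<le> 243 * (half_exp t)\<^sup>2 / (cosh_size (cos (Im \<eta>)) t)\<^sup>2 * cmod s"
proof (rule near_axis_chain[OF assms, where f = "\<lambda>z. 1 / cosh z" and f' = "\<lambda>z. - (sinh z / (cosh z)\<^sup>2)"])
  fix z :: complex assume "cosh z \<noteq> 0"
  thus "((\<lambda>z. 1 / cosh z) has_field_derivative - (sinh z / (cosh z)\<^sup>2)) (at z)"
    by (auto intro!: derivative_eq_intros simp: power2_eq_square)
next
  fix s' assume "cmod s' \<le> cmod s"
  from trig_bounds(4)[OF near_axis_mono[OF assms this], of t]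
  show "cmod (- (sinh (of_real t - \<eta> + s') / (cosh (of_real t - \<eta> + s'))\<^sup>2)) \<le> 243 * (half_exp t)\<^sup>2 / (cosh_size (cos (Im \<eta>)) t)\<^sup>2"
    by simp
qed

lemma sech2_shift:
  assumes "near_axis \<eta> s"
  shows "cmod (1 / (cosh (of_real t - \<eta> + s))\<^sup>2 - 1 / (cosh (of_real t - \<eta>))\<^sup>2)
    \<le> 4374 * (half_exp t)\<^sup>2 / (cosh_size (cos (Im \<eta>)) t) ^ 3 * cmod s"
proof (rule near_axis_chain[OF assms, where f = "\<lambda>z. 1 / (cosh z)\<^sup>2" and f' = "\<lambda>z. - 2 * (sinh z / (cosh z)\<^sup>2) * (1 / cosh z)"])
  fix z :: complex assume "cosh z \<noteq> 0"
  thus "((\<lambda>z. 1 / (cosh z)\<^sup>2) has_field_derivative - 2 * (sinh z / (cosh z)\<^sup>2) * (1 / cosh z)) (at z)"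
    by (auto intro!: derivative_eq_intros simp: field_simps eval_nat_numeral)
next
  fix s' assume "cmod s' \<le> cmod s"
  note n = near_axis_mono[OF assms this]
  have "cmod (- 2 * (sinh (of_real t - \<eta> + s') / (cosh (of_real t - \<eta> + s'))\<^sup>2) * (1 / cosh (of_real t - \<eta> + s')))
    = 2 * (cmod (sinh (of_real t - \<eta> + s') / (cosh (of_real t - \<eta> + s'))\<^sup>2) * cmod (1 / cosh (of_real t - \<eta> + s')))"
    by (simp add: norm_mult norm_divide)
  also have "\<dots> \<le> 2 * (243 * (half_exp t)\<^sup>2 / (cosh_size (cos (Im \<eta>)) t)\<^sup>2 * (9 / cosh_size (cos (Im \<eta>)) t))"
    by (intro mult_left_mono mult_mono trig_bounds[OF n]) auto
  finally show "cmod (- 2 * (sinh (of_real t - \<eta> + s') / (cosh (of_real t - \<eta> + s'))\<^sup>2) * (1 / cosh (of_real t - \<eta> + s')))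
     \<le> 4374 * (half_exp t)\<^sup>2 / (cosh_size (cos (Im \<eta>)) t) ^ 3" by (simp add: power3_eq_cube power2_eq_square)
qed

lemma csep_shift:
  assumes "near_axis \<eta> s"
  shows "cmod (csep (of_real t - \<eta> + s) - csep (of_real t - \<eta>) - s * (2 / cosh (of_real t - \<eta>)))
    \<le> 486 * (half_exp t)\<^sup>2 / (cosh_size (cos (Im \<eta>)) t)\<^sup>2 * (cmod s)\<^sup>2"
    and "cmod (csep (of_real t - \<eta> + s) - csep (of_real t - \<eta>)) \<le> 18 / cosh_size (cos (Im \<eta>)) t * cmod s"
proof -
  define S where "S = (\<lambda>s'. of_real t - \<eta> + s') ` cball 0 (cmod s)"
  have cv: "convex S" unfolding S_def by (rule convex_translation) (rule convex_cball)
  have inS: "\<exists>s'. z = of_real t - \<eta> + s' \<and> cmod s' \<le> cmod s" if "z \<in> S" for z using that unfolding S_def by (metis (no_types, lifting) imageE mem_cball_0)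
  define f where "f i = (if i = 0 then csep else if i = 1 then (\<lambda>z. 2 / cosh z) else (\<lambda>z. - 2 * (sinh z / (cosh z)\<^sup>2)))" for i :: nat
  have "cmod (f 0 (of_real t - \<eta> + s) - (\<Sum>i\<le>1. f i (of_real t - \<eta>) * ((of_real t - \<eta> + s) - (of_real t - \<eta>)) ^ i / fact i))
     \<le> 486 * (half_exp t)\<^sup>2 / (cosh_size (cos (Im \<eta>)) t)\<^sup>2 * cmod ((of_real t - \<eta> + s) - (of_real t - \<eta>)) ^ Suc 1 / fact 1"
  proof (rule complex_Taylor[OF cv])
    fix i :: nat and z assume "z \<in> S" "i \<le> 1"
    then obtain s' where s': "z = of_real t - \<eta> + s'" "cmod s' \<le> cmod s" using inS by blast
    note n = near_axis_mono[OF assms(1) s'(2)]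
    have z: "\<bar>Im z\<bar> < pi / 2" "cosh z \<noteq> 0" using near_axis_Im[OF n, of t] near_axis_cosh(5)[OF n, of t] s'(1) by auto
    show "(f i has_field_derivative f (Suc i) z) (at z within S)"
    proof (cases "i = 0")
      case True
      thus ?thesis using csep_deriv[OF z(1)] by (simp add: f_def has_field_derivative_at_within)
    next
      case False
      hence "i = 1" using \<open>i \<le> 1\<close> by simp
      thus ?thesis using z by (auto simp: f_def power2_eq_square intro!: derivative_eq_intros)
    qed
  next
    fix z assume "z \<in> S"
    then obtain s' where s': "z = of_real t - \<eta> + s'" "cmod s' \<le> cmod s" using inS by blast
    note n = near_axis_mono[OF assms(1) s'(2)]
    have "cmod (f (Suc 1) z) = 2 * cmod (sinh z / (cosh z)\<^sup>2)"
      by (simp add: f_def norm_mult norm_divide)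
    also have "\<dots> \<le> 2 * (243 * (half_exp t)\<^sup>2 / (cosh_size (cos (Im \<eta>)) t)\<^sup>2)"
      using trig_bounds(4)[OF n, of t] s'(1) by (intro mult_left_mono) auto
    finally show "cmod (f (Suc 1) z) \<le> 486 * (half_exp t)\<^sup>2 / (cosh_size (cos (Im \<eta>)) t)\<^sup>2" by simp
  next
    show "of_real t - \<eta> \<in> S" unfolding S_def by (rule image_eqI[of _ _ 0]) auto
    show "of_real t - \<eta> + s \<in> S" unfolding S_def by (rule image_eqI[of _ _ s]) auto
  qed
  thus "cmod (csep (of_real t - \<eta> + s) - csep (of_real t - \<eta>) - s * (2 / cosh (of_real t - \<eta>)))
    \<le> 486 * (half_exp t)\<^sup>2 / (cosh_size (cos (Im \<eta>)) t)\<^sup>2 * (cmod s)\<^sup>2"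
    by (simp add: f_def power2_eq_square algebra_simps)
  show "cmod (csep (of_real t - \<eta> + s) - csep (of_real t - \<eta>)) \<le> 18 / cosh_size (cos (Im \<eta>)) t * cmod s"
  proof (rule near_axis_chain[OF assms, where f = csep and f' = "\<lambda>z. 2 / cosh z"])
    fix s' assume "cmod s' \<le> cmod s"
    from trig_bounds(1)[OF near_axis_mono[OF assms this], of t]
    show "cmod (2 / cosh (of_real t - \<eta> + s')) \<le> 18 / cosh_size (cos (Im \<eta>)) t" by (simp add: norm_divide)
  qed (auto intro: csep_deriv)
qed

lemma half_exp_pow: "t \<ge> 0 \<Longrightarrow> 1 / half_exp t ^ n = exp (- (of_nat n / 2 * t))"
  by (simp add: half_exp_def exp_minus inverse_eq_divide mult.commute flip: exp_of_nat_mult)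

text \<open>
  With \<open>b = half_exp t\<close> and \<open>\<lambda> = cosh_size \<kappa> t\<close>, \<open>\<lambda>\<^sup>3 / b\<^sup>5\<close> has the derivative
  \<open>(3 - 5/2 \<lambda> / b\<^sup>2) \<lambda>\<^sup>2 / b\<^sup>3\<close> for \<open>t > 0\<close>, and the bracket is at least \<open>1/2\<close> as \<open>\<lambda> \<le> b\<^sup>2\<close>.
\<close>

lemma primitive_weight_bound:
  fixes Y y :: "real \<Rightarrow> complex"
  assumes \<kappa>: "0 < \<kappa>" "\<kappa> \<le> 1" and G: "G \<ge> 0"
    and der: "\<And>t. (Y has_vector_derivative y t) (at t)"
    and bd: "\<And>t. cmod (y t) \<le> G * (cosh_size \<kappa> t)\<^sup>2 / half_exp t ^ 3" and Y0: "Y 0 = 0"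
  shows "cmod (Y t) \<le> 2 * G * cosh_size \<kappa> t ^ 3 / half_exp t ^ 5"
proof -
  have pos: "cmod (Y t) \<le> 2 * G * cosh_size \<kappa> t ^ 3 / half_exp t ^ 5"
    if der: "\<And>t. (Y has_vector_derivative y t) (at t)"
      and bd: "\<And>t. cmod (y t) \<le> G * (cosh_size \<kappa> t)\<^sup>2 / half_exp t ^ 3" and Y0: "Y 0 = 0" and t: "t \<ge> 0"
    for Y y :: "real \<Rightarrow> complex" and t
  proof (cases "t = 0")
    case True
    thus ?thesis using Y0 G cosh_size_bounds(4)[OF \<kappa>, of t] half_exp_pos[of t] by simp
  next
    case False
    hence t: "t > 0" using t by simp
    define L where "L s = exp s - 1 + \<kappa>" for s :: real
    define \<phi> where "\<phi> s = 2 * G * (L s ^ 3 * exp (- (5/2 * s)))" for s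
    define \<phi>' where "\<phi>' s = 2 * G * ((3 * (L s)\<^sup>2 * exp s) * exp (- (5/2 * s)) - 5/2 * (L s ^ 3 * exp (- (5/2 * s))))" for s
    have "norm (Y t - Y 0) \<le> \<phi> t - \<phi> 0"
    proof (rule differentiable_bound_general[OF t, of Y \<phi> y \<phi>'])
      show "continuous_on {0..t} Y"
        by (rule continuous_on_vector_derivative) (rule has_vector_derivative_at_within[OF der])
      show "continuous_on {0..t} \<phi>" unfolding \<phi>_def L_def by (intro continuous_intros)
      fix s :: real assume s: "0 < s" "s < t"
      show "(Y has_vector_derivative y s) (at s)" by (rule der)
      have dL: "(L has_real_derivative exp s) (at s)" unfolding L_def by (auto intro!: derivative_eq_intros)
      show "(\<phi> has_vector_derivative \<phi>' s) (at s)"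
      proof -
        have "((\<lambda>s. L s ^ 3) has_real_derivative 3 * (L s)\<^sup>2 * exp s) (at s)"
          using DERIV_power[OF dL, of 3] by (simp add: mult_ac)
        moreover have "((\<lambda>s. exp (- (5/2 * s))) has_real_derivative - (5/2) * exp (- (5/2 * s))) (at s)"
          by (auto intro!: derivative_eq_intros)
        ultimately have "((\<lambda>s. 2 * G * (L s ^ 3 * exp (- (5/2 * s)))) has_real_derivative
            2 * G * (L s ^ 3 * (- (5/2) * exp (- (5/2 * s))) + 3 * (L s)\<^sup>2 * exp s * exp (- (5/2 * s)))) (at s)"
          by (intro DERIV_cmult DERIV_mult')
        thus ?thesis
          unfolding has_real_derivative_iff_has_vector_derivative[symmetric] \<phi>_def \<phi>'_def by (simp add: mult_ac)
      qed
      have Ls: "L s = cosh_size \<kappa> s" "L s \<le> exp s" "0 < L s" using cosh_size_bounds[OF \<kappa>, of s] s by (auto simp: L_def cosh_size_def)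
      have e5: "exp (- (5/2 * s)) * exp s = 1 / half_exp s ^ 3"
        using s by (simp add: half_exp_pow exp_add[symmetric])
      have "L s * (5/2) + exp s / 2 \<le> 3 * exp s" using Ls(2) by simp
      hence "2 * G * ((L s)\<^sup>2 * exp (- (5/2 * s)) * (exp s / 2)) \<le> 2 * G * ((L s)\<^sup>2 * exp (- (5/2 * s)) * (3 * exp s - L s * (5/2)))"
        using G by (intro mult_left_mono) auto
      also have "\<dots> = \<phi>' s" by (simp add: \<phi>'_def right_diff_distrib power2_eq_square power3_eq_cube)
      also have "2 * G * ((L s)\<^sup>2 * exp (- (5/2 * s)) * (exp s / 2)) = G * (L s)\<^sup>2 * (exp (- (5/2 * s)) * exp s)" by simp
      finally show "norm (y s) \<le> \<phi>' s" using bd[of s] unfolding e5 Ls(1) by simp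
    qed
    also have "\<dots> \<le> \<phi> t" using G \<kappa> by (simp add: \<phi>_def L_def)
    also have "\<phi> t = 2 * G * cosh_size \<kappa> t ^ 3 / half_exp t ^ 5"
    proof -
      have "exp (- (5/2 * t)) = 1 / half_exp t ^ 5"
        using t by (simp add: half_exp_pow)
      thus ?thesis using t by (simp add: \<phi>_def L_def cosh_size_def)
    qed
    finally show ?thesis using Y0 by simp
  qed
  show ?thesis
  proof (cases "t \<ge> 0")
    case True
    from pos[OF der bd Y0 this] show ?thesis .
  next
    case False
    have "cmod (Y (- (- t))) \<le> 2 * G * cosh_size \<kappa> (- t) ^ 3 / half_exp (- t) ^ 5"
    proof (rule pos[of "\<lambda>t. Y (- t)" "\<lambda>t. - y (- t)"])
      fix u :: real
      show "((\<lambda>t. Y (- t)) has_vector_derivative - y (- u)) (at u)"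
      proof -
        have "(uminus has_vector_derivative (-1)) (at u)" by (auto intro!: derivative_eq_intros)
        from vector_diff_chain_at[OF this der] show ?thesis by (simp add: o_def)
      qed
      show "cmod (- y (- u)) \<le> G * (cosh_size \<kappa> u)\<^sup>2 / half_exp u ^ 3" using bd[of "-u"] by (simp add: cosh_size_def half_exp_def)
    qed (use Y0 False in auto)
    thus ?thesis by (simp add: cosh_size_def half_exp_def)
  qed
qed

section \<open>The residual force and the solvability condition\<close>

text \<open>
  Inserting \<open>Q = q + w\<close> into the equation and moving the part that is linear in \<open>w\<close> to the left
  leaves \<open>- w'' + cos q * w = residual_term + \<alpha> \<psi>\<close>, with \<open>H\<close> the value of the forcing.
\<close>

definition residual_term :: "real \<Rightarrow> complex \<Rightarrow> complex \<Rightarrow> complex \<Rightarrow> complex" where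
  "residual_term \<mu> H z w = - (sin_sep z * (cos w - 1) + cos_sep z * (sin w - w)) - of_real \<mu> * H * (sin_sep z * cos w + cos_sep z * sin w)"

lemma prof_weight_arith:
  fixes b L :: real assumes "b > 0" "L > 0"
  shows "(L\<^sup>2 / b ^ 5)\<^sup>2 * (b ^ 4 / L\<^sup>2) = L\<^sup>2 / b ^ 6" "(L\<^sup>2 / b ^ 5) * (b ^ 4 / L\<^sup>2) = 1 / b"
    "(L\<^sup>2 / b ^ 5) * (L\<^sup>2 / b ^ 6) = L ^ 4 / b ^ 11"
proof -
  have p: "b ^ 10 = b ^ 6 * b ^ 4" "L ^ 4 = L\<^sup>2 * L\<^sup>2" "b ^ 5 = b * b ^ 4" "b ^ 11 = b ^ 5 * b ^ 6"
    by (simp_all add: eval_nat_numeral)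
  have "(L\<^sup>2 / b ^ 5)\<^sup>2 = (L\<^sup>2 * L\<^sup>2) / (b ^ 6 * b ^ 4)"
    by (simp add: power_divide power_mult[symmetric] p(1,2)[symmetric])
  hence "(L\<^sup>2 / b ^ 5)\<^sup>2 * (b ^ 4 / L\<^sup>2) = (L\<^sup>2 * L\<^sup>2) / (b ^ 6 * b ^ 4) * (b ^ 4 / L\<^sup>2)" by (simp only:)
  also have "\<dots> = (L\<^sup>2 / b ^ 6) * (L\<^sup>2 / L\<^sup>2) * (b ^ 4 / b ^ 4)" by (simp only: times_divide_times_eq mult_ac)
  also have "\<dots> = L\<^sup>2 / b ^ 6" using assms by simp
  finally show "(L\<^sup>2 / b ^ 5)\<^sup>2 * (b ^ 4 / L\<^sup>2) = L\<^sup>2 / b ^ 6" .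
  show "(L\<^sup>2 / b ^ 5) * (b ^ 4 / L\<^sup>2) = 1 / b" using assms unfolding p(3) by simp
  show "(L\<^sup>2 / b ^ 5) * (L\<^sup>2 / b ^ 6) = L ^ 4 / b ^ 11" unfolding p(2,4) by simp
qed

lemma prof_weight_bounds:
  assumes "0 < \<kappa>" "\<kappa> \<le> 1"
  shows "0 \<le> prof_weight \<kappa> t" "prof_weight \<kappa> t \<le> 1 / half_exp t" "prof_weight \<kappa> t \<le> 1"
    "1 / half_exp t ^ 3 \<le> src_weight \<kappa> t" "half_exp t ^ 3 / cosh_size \<kappa> t ^ 3 \<le> src_weight \<kappa> t / \<kappa>\<^sup>2" "0 < prof_weight \<kappa> t"
proof -
  note l = cosh_size_bounds[OF assms, of t]
  have Lb: "cosh_size \<kappa> t \<le> (half_exp t)\<^sup>2" using l by (simp add: half_exp_sq)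
  note wa = weights_arith[OF half_exp_ge1 assms(1) l(1) Lb assms(2)]
  show "0 < prof_weight \<kappa> t" "0 \<le> prof_weight \<kappa> t" using half_exp_pos[of t] l(4) by (simp_all add: prof_weight_def)
  show 1: "prof_weight \<kappa> t \<le> 1 / half_exp t" using wa(5) by (simp add: prof_weight_def)
  show "prof_weight \<kappa> t \<le> 1" using 1 wa(6) by linarith
  show "1 / half_exp t ^ 3 \<le> src_weight \<kappa> t" using half_exp_pos[of t] l(4) by (simp add: src_weight_def)
  show "half_exp t ^ 3 / cosh_size \<kappa> t ^ 3 \<le> src_weight \<kappa> t / \<kappa>\<^sup>2"
    using assms half_exp_pos[of t] l(4) by (simp add: src_weight_def add_divide_distrib)
qed

text \<open>
  The quadratic terms cost a double pole, which the square of the profile weight outweighs. The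
  forced term is not small near the pole and is the source of the factor \<open>\<kappa>\<^sup>-\<^sup>2\<close>.
\<close>

lemma residual_term_bound:
  assumes na: "near_axis \<eta> s"
  defines "\<kappa> \<equiv> cos (Im \<eta>)"
  assumes w: "cmod w \<le> R * prof_weight \<kappa> t" and R: "0 \<le> R" "R \<le> 1" and H: "cmod H \<le> M" and \<mu>: "0 \<le> \<mu>"
  shows "cmod (residual_term \<mu> H (of_real t - \<eta> + s) w / cosh (of_real t - \<eta> + s)) \<le> 23400 * (R\<^sup>2 + \<mu> * M / \<kappa>\<^sup>2) * src_weight \<kappa> t"
proof -
  note k = near_axis_kappa[OF na, folded \<kappa>_def]
  define z where "z = of_real t - \<eta> + s"
  define b where "b = half_exp t" define L where "L = cosh_size \<kappa> t"
  define V where "V = prof_weight \<kappa> t"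
  note tb = trig_bounds[OF na, of t, folded \<kappa>_def z_def, folded b_def L_def]
  note l = cosh_size_bounds[OF k, of t, folded L_def]
  have b: "1 \<le> b" "0 < b" using half_exp_ge1 half_exp_pos by (auto simp: b_def)
  have Lb: "L \<le> b\<^sup>2" using l by (simp add: half_exp_sq b_def)
  note wa = weights_arith[OF b(1) k(1) l(1) Lb k(2)]
  note Vb = prof_weight_bounds[OF k, of t, folded V_def b_def L_def]
  have V: "V = L\<^sup>2 / b ^ 5" by (simp add: V_def prof_weight_def b_def L_def)
  have w1: "cmod w \<le> 1" using w R Vb(1,3) mult_mono[of R 1 V 1] by (simp add: V_def)
  note sc = complex_sin_cos_bounds[OF w1]
  have M: "0 \<le> M" using H norm_ge_zero order_trans by blast
  have ww: "(cmod w)\<^sup>2 \<le> cmod w" using w1 by (simp add: power2_eq_square mult_left_le)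
  define q where "q = b ^ 4 / L\<^sup>2"
  have q0: "0 \<le> q" by (simp add: q_def)
  have p1: "cmod (sin_sep z) \<le> 500 * (b\<^sup>2 / L\<^sup>2)" using tb(2) by simp
  have "b\<^sup>2 / L\<^sup>2 \<le> q" unfolding q_def using b(1) by (intro divide_right_mono power_increasing) auto
  hence p2: "cmod (sin_sep z) \<le> 500 * q" using p1 by linarith
  have p3: "cmod (cos_sep z) \<le> 200 * q" using tb(3) by (simp add: q_def)
  \<comment> \<open>Here \<open>q = b^4 / L\<^sup>2\<close> is the double pole and \<open>V\<^sup>2 q = L\<^sup>2 / b^6\<close> no longer has one.\<close>
  have quad: "cmod (sin_sep z * (cos w - 1) + cos_sep z * (sin w - w)) \<le> 2100 * R\<^sup>2 * (L\<^sup>2 / b ^ 6)"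
  proof -
    have "cmod (sin_sep z * (cos w - 1) + cos_sep z * (sin w - w)) \<le> (500 * q) * (3 * (cmod w)\<^sup>2) + (200 * q) * (3 * (cmod w)\<^sup>2)"
    proof (intro norm_triangle_le add_mono)
      show "cmod (sin_sep z * (cos w - 1)) \<le> (500 * q) * (3 * (cmod w)\<^sup>2)"
        unfolding norm_mult by (rule mult_mono[OF p2 sc(1)]) (use q0 in auto)
      show "cmod (cos_sep z * (sin w - w)) \<le> (200 * q) * (3 * (cmod w)\<^sup>2)"
        unfolding norm_mult by (rule mult_mono[OF p3 sc(2)]) (use q0 in auto)
    qed
    also have "\<dots> = 2100 * ((cmod w)\<^sup>2 * q)" by simp
    also have "\<dots> \<le> 2100 * ((R * V)\<^sup>2 * q)"
      using w q0 by (intro mult_left_mono mult_right_mono power_mono) (auto simp: V_def)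
    also have "\<dots> = 2100 * R\<^sup>2 * (V\<^sup>2 * q)" by (simp add: power_mult_distrib)
    also have "V\<^sup>2 * q = L\<^sup>2 / b ^ 6" unfolding V q_def by (rule prof_weight_arith) (use b l in auto)
    finally show ?thesis .
  qed
  have forc: "cmod (sin_sep z * cos w + cos_sep z * sin w) \<le> 500 * (b\<^sup>2 / L\<^sup>2) + 2100 * R * (1 / b)"
  proof -
    have "sin_sep z * cos w + cos_sep z * sin w = sin_sep z + (sin_sep z * (cos w - 1) + cos_sep z * sin w)" by (simp add: algebra_simps)
    also have "cmod \<dots> \<le> 500 * (b\<^sup>2 / L\<^sup>2) + ((500 * q) * (3 * cmod w) + (200 * q) * (3 * cmod w))"
    proof (intro norm_triangle_le add_mono p1)
      show "cmod (sin_sep z * (cos w - 1)) \<le> (500 * q) * (3 * cmod w)"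
        unfolding norm_mult using sc(1) ww q0 p2 by (intro mult_mono) auto
      show "cmod (cos_sep z * sin w) \<le> (200 * q) * (3 * cmod w)"
        unfolding norm_mult using sc(3) q0 p3 by (intro mult_mono) auto
    qed
    also have "(500 * q) * (3 * cmod w) + (200 * q) * (3 * cmod w) = 2100 * (cmod w * q)" by simp
    also have "cmod w * q \<le> (R * V) * q" using w q0 by (intro mult_right_mono) (auto simp: V_def)
    also have "(R * V) * q = R * (1 / b)"
      using prof_weight_arith(2)[OF b(2) l(4)] by (simp only: V q_def mult.assoc)
    finally show ?thesis by simp
  qed
  have "cmod (residual_term \<mu> H z w) \<le> 2100 * R\<^sup>2 * (L\<^sup>2 / b ^ 6) + \<mu> * M * (500 * (b\<^sup>2 / L\<^sup>2) + 2100 * R * (1 / b))"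
    unfolding residual_term_def
  proof (intro order_trans[OF norm_triangle_ineq4] add_mono)
    show "cmod (of_real \<mu> * H * (sin_sep z * cos w + cos_sep z * sin w)) \<le> \<mu> * M * (500 * (b\<^sup>2 / L\<^sup>2) + 2100 * R * (1 / b))"
      unfolding norm_mult using forc H \<mu> M by (intro mult_mono) auto
  qed (use quad in \<open>simp only: norm_minus_cancel\<close>)
  hence "cmod (residual_term \<mu> H z w * (1 / cosh z)) \<le> (2100 * R\<^sup>2 * (L\<^sup>2 / b ^ 6) + \<mu> * M * (500 * (b\<^sup>2 / L\<^sup>2) + 2100 * R * (1 / b))) * (9 / L)"
    unfolding norm_mult using tb(1) M \<mu> R b l by (intro mult_mono) auto
  also have "\<dots> = 18900 * R\<^sup>2 * (L\<^sup>2 / b ^ 6 / L) + \<mu> * M * (4500 * (b\<^sup>2 / L\<^sup>2 / L) + 18900 * R * (1 / b / L))"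
    by (simp add: algebra_simps)
  also have "L\<^sup>2 / b ^ 6 / L = L / b ^ 6" using l by (simp add: power2_eq_square)
  also have "b\<^sup>2 / L\<^sup>2 / L = b\<^sup>2 / L ^ 3" by (simp add: power3_eq_cube power2_eq_square)
  also have "1 / b / L = 1 / (b * L)" by simp
  also have "18900 * R\<^sup>2 * (L / b ^ 6) + \<mu> * M * (4500 * (b\<^sup>2 / L ^ 3) + 18900 * R * (1 / (b * L)))
     \<le> 23400 * R\<^sup>2 * src_weight \<kappa> t + \<mu> * M * (4500 * (src_weight \<kappa> t / \<kappa>\<^sup>2) + 18900 * 1 * (src_weight \<kappa> t / \<kappa>\<^sup>2))"
  proof (intro add_mono)
    have "L / b ^ 6 \<le> src_weight \<kappa> t" using wa(1,2) Vb(4) by linarith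
    thus "18900 * R\<^sup>2 * (L / b ^ 6) \<le> 23400 * R\<^sup>2 * src_weight \<kappa> t"
      using src_weight_nonneg[OF k] l b by (intro mult_mono) auto
    have "b\<^sup>2 / L ^ 3 \<le> src_weight \<kappa> t / \<kappa>\<^sup>2" "1 / (b * L) \<le> src_weight \<kappa> t / \<kappa>\<^sup>2" using wa(3,4) Vb(5) by linarith+
    moreover have "0 \<le> 1 / (b * L)" using b l by simp
    ultimately show "\<mu> * M * (4500 * (b\<^sup>2 / L ^ 3) + 18900 * R * (1 / (b * L))) \<le> \<mu> * M * (4500 * (src_weight \<kappa> t / \<kappa>\<^sup>2) + 18900 * 1 * (src_weight \<kappa> t / \<kappa>\<^sup>2))"
      using R \<mu> M by (intro mult_left_mono add_mono mult_mono) auto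
  qed
  also have "\<dots> = 23400 * (R\<^sup>2 + \<mu> * M / \<kappa>\<^sup>2) * src_weight \<kappa> t" by (simp add: algebra_simps)
  finally show ?thesis by (simp add: z_def)
qed

text \<open>
  The function \<open>1 / cosh\<close> spans the kernel of the linearised operator \<open>- w'' + cos q * w\<close>. This is
  its pairing with \<open>\<psi>\<close>, the number by which the solvability condition has to be divided.
\<close>

definition pairing :: "complex \<Rightarrow> complex \<Rightarrow> complex" where
  "pairing \<eta> s = (\<integral>t. cpsi (of_real t - \<eta>) / cosh (of_real t - \<eta> + s) \<partial>lborel)"

lemma cpsi_weight_bound:
  assumes na: "near_axis \<eta> 0"
  defines "\<kappa> \<equiv> cos (Im \<eta>)"
  shows "cmod (cpsi (of_real t - \<eta>)) \<le> 5400 * ((cosh_size \<kappa> t)\<^sup>2 / half_exp t ^ 6)"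
proof -
  have "exp \<bar>t\<bar> ^ 3 = half_exp t ^ 6" by (simp add: half_exp_sq[symmetric] power_mult[symmetric])
  thus ?thesis using cpsi_bound(1)[OF na, of t, folded \<kappa>_def] by simp
qed

lemma cpsi_sech_bound:
  assumes na: "near_axis \<eta> s"
  defines "\<kappa> \<equiv> cos (Im \<eta>)"
  shows "cmod (cpsi (of_real t - \<eta>) / cosh (of_real t - \<eta> + s)) \<le> 48600 / half_exp t ^ 4"
    "cmod (cpsi (of_real t - \<eta>) / cosh (of_real t - \<eta> + s)) \<le> 48600 * src_weight \<kappa> t"
    "cmod (cpsi (of_real t - \<eta>)) \<le> 5400 / (half_exp t)\<^sup>2"
proof -
  note k = near_axis_kappa[OF na, folded \<kappa>_def]
  define b where "b = half_exp t" define L where "L = cosh_size \<kappa> t"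
  note l = cosh_size_bounds[OF k, of t, folded L_def]
  have b: "1 \<le> b" "0 < b" using half_exp_ge1 half_exp_pos by (auto simp: b_def)
  have Lb: "L \<le> b\<^sup>2" using l by (simp add: half_exp_sq b_def)
  note wa = weights_arith[OF b(1) k(1) l(1) Lb k(2)]
  note pw = cpsi_weight_bound[OF near_axis_zero[OF na], of t, folded \<kappa>_def, folded b_def L_def]
  have "cmod (cpsi (of_real t - \<eta>) / cosh (of_real t - \<eta> + s)) = cmod (cpsi (of_real t - \<eta>)) * cmod (1 / cosh (of_real t - \<eta> + s))"
    by (simp add: norm_divide)
  also have "\<dots> \<le> 5400 * (L\<^sup>2 / b ^ 6) * (9 / L)"
    using pw trig_bounds(1)[OF na, of t, folded \<kappa>_def, folded L_def] by (intro mult_mono) auto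
  also have "\<dots> = 48600 * (L / b ^ 6)" using l by (simp add: power2_eq_square)
  finally have 1: "cmod (cpsi (of_real t - \<eta>) / cosh (of_real t - \<eta> + s)) \<le> 48600 * (1 / b ^ 4)" using wa(1) by linarith
  thus "cmod (cpsi (of_real t - \<eta>) / cosh (of_real t - \<eta> + s)) \<le> 48600 / half_exp t ^ 4" by (simp add: b_def)
  show "cmod (cpsi (of_real t - \<eta>) / cosh (of_real t - \<eta> + s)) \<le> 48600 * src_weight \<kappa> t"
    using 1 wa(2) prof_weight_bounds(4)[OF k, of t, folded b_def] by linarith
  have "L\<^sup>2 / b ^ 6 = (L\<^sup>2 / b ^ 4) * (1 / b\<^sup>2)" by (simp flip: power_add)
  also have "\<dots> \<le> 1 * (1 / b\<^sup>2)" using wa(8) by (intro mult_right_mono) auto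
  finally show "cmod (cpsi (of_real t - \<eta>)) \<le> 5400 / (half_exp t)\<^sup>2" using pw by (simp add: b_def)
qed

lemma continuous_trig:
  assumes na: "near_axis \<eta> s"
  shows "continuous_on A (\<lambda>t. 1 / cosh (of_real t - \<eta> + s))" "continuous_on A (\<lambda>t. cpsi (of_real t - \<eta>))"
    "continuous_on A (\<lambda>t. sin_sep (of_real t - \<eta> + s))" "continuous_on A (\<lambda>t. cos_sep (of_real t - \<eta> + s))"
    "continuous_on A (\<lambda>t. csep (of_real t - \<eta> + s))"
proof -
  note nz = near_axis_cosh(5)[OF na] cpsi_bound(2)[OF near_axis_zero[OF na]]
  show "continuous_on A (\<lambda>t. 1 / cosh (of_real t - \<eta> + s))"
    by (intro continuous_intros) (use nz in auto)
  show "continuous_on A (\<lambda>t. cpsi (of_real t - \<eta>))"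
    unfolding cpsi_def by (intro continuous_intros) (use nz in auto)
  show "continuous_on A (\<lambda>t. sin_sep (of_real t - \<eta> + s))" "continuous_on A (\<lambda>t. cos_sep (of_real t - \<eta> + s))"
    unfolding sin_sep_def cos_sep_def by (intro continuous_intros; use nz in auto)+
  show "continuous_on A (\<lambda>t. csep (of_real t - \<eta> + s))"
  proof (rule continuous_on_compose2[of "{z. \<bar>Im z\<bar> < pi / 2}" csep])
    show "continuous_on {z. \<bar>Im z\<bar> < pi / 2} csep"
    proof (rule DERIV_continuous_on)
      fix z :: complex assume "z \<in> {z. \<bar>Im z\<bar> < pi / 2}"
      thus "(csep has_field_derivative 2 / cosh z) (at z within {z. \<bar>Im z\<bar> < pi / 2})"
        by (intro has_field_derivative_at_within[OF csep_deriv]) simp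
    qed
    show "continuous_on A (\<lambda>t. complex_of_real t - \<eta> + s)" by (intro continuous_intros)
    show "(\<lambda>t. complex_of_real t - \<eta> + s) ` A \<subseteq> {z. \<bar>Im z\<bar> < pi / 2}"
      using near_axis_Im[OF na] by (simp add: image_subset_iff)
  qed
qed

text \<open>
  The integrand has the antiderivative \<open>(X - X\<^sup>5 / 5) / 4\<close> with
  \<open>X = tanh ((t - \<eta>) / 2) = sinh / (1 + cosh)\<close>, and \<open>X\<close> tends to \<open>\<plusminus>1\<close> for every \<open>\<eta>\<close>.
\<close>

lemma pairing_zero:
  assumes na: "near_axis \<eta> 0"
  shows "pairing \<eta> 0 = 2 / 5"
proof -
  note k = near_axis_kappa[OF na]
  note cosh0 = near_axis_cosh(5)[OF na, simplified]
  note c1 = cpsi_bound(2)[OF na]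
  define X where "X t = sinh (of_real t - \<eta>) / (1 + cosh (of_real t - \<eta>))" for t :: real
  have "(\<integral>t. cpsi (of_real t - \<eta>) / cosh (of_real t - \<eta>) \<partial>lborel) = (1/5) - (- (1/5))"
  proof (rule integral_real_line_FTC[where K = "\<lambda>t. (X t - X t ^ 5 / 5) / 4"])
    fix t :: real
    define c where "c = cosh (of_real t - \<eta>)" define S where "S = sinh (of_real t - \<eta>)"
    have S2: "S\<^sup>2 = c\<^sup>2 - 1" unfolding c_def S_def by (rule sinh_square_eq)
    have nz: "c \<noteq> 0" "1 + c \<noteq> 0" using cosh0[of t] c1[of t] by (auto simp: c_def)
    define Xf where "Xf z = sinh (z - \<eta>) / (1 + cosh (z - \<eta>))" for z
    have dX: "(Xf has_field_derivative 1 / (1 + c)) (at (of_real t))"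
    proof -
      have "((\<lambda>z. sinh (z - \<eta>) / (1 + cosh (z - \<eta>))) has_field_derivative (c * (1 + c) - S * S) / ((1 + c) * (1 + c))) (at (of_real t))"
        using nz unfolding c_def S_def by (auto intro!: derivative_eq_intros)
      moreover have "c * (1 + c) - S * S = 1 + c" using S2 by (simp add: power2_eq_square algebra_simps)
      ultimately show ?thesis using nz by (simp add: Xf_def[abs_def])
    qed
    have X2: "(S / (1 + c))\<^sup>2 = (c - 1) / (1 + c)"
    proof -
      have "S\<^sup>2 = (c - 1) * (1 + c)" using S2 by (simp add: power2_eq_square algebra_simps)
      thus ?thesis using nz by (simp add: power_divide) (simp add: power2_eq_square)
    qed
    have "(1 - (S / (1 + c)) ^ 4) * (1 / (1 + c)) / 4 = c / (1 + c) ^ 3"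
    proof -
      have "(S / (1 + c)) ^ 4 = ((c - 1) / (1 + c))\<^sup>2" unfolding X2[symmetric] by (simp flip: power_mult)
      also have "1 - \<dots> = ((1 + c)\<^sup>2 - (c - 1)\<^sup>2) / (1 + c)\<^sup>2"
        using nz diff_divide_distrib[of "(1 + c)\<^sup>2" "(c - 1)\<^sup>2" "(1 + c)\<^sup>2"] unfolding power_divide by simp
      also have "(1 + c)\<^sup>2 - (c - 1)\<^sup>2 = 4 * c" by (simp add: power2_eq_square algebra_simps)
      finally show ?thesis using nz by (simp add: power3_eq_cube power2_eq_square)
    qed
    moreover have "((\<lambda>z. (Xf z - Xf z ^ 5 / 5) / 4) has_field_derivative (1 - Xf (of_real t) ^ 4) * (1 / (1 + c)) / 4) (at (of_real t))"
    proof -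
      have "((\<lambda>z. Xf z ^ 5) has_field_derivative 5 * (1 / (1 + c) * Xf (of_real t) ^ 4)) (at (of_real t))"
        using DERIV_power[OF dX, of 5] by simp
      from DERIV_cdivide[OF DERIV_diff[OF dX DERIV_cdivide[OF this, of 5]], of 4]
      moreover have "(d - 5 * (d * Y) / 5) / 4 = (1 - Y) * d / 4" for d Y :: complex
        by (simp add: algebra_simps)
      ultimately show ?thesis by (simp only:)
    qed
    moreover have "Xf (of_real t) = S / (1 + c)" by (simp add: Xf_def S_def c_def)
    ultimately have "((\<lambda>z. (Xf z - Xf z ^ 5 / 5) / 4) has_field_derivative c / (1 + c) ^ 3) (at (of_real t))" by simp
    from has_vector_derivative_real_field[OF this]
    show "((\<lambda>t. (X t - X t ^ 5 / 5) / 4) has_vector_derivative cpsi (of_real t - \<eta>) / cosh (of_real t - \<eta>)) (at t)"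
      using nz by (simp add: X_def Xf_def cpsi_def c_def[symmetric] power2_eq_square)
  next
    show "continuous_on UNIV (\<lambda>t. cpsi (of_real t - \<eta>) / cosh (of_real t - \<eta>))"
      using continuous_on_mult[OF continuous_trig(2)[OF na] continuous_trig(1)[OF na]] by simp
  next
    show "integrable lborel (\<lambda>t. cpsi (of_real t - \<eta>) / cosh (of_real t - \<eta>))"
      using cpsi_sech_bound(2)[OF na]
      by (intro src_weight_integral(1)[OF k, where G = 48600])
         (auto intro!: borel_measurable_continuous_onI continuous_on_mult[OF continuous_trig(2)[OF na] continuous_trig(1)[OF na], simplified])
  next
    have ez: "((\<lambda>t. exp (\<eta> - of_real t)) \<longlongrightarrow> 0) at_top"
    proof (rule Lim_null_comparison[OF always_eventually])
      show "\<forall>t. norm (exp (\<eta> - of_real t)) \<le> exp (Re \<eta>) * exp (- (1 * t))"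
        by (simp add: norm_exp_eq_Re flip: exp_add)
      show "((\<lambda>t. exp (Re \<eta>) * exp (- (1 * t))) \<longlongrightarrow> 0) at_top"
        using tendsto_mult[OF tendsto_const exp_neg_tendsto_0[of 1]] by simp
    qed
    have X1: "X t = (1 - exp (\<eta> - of_real t)) / (1 + exp (\<eta> - of_real t))" for t
    proof -
      define e where "e = exp (of_real t - \<eta>)"
      have e0: "e \<noteq> 0" by (simp add: e_def)
      have ei: "exp (\<eta> - of_real t) = 1 / e" by (simp add: e_def exp_minus[symmetric] inverse_eq_divide[symmetric])
      have cc: "cosh (of_real t - \<eta>) = (e + 1 / e) / 2" "sinh (of_real t - \<eta>) = (e - 1 / e) / 2"
        using ei by (simp_all add: cosh_field_def sinh_field_def e_def)
      have nz: "(e + 1)\<^sup>2 \<noteq> 0"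
      proof -
        have "1 + cosh (of_real t - \<eta>) = (e + 1)\<^sup>2 / (2 * e)" using e0 unfolding cc by (simp add: field_simps power2_eq_square)
        thus ?thesis using c1[of t] by auto
      qed
      have "X t = ((e - 1) * (e + 1) / (2 * e)) / ((e + 1)\<^sup>2 / (2 * e))"
        unfolding X_def cc using e0 by (simp add: field_simps power2_eq_square)
      also have "\<dots> = (e - 1) / (e + 1)" using e0 nz by (simp add: power2_eq_square)
      also have "\<dots> = ((e - 1) / e) / ((e + 1) / e)" using e0 by simp
      also have "\<dots> = (1 - 1 / e) / (1 + 1 / e)" using e0 by (simp add: diff_divide_distrib add_divide_distrib)
      finally show ?thesis by (simp add: ei)
    qed
    have "((\<lambda>t. (1 - exp (\<eta> - of_real t)) / (1 + exp (\<eta> - of_real t))) \<longlongrightarrow> (1 - 0) / (1 + 0)) at_top"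
      by (intro tendsto_intros ez) auto
    hence Xt: "(X \<longlongrightarrow> 1) at_top" by (simp add: X1[abs_def])
    have "((\<lambda>t. (X t - X t ^ 5 / 5) / 4) \<longlongrightarrow> (1 - 1 ^ 5 / 5) / 4) at_top" by (intro tendsto_intros Xt) auto
    thus "((\<lambda>t. (X t - X t ^ 5 / 5) / 4) \<longlongrightarrow> 1/5) at_top" by simp
    have ez': "((\<lambda>t. exp (of_real t - \<eta>)) \<longlongrightarrow> 0) at_bot"
    proof -
      have "((\<lambda>t. exp (- \<eta> - of_real t)) \<longlongrightarrow> 0) at_top"
      proof (rule Lim_null_comparison[OF always_eventually])
        show "\<forall>t. norm (exp (- \<eta> - of_real t)) \<le> exp (- Re \<eta>) * exp (- (1 * t))"
          by (simp add: norm_exp_eq_Re flip: exp_add)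
        show "((\<lambda>t. exp (- Re \<eta>) * exp (- (1 * t))) \<longlongrightarrow> 0) at_top"
          using tendsto_mult[OF tendsto_const exp_neg_tendsto_0[of 1]] by simp
      qed
      thus ?thesis by (subst at_bot_mirror) (simp add: filterlim_filtermap minus_diff_commute[of "complex_of_real _" \<eta>])
    qed
    have X2: "X t = (exp (of_real t - \<eta>) - 1) / (exp (of_real t - \<eta>) + 1)" for t
    proof -
      have e0: "exp (of_real t - \<eta>) \<noteq> 0" by simp
      have ei: "exp (\<eta> - of_real t) = 1 / exp (of_real t - \<eta>)" by (simp add: exp_diff)
      show ?thesis unfolding X1 ei using e0 by (simp add: divide_simps)
    qed
    have "((\<lambda>t. (exp (of_real t - \<eta>) - 1) / (exp (of_real t - \<eta>) + 1)) \<longlongrightarrow> (0 - 1) / (0 + 1)) at_bot"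
      by (intro tendsto_intros ez') auto
    hence Xt: "(X \<longlongrightarrow> -1) at_bot" by (simp add: X2[abs_def])
    have "((\<lambda>t. (X t - X t ^ 5 / 5) / 4) \<longlongrightarrow> ((-1) - (-1) ^ 5 / 5) / 4) at_bot" by (intro tendsto_intros Xt) auto
    thus "((\<lambda>t. (X t - X t ^ 5 / 5) / 4) \<longlongrightarrow> - (1/5)) at_bot" by simp
  qed
  thus ?thesis by (simp add: pairing_def)
qed

lemma pairing_bound:
  assumes na: "near_axis \<eta> s" and s: "cmod s \<le> 1 / 10 ^ 8"
  shows "1 / 5 \<le> cmod (pairing \<eta> s)"
proof -
  define \<kappa> where "\<kappa> = cos (Im \<eta>)"
  note k = near_axis_kappa[OF na, folded \<kappa>_def]
  note na0 = near_axis_zero[OF na]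
  have mm: "(\<lambda>t. cpsi (of_real t - \<eta>) / cosh (of_real t - \<eta> + s)) \<in> borel_measurable borel" if "near_axis \<eta> s" for s
    using continuous_on_mult[OF continuous_trig(2)[OF that] continuous_trig(1)[OF that], of UNIV]
    by (intro borel_measurable_continuous_onI) simp
  have ii: "integrable lborel (\<lambda>t. cpsi (of_real t - \<eta>) / cosh (of_real t - \<eta> + s))" if "near_axis \<eta> s" for s
    by (rule src_weight_integral(1)[OF k mm[OF that], of 48600]) (use cpsi_sech_bound(2)[OF that] in \<open>auto simp: \<kappa>_def\<close>)
  let ?d = "\<lambda>t. cpsi (of_real t - \<eta>) / cosh (of_real t - \<eta> + s) - cpsi (of_real t - \<eta>) / cosh (of_real t - \<eta>)"
  have "pairing \<eta> s - pairing \<eta> 0 = (\<integral>t. ?d t \<partial>lborel)"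
    unfolding pairing_def using ii[OF na] ii[OF na0] by simp
  also have "cmod \<dots> \<le> 4 * (1312200 * cmod s)"
  proof (rule src_weight_integral(2)[OF k])
    show "?d \<in> borel_measurable borel" using mm[OF na] mm[OF na0] by simp
    fix t
    define b where "b = half_exp t" define L where "L = cosh_size \<kappa> t"
    note l = cosh_size_bounds[OF k, of t, folded L_def]
    have b: "1 \<le> b" "0 < b" using half_exp_ge1 half_exp_pos by (auto simp: b_def)
    have Lb: "L \<le> b\<^sup>2" using l by (simp add: half_exp_sq b_def)
    note wa = weights_arith[OF b(1) k(1) l(1) Lb k(2)]
    have "cmod (?d t) = cmod (cpsi (of_real t - \<eta>)) * cmod (1 / cosh (of_real t - \<eta> + s) - 1 / cosh (of_real t - \<eta>))"
      by (simp add: norm_mult[symmetric] right_diff_distrib)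
    also have "\<dots> \<le> 5400 * (L\<^sup>2 / b ^ 6) * (243 * b\<^sup>2 / L\<^sup>2 * cmod s)"
      using cpsi_weight_bound[OF na0, of t] sech_shift[OF na, of t]
      by (intro mult_mono) (auto simp: \<kappa>_def b_def L_def)
    also have "\<dots> = 1312200 * cmod s * (b\<^sup>2 / b ^ 6)" using l by simp
    also have "b\<^sup>2 / b ^ 6 = 1 / b ^ 4"
    proof -
      have "b ^ 6 = b\<^sup>2 * b ^ 4" by (simp flip: power_add)
      thus ?thesis using b nonzero_divide_mult_cancel_left[of "b\<^sup>2" "b ^ 4"] by simp
    qed
    also have "1312200 * cmod s * (1 / b ^ 4) \<le> 1312200 * cmod s * src_weight \<kappa> t"
      using wa(2) prof_weight_bounds(4)[OF k, of t] by (intro mult_left_mono) (auto simp: b_def)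
    finally show "cmod (?d t) \<le> 1312200 * cmod s * src_weight \<kappa> t" .
  qed simp
  finally have "cmod (pairing \<eta> s - 2 / 5) \<le> 4 * (1312200 * cmod s)" using pairing_zero[OF na0] by simp
  also have "\<dots> \<le> 1 / 5" using s by simp
  finally show ?thesis using norm_triangle_ineq3[of "pairing \<eta> s" "2/5"] by (simp add: norm_divide)
qed

section \<open>One step of the iteration\<close>

definition residual :: "complex \<Rightarrow> real \<Rightarrow> (real \<Rightarrow> complex) \<Rightarrow> complex \<Rightarrow> (real \<Rightarrow> complex) \<Rightarrow> real \<Rightarrow> complex" where
  "residual \<eta> \<mu> h s w t = residual_term \<mu> (h t) (of_real t - \<eta> + s) (w t)"

text \<open>
  The value of \<open>\<alpha>\<close> for which \<open>residual + \<alpha> \<psi>\<close> is orthogonal to the kernel element \<open>1 / cosh\<close>.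
\<close>

definition multiplier :: "complex \<Rightarrow> real \<Rightarrow> (real \<Rightarrow> complex) \<Rightarrow> complex \<Rightarrow> (real \<Rightarrow> complex) \<Rightarrow> complex" where
  "multiplier \<eta> \<mu> h s w = - (\<integral>t. residual \<eta> \<mu> h s w t / cosh (of_real t - \<eta> + s) \<partial>lborel) / pairing \<eta> s"

text \<open>
  Reduction of order: \<open>- w'' + cos q * w = cosh * k\<close> with \<open>k\<close> the balanced source is solved by
  \<open>w = - y / cosh\<close>, \<open>y' = cosh\<^sup>2 P\<close>, \<open>P' = k\<close>. The primitive \<open>P\<close> starts at \<open>- \<infinity>\<close> and vanishes at
  both ends since \<open>k\<close> has integral zero; \<open>y\<close> vanishes at \<open>t = 0\<close>, so that \<open>w\<close> vanishes there too,
  and translations are left to the shift \<open>s\<close>.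
\<close>

definition balanced_source :: "complex \<Rightarrow> real \<Rightarrow> (real \<Rightarrow> complex) \<Rightarrow> complex \<Rightarrow> (real \<Rightarrow> complex) \<Rightarrow> real \<Rightarrow> complex" where
  "balanced_source \<eta> \<mu> h s w t = (residual \<eta> \<mu> h s w t + multiplier \<eta> \<mu> h s w * cpsi (of_real t - \<eta>)) / cosh (of_real t - \<eta> + s)"

definition source_primitive :: "complex \<Rightarrow> real \<Rightarrow> (real \<Rightarrow> complex) \<Rightarrow> complex \<Rightarrow> (real \<Rightarrow> complex) \<Rightarrow> real \<Rightarrow> complex" where
  "source_primitive \<eta> \<mu> h s w t = (LINT r:{..t}|lborel. balanced_source \<eta> \<mu> h s w r)"

definition profile_primitive :: "complex \<Rightarrow> real \<Rightarrow> (real \<Rightarrow> complex) \<Rightarrow> complex \<Rightarrow> (real \<Rightarrow> complex) \<Rightarrow> real \<Rightarrow> complex" where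
  "profile_primitive \<eta> \<mu> h s w t = (LBINT r=0..t. (cosh (of_real r - \<eta> + s))\<^sup>2 * source_primitive \<eta> \<mu> h s w r)"

definition profile_step :: "complex \<Rightarrow> real \<Rightarrow> (real \<Rightarrow> complex) \<Rightarrow> complex \<Rightarrow> (real \<Rightarrow> complex) \<Rightarrow> real \<Rightarrow> complex" where
  "profile_step \<eta> \<mu> h s w t = - (profile_primitive \<eta> \<mu> h s w t / cosh (of_real t - \<eta> + s))"

text \<open>
  A Newton step for the orthogonality condition. The separatrix has the derivative \<open>2 / cosh\<close>, so
  at \<open>s = 0\<close> the integral has the derivative \<open>2 * pairing \<eta> 0 = 4/5\<close> with respect to \<open>s\<close>.
\<close>

definition shift_step :: "complex \<Rightarrow> complex \<Rightarrow> (real \<Rightarrow> complex) \<Rightarrow> complex" where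
  "shift_step \<eta> s w = s - 5/4 * (\<integral>t. (csep (of_real t - \<eta> + s) - csep (of_real t - \<eta>) + w t) * cpsi (of_real t - \<eta>) \<partial>lborel)"

lemma LBINT_vector_derivative:
  fixes k :: "real \<Rightarrow> complex" assumes "continuous_on UNIV k"
  shows "((\<lambda>t. LBINT r=0..t. k r) has_vector_derivative k t) (at t)"
proof -
  define a where "a = min 0 t - 1" define b where "b = max 0 t + 1"
  have "((\<lambda>u. LBINT r=ereal 0..ereal u. k r) has_vector_derivative k t) (at t within {a..b})"
    by (rule interval_integral_FTC2) (use continuous_on_subset[OF assms] in \<open>auto simp: a_def b_def\<close>)
  hence "((\<lambda>u. LBINT r=ereal 0..ereal u. k r) has_vector_derivative k t) (at t within {a<..<b})"
    by (rule has_vector_derivative_within_subset) auto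
  moreover have "at t within {a<..<b} = at t" by (rule at_within_open) (auto simp: a_def b_def)
  ultimately show ?thesis by (simp add: zero_ereal_def)
qed

locale iteration_state =
  fixes \<eta> :: complex and \<mu> M \<kappa> R :: real and h w :: "real \<Rightarrow> complex" and s :: complex
  assumes kap: "\<kappa> = cos (Im \<eta>)" and na: "near_axis \<eta> s" and s8: "cmod s \<le> 1 / 10 ^ 8"
    and hc: "continuous_on UNIV h" and hM: "\<And>t. cmod (h t) \<le> M" and mu0: "0 \<le> \<mu>"
    and wc: "continuous_on UNIV w" and wR: "\<And>t. cmod (w t) \<le> R * prof_weight \<kappa> t" and R0: "0 \<le> R" and R1: "R \<le> 1"
begin

definition G where "G = 23400 * (R\<^sup>2 + \<mu> * M / \<kappa>\<^sup>2)"

lemmas k = near_axis_kappa[OF na, folded kap]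
lemmas na0 = near_axis_zero[OF na]

lemma M0: "0 \<le> M" using hM[of 0] norm_ge_zero order_trans by blast
lemma G0: "0 \<le> G" using M0 mu0 by (simp add: G_def)

lemma g_bound: "cmod (residual \<eta> \<mu> h s w t / cosh (of_real t - \<eta> + s)) \<le> G * src_weight \<kappa> t"
  unfolding residual_def G_def by (rule residual_term_bound[OF na, folded kap, OF wR R0 R1 hM mu0])

lemma residual_cont: "continuous_on UNIV (residual \<eta> \<mu> h s w)"
  unfolding residual_def[abs_def] residual_term_def by (intro continuous_intros continuous_trig[OF na] wc hc)

lemma sech_mult_cont: "continuous_on UNIV f \<Longrightarrow> continuous_on UNIV (\<lambda>t. f t / cosh (of_real t - \<eta> + s))"
  using continuous_on_mult[OF _ continuous_trig(1)[OF na], of UNIV f] by simp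

lemma g_meas: "(\<lambda>t. residual \<eta> \<mu> h s w t / cosh (of_real t - \<eta> + s)) \<in> borel_measurable borel"
  by (rule borel_measurable_continuous_onI[OF sech_mult_cont[OF residual_cont]])

lemma psi_meas: "(\<lambda>t. cpsi (of_real t - \<eta>) / cosh (of_real t - \<eta> + s)) \<in> borel_measurable borel"
  by (rule borel_measurable_continuous_onI[OF sech_mult_cont[OF continuous_trig(2)[OF na0]]])

lemmas g_int = src_weight_integral[OF k g_meas G0 g_bound]
lemmas psi_int = src_weight_integral[OF k psi_meas _ cpsi_sech_bound(2)[OF na, folded kap], simplified]

lemma pairing_ge: "1/5 \<le> cmod (pairing \<eta> s)" by (rule pairing_bound[OF na s8])

lemma multiplier_bound: "cmod (multiplier \<eta> \<mu> h s w) \<le> 20 * G"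
proof -
  have "cmod (multiplier \<eta> \<mu> h s w) \<le> 4 * G / (1/5)"
    unfolding multiplier_def norm_divide norm_minus_cancel
    using g_int(2) pairing_ge by (intro frac_le) (auto simp: G0)
  thus ?thesis by simp
qed

lemma balanced_source_split: "balanced_source \<eta> \<mu> h s w t = residual \<eta> \<mu> h s w t / cosh (of_real t - \<eta> + s)
   + multiplier \<eta> \<mu> h s w * (cpsi (of_real t - \<eta>) / cosh (of_real t - \<eta> + s))"
  by (simp add: balanced_source_def add_divide_distrib)

lemma balanced_source_bound: "cmod (balanced_source \<eta> \<mu> h s w t) \<le> (10 ^ 6 * G) * src_weight \<kappa> t"
proof -
  have "cmod (balanced_source \<eta> \<mu> h s w t) \<le> G * src_weight \<kappa> t + (20 * G) * (48600 * src_weight \<kappa> t)"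
    unfolding balanced_source_split
  proof (intro norm_triangle_le add_mono g_bound)
    show "cmod (multiplier \<eta> \<mu> h s w * (cpsi (of_real t - \<eta>) / cosh (of_real t - \<eta> + s))) \<le> (20 * G) * (48600 * src_weight \<kappa> t)"
      unfolding norm_mult by (rule mult_mono[OF multiplier_bound cpsi_sech_bound(2)[OF na, folded kap]]) (use G0 in auto)
  qed
  also have "\<dots> \<le> (10 ^ 6 * G) * src_weight \<kappa> t" using G0 src_weight_nonneg[OF k, of t] by (simp add: mult_right_mono)
  finally show ?thesis .
qed

lemma balanced_source_cont: "continuous_on UNIV (balanced_source \<eta> \<mu> h s w)"
  unfolding balanced_source_def[abs_def] by (intro sech_mult_cont continuous_intros residual_cont continuous_trig[OF na0])

lemma G6: "0 \<le> 10 ^ 6 * G" using G0 by simp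

lemmas balanced_source_int = src_weight_integral[OF k borel_measurable_continuous_onI[OF balanced_source_cont] G6 balanced_source_bound]

lemma balanced_source_total: "(\<integral>t. balanced_source \<eta> \<mu> h s w t \<partial>lborel) = 0"
proof -
  have "(\<integral>t. balanced_source \<eta> \<mu> h s w t \<partial>lborel) = (\<integral>t. residual \<eta> \<mu> h s w t / cosh (of_real t - \<eta> + s) \<partial>lborel) + multiplier \<eta> \<mu> h s w * pairing \<eta> s"
    unfolding balanced_source_split pairing_def
    using Bochner_Integration.integral_add[OF g_int(1) integrable_mult_right[OF psi_int(1), of "multiplier \<eta> \<mu> h s w"]]
    by (simp only: integral_mult_right_zero)
  also have "\<dots> = 0" using pairing_ge by (auto simp: multiplier_def)
  finally show ?thesis .
qed

lemma source_primitive_deriv: "(source_primitive \<eta> \<mu> h s w has_vector_derivative balanced_source \<eta> \<mu> h s w t) (at t)"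
  unfolding source_primitive_def[abs_def] by (rule has_vector_derivative_integral_atMost[OF balanced_source_cont balanced_source_int(1)])

lemma source_primitive_cont: "continuous_on UNIV (source_primitive \<eta> \<mu> h s w)"
  by (rule continuous_on_vector_derivative) (rule has_vector_derivative_at_within[OF source_primitive_deriv])

text \<open>
  For \<open>t > 0\<close> the vanishing of the total integral replaces the integral over the past by the one
  over the future.
\<close>

lemma source_primitive_bound: "cmod (source_primitive \<eta> \<mu> h s w t) \<le> 2 * 10 ^ 6 * G / half_exp t ^ 3"
proof (cases "t \<le> 0")
  case True
  thus ?thesis using balanced_source_int(4)[OF True] by (simp add: source_primitive_def)
next
  case False
  have si: "set_integrable lborel A (balanced_source \<eta> \<mu> h s w)" if "A \<in> sets lborel" for A
    using integrable_mult_indicator[OF that balanced_source_int(1)] by (simp add: set_integrable_def)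
  have U: "{..t} \<union> {t<..} = (UNIV::real set)" "{..t} \<inter> {t<..} = ({}::real set)" by auto
  have "0 = (LINT r:{..t}|lborel. balanced_source \<eta> \<mu> h s w r) + (LINT r:{t<..}|lborel. balanced_source \<eta> \<mu> h s w r)"
    using set_integral_Un[OF U(2), of lborel "balanced_source \<eta> \<mu> h s w"] si balanced_source_total unfolding U(1)
    by (simp add: set_lebesgue_integral_def)
  also have "(LINT r:{t<..}|lborel. balanced_source \<eta> \<mu> h s w r) = (LINT r:{t..}|lborel. balanced_source \<eta> \<mu> h s w r)"
    by (rule set_integral_cong_set)
       (use si[of "{t<..}"] si[of "{t..}"] AE_lborel_singleton[of t] in \<open>auto simp: set_borel_measurable_def set_integrable_def elim!: eventually_mono\<close>)
  finally have "source_primitive \<eta> \<mu> h s w t = - (LINT r:{t..}|lborel. balanced_source \<eta> \<mu> h s w r)" by (simp add: source_primitive_def eq_neg_iff_add_eq_0)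
  thus ?thesis using balanced_source_int(3)[of t] False by simp
qed

lemma profile_primitive_integrand_cont: "continuous_on UNIV (\<lambda>r. (cosh (of_real r - \<eta> + s))\<^sup>2 * source_primitive \<eta> \<mu> h s w r)"
  by (intro continuous_intros source_primitive_cont)

lemma profile_primitive_deriv: "(profile_primitive \<eta> \<mu> h s w has_vector_derivative (cosh (of_real t - \<eta> + s))\<^sup>2 * source_primitive \<eta> \<mu> h s w t) (at t)"
  unfolding profile_primitive_def[abs_def] by (rule LBINT_vector_derivative[OF profile_primitive_integrand_cont])

lemma profile_primitive_integrand_bound: "cmod ((cosh (of_real t - \<eta> + s))\<^sup>2 * source_primitive \<eta> \<mu> h s w t) \<le> (5 * 10 ^ 7 * G) * (cosh_size \<kappa> t)\<^sup>2 / half_exp t ^ 3"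
proof -
  have "cmod ((cosh (of_real t - \<eta> + s))\<^sup>2 * source_primitive \<eta> \<mu> h s w t) \<le> (5 * cosh_size \<kappa> t)\<^sup>2 * (2 * 10 ^ 6 * G / half_exp t ^ 3)"
    unfolding norm_mult norm_power
    by (intro mult_mono power_mono source_primitive_bound near_axis_cosh(2)[OF na, folded kap]) auto
  also have "\<dots> = (5 * 10 ^ 7 * G) * (cosh_size \<kappa> t)\<^sup>2 / half_exp t ^ 3" by (simp add: power_mult_distrib)
  finally show ?thesis .
qed

lemma profile_primitive_bound: "cmod (profile_primitive \<eta> \<mu> h s w t) \<le> 10 ^ 8 * G * cosh_size \<kappa> t ^ 3 / half_exp t ^ 5"
proof -
  have "cmod (profile_primitive \<eta> \<mu> h s w t) \<le> 2 * (5 * 10 ^ 7 * G) * cosh_size \<kappa> t ^ 3 / half_exp t ^ 5"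
    by (rule primitive_weight_bound[OF k _ profile_primitive_deriv profile_primitive_integrand_bound]) (auto simp: profile_primitive_def G0 zero_ereal_def)
  thus ?thesis by simp
qed

lemma profile_step_bound: "cmod (profile_step \<eta> \<mu> h s w t) \<le> 9 * 10 ^ 8 * G * prof_weight \<kappa> t"
proof -
  have "cmod (profile_step \<eta> \<mu> h s w t) = cmod (profile_primitive \<eta> \<mu> h s w t) * cmod (1 / cosh (of_real t - \<eta> + s))"
    by (simp add: profile_step_def norm_divide)
  also have "\<dots> \<le> (10 ^ 8 * G * cosh_size \<kappa> t ^ 3 / half_exp t ^ 5) * (9 / cosh_size \<kappa> t)"
    using profile_primitive_bound trig_bounds(1)[OF na, folded kap] order_trans[OF norm_ge_zero profile_primitive_bound] by (intro mult_mono) auto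
  also have "\<dots> = 9 * 10 ^ 8 * G * prof_weight \<kappa> t"
    using cosh_size_bounds(4)[OF k, of t] by (simp add: prof_weight_def power3_eq_cube power2_eq_square)
  finally show ?thesis .
qed

lemma profile_step_deriv:
  "(profile_step \<eta> \<mu> h s w has_vector_derivative
     - (sinh (of_real t - \<eta> + s) / cosh (of_real t - \<eta> + s)) * profile_step \<eta> \<mu> h s w t - cosh (of_real t - \<eta> + s) * source_primitive \<eta> \<mu> h s w t) (at t)"
proof -
  define c where "c = cosh (of_real t - \<eta> + s)" define S where "S = sinh (of_real t - \<eta> + s)"
  have c: "c \<noteq> 0" using near_axis_cosh(5)[OF na] by (simp add: c_def)
  have dc: "((\<lambda>t. 1 / cosh (of_real t - \<eta> + s)) has_vector_derivative - (S / c\<^sup>2)) (at t)"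
    by (rule has_vector_derivative_real_field)
       (use c in \<open>auto intro!: derivative_eq_intros simp: c_def S_def power2_eq_square\<close>)
  have "((\<lambda>t. - (profile_primitive \<eta> \<mu> h s w t * (1 / cosh (of_real t - \<eta> + s)))) has_vector_derivative
     - (profile_primitive \<eta> \<mu> h s w t * (- (S / c\<^sup>2)) + (c\<^sup>2 * source_primitive \<eta> \<mu> h s w t) * (1 / c))) (at t)"
    using has_vector_derivative_minus[OF has_vector_derivative_mult[OF profile_primitive_deriv[of t] dc]] by (simp add: c_def)
  moreover have "- (profile_primitive \<eta> \<mu> h s w t * (- (S / c\<^sup>2)) + (c\<^sup>2 * source_primitive \<eta> \<mu> h s w t) * (1 / c))
     = - (S / c) * profile_step \<eta> \<mu> h s w t - c * source_primitive \<eta> \<mu> h s w t"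
    using c by (simp add: profile_step_def c_def[symmetric] power2_eq_square)
  ultimately show ?thesis by (simp add: c_def S_def profile_step_def[abs_def])
qed

lemma profile_step_cont: "continuous_on UNIV (profile_step \<eta> \<mu> h s w)"
  by (rule continuous_on_vector_derivative) (rule has_vector_derivative_at_within[OF profile_step_deriv])

text \<open>
  The term of first order in \<open>s\<close> cancels exactly against \<open>s\<close> itself; what remains is quadratic in
  \<open>s\<close> or comes from \<open>w\<close>.
\<close>

lemma shift_step_integrand:
  defines "I \<equiv> (\<lambda>t. (csep (of_real t - \<eta> + s) - csep (of_real t - \<eta>) + w t) * cpsi (of_real t - \<eta>))"
  shows "integrable lborel I" "cmod (shift_step \<eta> s w) \<le> 2 * 10 ^ 7 * (cmod s)\<^sup>2 + 27000 * R"
proof -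
  define A where "A t = (csep (of_real t - \<eta> + s) - csep (of_real t - \<eta>) - s * (2 / cosh (of_real t - \<eta>))) * cpsi (of_real t - \<eta>) + w t * cpsi (of_real t - \<eta>)" for t
  have na00: "cosh (of_real t - \<eta>) \<noteq> 0" for t using near_axis_cosh(5)[OF na0, of t] by simp
  have qcc: "continuous_on UNIV (\<lambda>t. csep (of_real t - \<eta>))" using continuous_trig(5)[OF na0, of UNIV] by simp
  have Ac: "continuous_on UNIV A"
    unfolding A_def by (intro continuous_intros wc continuous_trig(2,5)[OF na] qcc) (use na00 in auto)
  have Ab: "cmod (A t) \<le> (2624400 * (cmod s)\<^sup>2 + 5400 * R) * src_weight \<kappa> t" for t
  proof -
    define b where "b = half_exp t" define L where "L = cosh_size \<kappa> t"
    note l = cosh_size_bounds[OF k, of t, folded L_def]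
    have b: "1 \<le> b" "0 < b" using half_exp_ge1 half_exp_pos by (auto simp: b_def)
    have Lb: "L \<le> b\<^sup>2" using l by (simp add: half_exp_sq b_def)
    note wa = weights_arith[OF b(1) k(1) l(1) Lb k(2)]
    have bm: "1 / b ^ 3 \<le> src_weight \<kappa> t" using prof_weight_bounds(4)[OF k, of t] by (simp add: b_def)
    note pw = cpsi_weight_bound[OF na0, of t, folded kap b_def L_def]
    have "cmod ((csep (of_real t - \<eta> + s) - csep (of_real t - \<eta>) - s * (2 / cosh (of_real t - \<eta>))) * cpsi (of_real t - \<eta>))
       \<le> (486 * b\<^sup>2 / L\<^sup>2 * (cmod s)\<^sup>2) * (5400 * (L\<^sup>2 / b ^ 6))"
      unfolding norm_mult using csep_shift(1)[OF na, of t, folded kap b_def L_def] pw by (intro mult_mono) auto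
    also have "\<dots> = 2624400 * (cmod s)\<^sup>2 * (b\<^sup>2 / b ^ 6)" using l by simp
    also have "b\<^sup>2 / b ^ 6 = 1 / b ^ 4"
    proof -
      have "b ^ 6 = b\<^sup>2 * b ^ 4" by (simp flip: power_add)
      thus ?thesis using b nonzero_divide_mult_cancel_left[of "b\<^sup>2" "b ^ 4"] by simp
    qed
    also have "2624400 * (cmod s)\<^sup>2 * (1 / b ^ 4) \<le> 2624400 * (cmod s)\<^sup>2 * src_weight \<kappa> t"
      using wa(2) bm by (intro mult_left_mono) auto
    finally have 1: "cmod ((csep (of_real t - \<eta> + s) - csep (of_real t - \<eta>) - s * (2 / cosh (of_real t - \<eta>))) * cpsi (of_real t - \<eta>)) \<le> 2624400 * (cmod s)\<^sup>2 * src_weight \<kappa> t" .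
    have "cmod (w t) \<le> R * (L\<^sup>2 / b ^ 5)" using wR[of t] by (simp add: prof_weight_def b_def L_def)
    hence "cmod (w t * cpsi (of_real t - \<eta>)) \<le> (R * (L\<^sup>2 / b ^ 5)) * (5400 * (L\<^sup>2 / b ^ 6))"
      unfolding norm_mult using pw R0 b by (intro mult_mono) auto
    also have "\<dots> = 5400 * R * (L ^ 4 / b ^ 11)" using prof_weight_arith(3)[OF b(2) l(4)] by simp
    also have "\<dots> \<le> 5400 * R * src_weight \<kappa> t"
    proof -
      have "L ^ 4 \<le> (b\<^sup>2) ^ 4" using Lb l by (intro power_mono) auto
      hence "L ^ 4 / b ^ 11 \<le> b ^ 8 / b ^ 11" using b by (intro divide_right_mono) (auto simp flip: power_mult)
      also have "\<dots> = 1 / b ^ 3"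
      proof -
        have "b ^ 11 = b ^ 8 * b ^ 3" by (simp flip: power_add)
        thus ?thesis using b nonzero_divide_mult_cancel_left[of "b ^ 8" "b ^ 3"] by simp
      qed
      finally show ?thesis using bm R0 by (intro mult_left_mono) auto
    qed
    finally have 2: "cmod (w t * cpsi (of_real t - \<eta>)) \<le> 5400 * R * src_weight \<kappa> t" .
    show ?thesis unfolding A_def using norm_triangle_le[OF add_mono[OF 1 2]] by (simp add: distrib_right)
  qed
  have c0: "0 \<le> 2624400 * (cmod s)\<^sup>2 + 5400 * R" using R0 by simp
  note Ai = src_weight_integral[OF k borel_measurable_continuous_onI[OF Ac] c0 Ab]
  interpret z: iteration_state \<eta> \<mu> M \<kappa> R h w 0
    by unfold_locales (use kap na0 hc hM mu0 wc wR R0 R1 in auto)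
  have IA: "I = (\<lambda>t. A t + 2 * s * (cpsi (of_real t - \<eta>) / cosh (of_real t - \<eta>)))"
    by (rule ext) (simp add: I_def A_def algebra_simps)
  have p: "integrable lborel (\<lambda>t. cpsi (of_real t - \<eta>) / cosh (of_real t - \<eta>))" using z.psi_int(1) by simp
  note p2 = integrable_mult_right[OF p, of "2 * s"]
  show "integrable lborel I" unfolding IA by (rule Bochner_Integration.integrable_add[OF Ai(1) p2])
  have "(\<integral>t. I t \<partial>lborel) = (\<integral>t. A t \<partial>lborel) + 2 * s * pairing \<eta> 0"
    unfolding IA pairing_def using Bochner_Integration.integral_add[OF Ai(1) p2]
    by (simp only: integral_mult_right_zero add_0_right)
  hence "shift_step \<eta> s w = - (5/4) * (\<integral>t. A t \<partial>lborel)"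
    unfolding shift_step_def I_def[symmetric] using pairing_zero[OF na0] by (simp add: I_def algebra_simps)
  hence "cmod (shift_step \<eta> s w) = 5/4 * cmod (\<integral>t. A t \<partial>lborel)" by (simp add: norm_mult)
  also have "\<dots> \<le> 5/4 * (4 * (2624400 * (cmod s)\<^sup>2 + 5400 * R))" by (intro mult_left_mono Ai(2)) auto
  also have "\<dots> \<le> 2 * 10 ^ 7 * (cmod s)\<^sup>2 + 27000 * R" by simp
  finally show "cmod (shift_step \<eta> s w) \<le> 2 * 10 ^ 7 * (cmod s)\<^sup>2 + 27000 * R" .
qed

end

section \<open>Fixed points of holomorphic maps and holomorphic families\<close>

text \<open>
  A holomorphic map that sends a ball well inside itself is a contraction (Earle and Hamilton). On
  the complex line through two points of the ball of radius \<open>1/8\<close> at relative distance \<open>\<Delta>\<close>, the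
  map is defined for parameters in a disc of radius \<open>1 / (2 \<Delta>)\<close>, and Schwarz's lemma there gives
  the factor \<open>1/2\<close>; no derivative of the map is needed. The ball is given by weights on the
  coordinates, and \<open>A\<close> is a side condition (such as continuity in the index) that survives limits.
\<close>

theorem earle_hamilton_iteration:
  fixes \<Phi> :: "('i \<Rightarrow> complex) \<Rightarrow> ('i \<Rightarrow> complex)" and A :: "('i \<Rightarrow> complex) set" and \<omega> :: "'i \<Rightarrow> real"
  assumes pos: "\<And>i. \<omega> i > 0" and A0: "(\<lambda>_. 0) \<in> A"
    and maps: "\<And>x. x \<in> A \<Longrightarrow> (\<And>i. cmod (x i) \<le> \<omega> i) \<Longrightarrow> \<Phi> x \<in> A \<and> (\<forall>i. cmod (\<Phi> x i) \<le> \<omega> i / 8)"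
    and hol: "\<And>x y U i. x \<in> A \<Longrightarrow> y \<in> A \<Longrightarrow> open U \<Longrightarrow>
       (\<And>\<zeta> j. \<zeta> \<in> U \<Longrightarrow> cmod (x j + \<zeta> * (y j - x j)) \<le> \<omega> j) \<Longrightarrow>
       (\<lambda>\<zeta>. \<Phi> (\<lambda>j. x j + \<zeta> * (y j - x j)) i) holomorphic_on U"
    and aff: "\<And>x y \<zeta>. x \<in> A \<Longrightarrow> y \<in> A \<Longrightarrow> (\<lambda>j. x j + \<zeta> * (y j - x j)) \<in> A"
    and lim: "\<And>X x. (\<And>n. X n \<in> A) \<Longrightarrow> (\<And>n i. cmod (X n i - x i) \<le> \<omega> i / 2 ^ n) \<Longrightarrow> x \<in> A"
  obtains x where "x \<in> A" "\<Phi> x = x" "\<And>i. cmod (x i) \<le> \<omega> i" "\<And>n i. cmod ((\<Phi> ^^ n) (\<lambda>_. 0) i - x i) \<le> \<omega> i / 2 ^ n"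
proof -
  have lip: "cmod (\<Phi> y i - \<Phi> x i) \<le> \<Delta> / 2 * \<omega> i"
    if x: "x \<in> A" "\<And>i. cmod (x i) \<le> \<omega> i / 8" and y: "y \<in> A" "\<And>i. cmod (y i) \<le> \<omega> i / 8"
      and d: "\<And>i. cmod (y i - x i) \<le> \<Delta> * \<omega> i" and \<Delta>: "0 < \<Delta>" "\<Delta> \<le> 1/4" for x y \<Delta> i
  proof -
    \<comment> \<open>\<open>1/8 + \<rho> \<Delta> \<le> 1\<close>, so the line stays in the unit ball up to this parameter.\<close>
    define \<rho> where "\<rho> = 1 / (2 * \<Delta>)"
    have r1: "1 < \<rho>" using \<Delta> by (simp add: \<rho>_def field_simps)
    have inb: "cmod (x j + \<zeta> * (y j - x j)) \<le> \<omega> j" if "\<zeta> \<in> ball 0 \<rho>" for \<zeta> j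
    proof -
      have "cmod (x j + \<zeta> * (y j - x j)) \<le> \<omega> j / 8 + \<rho> * (\<Delta> * \<omega> j)"
        using that x(2)[of j] d[of j] r1 pos[of j] \<Delta>
        by (intro norm_triangle_le add_mono) (auto simp: norm_mult intro!: mult_mono)
      also have "\<dots> \<le> \<omega> j" using \<Delta> pos[of j] by (simp add: \<rho>_def)
      finally show ?thesis .
    qed
    have "cmod ((\<lambda>\<zeta>. \<Phi> (\<lambda>j. x j + \<zeta> * (y j - x j)) i) 1 - (\<lambda>\<zeta>. \<Phi> (\<lambda>j. x j + \<zeta> * (y j - x j)) i) 0)
      \<le> 2 * (\<omega> i / 8) / \<rho> * cmod (1 - 0)"
    proof (rule holomorphic_bounded_lipschitz)
      show "(\<lambda>\<zeta>. \<Phi> (\<lambda>j. x j + \<zeta> * (y j - x j)) i) holomorphic_on ball 0 \<rho>"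
        by (rule hol[OF x(1) y(1)]) (use inb in auto)
      show "cmod (\<Phi> (\<lambda>j. x j + \<zeta> * (y j - x j)) i) \<le> \<omega> i / 8" if "\<zeta> \<in> ball 0 \<rho>" for \<zeta>
        using maps[OF aff[OF x(1) y(1)]] inb[OF that] by blast
      show "(1::complex) \<in> ball 0 \<rho>" using r1 by (simp add: dist_norm)
    qed
    thus ?thesis using \<Delta> by (simp add: \<rho>_def)
  qed
  define X where "X n = (\<Phi> ^^ n) (\<lambda>_. 0)" for n
  have XS: "X (Suc n) = \<Phi> (X n)" for n by (simp add: X_def)
  have XA: "X n \<in> A \<and> (\<forall>i. cmod (X n i) \<le> \<omega> i / 8)" for n
  proof (induction n)
    case 0
    show ?case using A0 pos by (auto simp: X_def intro: less_imp_le)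
  next
    case (Suc n)
    have "cmod (X n i) \<le> \<omega> i" for i using Suc pos[of i] by (rule_tac order_trans[of _ "\<omega> i / 8"]) (auto simp: less_imp_le)
    thus ?case unfolding XS using maps[of "X n"] Suc by blast
  qed
  have Xstep: "cmod (X (Suc n) i - X n i) \<le> (1/4 * (1/2) ^ n) * \<omega> i" for n i
  proof (induction n arbitrary: i)
    case 0
    have "cmod (X 1 i) \<le> \<omega> i / 8" using XA[of 1] by blast
    thus ?case using pos[of i] by (simp add: X_def)
  next
    case (Suc n)
    have "cmod (\<Phi> (X (Suc n)) i - \<Phi> (X n) i) \<le> (1/4 * (1/2) ^ n) / 2 * \<omega> i"
      by (rule lip) (use XA Suc in \<open>auto simp: power_le_one\<close>)
    thus ?case by (simp add: XS)
  qed
  have diff: "cmod (X m i - X n i) \<le> 1/2 * ((1/2) ^ n - (1/2) ^ m) * \<omega> i" if "n \<le> m" for n m i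
    using that
  proof (induction m rule: dec_induct)
    case (step m)
    have "cmod (X (Suc m) i - X n i) \<le> (1/4 * (1/2) ^ m) * \<omega> i + 1/2 * ((1/2) ^ n - (1/2) ^ m) * \<omega> i"
      using norm_triangle_le[OF add_mono[OF Xstep[of m i] step.IH]] by simp
    thus ?case by (simp add: algebra_simps)
  qed simp
  have diff': "cmod (X m i - X n i) \<le> \<omega> i / 2 ^ n" if "n \<le> m" for n m i
  proof -
    have "1/2 * ((1/2) ^ n - (1/2) ^ m) \<le> (1/2::real) ^ n"
    proof -
      have h: "1/2 * (a - b) \<le> a" if "0 \<le> a" "0 \<le> b" for a b :: real using that by simp
      show ?thesis by (rule h) simp_all
    qed
    hence "1/2 * ((1/2) ^ n - (1/2) ^ m) * \<omega> i \<le> (1/2) ^ n * \<omega> i"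
      using pos[of i] by (intro mult_right_mono) auto
    thus ?thesis using diff[OF that, of i] by (simp add: power_divide)
  qed
  have small: "(\<lambda>n. \<omega> i / 2 ^ n) \<longlonglongrightarrow> 0" for i
    using tendsto_mult[OF tendsto_const[of "\<omega> i"] LIMSEQ_realpow_zero[of "1/2"]] by (simp add: power_divide)
  have conv: "convergent (\<lambda>n. X n i)" for i
  proof (rule Cauchy_convergent, rule CauchyI)
    fix e :: real assume e: "e > 0"
    obtain N where N: "\<omega> i / 2 ^ N < e / 2" using order_tendstoD(2)[OF small[of i], of "e/2"] e
      by (auto simp: eventually_sequentially)
    show "\<exists>N. \<forall>m\<ge>N. \<forall>n\<ge>N. norm (X m i - X n i) < e"
    proof (intro exI allI impI)
      fix m n assume "N \<le> m" "N \<le> n"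
      hence "cmod (X m i - X N i) < e / 2" "cmod (X n i - X N i) < e / 2"
        using diff'[OF \<open>N \<le> m\<close>, of i] diff'[OF \<open>N \<le> n\<close>, of i] N by linarith+
      thus "norm (X m i - X n i) < e" using norm_triangle_ineq4[of "X m i - X N i" "X n i - X N i"] by simp
    qed
  qed
  define x where "x i = lim (\<lambda>n. X n i)" for i
  have xl: "(\<lambda>n. X n i) \<longlonglongrightarrow> x i" for i using conv[of i] by (simp add: x_def convergent_LIMSEQ_iff)
  have xd: "cmod (X n i - x i) \<le> \<omega> i / 2 ^ n" for n i
  proof (rule tendsto_upperbound)
    show "(\<lambda>m. cmod (X n i - X m i)) \<longlonglongrightarrow> cmod (X n i - x i)" by (intro tendsto_intros xl)
    show "\<forall>\<^sub>F m in sequentially. cmod (X n i - X m i) \<le> \<omega> i / 2 ^ n"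
      using eventually_ge_at_top[of n]
    proof eventually_elim
      case (elim m)
      show ?case using diff'[OF elim, of i] by (simp add: norm_minus_commute)
    qed
  qed simp
  have xA: "x \<in> A" by (rule lim[of X]) (use XA xd in auto)
  have xb: "cmod (x i) \<le> \<omega> i / 8" for i
    by (rule tendsto_upperbound[OF tendsto_norm[OF xl]]) (use XA in auto)
  have "\<Phi> x i = x i" for i
  proof -
    have "(\<lambda>n. X (Suc n) i) \<longlonglongrightarrow> \<Phi> x i"
    proof (rule LIM_zero_cancel, rule Lim_null_comparison[OF _ small[of i]])
      show "\<forall>\<^sub>F n in sequentially. norm (X (Suc n) i - \<Phi> x i) \<le> \<omega> i / 2 ^ n"
        using eventually_ge_at_top[of 2]
      proof eventually_elim
        case (elim n)
        have "(1/2::real) ^ n \<le> (1/2) ^ 2" by (rule power_decreasing[OF elim]) auto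
        hence "(1/2::real) ^ n \<le> 1/4" by (simp add: power2_eq_square)
        hence "cmod (\<Phi> (X n) i - \<Phi> x i) \<le> (1/2) ^ n / 2 * \<omega> i"
          by (intro lip) (use XA xA xb xd in \<open>auto simp: power_divide\<close>)
        also have "\<dots> \<le> (1/2) ^ n * \<omega> i" using pos[of i] by simp
        finally show ?case by (simp add: XS power_divide)
      qed
    qed
    moreover have "(\<lambda>n. X (Suc n) i) \<longlonglongrightarrow> x i" using xl[of i] by (rule LIMSEQ_Suc)
    ultimately show ?thesis by (rule LIMSEQ_unique)
  qed
  moreover have "cmod (x i) \<le> \<omega> i" for i using xb[of i] pos[of i] by linarith
  ultimately show ?thesis using that[of x] xA xd by (auto simp: X_def fun_eq_iff)
qed

lemma holomorphic_on_cosh_sinh [holomorphic_intros]: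
  "f holomorphic_on A \<Longrightarrow> (\<lambda>z. cosh (f z)) holomorphic_on A"
  "f holomorphic_on A \<Longrightarrow> (\<lambda>z. sinh (f z)) holomorphic_on A"
  unfolding cosh_field_def sinh_field_def by (intro holomorphic_intros; simp)+

lemma holomorphic_on_csep:
  assumes "f holomorphic_on A" "\<And>z. z \<in> A \<Longrightarrow> \<bar>Im (f z)\<bar> < pi / 2"
  shows "(\<lambda>z. csep (f z)) holomorphic_on A"
proof -
  have "csep holomorphic_on {z. \<bar>Im z\<bar> < pi / 2}"
  proof (rule holomorphic_onI)
    fix z assume "z \<in> {z. \<bar>Im z\<bar> < pi / 2}"
    hence "(csep has_field_derivative 2 / cosh z) (at z)" by (intro csep_deriv) simp
    thus "csep field_differentiable (at z within {z. \<bar>Im z\<bar> < pi / 2})"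
      using field_differentiable_at_within field_differentiable_def by blast
  qed
  from holomorphic_on_compose_gen[OF assms(1) this] show ?thesis using assms(2) by (auto simp: o_def)
qed

text \<open>
  A single integrable majorant for all lines at distance at least \<open>k0\<close> from the poles, as required
  for differentiating under the integral.
\<close>

lemma src_weight_dominate:
  assumes "0 < k0" "k0 \<le> \<kappa>" "\<kappa> \<le> 1"
  shows "src_weight \<kappa> t \<le> src_weight k0 t / k0\<^sup>2"
proof -
  have k: "0 < \<kappa>" "k0 \<le> 1" using assms by auto
  note l0 = cosh_size_bounds(4)[OF assms(1) k(2), of t]
  have le: "cosh_size k0 t \<le> cosh_size \<kappa> t" using assms by (simp add: cosh_size_def)
  have b: "0 < half_exp t" by (rule half_exp_pos)
  have "\<kappa>\<^sup>2 * half_exp t ^ 3 / cosh_size \<kappa> t ^ 3 \<le> 1 * half_exp t ^ 3 / cosh_size k0 t ^ 3"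
    using le l0 b assms k by (intro frac_le mult_right_mono power_mono) (auto simp: power_le_one)
  moreover have "1 / half_exp t ^ 3 \<le> 1 / half_exp t ^ 3 / k0\<^sup>2"
  proof -
    have "k0\<^sup>2 \<le> 1" "k0\<^sup>2 > 0" using assms k by (auto simp: power_le_one)
    hence "(1 / half_exp t ^ 3) / 1 \<le> 1 / half_exp t ^ 3 / k0\<^sup>2" using b by (intro frac_le) auto
    thus ?thesis by simp
  qed
  ultimately show ?thesis using assms(1) by (simp add: src_weight_def add_divide_distrib)
qed

lemma exp_abs_integrable:
  assumes "c > 0" shows "integrable lborel (\<lambda>t::real. exp (- (c * \<bar>t\<bar>)))"
proof -
  have m1: "exp (- (3/2 * \<bar>t\<bar>)) \<le> src_weight 1 t" for t :: real
  proof -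
    have "exp (- (3/2 * \<bar>t\<bar>)) = 1 / half_exp t ^ 3" using half_exp_pow[of "\<bar>t\<bar>" 3] by (simp add: half_exp_def)
    thus ?thesis using prof_weight_bounds(4)[of 1 t] by simp
  qed
  have "integrable lborel (\<lambda>t::real. complex_of_real (exp (- (3/2 * \<bar>t\<bar>))))"
    by (rule src_weight_integral(1)[of 1 _ 1])
       (use m1 in \<open>auto simp del: of_real_exp intro!: borel_measurable_continuous_onI continuous_intros\<close>)
  from integrable_norm[OF this] have "integrable lborel (\<lambda>t::real. exp (- (3/2 * \<bar>t\<bar>)))" by simp
  from lborel_integrable_real_affine[OF this, of "2/3 * c" 0] show ?thesis
    using assms by (simp add: abs_mult)
qed

text \<open>
  States that depend holomorphically on a parameter are mapped to states that do. This serves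
  twice: on complex lines of states with \<open>\<eta>\<close> fixed, as needed for \<open>earle_hamilton_iteration\<close>, and
  with \<open>\<eta>\<close> itself as the parameter.
\<close>

locale holomorphic_states =
  fixes U :: "complex set" and eta sig :: "complex \<Rightarrow> complex" and W H :: "complex \<Rightarrow> real \<Rightarrow> complex"
    and \<mu> M k0 :: real and R :: "complex \<Rightarrow> real"
  assumes opn: "open U" and eta: "eta holomorphic_on U" and sig: "sig holomorphic_on U"
    and W: "\<And>t. (\<lambda>\<zeta>. W \<zeta> t) holomorphic_on U" and H: "\<And>t. (\<lambda>\<zeta>. H \<zeta> t) holomorphic_on U"
    and k0: "0 < k0" and kge: "\<And>\<zeta>. \<zeta> \<in> U \<Longrightarrow> k0 \<le> cos (Im (eta \<zeta>))"
    and st: "\<And>\<zeta>. \<zeta> \<in> U \<Longrightarrow> iteration_state (eta \<zeta>) \<mu> M (cos (Im (eta \<zeta>))) (R \<zeta>) (H \<zeta>) (W \<zeta>) (sig \<zeta>)"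
begin

definition Gmax where "Gmax = 23400 * (1 + \<mu> * M / k0\<^sup>2)"

lemma na: "\<zeta> \<in> U \<Longrightarrow> near_axis (eta \<zeta>) (sig \<zeta>)"
  using iteration_state.na[OF st] .

lemma G_le: assumes "\<zeta> \<in> U" shows "iteration_state.G \<mu> M (cos (Im (eta \<zeta>))) (R \<zeta>) \<le> Gmax"
proof -
  interpret s: iteration_state "eta \<zeta>" \<mu> M "cos (Im (eta \<zeta>))" "R \<zeta>" "H \<zeta>" "W \<zeta>" "sig \<zeta>" using st[OF assms] .
  have "(R \<zeta>)\<^sup>2 \<le> 1" using s.R0 s.R1 by (simp add: power_le_one)
  moreover have "\<mu> * M / (cos (Im (eta \<zeta>)))\<^sup>2 \<le> \<mu> * M / k0\<^sup>2"
    using kge[OF assms] k0 s.mu0 s.M0 by (intro divide_left_mono power_mono mult_nonneg_nonneg) auto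
  ultimately show ?thesis unfolding s.G_def Gmax_def by simp
qed

lemma dom: assumes "\<zeta> \<in> U" "0 \<le> c" "c \<le> d" and "cmod x \<le> c * src_weight (cos (Im (eta \<zeta>))) t"
  shows "cmod x \<le> d * (src_weight k0 t / k0\<^sup>2)"
proof -
  have k: "0 < cos (Im (eta \<zeta>))" "cos (Im (eta \<zeta>)) \<le> 1" using near_axis_kappa[OF na[OF assms(1)]] by auto
  have "cmod x \<le> c * (src_weight k0 t / k0\<^sup>2)"
    using assms(4) mult_left_mono[OF src_weight_dominate[OF k0 kge[OF assms(1)] k(2), of t] assms(2)] by linarith
  also have "\<dots> \<le> d * (src_weight k0 t / k0\<^sup>2)"
    using assms(3) src_weight_nonneg[of k0 t, OF k0 order_trans[OF kge[OF assms(1)] k(2)]] by (intro mult_right_mono) auto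
  finally show ?thesis .
qed

lemma k01: "\<zeta> \<in> U \<Longrightarrow> k0 \<le> 1" using kge near_axis_kappa(2)[OF na] by (meson order_trans)

lemma dom_int: "U \<noteq> {} \<Longrightarrow> integrable lborel (\<lambda>t. d * (src_weight k0 t / k0\<^sup>2))"
proof -
  assume "U \<noteq> {}"
  hence k1: "k0 \<le> 1" using k01 by auto
  have "integrable lborel (\<lambda>t. complex_of_real (src_weight k0 t))"
    by (rule src_weight_integral(1)[OF k0 k1, where G = 1])
       (use src_weight_nonneg[OF k0 k1] continuous_on_src_weight[OF k0 k1] in \<open>auto intro!: borel_measurable_continuous_onI continuous_intros\<close>)
  from integrable_norm[OF this] have "integrable lborel (\<lambda>t. src_weight k0 t)"
    using src_weight_nonneg[OF k0 k1] by simp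
  thus ?thesis by simp
qed

lemma nonzero: "\<zeta> \<in> U \<Longrightarrow> cosh (of_real t - eta \<zeta> + sig \<zeta>) \<noteq> 0" "\<zeta> \<in> U \<Longrightarrow> cosh (of_real t - eta \<zeta>) \<noteq> 0"
   "\<zeta> \<in> U \<Longrightarrow> 1 + cosh (of_real t - eta \<zeta>) \<noteq> 0"
  using near_axis_cosh(5)[OF na] near_axis_cosh(5)[OF near_axis_zero[OF na], of \<zeta> t] cpsi_bound(2)[OF near_axis_zero[OF na]] by auto

lemma hol_residual: "(\<lambda>\<zeta>. residual (eta \<zeta>) \<mu> (H \<zeta>) (sig \<zeta>) (W \<zeta>) t) holomorphic_on U"
  unfolding residual_def residual_term_def sin_sep_def cos_sep_def
  by (intro holomorphic_intros eta sig W H) (use nonzero in auto)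

lemma hol_cpsi: "(\<lambda>\<zeta>. cpsi (of_real t - eta \<zeta>)) holomorphic_on U"
  unfolding cpsi_def by (intro holomorphic_intros eta) (use nonzero in auto)

lemma hol_integral:
  assumes h: "\<And>t. (\<lambda>\<zeta>. K \<zeta> t) holomorphic_on U" and m: "\<And>\<zeta>. \<zeta> \<in> U \<Longrightarrow> K \<zeta> \<in> borel_measurable lborel"
    and b: "\<And>\<zeta> t. \<zeta> \<in> U \<Longrightarrow> cmod (K \<zeta> t) \<le> d * (src_weight k0 t / k0\<^sup>2)"
  shows "(\<lambda>\<zeta>. \<integral>t. K \<zeta> t \<partial>lborel) holomorphic_on U"
proof (cases "U = {}")
  case False
  show ?thesis by (rule holomorphic_on_lebesgue_integral[OF opn h m b dom_int[OF False]])
qed (simp add: holomorphic_on_def)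

lemma hol_multiplier: "(\<lambda>\<zeta>. multiplier (eta \<zeta>) \<mu> (H \<zeta>) (sig \<zeta>) (W \<zeta>)) holomorphic_on U"
proof -
  have 1: "(\<lambda>\<zeta>. \<integral>t. residual (eta \<zeta>) \<mu> (H \<zeta>) (sig \<zeta>) (W \<zeta>) t / cosh (of_real t - eta \<zeta> + sig \<zeta>) \<partial>lborel) holomorphic_on U"
  proof (rule hol_integral)
    show "(\<lambda>\<zeta>. residual (eta \<zeta>) \<mu> (H \<zeta>) (sig \<zeta>) (W \<zeta>) t / cosh (of_real t - eta \<zeta> + sig \<zeta>)) holomorphic_on U" for t
      by (intro holomorphic_intros hol_residual eta sig) (use nonzero in auto)
    show "(\<lambda>t. residual (eta \<zeta>) \<mu> (H \<zeta>) (sig \<zeta>) (W \<zeta>) t / cosh (of_real t - eta \<zeta> + sig \<zeta>)) \<in> borel_measurable lborel"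
      if "\<zeta> \<in> U" for \<zeta> using iteration_state.g_meas[OF st[OF that]] by simp
    show "cmod (residual (eta \<zeta>) \<mu> (H \<zeta>) (sig \<zeta>) (W \<zeta>) t / cosh (of_real t - eta \<zeta> + sig \<zeta>)) \<le> Gmax * (src_weight k0 t / k0\<^sup>2)"
      if "\<zeta> \<in> U" for \<zeta> t
      by (rule dom[OF that iteration_state.G0[OF st[OF that]] G_le[OF that] iteration_state.g_bound[OF st[OF that]]])
  qed
  have 2: "(\<lambda>\<zeta>. pairing (eta \<zeta>) (sig \<zeta>)) holomorphic_on U"
    unfolding pairing_def
  proof (rule hol_integral)
    show "(\<lambda>\<zeta>. cpsi (of_real t - eta \<zeta>) / cosh (of_real t - eta \<zeta> + sig \<zeta>)) holomorphic_on U" for t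
      by (intro holomorphic_intros hol_cpsi eta sig) (use nonzero in auto)
    show "(\<lambda>t. cpsi (of_real t - eta \<zeta>) / cosh (of_real t - eta \<zeta> + sig \<zeta>)) \<in> borel_measurable lborel"
      if "\<zeta> \<in> U" for \<zeta> using iteration_state.psi_meas[OF st[OF that]] by simp
    show "cmod (cpsi (of_real t - eta \<zeta>) / cosh (of_real t - eta \<zeta> + sig \<zeta>)) \<le> 48600 * (src_weight k0 t / k0\<^sup>2)"
      if "\<zeta> \<in> U" for \<zeta> t by (rule dom[OF that _ _ cpsi_sech_bound(2)[OF na[OF that]]]) auto
  qed
  have "pairing (eta \<zeta>) (sig \<zeta>) \<noteq> 0" if "\<zeta> \<in> U" for \<zeta>
    using iteration_state.pairing_ge[OF st[OF that]] by auto
  with 1 2 show ?thesis unfolding multiplier_def by (intro holomorphic_intros) auto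
qed

lemma hol_balanced_source: "(\<lambda>\<zeta>. balanced_source (eta \<zeta>) \<mu> (H \<zeta>) (sig \<zeta>) (W \<zeta>) t) holomorphic_on U"
  unfolding balanced_source_def by (intro holomorphic_intros hol_residual hol_cpsi hol_multiplier eta sig) (use nonzero in auto)

lemma balanced_source_dom: "\<zeta> \<in> U \<Longrightarrow> cmod (balanced_source (eta \<zeta>) \<mu> (H \<zeta>) (sig \<zeta>) (W \<zeta>) t) \<le> (10 ^ 6 * Gmax) * (src_weight k0 t / k0\<^sup>2)"
  by (rule dom[OF _ iteration_state.G6[OF st] _ iteration_state.balanced_source_bound[OF st]]) (use G_le in auto)

lemma hol_source_primitive: "(\<lambda>\<zeta>. source_primitive (eta \<zeta>) \<mu> (H \<zeta>) (sig \<zeta>) (W \<zeta>) t) holomorphic_on U"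
  unfolding source_primitive_def set_lebesgue_integral_def
proof (rule hol_integral)
  show "(\<lambda>\<zeta>. indicat_real {..t} r *\<^sub>R balanced_source (eta \<zeta>) \<mu> (H \<zeta>) (sig \<zeta>) (W \<zeta>) r) holomorphic_on U" for r
    unfolding scaleR_conv_of_real by (intro holomorphic_intros hol_balanced_source)
  show "(\<lambda>r. indicat_real {..t} r *\<^sub>R balanced_source (eta \<zeta>) \<mu> (H \<zeta>) (sig \<zeta>) (W \<zeta>) r) \<in> borel_measurable lborel"
    if "\<zeta> \<in> U" for \<zeta>
    using borel_measurable_continuous_onI[OF iteration_state.balanced_source_cont[OF st[OF that]]] by simp
  show "cmod (indicat_real {..t} r *\<^sub>R balanced_source (eta \<zeta>) \<mu> (H \<zeta>) (sig \<zeta>) (W \<zeta>) r) \<le> (10 ^ 6 * Gmax) * (src_weight k0 r / k0\<^sup>2)"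
    if "\<zeta> \<in> U" for \<zeta> r
    using balanced_source_dom[OF that, of r] order_trans[OF norm_ge_zero balanced_source_dom[OF that, of r]] by (auto simp: indicator_def)
qed

lemma hol_profile_primitive: "(\<lambda>\<zeta>. profile_primitive (eta \<zeta>) \<mu> (H \<zeta>) (sig \<zeta>) (W \<zeta>) t) holomorphic_on U"
proof -
  define K where "K \<zeta> r = (cosh (of_real r - eta \<zeta> + sig \<zeta>))\<^sup>2 * source_primitive (eta \<zeta>) \<mu> (H \<zeta>) (sig \<zeta>) (W \<zeta>) r" for \<zeta> r
  define B where "B = 9 * exp (2 * \<bar>t\<bar>) * (2 * 10 ^ 6 * Gmax)"
  have Kb: "cmod (K \<zeta> r) \<le> B" if "\<zeta> \<in> U" "\<bar>r\<bar> \<le> \<bar>t\<bar>" for \<zeta> r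
  proof -
    interpret s: iteration_state "eta \<zeta>" \<mu> M "cos (Im (eta \<zeta>))" "R \<zeta>" "H \<zeta>" "W \<zeta>" "sig \<zeta>" using st[OF that(1)] .
    have g0: "0 \<le> Gmax" using s.G0 G_le[OF that(1)] by linarith
    have "cmod (source_primitive (eta \<zeta>) \<mu> (H \<zeta>) (sig \<zeta>) (W \<zeta>) r) \<le> 2 * 10 ^ 6 * s.G / half_exp r ^ 3" by (rule s.source_primitive_bound)
    also have "\<dots> \<le> 2 * 10 ^ 6 * Gmax / 1"
      using G_le[OF that(1)] s.G0 half_exp_ge1[of r] g0 by (intro frac_le) auto
    finally have P: "cmod (source_primitive (eta \<zeta>) \<mu> (H \<zeta>) (sig \<zeta>) (W \<zeta>) r) \<le> 2 * 10 ^ 6 * Gmax" by simp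
    have "cmod (cosh (of_real r - eta \<zeta> + sig \<zeta>)) \<le> 3 * exp \<bar>t\<bar>"
      using near_axis_cosh(3)[OF na[OF that(1)], of r] that(2) by (meson exp_le_cancel_iff mult_left_mono order_trans zero_le_numeral)
    hence "(cmod (cosh (of_real r - eta \<zeta> + sig \<zeta>)))\<^sup>2 \<le> (3 * exp \<bar>t\<bar>)\<^sup>2" by (intro power_mono) auto
    also have "\<dots> = 9 * exp (2 * \<bar>t\<bar>)" by (simp add: power_mult_distrib exp_double)
    finally show ?thesis unfolding K_def B_def norm_mult norm_power using P by (intro mult_mono) auto
  qed
  have Kc: "continuous_on UNIV (K \<zeta>)" if "\<zeta> \<in> U" for \<zeta>
    unfolding K_def using iteration_state.profile_primitive_integrand_cont[OF st[OF that]] .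
  have Kh: "(\<lambda>\<zeta>. K \<zeta> r) holomorphic_on U" for r unfolding K_def by (intro holomorphic_intros hol_source_primitive eta sig)
  have *: "(\<lambda>\<zeta>. LINT r:I|lborel. K \<zeta> r) holomorphic_on U" if I: "I \<in> sets borel" "emeasure lborel I < \<infinity>" "I \<subseteq> {-\<bar>t\<bar>..\<bar>t\<bar>}" for I :: "real set"
    unfolding set_lebesgue_integral_def
  proof (rule holomorphic_on_lebesgue_integral[OF opn])
    show "(\<lambda>\<zeta>. indicat_real I r *\<^sub>R K \<zeta> r) holomorphic_on U" for r
      unfolding scaleR_conv_of_real by (intro holomorphic_intros Kh)
    show "(\<lambda>r. indicat_real I r *\<^sub>R K \<zeta> r) \<in> borel_measurable lborel" if "\<zeta> \<in> U" for \<zeta>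
      using borel_measurable_continuous_onI[OF Kc[OF that]] I by simp
    show "cmod (indicat_real I r *\<^sub>R K \<zeta> r) \<le> indicat_real I r * B" if "\<zeta> \<in> U" for \<zeta> r
      using Kb[OF that, of r] I(3) by (auto simp: indicator_def abs_le_iff)
    show "integrable lborel (\<lambda>r. indicat_real I r * B)" using I by (intro integrable_mult_left) auto
  qed
  have "(\<lambda>\<zeta>. LBINT r=ereal 0..ereal t. K \<zeta> r) holomorphic_on U"
  proof (cases "0 \<le> t")
    case True
    have "{0<..<t} \<subseteq> {-\<bar>t\<bar>..\<bar>t\<bar>}" by auto
    thus ?thesis using *[of "{0<..<t}"] True by (simp add: interval_lebesgue_integral_def einterval_eq)
  next
    case False
    have "{t<..<0} \<subseteq> {-\<bar>t\<bar>..\<bar>t\<bar>}" by auto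
    thus ?thesis using holomorphic_on_minus[OF *[of "{t<..<0}"]] False by (simp add: interval_lebesgue_integral_def einterval_eq)
  qed
  thus ?thesis by (simp add: profile_primitive_def K_def zero_ereal_def)
qed

lemma hol_profile_step: "(\<lambda>\<zeta>. profile_step (eta \<zeta>) \<mu> (H \<zeta>) (sig \<zeta>) (W \<zeta>) t) holomorphic_on U"
  unfolding profile_step_def by (intro holomorphic_intros hol_profile_primitive eta sig) (use nonzero in auto)

lemma hol_shift_step: "(\<lambda>\<zeta>. shift_step (eta \<zeta>) (sig \<zeta>) (W \<zeta>)) holomorphic_on U"
proof -
  have "(\<lambda>\<zeta>. \<integral>t. (csep (of_real t - eta \<zeta> + sig \<zeta>) - csep (of_real t - eta \<zeta>) + W \<zeta> t) * cpsi (of_real t - eta \<zeta>) \<partial>lborel) holomorphic_on U"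
  proof (cases "U = {}")
    case False
    then obtain \<zeta>1 where z1: "\<zeta>1 \<in> U" by auto
    define m where "m t = 21600 * exp (- \<bar>t\<bar>)" for t :: real
    show ?thesis
    proof (rule holomorphic_on_lebesgue_integral[OF opn, where m = m])
      show "(\<lambda>\<zeta>. (csep (of_real t - eta \<zeta> + sig \<zeta>) - csep (of_real t - eta \<zeta>) + W \<zeta> t) * cpsi (of_real t - eta \<zeta>)) holomorphic_on U" for t
        using near_axis_Im[OF na, of _ t] near_axis_Im[OF near_axis_zero[OF na], of _ t]
        by (intro holomorphic_intros holomorphic_on_csep hol_cpsi W eta sig) auto
      fix \<zeta> assume z: "\<zeta> \<in> U"
      interpret s: iteration_state "eta \<zeta>" \<mu> M "cos (Im (eta \<zeta>))" "R \<zeta>" "H \<zeta>" "W \<zeta>" "sig \<zeta>" using st[OF z] .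
      show "(\<lambda>t. (csep (of_real t - eta \<zeta> + sig \<zeta>) - csep (of_real t - eta \<zeta>) + W \<zeta> t) * cpsi (of_real t - eta \<zeta>)) \<in> borel_measurable lborel"
        using s.shift_step_integrand(1) by (rule borel_measurable_integrable)
      fix t
      have "cmod (csep (of_real t - eta \<zeta> + sig \<zeta>) - csep (of_real t - eta \<zeta>)) \<le> 18 / cosh_size (cos (Im (eta \<zeta>))) t * cmod (sig \<zeta>)"
        by (rule csep_shift(2)[OF s.na])
      also have "\<dots> \<le> 18 / cos (Im (eta \<zeta>)) * (cos (Im (eta \<zeta>)) / 8)"
        using s.k s.na cosh_size_bounds[OF s.k, of t] by (intro mult_mono frac_le) (auto simp: near_axis_def)
      also have "\<dots> \<le> 3" using s.k by simp
      finally have 1: "cmod (csep (of_real t - eta \<zeta> + sig \<zeta>) - csep (of_real t - eta \<zeta>)) \<le> 3" .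
      have "cmod (W \<zeta> t) \<le> 1 * 1"
        using s.wR[of t] prof_weight_bounds[OF s.k, of t] s.R0 s.R1 by (meson mult_mono order_trans zero_le_one)
      hence "cmod (csep (of_real t - eta \<zeta> + sig \<zeta>) - csep (of_real t - eta \<zeta>) + W \<zeta> t) \<le> 4"
        using norm_triangle_le[OF add_mono[OF 1]] by fastforce
      moreover have "cmod (cpsi (of_real t - eta \<zeta>)) \<le> 5400 * exp (- \<bar>t\<bar>)"
        using cpsi_sech_bound(3)[OF s.na, of t] by (simp add: half_exp_sq exp_minus divide_inverse)
      ultimately have "cmod (csep (of_real t - eta \<zeta> + sig \<zeta>) - csep (of_real t - eta \<zeta>) + W \<zeta> t) * cmod (cpsi (of_real t - eta \<zeta>))
         \<le> 4 * (5400 * exp (- \<bar>t\<bar>))" by (intro mult_mono) auto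
      thus "cmod ((csep (of_real t - eta \<zeta> + sig \<zeta>) - csep (of_real t - eta \<zeta>) + W \<zeta> t) * cpsi (of_real t - eta \<zeta>)) \<le> m t"
        by (simp add: norm_mult m_def)
    next
      show "integrable lborel m" unfolding m_def using exp_abs_integrable[of 1] by simp
    qed
  qed (simp add: holomorphic_on_def)
  thus ?thesis unfolding shift_step_def by (intro holomorphic_intros sig)
qed

end

section \<open>Solutions with a complex centre\<close>

text \<open>
  The index \<open>None\<close> carries the shift and \<open>Some t\<close> the profile at time \<open>t\<close>, so that one family of
  weights describes the ball.
\<close>

definition step_map :: "complex \<Rightarrow> real \<Rightarrow> (real \<Rightarrow> complex) \<Rightarrow> (real option \<Rightarrow> complex) \<Rightarrow> real option \<Rightarrow> complex" where
  "step_map \<eta> \<mu> h x i = (case i of None \<Rightarrow> shift_step \<eta> (x None) (\<lambda>t. x (Some t))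
     | Some t \<Rightarrow> profile_step \<eta> \<mu> h (x None) (\<lambda>t. x (Some t)) t)"

definition iterate :: "complex \<Rightarrow> real \<Rightarrow> (real \<Rightarrow> complex) \<Rightarrow> nat \<Rightarrow> real option \<Rightarrow> complex" where
  "iterate \<eta> \<mu> h n = (step_map \<eta> \<mu> h ^^ n) (\<lambda>_. 0)"

definition shift_sol :: "complex \<Rightarrow> real \<Rightarrow> (real \<Rightarrow> complex) \<Rightarrow> complex" where
  "shift_sol \<eta> \<mu> h = lim (\<lambda>n. iterate \<eta> \<mu> h n None)"

definition profile_sol :: "complex \<Rightarrow> real \<Rightarrow> (real \<Rightarrow> complex) \<Rightarrow> real \<Rightarrow> complex" where
  "profile_sol \<eta> \<mu> h t = lim (\<lambda>n. iterate \<eta> \<mu> h n (Some t))"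

definition sol_radius :: "real \<Rightarrow> real \<Rightarrow> real \<Rightarrow> real" where
  "sol_radius \<mu> M \<kappa> = 16 * 10 ^ 14 * (\<mu> * M / \<kappa>\<^sup>2)"

text \<open>
  The shift is allowed to be larger than the profile by the factor \<open>10^6\<close>, since the shift step
  multiplies the profile bound by \<open>27000\<close>.
\<close>

definition ball_weight :: "real \<Rightarrow> real \<Rightarrow> real \<Rightarrow> real option \<Rightarrow> real" where
  "ball_weight \<mu> M \<kappa> i = (case i of None \<Rightarrow> 10 ^ 6 * sol_radius \<mu> M \<kappa> | Some t \<Rightarrow> sol_radius \<mu> M \<kappa> * prof_weight \<kappa> t)"

text \<open>
  The solution has size \<open>\<mu> M / \<kappa>\<^sup>2\<close>, and the shift must be small against the distance \<open>\<kappa>\<close> to the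
  poles; hence the third power.
\<close>

locale pendulum_problem =
  fixes \<eta> :: complex and \<mu> M \<kappa> :: real and h :: "real \<Rightarrow> complex"
  assumes kap: "\<kappa> = cos (Im \<eta>)" and na0: "near_axis \<eta> 0"
    and hc: "continuous_on UNIV h" and hM: "\<And>t. cmod (h t) \<le> M"
    and mu: "0 < \<mu>" and M: "0 < M" and small: "\<mu> * M \<le> \<kappa> ^ 3 / 10 ^ 32"
begin

definition R where "R = sol_radius \<mu> M \<kappa>"

lemmas k = near_axis_kappa[OF na0, folded kap]

lemma R_bounds: "0 < R" "R \<le> \<kappa> / 10 ^ 16" "R \<le> 1 / 10 ^ 16"
proof -
  show "0 < R" using mu M k by (simp add: R_def sol_radius_def)
  have "\<mu> * M / \<kappa>\<^sup>2 \<le> \<kappa> ^ 3 / 10 ^ 32 / \<kappa>\<^sup>2" using small by (intro divide_right_mono) auto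
  also have "\<dots> = \<kappa> / 10 ^ 32" using k by (simp add: power3_eq_cube power2_eq_square)
  finally show 1: "R \<le> \<kappa> / 10 ^ 16" using k by (simp add: R_def sol_radius_def)
  thus "R \<le> 1 / 10 ^ 16" using k by simp
qed

lemma state:
  assumes "continuous_on UNIV w" "\<And>t. cmod (w t) \<le> R * prof_weight \<kappa> t" "cmod s \<le> 10 ^ 6 * R"
  shows "iteration_state \<eta> \<mu> M \<kappa> R h w s"
proof
  show "near_axis \<eta> s"
    using na0 assms(3) R_bounds k by (auto simp: near_axis_def kap[symmetric])
  show "cmod s \<le> 1 / 10 ^ 8" using assms(3) R_bounds by simp
qed (use assms kap hc hM mu R_bounds in auto)

lemma G_le_R:
  assumes "iteration_state \<eta> \<mu> M \<kappa> R h w s"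
  shows "9 * 10 ^ 8 * iteration_state.G \<mu> M \<kappa> R \<le> R / 8"
proof -
  interpret iteration_state \<eta> \<mu> M \<kappa> R h w s by fact
  have "R\<^sup>2 \<le> R * (1 / 10 ^ 16)" unfolding power2_eq_square using R_bounds by (intro mult_left_mono) auto
  moreover have "\<mu> * M / \<kappa>\<^sup>2 = R / (16 * 10 ^ 14)"
    by (simp add: pendulum_problem.R_def[OF pendulum_problem_axioms] sol_radius_def)
  moreover have "9 * 10 ^ 8 * (23400 * (r2 + X)) \<le> r / 8"
    if "r2 \<le> r * (1 / 10 ^ 16)" "X = r / (16 * 10 ^ 14)" "0 < r" for r r2 X :: real
    using that by simp
  ultimately show ?thesis unfolding G_def using R_bounds(1) by blast
qed

lemma step_map_maps:
  assumes c: "continuous_on UNIV (\<lambda>t. x (Some t))" and b: "\<And>i. cmod (x i) \<le> ball_weight \<mu> M \<kappa> i"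
  shows "continuous_on UNIV (\<lambda>t. step_map \<eta> \<mu> h x (Some t))" "cmod (step_map \<eta> \<mu> h x i) \<le> ball_weight \<mu> M \<kappa> i / 8"
proof -
  have st: "iteration_state \<eta> \<mu> M \<kappa> R h (\<lambda>t. x (Some t)) (x None)"
    using b[of None] b[of "Some _"] by (intro state c) (auto simp: ball_weight_def R_def)
  interpret s: iteration_state \<eta> \<mu> M \<kappa> R h "\<lambda>t. x (Some t)" "x None" by (rule st)
  show "continuous_on UNIV (\<lambda>t. step_map \<eta> \<mu> h x (Some t))" using s.profile_step_cont by (simp add: step_map_def)
  show "cmod (step_map \<eta> \<mu> h x i) \<le> ball_weight \<mu> M \<kappa> i / 8"
  proof (cases i)
    case None
    have "(cmod (x None))\<^sup>2 \<le> (10 ^ 6 * R)\<^sup>2" using b[of None] by (intro power_mono) (auto simp: ball_weight_def R_def)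
    also have "\<dots> = 10 ^ 12 * (R * R)" by (simp add: power_mult_distrib power2_eq_square)
    also have "\<dots> \<le> 10 ^ 12 * (R * (1 / 10 ^ 16))" using R_bounds by (intro mult_left_mono) auto
    finally have "(cmod (x None))\<^sup>2 \<le> R / 10 ^ 4" by simp
    hence "cmod (shift_step \<eta> (x None) (\<lambda>t. x (Some t))) \<le> 2 * 10 ^ 7 * (R / 10 ^ 4) + 27000 * R"
      using s.shift_step_integrand(2) by simp
    also have "\<dots> \<le> 10 ^ 6 * R / 8" using R_bounds(1) by simp
    finally show ?thesis by (simp add: None step_map_def ball_weight_def R_def)
  next
    case (Some t)
    have "cmod (profile_step \<eta> \<mu> h (x None) (\<lambda>t. x (Some t)) t) \<le> R / 8 * prof_weight \<kappa> t"
      using s.profile_step_bound[of t] mult_right_mono[OF G_le_R[OF st] prof_weight_bounds(1)[OF k, of t]] by linarith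
    thus ?thesis by (simp add: Some step_map_def ball_weight_def R_def)
  qed
qed

lemma ball_weight_pos: "0 < ball_weight \<mu> M \<kappa> i"
  using R_bounds(1) prof_weight_bounds(6)[OF k] by (cases i) (auto simp: ball_weight_def R_def)

lemma solution:
  shows "iteration_state \<eta> \<mu> M \<kappa> R h (profile_sol \<eta> \<mu> h) (shift_sol \<eta> \<mu> h)"
    "profile_step \<eta> \<mu> h (shift_sol \<eta> \<mu> h) (profile_sol \<eta> \<mu> h) = profile_sol \<eta> \<mu> h"
    "shift_step \<eta> (shift_sol \<eta> \<mu> h) (profile_sol \<eta> \<mu> h) = shift_sol \<eta> \<mu> h"
    "cmod (iterate \<eta> \<mu> h n None - shift_sol \<eta> \<mu> h) \<le> ball_weight \<mu> M \<kappa> None / 2 ^ n"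
    "cmod (iterate \<eta> \<mu> h n (Some t) - profile_sol \<eta> \<mu> h t) \<le> ball_weight \<mu> M \<kappa> (Some t) / 2 ^ n"
    "cmod (shift_sol \<eta> \<mu> h) \<le> 10 ^ 6 * R"
proof -
  \<comment> \<open>Continuity of the profile is the side condition; it is preserved by the uniform convergence that the weights imply.\<close>
  define A where "A = {x :: real option \<Rightarrow> complex. continuous_on UNIV (\<lambda>t. x (Some t))}"
  obtain x where x: "x \<in> A" "step_map \<eta> \<mu> h x = x" "\<And>i. cmod (x i) \<le> ball_weight \<mu> M \<kappa> i"
    "\<And>n i. cmod ((step_map \<eta> \<mu> h ^^ n) (\<lambda>_. 0) i - x i) \<le> ball_weight \<mu> M \<kappa> i / 2 ^ n"
  proof (rule earle_hamilton_iteration[of "ball_weight \<mu> M \<kappa>" A "step_map \<eta> \<mu> h"])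
    show "0 < ball_weight \<mu> M \<kappa> i" for i by (rule ball_weight_pos)
    show "(\<lambda>_. 0) \<in> A" by (simp add: A_def)
    show "step_map \<eta> \<mu> h x \<in> A \<and> (\<forall>i. cmod (step_map \<eta> \<mu> h x i) \<le> ball_weight \<mu> M \<kappa> i / 8)"
      if "x \<in> A" "\<And>i. cmod (x i) \<le> ball_weight \<mu> M \<kappa> i" for x
      using step_map_maps[of x] that by (auto simp: A_def)
    show "(\<lambda>j. x j + \<zeta> * (y j - x j)) \<in> A" if "x \<in> A" "y \<in> A" for x y \<zeta>
      using that by (auto simp: A_def intro!: continuous_intros)
    show "x \<in> A" if X: "\<And>n. X n \<in> A" and b: "\<And>n i. cmod (X n i - x i) \<le> ball_weight \<mu> M \<kappa> i / 2 ^ n" for X x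
    proof -
      have "uniform_limit UNIV (\<lambda>n t. X n (Some t)) (\<lambda>t. x (Some t)) sequentially"
      proof (rule uniform_limitI)
        fix e :: real assume e: "e > 0"
        have "(\<lambda>n. R * (1/2) ^ n) \<longlonglongrightarrow> R * 0" by (intro tendsto_intros LIMSEQ_realpow_zero) auto
        hence "\<forall>\<^sub>F n in sequentially. R * (1/2) ^ n < e" using order_tendstoD(2)[of _ "R * 0" _ e] e by simp
        thus "\<forall>\<^sub>F n in sequentially. \<forall>t\<in>UNIV. dist (X n (Some t)) (x (Some t)) < e"
        proof eventually_elim
          case (elim n)
          have "dist (X n (Some t)) (x (Some t)) < e" for t
          proof -
            have "R * prof_weight \<kappa> t / 2 ^ n \<le> R * 1 / 2 ^ n"
              using R_bounds prof_weight_bounds(3)[OF k, of t] by (intro divide_right_mono mult_left_mono) auto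
            thus ?thesis using b[of n "Some t"] elim by (simp add: ball_weight_def R_def dist_norm power_divide)
          qed
          thus ?case by simp
        qed
      qed
      hence "continuous_on UNIV (\<lambda>t. x (Some t))"
        by (rule uniform_limit_theorem[rotated]) (use X in \<open>auto simp: A_def\<close>)
      thus ?thesis by (simp add: A_def)
    qed
    fix x y :: "real option \<Rightarrow> complex" and U i
    assume xy: "x \<in> A" "y \<in> A" and U: "open U"
      and b: "\<And>\<zeta> j. \<zeta> \<in> U \<Longrightarrow> cmod (x j + \<zeta> * (y j - x j)) \<le> ball_weight \<mu> M \<kappa> j"
    interpret H: holomorphic_states U "\<lambda>_. \<eta>" "\<lambda>\<zeta>. x None + \<zeta> * (y None - x None)"
      "\<lambda>\<zeta> t. x (Some t) + \<zeta> * (y (Some t) - x (Some t))" "\<lambda>_. h" \<mu> M \<kappa> "\<lambda>_. R"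
    proof (rule holomorphic_states.intro)
      fix \<zeta> assume z: "\<zeta> \<in> U"
      show "iteration_state \<eta> \<mu> M (cos (Im \<eta>)) R h (\<lambda>t. x (Some t) + \<zeta> * (y (Some t) - x (Some t))) (x None + \<zeta> * (y None - x None))"
        unfolding kap[symmetric]
      proof (rule state)
        show "continuous_on UNIV (\<lambda>t. x (Some t) + \<zeta> * (y (Some t) - x (Some t)))"
          using xy by (intro continuous_intros) (auto simp: A_def)
        show "cmod (x (Some t) + \<zeta> * (y (Some t) - x (Some t))) \<le> R * prof_weight \<kappa> t" for t
          using b[OF z, of "Some t"] by (simp add: ball_weight_def R_def)
        show "cmod (x None + \<zeta> * (y None - x None)) \<le> 10 ^ 6 * R"
          using b[OF z, of None] by (simp add: ball_weight_def R_def)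
      qed
    qed (use U k kap in \<open>auto intro!: holomorphic_intros\<close>)
    show "(\<lambda>\<zeta>. step_map \<eta> \<mu> h (\<lambda>j. x j + \<zeta> * (y j - x j)) i) holomorphic_on U"
      using H.hol_shift_step H.hol_profile_step by (cases i) (auto simp: step_map_def)
  qed (use that in auto)
  have lim: "(\<lambda>n. iterate \<eta> \<mu> h n i) \<longlonglongrightarrow> x i" for i
  proof (rule LIM_zero_cancel, rule Lim_null_comparison)
    show "\<forall>\<^sub>F n in sequentially. norm (iterate \<eta> \<mu> h n i - x i) \<le> ball_weight \<mu> M \<kappa> i * (1/2) ^ n"
      using x(4)[of _ i] by (auto simp: iterate_def power_divide)
    show "(\<lambda>n. ball_weight \<mu> M \<kappa> i * (1/2) ^ n) \<longlonglongrightarrow> 0"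
      using tendsto_mult[OF tendsto_const LIMSEQ_realpow_zero[of "1/2"], of "ball_weight \<mu> M \<kappa> i"] by simp
  qed
  have ss: "shift_sol \<eta> \<mu> h = x None" using lim[of None] by (simp add: shift_sol_def limI)
  have ww: "profile_sol \<eta> \<mu> h = (\<lambda>t. x (Some t))"
    using lim[of "Some _"] by (auto simp: profile_sol_def limI fun_eq_iff)
  show "cmod (iterate \<eta> \<mu> h n None - shift_sol \<eta> \<mu> h) \<le> ball_weight \<mu> M \<kappa> None / 2 ^ n"
    "cmod (iterate \<eta> \<mu> h n (Some t) - profile_sol \<eta> \<mu> h t) \<le> ball_weight \<mu> M \<kappa> (Some t) / 2 ^ n"
    using x(4) by (auto simp: ss ww iterate_def)
  show "cmod (shift_sol \<eta> \<mu> h) \<le> 10 ^ 6 * R" using x(3)[of None] by (simp add: ss ball_weight_def R_def)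
  show "iteration_state \<eta> \<mu> M \<kappa> R h (profile_sol \<eta> \<mu> h) (shift_sol \<eta> \<mu> h)"
    using x(1) x(3)[of None] x(3)[of "Some _"] by (intro state) (auto simp: ss ww A_def ball_weight_def R_def)
  show "profile_step \<eta> \<mu> h (shift_sol \<eta> \<mu> h) (profile_sol \<eta> \<mu> h) = profile_sol \<eta> \<mu> h"
    using fun_cong[OF x(2), of "Some _"] by (auto simp: ss ww step_map_def)
  show "shift_step \<eta> (shift_sol \<eta> \<mu> h) (profile_sol \<eta> \<mu> h) = shift_sol \<eta> \<mu> h"
    using fun_cong[OF x(2), of None] by (auto simp: ss ww step_map_def)
qed

lemma iterate_bound: "cmod (iterate \<eta> \<mu> h n i) \<le> ball_weight \<mu> M \<kappa> i"
  and iterate_cont: "continuous_on UNIV (\<lambda>t. iterate \<eta> \<mu> h n (Some t))"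
proof -
  have "continuous_on UNIV (\<lambda>t. iterate \<eta> \<mu> h n (Some t)) \<and> (\<forall>i. cmod (iterate \<eta> \<mu> h n i) \<le> ball_weight \<mu> M \<kappa> i)"
  proof (induction n)
    case 0
    show ?case using ball_weight_pos by (auto simp: iterate_def less_imp_le)
  next
    case (Suc n)
    have "cmod (step_map \<eta> \<mu> h (iterate \<eta> \<mu> h n) i) \<le> ball_weight \<mu> M \<kappa> i" for i
      using step_map_maps(2)[of "iterate \<eta> \<mu> h n" i] Suc ball_weight_pos[of i] by (rule_tac order_trans[of _ "ball_weight \<mu> M \<kappa> i / 8"]) auto
    thus ?case using step_map_maps(1)[of "iterate \<eta> \<mu> h n"] Suc by (simp add: iterate_def)
  qed
  thus "cmod (iterate \<eta> \<mu> h n i) \<le> ball_weight \<mu> M \<kappa> i" "continuous_on UNIV (\<lambda>t. iterate \<eta> \<mu> h n (Some t))" by auto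
qed

end

lemma Reals_trig:
  fixes z :: complex assumes "z \<in> \<real>"
  shows "cosh z \<in> \<real>" "sinh z \<in> \<real>" "cos z \<in> \<real>" "sin z \<in> \<real>" "sin_sep z \<in> \<real>" "cos_sep z \<in> \<real>" "cpsi z \<in> \<real>" "csep z \<in> \<real>"
proof -
  obtain x where x: "z = of_real x" using assms by (rule Reals_cases)
  show c: "cosh z \<in> \<real>" and s: "sinh z \<in> \<real>"
    unfolding x cosh_field_def sinh_field_def of_real_minus[symmetric] exp_of_real by (intro Reals_add Reals_diff Reals_divide; simp)+
  show "cos z \<in> \<real>" "sin z \<in> \<real>" unfolding x cos_of_real sin_of_real by auto
  show "sin_sep z \<in> \<real>" "cos_sep z \<in> \<real>" "cpsi z \<in> \<real>" using c s by (auto simp: sin_sep_def cos_sep_def cpsi_def)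
  show "csep z \<in> \<real>" unfolding csep_def x exp_of_real Arctan_of_real by simp
qed

lemma integral_in_Reals:
  fixes f :: "'a \<Rightarrow> complex" assumes "\<And>t. f t \<in> \<real>" shows "(\<integral>t. f t \<partial>M) \<in> \<real>"
proof -
  have "f = (\<lambda>t. of_real (Re (f t)))" using assms by (auto simp: fun_eq_iff complex_is_Real_iff complex_eq_iff)
  hence "(\<integral>t. f t \<partial>M) = of_real (\<integral>t. Re (f t) \<partial>M)" by (metis integral_complex_of_real)
  thus ?thesis by simp
qed

lemma real_data_real:
  assumes "\<eta> \<in> \<real>" "s \<in> \<real>" "\<And>t. h t \<in> \<real>" "\<And>t. w t \<in> \<real>"
  shows "residual \<eta> \<mu> h s w t \<in> \<real>" "multiplier \<eta> \<mu> h s w \<in> \<real>" "source_primitive \<eta> \<mu> h s w t \<in> \<real>" "profile_step \<eta> \<mu> h s w t \<in> \<real>" "shift_step \<eta> s w \<in> \<real>"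
proof -
  have z: "of_real t - \<eta> + s \<in> \<real>" "of_real t - \<eta> \<in> \<real>" for t using assms by auto
  note r = Reals_trig[OF z(1)] Reals_trig[OF z(2)] Reals_trig[OF assms(4)]
  show g: "residual \<eta> \<mu> h s w t \<in> \<real>" for t unfolding residual_def residual_term_def by (intro Reals_diff Reals_minus Reals_mult Reals_add r assms) auto
  show a: "multiplier \<eta> \<mu> h s w \<in> \<real>" unfolding multiplier_def pairing_def
    by (intro Reals_divide Reals_minus integral_in_Reals g r)
  have kr: "balanced_source \<eta> \<mu> h s w t \<in> \<real>" for t unfolding balanced_source_def by (intro Reals_divide Reals_add Reals_mult g a r)
  show p: "source_primitive \<eta> \<mu> h s w t \<in> \<real>" for t unfolding source_primitive_def set_lebesgue_integral_def scaleR_conv_of_real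
    by (intro integral_in_Reals Reals_mult kr) auto
  have "profile_primitive \<eta> \<mu> h s w t \<in> \<real>" for t unfolding profile_primitive_def interval_lebesgue_integral_def set_lebesgue_integral_def scaleR_conv_of_real
    by (auto intro!: integral_in_Reals Reals_mult Reals_power p r)
  thus "profile_step \<eta> \<mu> h s w t \<in> \<real>" unfolding profile_step_def by (intro Reals_minus Reals_divide r)
  show "shift_step \<eta> s w \<in> \<real>" unfolding shift_step_def by (intro Reals_diff Reals_mult Reals_add integral_in_Reals assms r) auto
qed

lemma solution_real:
  assumes "pendulum_problem \<eta> \<mu> M \<kappa> h" "\<eta> \<in> \<real>" "\<And>t. h t \<in> \<real>"
  shows "shift_sol \<eta> \<mu> h \<in> \<real>" "profile_sol \<eta> \<mu> h t \<in> \<real>" "source_primitive \<eta> \<mu> h (shift_sol \<eta> \<mu> h) (profile_sol \<eta> \<mu> h) t \<in> \<real>"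
    "multiplier \<eta> \<mu> h (shift_sol \<eta> \<mu> h) (profile_sol \<eta> \<mu> h) \<in> \<real>"
proof -
  interpret pendulum_problem \<eta> \<mu> M \<kappa> h by fact
  have it: "iterate \<eta> \<mu> h n i \<in> \<real>" for n i
  proof (induction n arbitrary: i)
    case 0 thus ?case by (simp add: iterate_def)
  next
    case (Suc n)
    have "iterate \<eta> \<mu> h (Suc n) i = step_map \<eta> \<mu> h (iterate \<eta> \<mu> h n) i" by (simp add: iterate_def)
    also have "\<dots> \<in> \<real>" unfolding step_map_def using Suc real_data_real[OF assms(2) _ assms(3)] by (cases i) auto
    finally show ?case .
  qed
  have lim: "(\<lambda>n. c / 2 ^ n) \<longlonglongrightarrow> 0" for c :: real
    using tendsto_mult[OF tendsto_const LIMSEQ_realpow_zero[of "1/2"], of c] by (simp add: power_divide)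
  have l1: "(\<lambda>n. iterate \<eta> \<mu> h n None) \<longlonglongrightarrow> shift_sol \<eta> \<mu> h"
    by (rule LIM_zero_cancel, rule Lim_null_comparison[OF always_eventually lim]) (use solution(4) in blast)
  have l2: "(\<lambda>n. iterate \<eta> \<mu> h n (Some t)) \<longlonglongrightarrow> profile_sol \<eta> \<mu> h t" for t
    by (rule LIM_zero_cancel, rule Lim_null_comparison[OF always_eventually lim]) (use solution(5) in blast)
  have cl: "closed (\<real> :: complex set)" by (rule closed_complex_Reals)
  show s: "shift_sol \<eta> \<mu> h \<in> \<real>" and w: "profile_sol \<eta> \<mu> h t \<in> \<real>" for t
    using closed_sequentially[OF cl _ l1] closed_sequentially[OF cl _ l2] it by auto
  show "source_primitive \<eta> \<mu> h (shift_sol \<eta> \<mu> h) (profile_sol \<eta> \<mu> h) t \<in> \<real>" "multiplier \<eta> \<mu> h (shift_sol \<eta> \<mu> h) (profile_sol \<eta> \<mu> h) \<in> \<real>"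
    using real_data_real[OF assms(2) s assms(3) w] by auto
qed

section \<open>The action of a solution\<close>

lemma sech2_weight_integral:
  fixes k :: "real \<Rightarrow> complex"
  assumes \<kappa>: "0 < \<kappa>" "\<kappa> \<le> 1" and k: "k \<in> borel_measurable borel" and G: "G \<ge> 0"
    and bd: "\<And>t. cmod (k t) \<le> G / (cosh_size \<kappa> t)\<^sup>2"
  shows "integrable lborel k" "cmod (\<integral>t. k t \<partial>lborel) \<le> 2 * G / \<kappa>"
proof -
  define L where "L t = exp t - 1 + \<kappa>" for t :: real
  have L: "0 < L t" "L t = cosh_size \<kappa> t" "exp t \<ge> 1" if "t \<ge> 0" for t
    using cosh_size_bounds[OF \<kappa>, of t] that by (auto simp: L_def cosh_size_def)
  have dL: "(L has_real_derivative exp t) (at t)" for t unfolding L_def by (auto intro!: derivative_eq_intros)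
  have dZ: "((\<lambda>t. 1 / L t) has_real_derivative - (exp t / (L t)\<^sup>2)) (at t)" if "t \<ge> 0" for t
    using DERIV_inverse_fun[OF dL, of t] L(1)[OF that] by (simp add: divide_inverse power2_eq_square mult_ac)
  have lim: "((\<lambda>t. 1 / L t) \<longlongrightarrow> 0) at_top"
  proof -
    have "filterlim L at_top at_top" unfolding L_def
      using filterlim_tendsto_add_at_top[OF tendsto_const[of "\<kappa> - 1"] exp_at_top] by (simp add: algebra_simps)
    from tendsto_inverse_0_at_top[OF this] show ?thesis by (simp add: divide_inverse)
  qed
  note E = even_weight_integral[where m = "\<lambda>t. 1 / (L t)\<^sup>2" and z = "\<lambda>t. exp t / (L t)\<^sup>2" and Z = "\<lambda>t. 1 / L t", OF k G _ dZ _ _ _ lim]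
  have 1: "cmod (k t) \<le> G * (1 / (L \<bar>t\<bar>)\<^sup>2)" for t using bd[of t] by (simp add: L_def cosh_size_def)
  have 2: "1 / (L t)\<^sup>2 \<le> exp t / (L t)\<^sup>2" "0 \<le> 1 / (L t)\<^sup>2" if "t \<ge> 0" for t
    using L[OF that] by (auto intro!: divide_right_mono)
  have 3: "(\<lambda>t. exp t / (L t)\<^sup>2) \<in> borel_measurable borel" unfolding L_def by measurable
  show "integrable lborel k" by (rule E(1)[OF 1 _ 2 3])
  show "cmod (\<integral>t. k t \<partial>lborel) \<le> 2 * G / \<kappa>" using E(2)[OF 1 _ 2 3] by (simp add: L_def)
qed

definition profile_velocity :: "complex \<Rightarrow> real \<Rightarrow> (real \<Rightarrow> complex) \<Rightarrow> real \<Rightarrow> complex" where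
  "profile_velocity \<eta> \<mu> h t = - (sinh (of_real t - \<eta> + shift_sol \<eta> \<mu> h) / cosh (of_real t - \<eta> + shift_sol \<eta> \<mu> h)) * profile_sol \<eta> \<mu> h t
     - cosh (of_real t - \<eta> + shift_sol \<eta> \<mu> h) * source_primitive \<eta> \<mu> h (shift_sol \<eta> \<mu> h) (profile_sol \<eta> \<mu> h) t"

text \<open>
  The Lagrangian of \<open>q + w\<close> diminished by \<open>4 / cosh\<^sup>2\<close>, whose integral is \<open>8\<close>, and by the total
  derivative of \<open>q' w\<close>. The terms that are linear in \<open>w\<close> without a factor \<open>\<mu>\<close> are thereby removed.
\<close>

definition action_integrand :: "complex \<Rightarrow> real \<Rightarrow> (real \<Rightarrow> complex) \<Rightarrow> real \<Rightarrow> complex" where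
  "action_integrand \<eta> \<mu> h t = (let z = of_real t - \<eta> + shift_sol \<eta> \<mu> h; w = profile_sol \<eta> \<mu> h t in
     (profile_velocity \<eta> \<mu> h t)\<^sup>2 / 2 + cos_sep z * (1 - cos w) + sin_sep z * (sin w - w)
     + of_real \<mu> * h t * (1 - cos_sep z * cos w + sin_sep z * sin w))"

definition complex_action :: "complex \<Rightarrow> real \<Rightarrow> (real \<Rightarrow> complex) \<Rightarrow> complex" where
  "complex_action \<eta> \<mu> h = 8 + (\<integral>t. action_integrand \<eta> \<mu> h t \<partial>lborel)"

text \<open>
  The Poincare--Melnikov integral: \<open>1 - cos q = 2 / cosh\<^sup>2\<close>.
\<close>

definition complex_melnikov :: "complex \<Rightarrow> (real \<Rightarrow> complex) \<Rightarrow> complex" where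
  "complex_melnikov \<eta> h = (\<integral>t. 2 * h t / (cosh (of_real t - \<eta>))\<^sup>2 \<partial>lborel)"

lemma exp_abs_integral: "(\<integral>t. exp (- \<bar>t\<bar>) \<partial>lborel) \<le> (2::real)"
proof -
  have "cmod (\<integral>t. complex_of_real (exp (- \<bar>t\<bar>)) \<partial>lborel) \<le> 2 * 1 * exp (- (1 * 0))"
  proof (rule even_weight_integral(2)[where m = "\<lambda>t. exp (- (1 * t))" and z = "\<lambda>t. exp (- (1 * t))" and Z = "\<lambda>t. exp (- (1 * t))"])
    show "(\<lambda>t. complex_of_real (exp (- \<bar>t\<bar>))) \<in> borel_measurable borel"
      by (intro borel_measurable_continuous_onI continuous_intros)
    show "((\<lambda>t. exp (- (1 * t))) has_real_derivative - exp (- (1 * s))) (at s)" for s :: real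
      by (auto intro!: derivative_eq_intros)
  qed (use exp_neg_tendsto_0[of 1] in \<open>auto simp del: of_real_exp\<close>)
  thus ?thesis by (simp del: of_real_exp add: integral_nonneg_AE)
qed

context pendulum_problem
begin

sublocale st: iteration_state \<eta> \<mu> M \<kappa> R h "profile_sol \<eta> \<mu> h" "shift_sol \<eta> \<mu> h"
  by (rule solution(1))

abbreviation "w \<equiv> profile_sol \<eta> \<mu> h"
abbreviation "s \<equiv> shift_sol \<eta> \<mu> h"

lemma G_R: "st.G \<le> R"
  using G_le_R[OF solution(1)] R_bounds(1) st.G0 by simp

lemma profile_sol_deriv: "(w has_vector_derivative profile_velocity \<eta> \<mu> h t) (at t)"
  using st.profile_step_deriv[of t] by (simp add: solution(2) profile_velocity_def)

lemma profile_velocity_cont: "continuous_on A (profile_velocity \<eta> \<mu> h)"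
  unfolding profile_velocity_def[abs_def]
  by (intro continuous_intros continuous_on_subset[OF st.wc] continuous_on_subset[OF st.source_primitive_cont])
     (use near_axis_cosh(5)[OF st.na] in auto)

lemma weights: "cosh_size \<kappa> t / half_exp t ^ 3 \<le> 1 / half_exp t" "prof_weight \<kappa> t = (cosh_size \<kappa> t)\<^sup>2 / half_exp t ^ 5" "0 < cosh_size \<kappa> t"
proof -
  note l = cosh_size_bounds[OF k, of t]
  have "cosh_size \<kappa> t / half_exp t ^ 3 \<le> (half_exp t)\<^sup>2 / half_exp t ^ 3"
    using l half_exp_pos[of t] by (intro divide_right_mono) (auto simp: half_exp_sq)
  also have "\<dots> = 1 / half_exp t" using half_exp_pos[of t] by (simp add: power3_eq_cube power2_eq_square)
  finally show "cosh_size \<kappa> t / half_exp t ^ 3 \<le> 1 / half_exp t" .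
qed (auto simp: prof_weight_def cosh_size_bounds(4)[OF k])

lemma profile_velocity_bound: "cmod (profile_velocity \<eta> \<mu> h t) \<le> 2 * 10 ^ 7 * R / half_exp t"
proof -
  define b where "b = half_exp t" define L where "L = cosh_size \<kappa> t"
  have b: "0 < b" "1 \<le> b" using half_exp_pos half_exp_ge1 by (auto simp: b_def)
  have L: "0 < L" using weights(3) by (simp add: L_def)
  note nc = near_axis_cosh[OF st.na, of t, folded kap L_def]
  define S where "S = sinh (of_real t - \<eta> + s)" define C where "C = cosh (of_real t - \<eta> + s)"
  have "cmod (S / C * w t) = cmod S * cmod (1 / C) * cmod (w t)" by (simp add: norm_mult norm_divide)
  also have "\<dots> \<le> (3 * b\<^sup>2) * (9 / L) * (R * (L\<^sup>2 / b ^ 5))"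
    using nc(4) trig_bounds(1)[OF st.na, of t, folded kap L_def] st.wR[of t] b L
    by (intro mult_mono) (auto simp: S_def C_def b_def half_exp_sq weights(2) L_def)
  also have "\<dots> = 27 * R * (L / b ^ 3) * (b\<^sup>2 * b ^ 3 / b ^ 5)" using L b by (simp add: power2_eq_square)
  also have "b\<^sup>2 * b ^ 3 / b ^ 5 = 1" using b by (simp flip: power_add)
  finally have 1: "cmod (S / C * w t) \<le> 27 * R * (L / b ^ 3)" by simp
  have "cmod (C * source_primitive \<eta> \<mu> h s w t) \<le> (5 * L) * (2 * 10 ^ 6 * R / b ^ 3)"
    unfolding norm_mult
  proof (rule mult_mono)
    show "cmod C \<le> 5 * L" using nc(2) by (simp add: C_def)
    have "2 * 10 ^ 6 * st.G / b ^ 3 \<le> 2 * 10 ^ 6 * R / b ^ 3" using G_R b by (intro divide_right_mono) auto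
    thus "cmod (source_primitive \<eta> \<mu> h s w t) \<le> 2 * 10 ^ 6 * R / b ^ 3" using st.source_primitive_bound[of t] by (simp add: b_def)
  qed (use L in auto)
  hence 2: "cmod (C * source_primitive \<eta> \<mu> h s w t) \<le> 10 ^ 7 * R * (L / b ^ 3)" by (simp add: mult_ac)
  have "cmod (profile_velocity \<eta> \<mu> h t) \<le> cmod (S / C * w t) + cmod (C * source_primitive \<eta> \<mu> h s w t)"
    using norm_triangle_ineq4[of "- (S / C * w t)" "C * source_primitive \<eta> \<mu> h s w t"] by (simp add: profile_velocity_def S_def C_def)
  also have "\<dots> \<le> 27 * R * (L / b ^ 3) + 10 ^ 7 * R * (L / b ^ 3)" using 1 2 by (rule add_mono)
  also have "\<dots> = (27 + 10 ^ 7) * R * (L / b ^ 3)" by (simp only: distrib_right)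
  also have "\<dots> \<le> 2 * 10 ^ 7 * R * (1 / b)"
    using weights(1)[of t] R_bounds(1) L b by (intro mult_mono) (auto simp: L_def b_def)
  finally show ?thesis by (simp add: b_def)
qed

lemma profile_sol_bound: "cmod (w t) \<le> R / half_exp t" "cmod (w t) \<le> R" "cmod (w t) \<le> 1"
proof -
  have "cmod (w t) \<le> R * (1 / half_exp t)"
    using st.wR[of t] mult_left_mono[OF prof_weight_bounds(2)[OF k, of t] st.R0] by linarith
  thus 1: "cmod (w t) \<le> R / half_exp t" by simp
  have "R / half_exp t \<le> R / 1" using half_exp_ge1[of t] st.R0 by (intro divide_left_mono) auto
  thus "cmod (w t) \<le> R" using 1 by simp
  thus "cmod (w t) \<le> 1" using st.R1 by linarith
qed

text \<open>
  In each product the profile weight beats the double pole, leaving plain exponential decay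
  without negative powers of \<open>\<kappa>\<close>.
\<close>

lemma nonlinear_bounds:
  defines "z \<equiv> \<lambda>t. of_real t - \<eta> + s"
  shows "cmod (cos_sep (z t) * (1 - cos (w t))) \<le> 600 * R\<^sup>2 * exp (- \<bar>t\<bar>)"
    "cmod (sin_sep (z t) * (sin (w t) - w t)) \<le> 1500 * R\<^sup>2 * exp (- \<bar>t\<bar>)"
    "cmod (sin_sep (z t) * sin (w t)) \<le> 1500 * R * exp (- \<bar>t\<bar>)"
    "cmod (sin_sep (z t) * w t) \<le> 500 * R * exp (- \<bar>t\<bar>)"
proof -
  define b where "b = half_exp t" define L where "L = cosh_size \<kappa> t"
  have b: "0 < b" "1 \<le> b" using half_exp_pos half_exp_ge1 by (auto simp: b_def)
  have L: "0 < L" using weights(3) by (simp add: L_def)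
  have zf: "of_real t - \<eta> + s = z t" by (simp add: z_def)
  note tb = trig_bounds[OF st.na, of t, folded kap L_def b_def, unfolded zf]
  note sc = complex_sin_cos_bounds[OF profile_sol_bound(3)[of t]]
  have V: "prof_weight \<kappa> t = L\<^sup>2 / b ^ 5" by (simp add: weights(2) L_def b_def)
  have e: "exp (- \<bar>t\<bar>) = 1 / b\<^sup>2" by (simp add: b_def half_exp_sq exp_minus divide_inverse)
  have w2: "(cmod (w t))\<^sup>2 \<le> (R * (L\<^sup>2 / b ^ 5))\<^sup>2" using st.wR[of t] unfolding V by (intro power_mono) auto
  have LL: "L\<^sup>2 / b ^ 6 \<le> 1 / b\<^sup>2"
  proof -
    have "L\<^sup>2 \<le> b ^ 4" using power_mono[OF cosh_size_bounds(2)[OF k, of t], of 2] L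
      by (simp add: L_def b_def half_exp_sq[symmetric] flip: power_mult)
    hence "L\<^sup>2 / b ^ 6 \<le> b ^ 4 / b ^ 6" using b by (intro divide_right_mono) auto
    also have "\<dots> = 1 / b\<^sup>2"
    proof -
      have "b ^ 6 = b ^ 4 * b\<^sup>2" by (simp flip: power_add)
      thus ?thesis using b nonzero_divide_mult_cancel_left[of "b ^ 4" "b\<^sup>2"] by simp
    qed
    finally show ?thesis .
  qed
  have sq: "cmod (sin_sep (z t)) \<le> 500 * (b ^ 4 / L\<^sup>2)"
  proof -
    have "b\<^sup>2 / L\<^sup>2 \<le> b ^ 4 / L\<^sup>2" using b by (intro divide_right_mono power_increasing) auto
    hence "500 * (b\<^sup>2 / L\<^sup>2) \<le> 500 * (b ^ 4 / L\<^sup>2)" by (intro mult_left_mono) auto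
    thus ?thesis using tb(2) by (simp only: times_divide_eq_right[symmetric] mult.assoc)
  qed
  have q: "cmod x \<le> 3 * (cmod (w t))\<^sup>2 \<Longrightarrow> cmod y \<le> c * (b ^ 4 / L\<^sup>2) \<Longrightarrow> 0 \<le> c \<Longrightarrow> cmod (y * x) \<le> 3 * c * R\<^sup>2 * exp (- \<bar>t\<bar>)" for x y c
  proof -
    assume a: "cmod x \<le> 3 * (cmod (w t))\<^sup>2" "cmod y \<le> c * (b ^ 4 / L\<^sup>2)" "0 \<le> c"
    have "cmod (y * x) \<le> (c * (b ^ 4 / L\<^sup>2)) * (3 * (R * (L\<^sup>2 / b ^ 5))\<^sup>2)"
      unfolding norm_mult using a w2 L b by (intro mult_mono) auto
    also have "\<dots> = 3 * c * R\<^sup>2 * ((L\<^sup>2 / b ^ 5)\<^sup>2 * (b ^ 4 / L\<^sup>2))" by (simp only: power_mult_distrib mult_ac)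
    also have "\<dots> = 3 * c * R\<^sup>2 * (L\<^sup>2 / b ^ 6)" using prof_weight_arith(1)[OF b(1) L] by (simp only:)
    also have "\<dots> \<le> 3 * c * R\<^sup>2 * (1 / b\<^sup>2)" using LL a(3) by (intro mult_left_mono) auto
    finally show ?thesis by (simp add: e)
  qed
  show "cmod (cos_sep (z t) * (1 - cos (w t))) \<le> 600 * R\<^sup>2 * exp (- \<bar>t\<bar>)"
    using q[of "1 - cos (w t)" "cos_sep (z t)" 200] sc(1) tb(3) by (simp add: norm_minus_commute)
  show "cmod (sin_sep (z t) * (sin (w t) - w t)) \<le> 1500 * R\<^sup>2 * exp (- \<bar>t\<bar>)"
    using q[of "sin (w t) - w t" "sin_sep (z t)" 500] sc(2) sq by simp
  have p: "cmod x \<le> c * cmod (w t) \<Longrightarrow> 0 \<le> c \<Longrightarrow> cmod (sin_sep (z t) * x) \<le> 500 * c * R * exp (- \<bar>t\<bar>)" for x c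
  proof -
    assume a: "cmod x \<le> c * cmod (w t)" "0 \<le> c"
    have "cmod x \<le> c * (R * (L\<^sup>2 / b ^ 5))" using a mult_left_mono[OF st.wR[of t] a(2)] unfolding V by linarith
    hence "cmod (sin_sep (z t) * x) \<le> (500 * b\<^sup>2 / L\<^sup>2) * (c * (R * (L\<^sup>2 / b ^ 5)))"
      unfolding norm_mult using tb(2) L b by (intro mult_mono) auto
    also have "\<dots> = 500 * c * R * (b\<^sup>2 / b ^ 5)" using L by simp
    also have "b\<^sup>2 / b ^ 5 = 1 / b ^ 3"
    proof -
      have "b ^ 5 = b\<^sup>2 * b ^ 3" by (simp flip: power_add)
      thus ?thesis using b nonzero_divide_mult_cancel_left[of "b\<^sup>2" "b ^ 3"] by simp
    qed
    also have "500 * c * R * (1 / b ^ 3) \<le> 500 * c * R * (1 / b\<^sup>2)"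
      using a(2) st.R0 b by (intro mult_left_mono divide_left_mono power_increasing) auto
    finally show ?thesis by (simp add: e)
  qed
  show "cmod (sin_sep (z t) * sin (w t)) \<le> 1500 * R * exp (- \<bar>t\<bar>)" using p[of "sin (w t)" 3] sc(3) by simp
  show "cmod (sin_sep (z t) * w t) \<le> 500 * R * exp (- \<bar>t\<bar>)" using p[of "w t" 1] by simp
qed

lemma forcing_le_R: "\<mu> * M \<le> R" "\<mu> * M / \<kappa>\<^sup>2 \<le> R / 10 ^ 15"
proof -
  have e: "R = 16 * 10 ^ 14 * (\<mu> * M / \<kappa>\<^sup>2)" by (simp add: R_def sol_radius_def)
  have "X \<le> 16 * 10 ^ 14 * X / 10 ^ 15" if "0 \<le> X" for X :: real using that by simp
  moreover have "0 \<le> \<mu> * M / \<kappa>\<^sup>2" using mu M by simp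
  ultimately show 1: "\<mu> * M / \<kappa>\<^sup>2 \<le> R / 10 ^ 15" unfolding e by blast
  have "\<mu> * M / 1 \<le> \<mu> * M / \<kappa>\<^sup>2" using mu M k by (intro divide_left_mono) (auto simp: power_le_one)
  moreover have "R / 10 ^ 15 \<le> R" using R_bounds(1) by simp
  ultimately show "\<mu> * M \<le> R" using 1 by linarith
qed

definition action_remainder where
  "action_remainder t = action_integrand \<eta> \<mu> h t - of_real \<mu> * (2 * h t / (cosh (of_real t - \<eta> + s))\<^sup>2)"

lemma action_remainder_bound: "cmod (action_remainder t) \<le> (3 * 10 ^ 14 * R\<^sup>2) * exp (- \<bar>t\<bar>)"
proof -
  define z where "z = of_real t - \<eta> + s"
  define e where "e = exp (- \<bar>t\<bar>)"
  have e0: "0 \<le> e" by (simp add: e_def)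
  note nb = nonlinear_bounds[of t, folded z_def e_def]
  have be: "(1 / half_exp t)\<^sup>2 = e" by (simp add: e_def half_exp_sq exp_minus divide_inverse power_mult_distrib power_inverse)
  have eq: "action_remainder t = (profile_velocity \<eta> \<mu> h t)\<^sup>2 / 2 + cos_sep z * (1 - cos (w t)) + sin_sep z * (sin (w t) - w t)
     + of_real \<mu> * h t * (cos_sep z * (1 - cos (w t)) + sin_sep z * sin (w t))"
  proof -
    define c where "c = 1 / (cosh z)\<^sup>2"
    have c: "cos_sep z = 1 - 2 * c" "2 * h t / (cosh z)\<^sup>2 = 2 * h t * c" by (simp_all add: c_def cos_sep_def)
    show ?thesis
      unfolding action_remainder_def action_integrand_def Let_def z_def[symmetric] c by (simp add: algebra_simps)
  qed
  have d2: "cmod ((profile_velocity \<eta> \<mu> h t)\<^sup>2 / 2) \<le> 2 * 10 ^ 14 * R\<^sup>2 * e"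
  proof -
    have "(cmod (profile_velocity \<eta> \<mu> h t))\<^sup>2 \<le> (2 * 10 ^ 7 * R * (1 / half_exp t))\<^sup>2"
      using profile_velocity_bound[of t] by (intro power_mono) auto
    also have "\<dots> = 4 * 10 ^ 14 * R\<^sup>2 * e" unfolding be[symmetric] by (simp add: power_mult_distrib power_divide)
    finally show ?thesis by (simp add: norm_divide norm_power)
  qed
  have R2: "R\<^sup>2 \<le> R" using st.R0 st.R1 by (simp add: power2_eq_square mult_left_le)
  have f: "cmod (of_real \<mu> * h t * (cos_sep z * (1 - cos (w t)) + sin_sep z * sin (w t))) \<le> R * (2100 * R * e)"
    unfolding norm_mult
  proof (rule mult_mono)
    show "cmod (of_real \<mu>) * cmod (h t) \<le> R" using mu order_trans[OF mult_left_mono[OF hM[of t], of \<mu>] forcing_le_R(1)] by simp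
    have "600 * R\<^sup>2 * e \<le> 600 * R * e" using R2 e0 by (intro mult_right_mono) auto
    thus "cmod (cos_sep z * (1 - cos (w t)) + sin_sep z * sin (w t)) \<le> 2100 * R * e"
      using norm_triangle_le[OF add_mono[OF nb(1) nb(3)]] by linarith
  qed (use st.R0 in auto)
  have "cmod (action_remainder t) \<le> 2 * 10 ^ 14 * R\<^sup>2 * e + 600 * R\<^sup>2 * e + 1500 * R\<^sup>2 * e + R * (2100 * R * e)"
    unfolding eq by (intro norm_triangle_le add_mono d2 nb(1) nb(2) f)
  also have "\<dots> = (2 * 10 ^ 14 + 4200) * (R\<^sup>2 * e)" by (simp add: power2_eq_square algebra_simps)
  also have "\<dots> \<le> (3 * 10 ^ 14) * (R\<^sup>2 * e)" using e0 by (intro mult_right_mono) auto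
  finally show ?thesis by (simp add: e_def)
qed

lemma act_integrand_cont: "continuous_on UNIV (action_integrand \<eta> \<mu> h)"
  unfolding action_integrand_def[abs_def] Let_def
  by (intro continuous_intros profile_velocity_cont hc st.wc continuous_trig(3,4)[OF st.na]) auto

lemma sech2_cont: "near_axis \<eta> s' \<Longrightarrow> continuous_on UNIV (\<lambda>t. 2 * h t / (cosh (of_real t - \<eta> + s'))\<^sup>2)"
  by (intro continuous_intros hc) (use near_axis_cosh(5) in auto)

lemma sech2_bound: assumes "near_axis \<eta> s'" shows "cmod (2 * h t / (cosh (of_real t - \<eta> + s'))\<^sup>2) \<le> 162 * M / (cosh_size \<kappa> t)\<^sup>2"
proof -
  have "cmod (2 * h t / (cosh (of_real t - \<eta> + s'))\<^sup>2) = 2 * cmod (h t) * (cmod (1 / cosh (of_real t - \<eta> + s')))\<^sup>2"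
    by (simp add: norm_divide norm_mult norm_power power_divide)
  also have "\<dots> \<le> 2 * M * (9 / cosh_size \<kappa> t)\<^sup>2"
    using hM[of t] trig_bounds(1)[OF assms, of t, folded kap] M by (intro mult_mono power_mono) auto
  finally show ?thesis by (simp add: power_divide)
qed

lemma sech2_integrable:
  assumes "near_axis \<eta> s'"
  shows "integrable lborel (\<lambda>t. 2 * h t / (cosh (of_real t - \<eta> + s'))\<^sup>2)"
    "cmod (\<integral>t. 2 * h t / (cosh (of_real t - \<eta> + s'))\<^sup>2 \<partial>lborel) \<le> 324 * M / \<kappa>"
  using sech2_weight_integral[OF k borel_measurable_continuous_onI[OF sech2_cont[OF assms]] _ sech2_bound[OF assms]] M
  by auto

lemma action_remainder_integrable: "integrable lborel action_remainder"
proof (rule Bochner_Integration.integrable_bound)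
  show "integrable lborel (\<lambda>t. (3 * 10 ^ 14 * R\<^sup>2) * exp (- \<bar>t\<bar>))" using exp_abs_integrable[of 1] by simp
  show "action_remainder \<in> borel_measurable lborel" unfolding action_remainder_def[abs_def]
    using borel_measurable_continuous_onI[OF continuous_on_diff[OF act_integrand_cont
        continuous_on_mult[OF continuous_on_const[of _ "complex_of_real \<mu>"] sech2_cont[OF st.na]]]] by simp
  show "AE t in lborel. norm (action_remainder t) \<le> norm ((3 * 10 ^ 14 * R\<^sup>2) * exp (- \<bar>t\<bar>))" using action_remainder_bound by auto
qed

lemma action_integrand_integrable: "integrable lborel (action_integrand \<eta> \<mu> h)"
proof -
  have "action_integrand \<eta> \<mu> h = (\<lambda>t. action_remainder t + of_real \<mu> * (2 * h t / (cosh (of_real t - \<eta> + s))\<^sup>2))"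
    by (simp add: action_remainder_def fun_eq_iff)
  thus ?thesis using action_remainder_integrable integrable_mult_right[OF sech2_integrable(1)[OF st.na], of "of_real \<mu>"]
    by (simp only: Bochner_Integration.integrable_add)
qed

text \<open>
  The integrand minus its Melnikov part is quadratic in \<open>R = O(\<mu> M / \<kappa>\<^sup>2)\<close>. Removing the shift
  \<open>s = O(R)\<close> from the Melnikov part changes it by \<open>O(\<mu> M s / \<kappa>\<^sup>2)\<close>, which is again quadratic. In
  the second bound one factor \<open>R \<le> \<kappa>\<close> is given away, so that a single \<open>1 / \<kappa>\<close> remains.
\<close>

theorem action_expansion:
  "cmod (complex_action \<eta> \<mu> h - 8 - of_real \<mu> * complex_melnikov \<eta> h) \<le> 10 ^ 46 * (\<mu> * M / \<kappa>\<^sup>2)\<^sup>2"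
  "cmod (complex_action \<eta> \<mu> h - 8) \<le> 10 ^ 14 * (\<mu> * M / \<kappa>)"
proof -
  define I1 where "I1 = (\<integral>t. 2 * h t / (cosh (of_real t - \<eta> + s))\<^sup>2 \<partial>lborel)"
  have a: "complex_action \<eta> \<mu> h - 8 = (\<integral>t. action_remainder t \<partial>lborel) + of_real \<mu> * I1"
  proof -
    have "action_integrand \<eta> \<mu> h = (\<lambda>t. action_remainder t + of_real \<mu> * (2 * h t / (cosh (of_real t - \<eta> + s))\<^sup>2))"
      by (simp add: action_remainder_def fun_eq_iff)
    hence "(\<integral>t. action_integrand \<eta> \<mu> h t \<partial>lborel) = (\<integral>t. action_remainder t \<partial>lborel) + of_real \<mu> * I1"
      using Bochner_Integration.integral_add[OF action_remainder_integrable integrable_mult_right[OF sech2_integrable(1)[OF st.na], of "of_real \<mu>"]]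
      by (simp only: I1_def integral_mult_right_zero)
    thus ?thesis by (simp add: complex_action_def)
  qed
  have r: "cmod (\<integral>t. action_remainder t \<partial>lborel) \<le> 6 * 10 ^ 14 * R\<^sup>2"
  proof -
    have "cmod (\<integral>t. action_remainder t \<partial>lborel) \<le> (\<integral>t. (3 * 10 ^ 14 * R\<^sup>2) * exp (- \<bar>t\<bar>) \<partial>lborel)"
      by (rule Bochner_Integration.integral_norm_bound_integral[OF action_remainder_integrable])
         (use action_remainder_bound exp_abs_integrable[of 1] in auto)
    also have "\<dots> = (3 * 10 ^ 14 * R\<^sup>2) * (\<integral>t. exp (- \<bar>t\<bar>) \<partial>lborel)" by simp
    also have "\<dots> \<le> (3 * 10 ^ 14 * R\<^sup>2) * 2" by (intro mult_left_mono exp_abs_integral) auto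
    finally show ?thesis by simp
  qed
  have "cmod (I1 - complex_melnikov \<eta> h) \<le> 4 * (8748 * M * cmod s / \<kappa>\<^sup>2)"
  proof -
    have 0: "integrable lborel (\<lambda>t. 2 * h t / (cosh (of_real t - \<eta>))\<^sup>2)" using sech2_integrable(1)[OF na0] by simp
    have "I1 - complex_melnikov \<eta> h = (\<integral>t. 2 * h t / (cosh (of_real t - \<eta> + s))\<^sup>2 - 2 * h t / (cosh (of_real t - \<eta>))\<^sup>2 \<partial>lborel)"
      unfolding I1_def complex_melnikov_def by (rule Bochner_Integration.integral_diff[OF sech2_integrable(1)[OF st.na] 0, symmetric])
    also have "cmod \<dots> \<le> 4 * (8748 * M * cmod s / \<kappa>\<^sup>2)"
    proof (rule src_weight_integral(2)[OF k])
      show "(\<lambda>t. 2 * h t / (cosh (of_real t - \<eta> + s))\<^sup>2 - 2 * h t / (cosh (of_real t - \<eta>))\<^sup>2) \<in> borel_measurable borel"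
        using borel_measurable_integrable[OF sech2_integrable(1)[OF st.na]] borel_measurable_integrable[OF 0] by simp
      show "0 \<le> 8748 * M * cmod s / \<kappa>\<^sup>2" using M by simp
      fix t
      define b where "b = half_exp t" define L where "L = cosh_size \<kappa> t"
      have b: "0 < b" "1 \<le> b" using half_exp_pos half_exp_ge1 by (auto simp: b_def)
      have L: "0 < L" using weights(3) by (simp add: L_def)
      have "cmod (2 * h t / (cosh (of_real t - \<eta> + s))\<^sup>2 - 2 * h t / (cosh (of_real t - \<eta>))\<^sup>2)
         = 2 * cmod (h t) * cmod (1 / (cosh (of_real t - \<eta> + s))\<^sup>2 - 1 / (cosh (of_real t - \<eta>))\<^sup>2)"
      proof -
        have "2 * h t / (cosh (of_real t - \<eta> + s))\<^sup>2 - 2 * h t / (cosh (of_real t - \<eta>))\<^sup>2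
          = 2 * h t * (1 / (cosh (of_real t - \<eta> + s))\<^sup>2 - 1 / (cosh (of_real t - \<eta>))\<^sup>2)" by (simp add: algebra_simps)
        thus ?thesis by (simp only: norm_mult norm_numeral)
      qed
      also have "\<dots> \<le> 2 * M * (4374 * b\<^sup>2 / L ^ 3 * cmod s)"
        using sech2_shift[OF st.na, of t, folded kap b_def L_def] hM[of t] M by (intro mult_mono) auto
      also have "\<dots> = 8748 * M * cmod s * (b\<^sup>2 / L ^ 3)" by simp
      also have "\<dots> \<le> 8748 * M * cmod s * (src_weight \<kappa> t / \<kappa>\<^sup>2)"
      proof -
        have "b\<^sup>2 / L ^ 3 \<le> b ^ 3 / L ^ 3" using b L by (intro divide_right_mono power_increasing) auto
        also have "\<dots> \<le> src_weight \<kappa> t / \<kappa>\<^sup>2" using prof_weight_bounds(5)[OF k, of t] by (simp add: b_def L_def)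
        finally show ?thesis using M by (intro mult_left_mono) auto
      qed
      finally show "cmod (2 * h t / (cosh (of_real t - \<eta> + s))\<^sup>2 - 2 * h t / (cosh (of_real t - \<eta>))\<^sup>2) \<le> 8748 * M * cmod s / \<kappa>\<^sup>2 * src_weight \<kappa> t" by simp
    qed
    finally show ?thesis .
  qed
  hence "\<mu> * cmod (I1 - complex_melnikov \<eta> h) \<le> \<mu> * (4 * (8748 * M * cmod s / \<kappa>\<^sup>2))" using mu by (intro mult_left_mono) auto
  also have "\<dots> = 34992 * (\<mu> * M / \<kappa>\<^sup>2) * cmod s" by simp
  also have "\<dots> \<le> 34992 * (R / 10 ^ 15) * (10 ^ 6 * R)"
    using forcing_le_R(2) solution(6) R_bounds(1) mu M by (intro mult_mono mult_left_mono) auto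
  also have "\<dots> \<le> R\<^sup>2" by (simp add: power2_eq_square)
  finally have m: "\<mu> * cmod (I1 - complex_melnikov \<eta> h) \<le> R\<^sup>2" .
  have "complex_action \<eta> \<mu> h - 8 - of_real \<mu> * complex_melnikov \<eta> h = (\<integral>t. action_remainder t \<partial>lborel) + of_real \<mu> * (I1 - complex_melnikov \<eta> h)"
    by (simp add: a algebra_simps)
  also have "cmod \<dots> \<le> 6 * 10 ^ 14 * R\<^sup>2 + R\<^sup>2"
    using r m mu by (intro norm_triangle_le add_mono) (auto simp: norm_mult)
  also have "\<dots> = (6 * 10 ^ 14 + 1) * (16 * 10 ^ 14)\<^sup>2 * (\<mu> * M / \<kappa>\<^sup>2)\<^sup>2"
    by (simp add: R_def sol_radius_def power_mult_distrib power_divide)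
  also have "\<dots> \<le> 10 ^ 46 * (\<mu> * M / \<kappa>\<^sup>2)\<^sup>2" by (intro mult_right_mono) auto
  finally show "cmod (complex_action \<eta> \<mu> h - 8 - of_real \<mu> * complex_melnikov \<eta> h) \<le> 10 ^ 46 * (\<mu> * M / \<kappa>\<^sup>2)\<^sup>2" .
  have "6 * 10 ^ 14 * R\<^sup>2 \<le> 6 * 10 ^ 14 * ((\<kappa> / 10 ^ 16) * R)"
    unfolding power2_eq_square using R_bounds by (intro mult_left_mono mult_right_mono) auto
  also have "\<dots> = (96 * 10 ^ 12) * (\<mu> * M / \<kappa>)" using k by (simp add: R_def sol_radius_def power2_eq_square)
  finally have "cmod (\<integral>t. action_remainder t \<partial>lborel) \<le> (96 * 10 ^ 12) * (\<mu> * M / \<kappa>)" using r by linarith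
  moreover have "cmod (of_real \<mu> * I1) \<le> 324 * (\<mu> * M / \<kappa>)"
    using mult_left_mono[OF sech2_integrable(2)[OF st.na], of \<mu>] mu by (simp add: norm_mult I1_def mult_ac)
  ultimately have "cmod (complex_action \<eta> \<mu> h - 8) \<le> (96 * 10 ^ 12) * (\<mu> * M / \<kappa>) + 324 * (\<mu> * M / \<kappa>)"
    unfolding a by (intro norm_triangle_le add_mono)
  also have "\<dots> \<le> 10 ^ 14 * (\<mu> * M / \<kappa>)"
  proof -
    have "(96 * 10 ^ 12) * X + 324 * X \<le> 10 ^ 14 * X" if "0 \<le> X" for X :: real using that by simp
    moreover have "0 \<le> \<mu> * M / \<kappa>" using mu M k by simp
    ultimately show ?thesis by blast
  qed
  finally show "cmod (complex_action \<eta> \<mu> h - 8) \<le> 10 ^ 14 * (\<mu> * M / \<kappa>)" .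
qed

end

section \<open>Holomorphic dependence on the centre\<close>

lemma cosh_size_inverse_square_integrable:
  assumes "0 < \<kappa>" "\<kappa> \<le> 1" shows "integrable lborel (\<lambda>t. 1 / (cosh_size \<kappa> t)\<^sup>2)"
proof -
  have "continuous_on UNIV (\<lambda>t. complex_of_real (1 / (cosh_size \<kappa> t)\<^sup>2))"
    by (intro continuous_intros) (use cosh_size_bounds(4)[OF assms] in \<open>auto simp: less_le\<close>)
  from sech2_weight_integral(1)[OF assms borel_measurable_continuous_onI[OF this], of 1]
  have "integrable lborel (\<lambda>t. complex_of_real (1 / (cosh_size \<kappa> t)\<^sup>2))" by (simp add: norm_divide norm_power)
  from integrable_norm[OF this] show ?thesis by (simp add: norm_divide norm_power)
qed

locale action_family =
  fixes V :: "complex set" and \<mu> M k0 :: real and H :: "complex \<Rightarrow> real \<Rightarrow> complex"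
  assumes opn: "open V" and hol: "\<And>t. (\<lambda>\<eta>. H \<eta> t) holomorphic_on V"
    and prob: "\<And>\<eta>. \<eta> \<in> V \<Longrightarrow> pendulum_problem \<eta> \<mu> M (cos (Im \<eta>)) (H \<eta>)"
    and k0: "0 < k0" and kge: "\<And>\<eta>. \<eta> \<in> V \<Longrightarrow> k0 \<le> cos (Im \<eta>)"
begin

lemma iterate_holomorphic: "(\<lambda>\<eta>. iterate \<eta> \<mu> (H \<eta>) n i) holomorphic_on V"
proof (induction n arbitrary: i)
  case 0
  show ?case by (simp add: iterate_def)
next
  case (Suc n)
  interpret S: holomorphic_states V "\<lambda>\<eta>. \<eta>" "\<lambda>\<eta>. iterate \<eta> \<mu> (H \<eta>) n None" "\<lambda>\<eta> t. iterate \<eta> \<mu> (H \<eta>) n (Some t)"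
    H \<mu> M k0 "\<lambda>\<eta>. sol_radius \<mu> M (cos (Im \<eta>))"
  proof (rule holomorphic_states.intro)
    fix \<eta> assume "\<eta> \<in> V"
    interpret p: pendulum_problem \<eta> \<mu> M "cos (Im \<eta>)" "H \<eta>" by (rule prob) fact
    show "iteration_state \<eta> \<mu> M (cos (Im \<eta>)) (sol_radius \<mu> M (cos (Im \<eta>))) (H \<eta>) (\<lambda>t. iterate \<eta> \<mu> (H \<eta>) n (Some t)) (iterate \<eta> \<mu> (H \<eta>) n None)"
      using p.state[of "\<lambda>t. iterate \<eta> \<mu> (H \<eta>) n (Some t)" "iterate \<eta> \<mu> (H \<eta>) n None"]
        p.iterate_cont p.iterate_bound[of n None] p.iterate_bound[of n "Some _"]
      by (simp add: p.R_def ball_weight_def)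
  qed (use opn hol k0 kge Suc in \<open>auto intro!: holomorphic_intros\<close>)
  have "iterate \<eta> \<mu> (H \<eta>) (Suc n) i = step_map \<eta> \<mu> (H \<eta>) (iterate \<eta> \<mu> (H \<eta>) n) i" for \<eta>
    by (simp add: iterate_def)
  thus ?case using S.hol_shift_step S.hol_profile_step by (cases i) (auto simp: step_map_def)
qed

text \<open>
  The iterates converge geometrically, and uniformly on the region because \<open>k0\<close> bounds the
  weights.
\<close>

lemma limit_holomorphic:
  assumes "\<And>\<eta> n. \<eta> \<in> V \<Longrightarrow> cmod (iterate \<eta> \<mu> (H \<eta>) n i - g \<eta>) \<le> ball_weight \<mu> M (cos (Im \<eta>)) i / 2 ^ n"
  shows "g holomorphic_on V"
proof (rule holomorphic_uniform_sequence[OF opn iterate_holomorphic])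
  have b1: "ball_weight \<mu> M (cos (Im \<eta>)) i \<le> 1" if "\<eta> \<in> V" for \<eta>
  proof -
    interpret p: pendulum_problem \<eta> \<mu> M "cos (Im \<eta>)" "H \<eta>" by (rule prob) fact
    have "p.R * prof_weight (cos (Im \<eta>)) t \<le> 1 * 1" for t
      using p.R_bounds prof_weight_bounds[OF p.k, of t] by (intro mult_mono) auto
    thus ?thesis using p.R_bounds by (cases i) (auto simp: ball_weight_def p.R_def)
  qed
  fix \<eta>0 assume "\<eta>0 \<in> V"
  then obtain d where d: "d > 0" "cball \<eta>0 d \<subseteq> V" using opn open_contains_cball by blast
  have "uniform_limit (cball \<eta>0 d) (\<lambda>n \<eta>. iterate \<eta> \<mu> (H \<eta>) n i) g sequentially"
  proof (rule uniform_limitI)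
    fix e :: real assume "e > 0"
    hence "\<forall>\<^sub>F n in sequentially. (1/2) ^ n < e"
      using order_tendstoD(2)[OF LIMSEQ_realpow_zero[of "1/2"], of e] by simp
    thus "\<forall>\<^sub>F n in sequentially. \<forall>\<eta>\<in>cball \<eta>0 d. dist (iterate \<eta> \<mu> (H \<eta>) n i) (g \<eta>) < e"
    proof eventually_elim
      case (elim n)
      have "dist (iterate \<eta> \<mu> (H \<eta>) n i) (g \<eta>) < e" if "\<eta> \<in> cball \<eta>0 d" for \<eta>
      proof -
        have v: "\<eta> \<in> V" using that d by blast
        have "ball_weight \<mu> M (cos (Im \<eta>)) i / 2 ^ n \<le> 1 / 2 ^ n" by (rule divide_right_mono[OF b1[OF v]]) simp
        thus ?thesis using assms[OF v, of n] elim by (simp add: dist_norm power_divide)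
      qed
      thus ?case by blast
    qed
  qed
  thus "\<exists>d>0. cball \<eta>0 d \<subseteq> V \<and> uniform_limit (cball \<eta>0 d) (\<lambda>n \<eta>. iterate \<eta> \<mu> (H \<eta>) n i) g sequentially"
    using d by blast
qed

lemma sol_holomorphic: "(\<lambda>\<eta>. shift_sol \<eta> \<mu> (H \<eta>)) holomorphic_on V" "(\<lambda>\<eta>. profile_sol \<eta> \<mu> (H \<eta>) t) holomorphic_on V"
  using limit_holomorphic[OF pendulum_problem.solution(4)[OF prob]] limit_holomorphic[OF pendulum_problem.solution(5)[OF prob]]
  by auto

sublocale S: holomorphic_states V "\<lambda>\<eta>. \<eta>" "\<lambda>\<eta>. shift_sol \<eta> \<mu> (H \<eta>)" "\<lambda>\<eta>. profile_sol \<eta> \<mu> (H \<eta>)" H \<mu> M k0 "\<lambda>\<eta>. sol_radius \<mu> M (cos (Im \<eta>))"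
proof (rule holomorphic_states.intro)
  fix \<eta> assume v: "\<eta> \<in> V"
  interpret p: pendulum_problem \<eta> \<mu> M "cos (Im \<eta>)" "H \<eta>" by (rule prob) fact
  show "iteration_state \<eta> \<mu> M (cos (Im \<eta>)) (sol_radius \<mu> M (cos (Im \<eta>))) (H \<eta>) (profile_sol \<eta> \<mu> (H \<eta>)) (shift_sol \<eta> \<mu> (H \<eta>))"
    using p.solution(1) by (simp add: p.R_def)
qed (use opn hol k0 kge sol_holomorphic in \<open>auto intro!: holomorphic_intros\<close>)

lemma cosh_size_mono: "\<eta> \<in> V \<Longrightarrow> 1 / (cosh_size (cos (Im \<eta>)) t)\<^sup>2 \<le> 1 / (cosh_size k0 t)\<^sup>2"
proof -
  assume v: "\<eta> \<in> V"
  have "cosh_size k0 t \<le> cosh_size (cos (Im \<eta>)) t" using kge[OF v] by (simp add: cosh_size_def)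
  moreover have "0 < cosh_size k0 t" using cosh_size_bounds(4)[OF k0, of t] S.k01[OF v] by simp
  ultimately show ?thesis by (intro divide_left_mono power_mono mult_pos_pos) auto
qed

lemma complex_melnikov_holomorphic: "(\<lambda>\<eta>. complex_melnikov \<eta> (H \<eta>)) holomorphic_on V"
proof (cases "V = {}")
  case False
  then obtain v where "v \<in> V" by blast
  hence k1: "k0 \<le> 1" by (rule S.k01)
  show ?thesis unfolding complex_melnikov_def
  proof (rule holomorphic_on_lebesgue_integral[OF opn, where m = "\<lambda>t. 162 * M * (1 / (cosh_size k0 t)\<^sup>2)"])
    show "(\<lambda>\<eta>. 2 * H \<eta> t / (cosh (of_real t - \<eta>))\<^sup>2) holomorphic_on V" for t
      by (intro holomorphic_intros hol) (use S.nonzero in auto)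
    fix \<eta> assume v: "\<eta> \<in> V"
    interpret p: pendulum_problem \<eta> \<mu> M "cos (Im \<eta>)" "H \<eta>" by (rule prob) fact
    show "(\<lambda>t. 2 * H \<eta> t / (cosh (of_real t - \<eta>))\<^sup>2) \<in> borel_measurable lborel"
      using borel_measurable_integrable[OF p.sech2_integrable(1)[OF p.na0]] by simp
    fix t
    have "162 * M * (1 / (cosh_size (cos (Im \<eta>)) t)\<^sup>2) \<le> 162 * M * (1 / (cosh_size k0 t)\<^sup>2)"
      using cosh_size_mono[OF v] p.M by (intro mult_left_mono) auto
    thus "cmod (2 * H \<eta> t / (cosh (of_real t - \<eta>))\<^sup>2) \<le> 162 * M * (1 / (cosh_size k0 t)\<^sup>2)"
      using p.sech2_bound[OF p.na0, of t] by simp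
  next
    show "integrable lborel (\<lambda>t. 162 * M * (1 / (cosh_size k0 t)\<^sup>2))"
      by (rule integrable_mult_right[OF cosh_size_inverse_square_integrable[OF k0 k1]])
  qed
qed (simp add: holomorphic_on_def)

lemma action_holomorphic: "(\<lambda>\<eta>. complex_action \<eta> \<mu> (H \<eta>)) holomorphic_on V"
proof (cases "V = {}")
  case False
  then obtain v where "v \<in> V" by blast
  hence k1: "k0 \<le> 1" by (rule S.k01)
  define m where "m t = 3 * 10 ^ 14 * exp (- \<bar>t\<bar>) + \<mu> * (162 * M) * (1 / (cosh_size k0 t)\<^sup>2)" for t
  have "(\<lambda>\<eta>. \<integral>t. action_integrand \<eta> \<mu> (H \<eta>) t \<partial>lborel) holomorphic_on V"
  proof (rule holomorphic_on_lebesgue_integral[OF opn, where m = m])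
    show "(\<lambda>\<eta>. action_integrand \<eta> \<mu> (H \<eta>) t) holomorphic_on V" for t
      unfolding action_integrand_def profile_velocity_def Let_def sin_sep_def cos_sep_def
      by (intro holomorphic_intros hol sol_holomorphic S.hol_source_primitive) (use S.nonzero in auto)
    show "integrable lborel m" unfolding m_def
      using exp_abs_integrable[of 1] integrable_mult_right[OF cosh_size_inverse_square_integrable[OF k0 k1], of "\<mu> * (162 * M)"]
      by (intro Bochner_Integration.integrable_add) auto
    fix \<eta> assume v: "\<eta> \<in> V"
    interpret p: pendulum_problem \<eta> \<mu> M "cos (Im \<eta>)" "H \<eta>" by (rule prob) fact
    show "action_integrand \<eta> \<mu> (H \<eta>) \<in> borel_measurable lborel"
      by (rule borel_measurable_integrable[OF p.action_integrand_integrable])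
    fix t
    have r2: "p.R\<^sup>2 \<le> 1" using p.st.R0 p.st.R1 by (simp add: power_le_one)
    have "(3 * 10 ^ 14 * p.R\<^sup>2) * exp (- \<bar>t\<bar>) \<le> (3 * 10 ^ 14 * 1) * exp (- \<bar>t\<bar>)"
      by (intro mult_right_mono mult_left_mono r2) auto
    hence "cmod (p.action_remainder t) \<le> 3 * 10 ^ 14 * exp (- \<bar>t\<bar>)"
      using p.action_remainder_bound[of t] by linarith
    moreover have "cmod (of_real \<mu> * (2 * H \<eta> t / (cosh (of_real t - \<eta> + shift_sol \<eta> \<mu> (H \<eta>)))\<^sup>2)) \<le> \<mu> * (162 * M) * (1 / (cosh_size k0 t)\<^sup>2)"
    proof -
      have "\<mu> * cmod (2 * H \<eta> t / (cosh (of_real t - \<eta> + shift_sol \<eta> \<mu> (H \<eta>)))\<^sup>2) \<le> \<mu> * (162 * M * (1 / (cosh_size k0 t)\<^sup>2))"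
      proof (rule mult_left_mono)
        have "162 * M * (1 / (cosh_size (cos (Im \<eta>)) t)\<^sup>2) \<le> 162 * M * (1 / (cosh_size k0 t)\<^sup>2)"
          using cosh_size_mono[OF v] p.M by (intro mult_left_mono) auto
        thus "cmod (2 * H \<eta> t / (cosh (of_real t - \<eta> + shift_sol \<eta> \<mu> (H \<eta>)))\<^sup>2) \<le> 162 * M * (1 / (cosh_size k0 t)\<^sup>2)"
          using p.sech2_bound[OF p.st.na, of t] by simp
      qed (use p.mu in simp)
      thus ?thesis using p.mu by (simp only: norm_mult norm_of_real abs_of_pos mult.assoc)
    qed
    ultimately have "cmod (p.action_remainder t + of_real \<mu> * (2 * H \<eta> t / (cosh (of_real t - \<eta> + shift_sol \<eta> \<mu> (H \<eta>)))\<^sup>2)) \<le> m t"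
      unfolding m_def by (intro norm_triangle_le add_mono) auto
    thus "cmod (action_integrand \<eta> \<mu> (H \<eta>) t) \<le> m t" by (simp add: p.action_remainder_def)
  qed
  thus ?thesis unfolding complex_action_def by (intro holomorphic_intros)
qed (simp add: holomorphic_on_def)

end

section \<open>Solutions with a real centre\<close>

lemma sin_cos_separatrix:
  fixes y :: real
  shows "sin (4 * arctan (exp y)) = - 2 * sinh y / (cosh y)\<^sup>2" "cos (4 * arctan (exp y)) = 1 - 2 / (cosh y)\<^sup>2"
proof -
  define a where "a = arctan (exp y)"
  have c: "cos a \<noteq> 0" unfolding a_def by (simp add: cos_arctan_not_zero)
  have t: "sin a = exp y * cos a" using tan_arctan[of "exp y"] c by (simp add: tan_def a_def field_simps)
  have "1 = (sin a)\<^sup>2 + (cos a)\<^sup>2" by simp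
  also have "\<dots> = (1 + (exp y)\<^sup>2) * (cos a)\<^sup>2" unfolding t by (simp add: power_mult_distrib algebra_simps)
  finally have cc: "(1 + (exp y)\<^sup>2) * (cos a)\<^sup>2 = 1" by simp
  have e: "1 + (exp y)\<^sup>2 = 2 * exp y * cosh y" "1 - (exp y)\<^sup>2 = - 2 * exp y * sinh y"
    by (simp_all add: cosh_field_def sinh_field_def exp_minus power2_eq_square field_simps)
  have ca: "exp y * (cos a)\<^sup>2 = 1 / (2 * cosh y)" using cc unfolding e(1) by (simp add: field_simps)
  have s2: "sin (2 * a) = 1 / cosh y"
    using ca unfolding sin_double t by (simp add: power2_eq_square)
  have c2: "cos (2 * a) = - sinh y / cosh y"
  proof -
    have "cos (2 * a) = (1 - (exp y)\<^sup>2) * (cos a)\<^sup>2"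
      unfolding cos_double t by (simp add: power_mult_distrib algebra_simps)
    also have "\<dots> = - 2 * sinh y * (exp y * (cos a)\<^sup>2)" unfolding e(2) by simp
    also have "\<dots> = - sinh y / cosh y" unfolding ca by simp
    finally show ?thesis .
  qed
  have "sin (4 * a) = 2 * sin (2 * a) * cos (2 * a)" using sin_double[of "2 * a"] by simp
  thus "sin (4 * arctan (exp y)) = - 2 * sinh y / (cosh y)\<^sup>2"
    unfolding s2 c2 by (simp add: a_def power2_eq_square)
  have "cos (4 * a) = 1 - 2 * (sin (2 * a))\<^sup>2" using cos_double_sin[of "2 * a"] by simp
  thus "cos (4 * arctan (exp y)) = 1 - 2 / (cosh y)\<^sup>2"
    unfolding s2 by (simp add: a_def power_divide)
qed

lemma of_real_trig:
  fixes y :: real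
  shows "cosh (complex_of_real y) = of_real (cosh y)" "sinh (complex_of_real y) = of_real (sinh y)"
    "sin_sep (of_real y) = of_real (sin (4 * arctan (exp y)))" "cos_sep (of_real y) = of_real (cos (4 * arctan (exp y)))"
    "csep (of_real y) = of_real (4 * arctan (exp y))" "cpsi (of_real y) = of_real (psi0 y)"
proof -
  have e: "exp (- complex_of_real y) = of_real (exp (- y))" by (simp flip: exp_of_real)
  show c: "cosh (complex_of_real y) = of_real (cosh y)" and s: "sinh (complex_of_real y) = of_real (sinh y)"
    unfolding cosh_field_def sinh_field_def e exp_of_real by simp_all
  show "sin_sep (of_real y) = of_real (sin (4 * arctan (exp y)))" "cos_sep (of_real y) = of_real (cos (4 * arctan (exp y)))"
    unfolding sin_cos_separatrix by (simp_all add: sin_sep_def cos_sep_def c s)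
  show "csep (of_real y) = of_real (4 * arctan (exp y))" by (simp add: csep_def exp_of_real Arctan_of_real)
  show "cpsi (of_real y) = of_real (psi0 y)" by (simp add: cpsi_def psi0_def c)
qed

lemma has_vector_derivative_Re:
  "(f has_vector_derivative f') (at t) \<Longrightarrow> ((\<lambda>t. Re (f t)) has_real_derivative Re f') (at t)"
  unfolding has_real_derivative_iff_has_vector_derivative
  using bounded_linear.has_vector_derivative[OF bounded_linear_Re] .

context pendulum_problem
begin

lemma profile_velocity_deriv:
  "(profile_velocity \<eta> \<mu> h has_vector_derivative cos_sep (of_real t - \<eta> + s) * w t
     - (residual \<eta> \<mu> h s w t + multiplier \<eta> \<mu> h s w * cpsi (of_real t - \<eta>))) (at t)"
proof -
  define C where "C t = cosh (of_real t - \<eta> + s)" for t :: real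
  define S where "S t = sinh (of_real t - \<eta> + s)" for t :: real
  have C0: "C t \<noteq> 0" using near_axis_cosh(5)[OF st.na] by (simp add: C_def)
  have S2: "S t * S t = C t * C t - 1" using sinh_square_eq[of "of_real t - \<eta> + s"] by (simp add: C_def S_def power2_eq_square)
  have dC: "(C has_vector_derivative S t) (at t)" unfolding C_def S_def
    by (rule has_vector_derivative_real_field) (auto intro!: derivative_eq_intros)
  have dT: "((\<lambda>t. S t / C t) has_vector_derivative 1 / (C t)\<^sup>2) (at t)"
  proof -
    have "((\<lambda>z. sinh (z - \<eta> + s) / cosh (z - \<eta> + s)) has_field_derivative (C t * C t - S t * S t) / (C t * C t)) (at (of_real t))"
      using C0 unfolding C_def S_def by (auto intro!: derivative_eq_intros)
    from has_vector_derivative_real_field[OF this] show ?thesis unfolding S2 by (simp add: S_def C_def power2_eq_square)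
  qed
  have F1: "((\<lambda>t. - (S t / C t * w t) - C t * source_primitive \<eta> \<mu> h s w t) has_vector_derivative
     - (S t / C t * profile_velocity \<eta> \<mu> h t + 1 / (C t)\<^sup>2 * w t) - (C t * balanced_source \<eta> \<mu> h s w t + S t * source_primitive \<eta> \<mu> h s w t)) (at t)"
    by (intro has_vector_derivative_diff has_vector_derivative_minus has_vector_derivative_mult dT dC profile_sol_deriv st.source_primitive_deriv)
  have F2: "- (S t / C t * profile_velocity \<eta> \<mu> h t + 1 / (C t)\<^sup>2 * w t) - (C t * balanced_source \<eta> \<mu> h s w t + S t * source_primitive \<eta> \<mu> h s w t)
     = cos_sep (of_real t - \<eta> + s) * w t - C t * balanced_source \<eta> \<mu> h s w t"
  proof -
    have wd: "profile_velocity \<eta> \<mu> h t = - (S t / C t) * w t - C t * source_primitive \<eta> \<mu> h s w t" by (simp add: profile_velocity_def S_def C_def)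
    have "S t / C t * profile_velocity \<eta> \<mu> h t = - (S t * S t / (C t * C t)) * w t - S t * source_primitive \<eta> \<mu> h s w t"
      unfolding wd using C0 by (simp add: right_diff_distrib)
    also have "S t * S t / (C t * C t) = 1 - 1 / (C t)\<^sup>2" unfolding S2 using C0 by (simp add: diff_divide_distrib power2_eq_square)
    finally have e: "S t / C t * profile_velocity \<eta> \<mu> h t = - (1 - 1 / (C t)\<^sup>2) * w t - S t * source_primitive \<eta> \<mu> h s w t" .
    have cq: "cos_sep (of_real t - \<eta> + s) = 1 - 2 * (1 / (C t)\<^sup>2)" by (simp add: cos_sep_def C_def)
    show ?thesis unfolding e cq by (simp add: algebra_simps)
  qed
  have F3: "C t * balanced_source \<eta> \<mu> h s w t = residual \<eta> \<mu> h s w t + multiplier \<eta> \<mu> h s w * cpsi (of_real t - \<eta>)"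
    using C0 by (simp add: balanced_source_def C_def)
  have F4: "profile_velocity \<eta> \<mu> h = (\<lambda>t. - (S t / C t * w t) - C t * source_primitive \<eta> \<mu> h s w t)"
    by (simp add: fun_eq_iff profile_velocity_def S_def C_def)
  show ?thesis unfolding F4 using F1[unfolded F2, unfolded F3] .
qed

end

lemma translation_limits: "filterlim (\<lambda>t::real. t - x + c) at_top at_top" "filterlim (\<lambda>t::real. t - x + c) at_bot at_bot"
proof -
  have "\<forall>\<^sub>F t in at_top. Z \<le> t - x + c" for Z
    using eventually_ge_at_top[of "Z + x - c"] by eventually_elim linarith
  thus "filterlim (\<lambda>t::real. t - x + c) at_top at_top" by (simp add: filterlim_at_top)
  have "\<forall>\<^sub>F t in at_bot. t - x + c \<le> Z" for Z
    using eventually_le_at_bot[of "Z + x - c"] by eventually_elim linarith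
  thus "filterlim (\<lambda>t::real. t - x + c) at_bot at_bot" by (simp add: filterlim_at_bot)
qed

text \<open>
  The solution for a real centre \<open>x\<close>; for real data \<open>shift_sol\<close> and \<open>profile_sol\<close> are real
  (\<open>solution_real\<close>).
\<close>

definition forced_separatrix :: "real \<Rightarrow> real \<Rightarrow> (real \<Rightarrow> real) \<Rightarrow> real \<Rightarrow> real" where
  "forced_separatrix x \<mu> f t = 4 * arctan (exp (t - x + Re (shift_sol (of_real x) \<mu> (\<lambda>t. of_real (f t)))))
     + Re (profile_sol (of_real x) \<mu> (\<lambda>t. of_real (f t)) t)"

locale real_problem =
  fixes x \<mu> M :: real and f :: "real \<Rightarrow> real"
  assumes prob: "pendulum_problem (of_real x) \<mu> M 1 (\<lambda>t. of_real (f t))"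
begin

sublocale pendulum_problem "of_real x" \<mu> M 1 "\<lambda>t. of_real (f t)" by (rule prob)

definition "\<sigma> = Re s"
definition "W t = Re (w t)"
definition "Wd t = Re (profile_velocity (of_real x) \<mu> (\<lambda>t. of_real (f t)) t)"
definition "\<alpha> = Re (multiplier (of_real x) \<mu> (\<lambda>t. of_real (f t)) s w)"
definition "q t = 4 * arctan (exp (t - x + \<sigma>))"

lemma reals: "s = of_real \<sigma>" "w t = of_real (W t)" "profile_velocity (of_real x) \<mu> (\<lambda>t. of_real (f t)) t = of_real (Wd t)"
  "multiplier (of_real x) \<mu> (\<lambda>t. of_real (f t)) s w = of_real \<alpha>"
proof -
  note r = solution_real[OF prob, simplified]
  show s: "s = of_real \<sigma>" using r(1) by (simp add: \<sigma>_def)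
  show w: "w t = of_real (W t)" using r(2) by (simp add: W_def)
  show "multiplier (of_real x) \<mu> (\<lambda>t. of_real (f t)) s w = of_real \<alpha>" using r(4) by (simp add: \<alpha>_def)
  have z: "of_real t - of_real x + s \<in> \<real>" using r(1) by auto
  have "profile_velocity (of_real x) \<mu> (\<lambda>t. of_real (f t)) t \<in> \<real>"
    unfolding profile_velocity_def by (intro Reals_diff Reals_mult Reals_minus Reals_divide Reals_trig[OF z] r)
  thus "profile_velocity (of_real x) \<mu> (\<lambda>t. of_real (f t)) t = of_real (Wd t)" by (simp add: Wd_def)
qed

lemma arg: "complex_of_real t - of_real x + s = of_real (t - x + \<sigma>)" "complex_of_real t - of_real x = of_real (t - x)"
  by (simp_all add: reals(1))

lemma Q_eq: "forced_separatrix x \<mu> f t = q t + W t" by (simp add: forced_separatrix_def q_def W_def \<sigma>_def)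

lemma trig_real: "sin_sep (complex_of_real t - of_real x + s) = of_real (sin (q t))" "cos_sep (complex_of_real t - of_real x + s) = of_real (cos (q t))"
  "cosh (complex_of_real t - of_real x + s) = of_real (cosh (t - x + \<sigma>))" "csep (complex_of_real t - of_real x + s) = of_real (q t)"
  "cpsi (complex_of_real t - of_real x) = of_real (psi x t)" "csep (complex_of_real t - of_real x) = of_real (q_sep x t)"
proof -
  show "sin_sep (complex_of_real t - of_real x + s) = of_real (sin (q t))" "cos_sep (complex_of_real t - of_real x + s) = of_real (cos (q t))"
    "cosh (complex_of_real t - of_real x + s) = of_real (cosh (t - x + \<sigma>))" "csep (complex_of_real t - of_real x + s) = of_real (q t)"
    unfolding arg(1) of_real_trig q_def by (rule refl)+
  show "cpsi (complex_of_real t - of_real x) = of_real (psi x t)" "csep (complex_of_real t - of_real x) = of_real (q_sep x t)"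
    unfolding arg(2) of_real_trig psi_def q_sep_def by (rule refl)+
qed

lemma q_deriv: "(q has_real_derivative 2 / cosh (t - x + \<sigma>)) (at t)"
proof -
  define y where "y = t - x + \<sigma>"
  have "(q has_real_derivative 4 * (inverse (1 + (exp y)\<^sup>2) * exp y)) (at t)"
    unfolding q_def y_def by (auto intro!: derivative_eq_intros)
  moreover have "1 + (exp y)\<^sup>2 = 2 * exp y * cosh y"
    by (simp add: cosh_field_def exp_minus power2_eq_square field_simps)
  moreover have "4 * (inverse (2 * exp y * cosh y) * exp y) = 2 / cosh y" by (simp add: field_simps)
  ultimately show ?thesis by (simp only: y_def[symmetric])
qed

lemma q_deriv2: "((\<lambda>t. 2 / cosh (t - x + \<sigma>)) has_real_derivative sin (q t)) (at t)"
  unfolding q_def sin_cos_separatrix by (auto intro!: derivative_eq_intros simp: power2_eq_square)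

lemma W_deriv: "(W has_real_derivative Wd t) (at t)"
  unfolding W_def[abs_def] Wd_def by (rule has_vector_derivative_Re[OF profile_sol_deriv])

lemma Wd_deriv: "(Wd has_real_derivative sin (q t + W t) * (1 + \<mu> * f t) - sin (q t) - \<alpha> * psi x t) (at t)"
proof -
  have "cos_sep (complex_of_real t - of_real x + s) * w t - (residual (of_real x) \<mu> (\<lambda>t. of_real (f t)) s w t + multiplier (of_real x) \<mu> (\<lambda>t. of_real (f t)) s w * cpsi (of_real t - of_real x))
    = of_real (sin (q t + W t) * (1 + \<mu> * f t) - sin (q t) - \<alpha> * psi x t)"
    unfolding residual_def residual_term_def trig_real reals(2,4) sin_of_real cos_of_real sin_add
    by (simp add: algebra_simps)
  with has_vector_derivative_Re[OF profile_velocity_deriv[of t]] show ?thesis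
    unfolding Wd_def[abs_def] by simp
qed

lemma Q_deriv: "(forced_separatrix x \<mu> f has_real_derivative 2 / cosh (t - x + \<sigma>) + Wd t) (at t)"
  unfolding Q_eq[abs_def] by (rule DERIV_add[OF q_deriv W_deriv])

lemma deriv_Q: "deriv (forced_separatrix x \<mu> f) = (\<lambda>t. 2 / cosh (t - x + \<sigma>) + Wd t)"
  using Q_deriv by (auto simp: fun_eq_iff intro: DERIV_imp_deriv)

lemma Q_deriv2: "(deriv (forced_separatrix x \<mu> f) has_real_derivative sin (forced_separatrix x \<mu> f t) * (1 + \<mu> * f t) - \<alpha> * psi x t) (at t)"
  unfolding deriv_Q using DERIV_add[OF q_deriv2 Wd_deriv, of t] by (simp add: Q_eq)

lemma W_bound: "\<bar>W t\<bar> \<le> R / half_exp t" "\<bar>W t\<bar> \<le> R"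
  using profile_sol_bound(1,2)[of t] by (simp_all add: reals(2))

lemma exp_tendsto: "((\<lambda>t. R / half_exp t) \<longlongrightarrow> 0) at_top" "((\<lambda>t. R / half_exp t) \<longlongrightarrow> 0) at_bot"
proof -
  have 1: "((\<lambda>t. R * exp (- (1/2 * t))) \<longlongrightarrow> 0) at_top"
    using tendsto_mult[OF tendsto_const exp_neg_tendsto_0[of "1/2"]] by simp
  have 2: "\<forall>\<^sub>F t in at_top. R * exp (- (1/2 * t)) = R / half_exp t"
    using eventually_ge_at_top[of "0::real"]
  proof eventually_elim
    case (elim t)
    have "R / half_exp t = R * (1 / half_exp t ^ 1)" by simp
    also have "\<dots> = R * exp (- (1/2 * t))" unfolding half_exp_pow[OF elim] by simp
    finally show ?case ..
  qed
  show t: "((\<lambda>t. R / half_exp t) \<longlongrightarrow> 0) at_top"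
    by (rule Lim_transform_eventually[OF 1 2])
  show "((\<lambda>t. R / half_exp t) \<longlongrightarrow> 0) at_bot"
    using t by (subst at_bot_mirror) (simp add: filterlim_filtermap half_exp_def)
qed

lemma Q_limits: "(forced_separatrix x \<mu> f \<longlongrightarrow> 0) at_bot" "(forced_separatrix x \<mu> f \<longlongrightarrow> 2 * pi) at_top"
proof -
  have W: "(W \<longlongrightarrow> 0) at_top" "(W \<longlongrightarrow> 0) at_bot"
    by (rule Lim_null_comparison[OF always_eventually exp_tendsto(1)], simp add: W_bound(1))
       (rule Lim_null_comparison[OF always_eventually exp_tendsto(2)], simp add: W_bound(1))
  note lin = translation_limits[of x \<sigma>]
  have "((\<lambda>t. arctan (exp (t - x + \<sigma>))) \<longlongrightarrow> pi / 2) at_top"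
    by (rule filterlim_compose[OF tendsto_arctan_at_top filterlim_compose[OF exp_at_top lin(1)]])
  from tendsto_mult[OF tendsto_const[of 4] this] have "(q \<longlongrightarrow> 4 * (pi / 2)) at_top"
    by (simp only: q_def[abs_def])
  from tendsto_add[OF this W(1)] show "(forced_separatrix x \<mu> f \<longlongrightarrow> 2 * pi) at_top" by (simp add: Q_eq[abs_def])
  have "((\<lambda>t. arctan (exp (t - x + \<sigma>))) \<longlongrightarrow> arctan 0) at_bot"
    by (rule tendsto_arctan[OF filterlim_compose[OF exp_at_bot lin(2)]])
  from tendsto_mult[OF tendsto_const[of 4] this] have "(q \<longlongrightarrow> 4 * arctan 0) at_bot"
    by (simp only: q_def[abs_def])
  from tendsto_add[OF this W(2)] show "(forced_separatrix x \<mu> f \<longlongrightarrow> 0) at_bot" by (simp add: Q_eq[abs_def])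
qed

lemma Q_near: "\<bar>forced_separatrix x \<mu> f t - q_sep x t\<bar> \<le> 2 * 10 ^ 7 * R"
proof -
  have "cmod (of_real (q t - q_sep x t)) \<le> 18 / cosh_size 1 t * cmod s"
    using csep_shift(2)[OF st.na, of t] by (simp add: trig_real)
  also have "\<dots> \<le> 18 / 1 * (10 ^ 6 * R)"
    using solution(6) cosh_size_bounds[of 1 t] by (intro mult_mono frac_le) auto
  finally have "\<bar>q t - q_sep x t\<bar> \<le> 18 * 10 ^ 6 * R" by (simp del: of_real_diff)
  thus ?thesis using W_bound(2)[of t] R_bounds(1) unfolding Q_eq by simp
qed

lemma Q_orthogonal: "(LINT t|lborel. (forced_separatrix x \<mu> f t - q_sep x t) * psi x t) = 0"
proof -
  have "(csep (complex_of_real t - of_real x + s) - csep (of_real t - of_real x) + w t) * cpsi (of_real t - of_real x)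
     = of_real ((forced_separatrix x \<mu> f t - q_sep x t) * psi x t)" for t
    unfolding trig_real reals(2) Q_eq by simp
  hence "shift_step (of_real x) s w = s - 5/4 * of_real (LINT t|lborel. (forced_separatrix x \<mu> f t - q_sep x t) * psi x t)"
    unfolding shift_step_def by (simp only: integral_complex_of_real)
  thus ?thesis using solution(3) by simp
qed

lemma exp_dominated_integrable_complex:
  assumes "continuous_on UNIV g" "\<And>t. cmod (g t) \<le> c * exp (- \<bar>t\<bar>)"
  shows "integrable lborel g"
proof (rule Bochner_Integration.integrable_bound)
  show "integrable lborel (\<lambda>t. c * exp (- \<bar>t\<bar>))" using exp_abs_integrable[of 1] by simp
  show "g \<in> borel_measurable lborel" using borel_measurable_continuous_onI[OF assms(1)] by simp
  show "AE t in lborel. norm (g t) \<le> norm (c * exp (- \<bar>t\<bar>))"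
    using assms(2) by (auto intro: order_trans[OF _ abs_ge_self])
qed

text \<open>
  The terms that \<open>action_integrand\<close> leaves out have the primitive \<open>4 tanh + q' w\<close>, which increases
  by \<open>8\<close> over the line.
\<close>

theorem action_real:
  "of_real (LINT t|lborel. (deriv (forced_separatrix x \<mu> f) t)\<^sup>2 / 2 + (1 - cos (forced_separatrix x \<mu> f t)) + \<mu> * (1 - cos (forced_separatrix x \<mu> f t)) * f t)
    = complex_action (of_real x) \<mu> (\<lambda>t. of_real (f t))"
proof -
  define L where "L t = (deriv (forced_separatrix x \<mu> f) t)\<^sup>2 / 2 + (1 - cos (forced_separatrix x \<mu> f t)) + \<mu> * (1 - cos (forced_separatrix x \<mu> f t)) * f t" for t
  define c where "c t = cosh (t - x + \<sigma>)" for t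
  define e where "e t = 4 / (c t)\<^sup>2 + (sin (q t) * W t + 2 / c t * Wd t)" for t
  define E where "E t = 4 * tanh (t - x + \<sigma>) + 2 / c t * W t" for t
  have c0: "c t > 0" for t by (simp add: c_def)
  have c1: "1 / c t \<le> 9 * exp (- \<bar>t\<bar>)" for t
  proof -
    have "cmod (1 / cosh (complex_of_real t - of_real x + s)) \<le> 9 / cosh_size 1 t"
      using trig_bounds(1)[OF st.na, of t] by simp
    thus ?thesis unfolding trig_real using c0[of t] by (simp add: norm_inverse c_def cosh_size_def exp_minus divide_inverse)
  qed
  have L_eq: "complex_of_real (L t) = action_integrand (of_real x) \<mu> (\<lambda>t. of_real (f t)) t + of_real (e t)" for t
  proof -
    have "action_integrand (of_real x) \<mu> (\<lambda>t. of_real (f t)) t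
      = of_real ((Wd t)\<^sup>2 / 2 + cos (q t) * (1 - cos (W t)) + sin (q t) * (sin (W t) - W t)
         + \<mu> * f t * (1 - cos (q t) * cos (W t) + sin (q t) * sin (W t)))"
      unfolding action_integrand_def Let_def trig_real reals(2,3) sin_of_real cos_of_real by simp
    moreover have "L t = (Wd t)\<^sup>2 / 2 + cos (q t) * (1 - cos (W t)) + sin (q t) * (sin (W t) - W t)
         + \<mu> * f t * (1 - cos (q t) * cos (W t) + sin (q t) * sin (W t)) + e t"
    proof -
      have cq: "cos (q t) = 1 - 2 * (1 / c t)\<^sup>2" unfolding q_def sin_cos_separatrix by (simp add: c_def power_divide)
      have e: "e t = 4 * (1 / c t)\<^sup>2 + sin (q t) * W t + 2 * (1 / c t) * Wd t" by (simp add: e_def power_divide)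
      have d: "deriv (forced_separatrix x \<mu> f) t = 2 * (1 / c t) + Wd t" by (simp add: deriv_Q c_def)
      have "(2 * u + v)\<^sup>2 / 2 + (1 - (C * cw - S * sw)) + m * (1 - (C * cw - S * sw)) * F
        = v\<^sup>2 / 2 + C * (1 - cw) + S * (sw - y) + m * F * (1 - C * cw + S * sw) + (4 * u\<^sup>2 + S * y + 2 * u * v)"
        if "C = 1 - 2 * u\<^sup>2" for u v C S cw sw m F y :: real
        unfolding that by (simp add: power2_eq_square algebra_simps add_divide_distrib)
      from this[OF cq] show ?thesis unfolding L_def d Q_eq cos_add e .
    qed
    ultimately show ?thesis by (simp only: of_real_add)
  qed
  have dE: "(E has_real_derivative e t) (at t)" for t
  proof -
    have "((\<lambda>t. tanh (t - x + \<sigma>)) has_real_derivative 1 / (c t)\<^sup>2) (at t)"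
    proof -
      have "((\<lambda>t. tanh (t - x + \<sigma>)) has_real_derivative 1 - (tanh (t - x + \<sigma>))\<^sup>2) (at t)"
        by (auto intro!: derivative_eq_intros)
      moreover have "1 - (tanh (t - x + \<sigma>))\<^sup>2 = 1 / (c t)\<^sup>2"
      proof -
        have "1 - (S / c t)\<^sup>2 = ((c t)\<^sup>2 - S\<^sup>2) / (c t)\<^sup>2" for S
          using c0[of t] by (simp add: power_divide diff_divide_distrib)
        from this[of "sinh (t - x + \<sigma>)"] show ?thesis
          using hyperbolic_pythagoras[of "t - x + \<sigma>"] by (simp add: tanh_def c_def)
      qed
      ultimately show ?thesis by simp
    qed
    from DERIV_add[OF DERIV_cmult[OF this, of 4] DERIV_mult[OF q_deriv2[of t] W_deriv[of t]]]
    show ?thesis unfolding E_def[abs_def] e_def c_def by (simp add: algebra_simps)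
  qed
  have ebd: "\<bar>e t\<bar> \<le> (324 + 500 * R + 18 * (2 * 10 ^ 7 * R)) * exp (- \<bar>t\<bar>)" for t
  proof -
    have 1: "\<bar>4 / (c t)\<^sup>2\<bar> \<le> 324 * exp (- \<bar>t\<bar>)"
    proof -
      have "(1 / c t)\<^sup>2 \<le> (9 * exp (- \<bar>t\<bar>))\<^sup>2" using c1[of t] c0[of t] by (intro power_mono) auto
      also have "\<dots> = 81 * (exp (- \<bar>t\<bar>) * exp (- \<bar>t\<bar>))" by (simp add: power2_eq_square)
      also have "\<dots> \<le> 81 * (exp (- \<bar>t\<bar>) * 1)" by (intro mult_left_mono) auto
      finally show ?thesis by (simp add: power_divide)
    qed
    have 2: "\<bar>sin (q t) * W t\<bar> \<le> 500 * R * exp (- \<bar>t\<bar>)"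
      using nonlinear_bounds(4)[of t] unfolding trig_real reals(2) by (simp flip: of_real_mult)
    have 3: "\<bar>2 / c t * Wd t\<bar> \<le> 18 * (2 * 10 ^ 7 * R) * exp (- \<bar>t\<bar>)"
    proof -
      have "\<bar>Wd t\<bar> \<le> 2 * 10 ^ 7 * R / half_exp t" using profile_velocity_bound[of t] by (simp add: reals(3))
      also have "\<dots> \<le> 2 * 10 ^ 7 * R / 1" using half_exp_ge1[of t] R_bounds(1) by (intro divide_left_mono) auto
      finally have "\<bar>2 / c t * Wd t\<bar> \<le> (18 * exp (- \<bar>t\<bar>)) * (2 * 10 ^ 7 * R)"
        unfolding abs_mult using c1[of t] c0[of t] by (intro mult_mono) auto
      thus ?thesis by (simp add: mult_ac)
    qed
    have "\<bar>e t\<bar> \<le> \<bar>4 / (c t)\<^sup>2\<bar> + (\<bar>sin (q t) * W t\<bar> + \<bar>2 / c t * Wd t\<bar>)"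
      unfolding e_def by (intro order_trans[OF abs_triangle_ineq] add_left_mono abs_triangle_ineq)
    thus ?thesis using 1 2 3 unfolding distrib_right by linarith
  qed
  have ec: "continuous_on UNIV (\<lambda>t. complex_of_real (e t))"
  proof -
    have "continuous_on UNIV q" "continuous_on UNIV W" "continuous_on UNIV Wd" "continuous_on UNIV c"
      by (rule DERIV_continuous_on[OF q_deriv], rule DERIV_continuous_on[OF W_deriv], rule DERIV_continuous_on[OF Wd_deriv])
         (auto simp: c_def[abs_def] intro!: continuous_intros)
    thus ?thesis unfolding e_def by (intro continuous_intros) (use c0 in \<open>auto simp: less_le\<close>)
  qed
  have ei: "integrable lborel (\<lambda>t. complex_of_real (e t))"
    by (rule exp_dominated_integrable_complex[OF ec]) (use ebd in auto)
  note lin = translation_limits[of x \<sigma>]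
  have cW: "\<bar>2 / c t * W t\<bar> \<le> 2 * (R / half_exp t)" for t
  proof -
    have "1 \<le> c t" by (simp add: c_def cosh_real_ge_1)
    hence "\<bar>2 / c t\<bar> \<le> 2" using c0[of t] by (simp add: divide_le_eq)
    thus ?thesis unfolding abs_mult using W_bound(1)[of t] by (intro mult_mono) auto
  qed
  have lim0: "((\<lambda>t. 2 / c t * W t) \<longlongrightarrow> 0) at_top" "((\<lambda>t. 2 / c t * W t) \<longlongrightarrow> 0) at_bot"
  proof -
    have z: "((\<lambda>t. 2 * (R / half_exp t)) \<longlongrightarrow> 2 * 0) at_top" "((\<lambda>t. 2 * (R / half_exp t)) \<longlongrightarrow> 2 * 0) at_bot"
      by (intro tendsto_mult tendsto_const exp_tendsto)+
    have n: "\<forall>t. norm (2 / c t * W t) \<le> 2 * (R / half_exp t)" using cW by (simp only: real_norm_def) blast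
    show "((\<lambda>t. 2 / c t * W t) \<longlongrightarrow> 0) at_top" "((\<lambda>t. 2 / c t * W t) \<longlongrightarrow> 0) at_bot"
      by (rule Lim_null_comparison[OF always_eventually[OF n]], use z in simp)+
  qed
  have "(E \<longlongrightarrow> 4 * 1 + 0) at_top" unfolding E_def[abs_def]
    by (intro tendsto_add tendsto_mult tendsto_const filterlim_compose[OF tanh_real_at_top lin(1)] lim0)
  hence E1: "((\<lambda>t. complex_of_real (E t)) \<longlongrightarrow> 4) at_top" using tendsto_of_real by fastforce
  have "(E \<longlongrightarrow> 4 * (- 1) + 0) at_bot" unfolding E_def[abs_def]
    by (intro tendsto_add tendsto_mult tendsto_const filterlim_compose[OF tanh_real_at_bot lin(2)] lim0)
  hence E2: "((\<lambda>t. complex_of_real (E t)) \<longlongrightarrow> - 4) at_bot" using tendsto_of_real by fastforce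
  have dEc: "((\<lambda>t. complex_of_real (E t)) has_vector_derivative of_real (e t)) (at t)" for t
    using dE[of t] unfolding has_real_derivative_iff_has_vector_derivative by (rule bounded_linear.has_vector_derivative[OF bounded_linear_of_real])
  have "(\<integral>t. complex_of_real (e t) \<partial>lborel) = 4 - (- 4)"
    by (rule integral_real_line_FTC[OF dEc ec ei E2 E1])
  moreover have "of_real (LINT t|lborel. L t) = (\<integral>t. complex_of_real (L t) \<partial>lborel)" by simp
  moreover have "(\<integral>t. complex_of_real (L t) \<partial>lborel) = (\<integral>t. action_integrand (of_real x) \<mu> (\<lambda>t. of_real (f t)) t \<partial>lborel) + (\<integral>t. complex_of_real (e t) \<partial>lborel)"
    unfolding L_eq by (rule Bochner_Integration.integral_add[OF action_integrand_integrable ei])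
  ultimately show ?thesis by (simp add: L_def[abs_def] complex_action_def)
qed

end

section \<open>Uniqueness of the perturbed separatrix\<close>

lemma sech_exp: "1 / cosh t \<le> 2 * exp (- \<bar>t::real\<bar>)"
  using cosh_exp_bounds(1)[of t] by (simp add: exp_minus field_simps)

lemma psi0_le_sech: "0 \<le> psi0 t" "psi0 t \<le> 1 / cosh t" "psi0 t \<le> 1"
proof -
  have c: "1 \<le> cosh t" by (rule cosh_real_ge_1)
  show "0 \<le> psi0 t" using c by (auto simp: psi0_def)
  have "(cosh t)\<^sup>2 / (1 + cosh t) ^ 3 \<le> (cosh t)\<^sup>2 / (cosh t) ^ 3"
    using c by (intro divide_left_mono power_mono) auto
  also have "\<dots> = 1 / cosh t" by (simp add: power2_eq_square power3_eq_cube)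
  finally show 1: "psi0 t \<le> 1 / cosh t" by (simp add: psi0_def)
  have "1 / cosh t \<le> 1" using c by simp
  thus "psi0 t \<le> 1" using 1 by linarith
qed

lemma continuous_on_psi0: "continuous_on A psi0"
proof -
  have "1 + cosh t \<noteq> 0" for t :: real using cosh_real_ge_1[of t] by linarith
  thus ?thesis unfolding psi0_def[abs_def] by (intro continuous_intros) auto
qed

lemma exp_dominated_integrable:
  fixes g :: "real \<Rightarrow> real"
  assumes "continuous_on UNIV g" "\<And>t. \<bar>g t\<bar> \<le> c * exp (- \<bar>t\<bar>)"
  shows "integrable lborel g" "\<bar>LINT t|lborel. g t\<bar> \<le> 2 * c"
proof -
  show i: "integrable lborel g"
  proof (rule Bochner_Integration.integrable_bound)
    show "integrable lborel (\<lambda>t. c * exp (- \<bar>t\<bar>))" using exp_abs_integrable[of 1] by simp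
    show "g \<in> borel_measurable lborel" using borel_measurable_continuous_onI[OF assms(1)] by simp
    show "AE t in lborel. norm (g t) \<le> norm (c * exp (- \<bar>t\<bar>))"
      using assms(2) by (auto intro: order_trans[OF _ abs_ge_self])
  qed
  have c0: "0 \<le> c" using assms(2)[of 0] by simp
  have "norm (LINT t|lborel. g t) \<le> (LINT t|lborel. c * exp (- \<bar>t\<bar>))"
    by (rule Bochner_Integration.integral_norm_bound_integral[OF i]) (use assms(2) exp_abs_integrable[of 1] in auto)
  also have "\<dots> = c * (LINT t|lborel. exp (- \<bar>t\<bar>))" by simp
  also have "\<dots> \<le> c * 2" by (intro mult_left_mono exp_abs_integral c0)
  finally show "\<bar>LINT t|lborel. g t\<bar> \<le> 2 * c" by simp
qed

lemma sech_psi0_integral: "(LINT t|lborel. psi0 t / cosh t) = 2 / 5"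
proof -
  have "near_axis 0 0" by (simp add: near_axis_def)
  from pairing_zero[OF this] have "(\<integral>t. complex_of_real (psi0 t / cosh t) \<partial>lborel) = 2 / 5"
    unfolding pairing_def by (simp add: of_real_trig)
  from this[unfolded integral_complex_of_real]
  have "complex_of_real (LINT t|lborel. psi0 t / cosh t) = of_real (2 / 5)" by simp
  thus ?thesis unfolding of_real_eq_iff .
qed

text \<open>
  The mean value of \<open>v'\<close> over a unit interval is at most \<open>2 B\<close>, and \<open>v'\<close> varies by at most \<open>C\<close> on
  it.
\<close>

lemma derivative_bounded:
  fixes v v' v'' :: "real \<Rightarrow> real"
  assumes dv: "\<And>t. (v has_real_derivative v' t) (at t)" and dv': "\<And>t. (v' has_real_derivative v'' t) (at t)"
    and B: "\<And>t. \<bar>v t\<bar> \<le> B" and C: "\<And>t. \<bar>v'' t\<bar> \<le> C"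
  shows "\<bar>v' t\<bar> \<le> 2 * B + C"
proof -
  obtain z where z: "t < z" "z < t + 1" "v (t + 1) - v t = (t + 1 - t) * v' z"
    using MVT2[of t "t + 1" v v'] dv by auto
  obtain y where y: "v' z - v' t = (z - t) * v'' y"
    using MVT2[of t z v' v''] dv' z by auto
  have "\<bar>(z - t) * v'' y\<bar> \<le> 1 * C" unfolding abs_mult using z C by (intro mult_mono) auto
  thus ?thesis using y z(3) B[of t] B[of "t + 1"] by auto
qed

lemma sech_tendsto: "((\<lambda>t::real. 1 / cosh t) \<longlongrightarrow> 0) at_top" "((\<lambda>t::real. 1 / cosh t) \<longlongrightarrow> 0) at_bot"
  using tendsto_inverse_0_at_top[OF cosh_real_at_top] tendsto_inverse_0_at_top[OF cosh_real_at_bot]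
  by (simp_all add: divide_inverse)

lemma decay_from_derivative:
  fixes y y' :: "real \<Rightarrow> real"
  assumes dy: "\<And>t. (y has_real_derivative y' t) (at t)" and b: "\<And>t. \<bar>y' t\<bar> \<le> K * exp (- \<bar>t\<bar>)"
    and lim: "(y \<longlongrightarrow> 0) at_top" and t: "t \<ge> 0"
  shows "\<bar>y t\<bar> \<le> K * exp (- t)"
proof -
  have main: "\<epsilon> * y t \<le> K * exp (- t)" if e: "\<bar>\<epsilon>\<bar> = 1" for \<epsilon>
  proof -
    define F where "F r = \<epsilon> * y r - K * exp (- r)" for r
    have dF: "(F has_real_derivative (\<epsilon> * y' r + K * exp (- r))) (at r)" for r
      unfolding F_def by (auto intro!: derivative_eq_intros dy)
    have up: "F t \<le> F r" if "t \<le> r" for r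
    proof (rule DERIV_nonneg_imp_nondecreasing[OF that])
      fix a assume "t \<le> a" "a \<le> r"
      have "\<bar>\<epsilon> * y' a\<bar> \<le> K * exp (- a)" unfolding abs_mult e using b[of a] \<open>t \<le> a\<close> t by simp
      hence "0 \<le> \<epsilon> * y' a + K * exp (- a)" by linarith
      thus "\<exists>d. (F has_real_derivative d) (at a) \<and> 0 \<le> d" using dF by blast
    qed
    have "((\<lambda>r. \<epsilon> * y r - K * exp (- (1 * r))) \<longlongrightarrow> \<epsilon> * 0 - K * 0) at_top"
      by (intro tendsto_diff tendsto_mult tendsto_const lim exp_neg_tendsto_0) simp
    hence "(F \<longlongrightarrow> 0) at_top" by (simp add: F_def[abs_def])
    moreover have "\<forall>\<^sub>F r in at_top. F t \<le> F r" using eventually_ge_at_top[of t] by eventually_elim (rule up)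
    ultimately have "F t \<le> 0" by (intro tendsto_lowerbound) auto
    thus ?thesis by (simp add: F_def)
  qed
  show ?thesis using main[of 1] main[of "-1"] by auto
qed

text \<open>
  With \<open>u = 1 / cosh\<close>, a solution of the homogeneous equation, the Wronskian \<open>y = u v' - u' v\<close>
  satisfies \<open>y' = u (e - a \<psi>)\<close>. Integrating this over the line determines \<open>a\<close>; a further
  integration, of \<open>(v / u)' = y / u\<^sup>2\<close>, determines \<open>v\<close> up to a multiple of \<open>u\<close>, and the
  orthogonality condition fixes the multiple.
\<close>

lemma linearized_bound:
  fixes v v' e :: "real \<Rightarrow> real"
  assumes dv: "\<And>t. (v has_real_derivative v' t) (at t)"
    and dv': "\<And>t. (v' has_real_derivative (1 - 2 / (cosh t)\<^sup>2) * v t + e t - a * psi0 t) (at t)"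
    and ec: "continuous_on UNIV e" and eb: "\<And>t. \<bar>e t\<bar> \<le> N" and B: "\<And>t. \<bar>v t\<bar> \<le> B"
    and orth: "(LINT t|lborel. v t * psi0 t) = 0"
  shows "\<bar>a\<bar> \<le> 10 * N" "\<bar>v t\<bar> \<le> 500 * N"
proof -
  define u where "u t = 1 / cosh t" for t :: real
  define u' where "u' t = - sinh t / (cosh t)\<^sup>2" for t :: real
  define y where "y t = u t * v' t - u' t * v t" for t
  have u: "0 < u t" "u t \<le> 1" "u t \<le> 2 * exp (- \<bar>t\<bar>)" for t
    using sech_exp[of t] cosh_real_ge_1[of t] by (auto simp: u_def)
  have N0: "0 \<le> N" using eb[of 0] by linarith
  have du: "(u has_real_derivative u' t) (at t)" for t
    unfolding u_def u'_def by (auto intro!: derivative_eq_intros simp: power2_eq_square)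
  have du': "(u' has_real_derivative (1 - 2 / (cosh t)\<^sup>2) * u t) (at t)" for t
  proof -
    have "(u' has_real_derivative (- cosh t * (cosh t)\<^sup>2 - (- sinh t) * (2 * cosh t * sinh t)) / ((cosh t)\<^sup>2 * (cosh t)\<^sup>2)) (at t)"
      unfolding u'_def by (auto intro!: derivative_eq_intros simp: power2_eq_square) (simp add: minus_divide_left mult_ac)
    moreover have "- cosh t * (cosh t)\<^sup>2 - (- sinh t) * (2 * cosh t * sinh t) = cosh t * ((cosh t)\<^sup>2 - 2)"
      using sinh_square_eq[of t] by algebra
    moreover have "cosh t * ((cosh t)\<^sup>2 - 2) / ((cosh t)\<^sup>2 * (cosh t)\<^sup>2) = (1 - 2 / (cosh t)\<^sup>2) * u t"
      unfolding u_def by (simp add: diff_divide_distrib power2_eq_square algebra_simps)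
    ultimately show ?thesis by simp
  qed
  have dy: "(y has_real_derivative u t * (e t - a * psi0 t)) (at t)" for t
  proof -
    have "(y has_real_derivative (u t * ((1 - 2 / (cosh t)\<^sup>2) * v t + e t - a * psi0 t) + u' t * v' t)
        - (u' t * v' t + (1 - 2 / (cosh t)\<^sup>2) * u t * v t)) (at t)"
      unfolding y_def by (intro DERIV_diff DERIV_mult' du du' dv dv')
    thus ?thesis by (simp add: algebra_simps)
  qed
  have vc: "continuous_on UNIV v" using dv by (intro DERIV_continuous_on) auto
  have uc: "continuous_on UNIV u" using du by (intro DERIV_continuous_on) auto
  have u'u: "\<bar>u' t\<bar> \<le> u t" for t
  proof -
    have "\<bar>sinh t\<bar> \<le> cosh t" using sinh_le_cosh_real[of "\<bar>t\<bar>"] by simp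
    hence "\<bar>sinh t\<bar> / (cosh t)\<^sup>2 \<le> cosh t / (cosh t)\<^sup>2" by (intro divide_right_mono) auto
    thus ?thesis by (simp add: u'_def u_def power2_eq_square abs_mult)
  qed
  have cq: "\<bar>1 - 2 / (cosh t)\<^sup>2\<bar> \<le> 1" for t :: real
  proof -
    have "1 \<le> (cosh t)\<^sup>2" by (simp add: cosh_square_eq)
    hence "2 / (cosh t)\<^sup>2 \<le> 2 / 1" by (intro divide_left_mono) auto
    moreover have "0 \<le> 2 / (cosh t)\<^sup>2" by simp
    ultimately show ?thesis by linarith
  qed
  have v'b: "\<bar>v' t\<bar> \<le> 2 * B + (B + N + \<bar>a\<bar>)" for t
  proof (rule derivative_bounded[OF dv dv' B])
    fix t
    have "\<bar>(1 - 2 / (cosh t)\<^sup>2) * v t\<bar> \<le> 1 * B" unfolding abs_mult using cq B by (intro mult_mono) auto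
    moreover have "\<bar>a * psi0 t\<bar> \<le> \<bar>a\<bar> * 1" unfolding abs_mult using psi0_le_sech[of t] by (intro mult_left_mono) auto
    ultimately show "\<bar>(1 - 2 / (cosh t)\<^sup>2) * v t + e t - a * psi0 t\<bar> \<le> B + N + \<bar>a\<bar>" using eb[of t] by linarith
  qed
  define Y where "Y = 2 * B + (B + N + \<bar>a\<bar>) + B"
  have yb: "\<bar>y t\<bar> \<le> Y * u t" for t
  proof -
    have "\<bar>u t * v' t\<bar> \<le> u t * (2 * B + (B + N + \<bar>a\<bar>))" unfolding abs_mult using v'b[of t] u[of t] by (intro mult_mono) auto
    moreover have "\<bar>u' t * v t\<bar> \<le> u t * B" unfolding abs_mult using u'u[of t] B[of t] u[of t] by (intro mult_mono) auto
    ultimately have "\<bar>y t\<bar> \<le> u t * (2 * B + (B + N + \<bar>a\<bar>)) + u t * B" unfolding y_def by linarith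
    thus ?thesis by (simp add: Y_def algebra_simps)
  qed
  have ylim: "(y \<longlongrightarrow> 0) at_top" "(y \<longlongrightarrow> 0) at_bot"
  proof -
    have n: "\<forall>t. norm (y t) \<le> Y * u t" using yb by simp
    have z: "((\<lambda>t. Y * u t) \<longlongrightarrow> Y * 0) at_top" "((\<lambda>t. Y * u t) \<longlongrightarrow> Y * 0) at_bot"
      unfolding u_def by (intro tendsto_mult tendsto_const sech_tendsto)+
    show "(y \<longlongrightarrow> 0) at_top" "(y \<longlongrightarrow> 0) at_bot"
      by (rule Lim_null_comparison[OF always_eventually[OF n]], use z in simp)+
  qed
  have ue: "continuous_on UNIV (\<lambda>t. u t * e t)" "\<bar>u t * e t\<bar> \<le> (2 * N) * exp (- \<bar>t\<bar>)" for t
  proof -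
    show "continuous_on UNIV (\<lambda>t. u t * e t)" by (intro continuous_intros uc ec)
    have "\<bar>u t * e t\<bar> \<le> (2 * exp (- \<bar>t\<bar>)) * N" unfolding abs_mult using u[of t] eb[of t] by (intro mult_mono) auto
    thus "\<bar>u t * e t\<bar> \<le> (2 * N) * exp (- \<bar>t\<bar>)" by (simp add: mult_ac)
  qed
  have up: "continuous_on UNIV (\<lambda>t. psi0 t / cosh t)" "\<bar>psi0 t / cosh t\<bar> \<le> 2 * exp (- \<bar>t\<bar>)" for t
  proof -
    show "continuous_on UNIV (\<lambda>t. psi0 t / cosh t)" by (intro continuous_intros continuous_on_psi0) auto
    have "\<bar>psi0 t * u t\<bar> \<le> 1 * (2 * exp (- \<bar>t\<bar>))" unfolding abs_mult using psi0_le_sech[of t] u[of t] by (intro mult_mono) auto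
    thus "\<bar>psi0 t / cosh t\<bar> \<le> 2 * exp (- \<bar>t\<bar>)" by (simp add: u_def)
  qed
  note ei = exp_dominated_integrable[OF ue] and pi = exp_dominated_integrable[OF up]
  have split: "u t * (e t - a * psi0 t) = u t * e t - a * (psi0 t / cosh t)" for t by (simp add: u_def algebra_simps)
  have "(LINT t|lborel. u t * (e t - a * psi0 t)) = 0 - 0"
  proof (rule integral_real_line_FTC[where K = y])
    show "(y has_vector_derivative u t * (e t - a * psi0 t)) (at t)" for t
      using dy by (simp add: has_real_derivative_iff_has_vector_derivative)
    show "continuous_on UNIV (\<lambda>t. u t * (e t - a * psi0 t))"
      by (intro continuous_intros uc ec continuous_on_psi0)
    show "integrable lborel (\<lambda>t. u t * (e t - a * psi0 t))"
      unfolding split using ei(1) pi(1) by (intro Bochner_Integration.integrable_diff integrable_mult_right)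
  qed (rule ylim)+
  hence "(LINT t|lborel. u t * e t) = a * (2 / 5)"
    unfolding split using Bochner_Integration.integral_diff[OF ei(1) integrable_mult_right[OF pi(1), of a]] sech_psi0_integral
    by (simp only: integral_mult_right_zero diff_0_right) 
  thus a: "\<bar>a\<bar> \<le> 10 * N" using ei(2) by (simp add: abs_mult)
  have y'b: "\<bar>u t * (e t - a * psi0 t)\<bar> \<le> 22 * N * exp (- \<bar>t\<bar>)" for t
  proof -
    have "\<bar>a * psi0 t\<bar> \<le> (10 * N) * 1" unfolding abs_mult using a psi0_le_sech[of t] by (intro mult_mono) auto
    hence "\<bar>e t - a * psi0 t\<bar> \<le> 11 * N" using eb[of t] by linarith
    hence "\<bar>u t * (e t - a * psi0 t)\<bar> \<le> (2 * exp (- \<bar>t\<bar>)) * (11 * N)"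
      unfolding abs_mult using u[of t] by (intro mult_mono) auto
    thus ?thesis by (simp add: mult_ac)
  qed
  have ydec: "\<bar>y t\<bar> \<le> 22 * N * exp (- \<bar>t\<bar>)" for t
  proof (cases "t \<ge> 0")
    case True
    thus ?thesis using decay_from_derivative[OF dy y'b ylim(1)] by simp
  next
    case False
    have "\<bar>y (- (- t))\<bar> \<le> 22 * N * exp (- (- t))"
    proof (rule decay_from_derivative[where y = "\<lambda>t. y (- t)" and y' = "\<lambda>t. - (u (- t) * (e (- t) - a * psi0 (- t)))"])
      fix r :: real
      show "((\<lambda>t. y (- t)) has_real_derivative - (u (- r) * (e (- r) - a * psi0 (- r)))) (at r)"
        by (rule iffD1[OF DERIV_mirror dy])
      show "\<bar>- (u (- r) * (e (- r) - a * psi0 (- r)))\<bar> \<le> 22 * N * exp (- \<bar>r\<bar>)" using y'b[of "- r"] by simp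
      show "((\<lambda>t. y (- t)) \<longlongrightarrow> 0) at_top" using ylim(2) by (simp add: at_bot_mirror filterlim_filtermap)
    qed (use False in simp)
    thus ?thesis using False by simp
  qed
  define z where "z t = v t * cosh t" for t
  have dz: "(z has_real_derivative y t * (cosh t)\<^sup>2) (at t)" for t
  proof -
    have "(z has_real_derivative v t * sinh t + v' t * cosh t) (at t)"
      unfolding z_def by (auto intro!: derivative_eq_intros dv)
    moreover have "v t * sinh t + v' t * cosh t = y t * (cosh t)\<^sup>2"
      by (simp add: y_def u_def u'_def power2_eq_square algebra_simps)
    ultimately show ?thesis by simp
  qed
  have zb: "\<bar>y t * (cosh t)\<^sup>2\<bar> \<le> 22 * N * exp \<bar>t\<bar>" for t
  proof -
    have "(cosh t)\<^sup>2 \<le> (exp \<bar>t\<bar>)\<^sup>2" using cosh_exp_bounds(2)[of t] by (intro power_mono) auto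
    hence "\<bar>y t\<bar> * (cosh t)\<^sup>2 \<le> (22 * N * exp (- \<bar>t\<bar>)) * (exp \<bar>t\<bar>)\<^sup>2" using ydec[of t] N0 by (intro mult_mono) auto
    also have "\<dots> = 22 * N * (exp (- \<bar>t\<bar>) * exp \<bar>t\<bar>) * exp \<bar>t\<bar>" by (simp only: power2_eq_square mult.assoc)
    also have "exp (- \<bar>t\<bar>) * exp \<bar>t\<bar> = 1" by (simp flip: exp_add)
    finally show ?thesis by (simp add: abs_mult)
  qed
  have zd: "\<bar>z t - z 0\<bar> \<le> 22 * N * exp \<bar>t\<bar>" for t
  proof -
    have "\<bar>z t - z 0\<bar> \<le> 22 * N * exp \<bar>t\<bar>" if dz: "\<And>t. (z has_real_derivative z' t) (at t)" and zb: "\<And>t. \<bar>z' t\<bar> \<le> 22 * N * exp \<bar>t\<bar>" and t: "t \<ge> 0" for z z' :: "real \<Rightarrow> real" and t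
    proof -
      have "22 * N * exp 0 - \<epsilon> * z 0 \<le> 22 * N * exp t - \<epsilon> * z t" if "\<bar>\<epsilon>\<bar> = 1" for \<epsilon>
      proof (rule DERIV_nonneg_imp_nondecreasing[OF t])
        fix r :: real assume "0 \<le> r"
        have "((\<lambda>t. 22 * N * exp t - \<epsilon> * z t) has_real_derivative 22 * N * exp r - \<epsilon> * z' r) (at r)"
          by (auto intro!: derivative_eq_intros dz)
        moreover have "\<bar>\<epsilon> * z' r\<bar> \<le> 22 * N * exp r" unfolding abs_mult that using zb[of r] \<open>0 \<le> r\<close> by simp
        hence "0 \<le> 22 * N * exp r - \<epsilon> * z' r" by linarith
        ultimately show "\<exists>d. ((\<lambda>t. 22 * N * exp t - \<epsilon> * z t) has_real_derivative d) (at r) \<and> 0 \<le> d" by blast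
      qed
      from this[of 1] this[of "-1"] show ?thesis using N0 t by simp
    qed
    note * = this
    show ?thesis
    proof (cases "t \<ge> 0")
      case True
      thus ?thesis using *[OF dz zb] by simp
    next
      case False
      have "\<bar>z (- (- t)) - z (- 0)\<bar> \<le> 22 * N * exp \<bar>- t\<bar>"
      proof (rule *[where z = "\<lambda>t. z (- t)" and z' = "\<lambda>t. - (y (- t) * (cosh (- t))\<^sup>2)"])
        fix r :: real
        show "((\<lambda>t. z (- t)) has_real_derivative - (y (- r) * (cosh (- r))\<^sup>2)) (at r)"
          by (rule iffD1[OF DERIV_mirror dz])
        show "\<bar>- (y (- r) * (cosh (- r))\<^sup>2)\<bar> \<le> 22 * N * exp \<bar>r\<bar>" using zb[of "- r"] by simp
      qed (use False in simp)
      thus ?thesis by simp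
    qed
  qed
  have vd: "\<bar>v t - v 0 * u t\<bar> \<le> 44 * N" for t
  proof -
    have "v t - v 0 * u t = (z t - z 0) * u t" by (simp add: z_def u_def left_diff_distrib diff_divide_distrib)
    also have "\<bar>\<dots>\<bar> \<le> (22 * N * exp \<bar>t\<bar>) * (2 * exp (- \<bar>t\<bar>))"
      unfolding abs_mult using zd[of t] u[of t] N0 by (intro mult_mono) auto
    also have "\<dots> = 44 * N" by (simp add: exp_minus)
    finally show ?thesis .
  qed
  define d where "d t = (v t - v 0 * u t) * psi0 t" for t
  have dc: "continuous_on UNIV d" unfolding d_def by (intro continuous_intros vc uc continuous_on_psi0)
  have db: "\<bar>d t\<bar> \<le> (88 * N) * exp (- \<bar>t\<bar>)" for t
  proof -
    have "\<bar>d t\<bar> \<le> (44 * N) * (2 * exp (- \<bar>t\<bar>))"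
      unfolding d_def abs_mult using vd[of t] psi0_le_sech[of t] u(3)[of t] N0 by (intro mult_mono) (auto simp: u_def)
    thus ?thesis by simp
  qed
  note di = exp_dominated_integrable[OF dc db]
  have "v t * psi0 t = d t + v 0 * (psi0 t / cosh t)" for t by (simp add: d_def u_def algebra_simps)
  hence "0 = (LINT t|lborel. d t) + v 0 * (2 / 5)"
    using orth Bochner_Integration.integral_add[OF di(1) integrable_mult_right[OF pi(1), of "v 0"]] sech_psi0_integral
    by (simp only: integral_mult_right_zero)
  hence "\<bar>v 0\<bar> * (2 / 5) = \<bar>LINT t|lborel. d t\<bar>" by (simp add: abs_if)
  hence v0: "\<bar>v 0\<bar> \<le> 440 * N" using di(2) by simp
  have "\<bar>v 0 * u t\<bar> \<le> (440 * N) * 1" unfolding abs_mult using v0 u[of t] by (intro mult_mono) auto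
  thus "\<bar>v t\<bar> \<le> 500 * N" using vd[of t] N0 by linarith
qed

text \<open>
  The difference \<open>v\<close> of two solutions satisfies the linearised equation with an error of at most
  \<open>(r + \<mu> M) |v|\<close>, so \<open>linearized_bound\<close> gives \<open>sup |v| \<le> 1/2 sup |v|\<close>.
\<close>

theorem perturbed_separatrix_unique:
  fixes f :: "real \<times> (real ^ 'm) \<Rightarrow> real"
  assumes p1: "perturbed_separatrix r f \<omega> \<mu> A 0 (Q1, \<alpha>1)" and p2: "perturbed_separatrix r f \<omega> \<mu> A 0 (Q2, \<alpha>2)"
    and segment_fourier: "continuous_on UNIV f" and fM: "\<And>x. \<bar>f x\<bar> \<le> M" and \<mu>: "0 \<le> \<mu>" and small: "r + \<mu> * M \<le> 1 / 1000"
  shows "Q1 = Q2 \<and> \<alpha>1 = \<alpha>2"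
proof -
  define F where "F t = f (t *\<^sub>R \<omega> + A)" for t
  have Fc: "continuous_on UNIV F" unfolding F_def
    by (rule continuous_on_compose2[OF segment_fourier]) (auto intro!: continuous_intros)
  have sep: "(Q has_real_derivative deriv Q t) (at t)"
    "(deriv Q has_real_derivative sin (Q t) * (1 + \<mu> * F t) - \<alpha> * psi0 t) (at t)"
    "\<bar>Q t - q_sep 0 t\<bar> \<le> r" "(LINT t|lborel. (Q t - q_sep 0 t) * psi0 t) = 0"
    if "perturbed_separatrix r f \<omega> \<mu> A 0 (Q, \<alpha>)" for Q \<alpha> t
  proof -
    note p = that[unfolded perturbed_separatrix_def prod.case, folded F_def]
    have eq: "- deriv (deriv Q) t + sin (Q t) = - \<mu> * sin (Q t) * F t + \<alpha> * psi 0 t" using p by blast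
    show "(Q has_real_derivative deriv Q t) (at t)" using p by (simp add: DERIV_deriv_iff_field_differentiable)
    have "(deriv Q has_real_derivative deriv (deriv Q) t) (at t)" using p by (simp add: DERIV_deriv_iff_field_differentiable)
    moreover have "deriv (deriv Q) t = sin (Q t) * (1 + \<mu> * F t) - \<alpha> * psi0 t" using eq by (simp add: psi_def algebra_simps)
    ultimately show "(deriv Q has_real_derivative sin (Q t) * (1 + \<mu> * F t) - \<alpha> * psi0 t) (at t)" by simp
    show "\<bar>Q t - q_sep 0 t\<bar> \<le> r" "(LINT t|lborel. (Q t - q_sep 0 t) * psi0 t) = 0" using p by (auto simp: psi_def)
  qed
  note s1 = sep[OF p1] and s2 = sep[OF p2]
  define v where "v t = Q1 t - Q2 t" for t
  define e where "e t = (sin (Q1 t) - sin (Q2 t)) * (1 + \<mu> * F t) - (1 - 2 / (cosh t)\<^sup>2) * v t" for t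
  define B where "B = (SUP t. \<bar>v t\<bar>)"
  have vb: "\<bar>v t\<bar> \<le> 2 * r" for t using s1(3)[of t] s2(3)[of t] by (simp add: v_def)
  have bdd: "bdd_above (range (\<lambda>t. \<bar>v t\<bar>))" using vb by (auto intro!: bdd_aboveI)
  have vB: "\<bar>v t\<bar> \<le> B" for t unfolding B_def by (rule cSUP_upper[OF _ bdd]) simp
  have B0: "0 \<le> B" using vB[of 0] by linarith
  have r0: "0 \<le> r" using s1(3)[of 0] by linarith
  have Qc: "continuous_on UNIV Q1" "continuous_on UNIV Q2"
    using DERIV_continuous_on[of UNIV Q1] DERIV_continuous_on[of UNIV Q2] s1(1) s2(1) by auto
  have ec: "continuous_on UNIV e" unfolding e_def v_def by (intro continuous_intros Fc Qc) auto
  have eb: "\<bar>e t\<bar> \<le> 1 / 1000 * B" for t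
  proof -
    define qt where "qt = q_sep 0 t"
    have cq: "1 - 2 / (cosh t)\<^sup>2 = cos qt" by (simp add: qt_def q_sep_def sin_cos_separatrix)
    have 1: "\<bar>(sin (Q1 t) - cos qt * Q1 t) - (sin (Q2 t) - cos qt * Q2 t)\<bar> \<le> r * \<bar>Q1 t - Q2 t\<bar>"
    proof -
      have "norm ((sin (Q1 t) - cos qt * Q1 t) - (sin (Q2 t) - cos qt * Q2 t)) \<le> r * norm (Q1 t - Q2 t)"
      proof (rule field_differentiable_bound[of "cball qt r" "\<lambda>x. sin x - cos qt * x" "\<lambda>x. cos x - cos qt"])
        show "((\<lambda>x. sin x - cos qt * x) has_field_derivative cos x - cos qt) (at x within cball qt r)" for x
          by (auto intro!: derivative_eq_intros)
        show "norm (cos x - cos qt) \<le> r" if "x \<in> cball qt r" for x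
        proof -
          have "norm (cos x - cos qt) \<le> 1 * norm (x - qt)"
            by (rule field_differentiable_bound[of UNIV cos "\<lambda>x. - sin x"]) (auto intro!: derivative_eq_intros)
          thus ?thesis using that by (simp add: dist_real_def abs_minus_commute)
        qed
        show "Q1 t \<in> cball qt r" "Q2 t \<in> cball qt r"
          using s1(3)[of t] s2(3)[of t] by (auto simp: qt_def dist_real_def abs_minus_commute)
      qed auto
      thus ?thesis by simp
    qed
    have 2: "\<bar>\<mu> * F t * (sin (Q1 t) - sin (Q2 t))\<bar> \<le> \<mu> * M * \<bar>Q1 t - Q2 t\<bar>"
    proof -
      have "norm (sin (Q1 t) - sin (Q2 t)) \<le> 1 * norm (Q1 t - Q2 t)"
        by (rule field_differentiable_bound[of UNIV sin cos]) (auto intro!: derivative_eq_intros)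
      thus ?thesis unfolding abs_mult using \<mu> fM[of "t *\<^sub>R \<omega> + A"]
        by (intro mult_mono mult_left_mono) (auto simp: F_def)
    qed
    have "e t = ((sin (Q1 t) - cos qt * Q1 t) - (sin (Q2 t) - cos qt * Q2 t)) + \<mu> * F t * (sin (Q1 t) - sin (Q2 t))"
      unfolding e_def cq by (simp add: v_def algebra_simps)
    hence "\<bar>e t\<bar> \<le> (r + \<mu> * M) * \<bar>v t\<bar>" using 1 2 unfolding v_def distrib_right by linarith
    also have "\<dots> \<le> 1 / 1000 * B" using small vB[of t] by (intro mult_mono) auto
    finally show ?thesis .
  qed
  have dv: "(v has_real_derivative deriv Q1 t - deriv Q2 t) (at t)" for t
    unfolding v_def by (rule DERIV_diff[OF s1(1) s2(1)])
  have dv': "((\<lambda>t. deriv Q1 t - deriv Q2 t) has_real_derivative (1 - 2 / (cosh t)\<^sup>2) * v t + e t - (\<alpha>1 - \<alpha>2) * psi0 t) (at t)" for t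
    using DERIV_diff[OF s1(2)[of t] s2(2)[of t]] by (simp add: e_def algebra_simps)
  have csep: "continuous_on UNIV (q_sep 0)" unfolding q_sep_def[abs_def] by (intro continuous_intros)
  have integ: "integrable lborel (\<lambda>t. (Q t - q_sep 0 t) * psi0 t)" if "continuous_on UNIV Q" "\<And>t. \<bar>Q t - q_sep 0 t\<bar> \<le> r" for Q
  proof (rule exp_dominated_integrable(1))
    show "continuous_on UNIV (\<lambda>t. (Q t - q_sep 0 t) * psi0 t)" by (intro continuous_intros that(1) csep continuous_on_psi0)
    show "\<bar>(Q t - q_sep 0 t) * psi0 t\<bar> \<le> (r * 2) * exp (- \<bar>t\<bar>)" for t
    proof -
      have "\<bar>(Q t - q_sep 0 t) * psi0 t\<bar> \<le> r * (2 * exp (- \<bar>t\<bar>))"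
        unfolding abs_mult using that(2)[of t] psi0_le_sech[of t] sech_exp[of t] by (intro mult_mono) auto
      thus ?thesis by simp
    qed
  qed
  have "(LINT t|lborel. v t * psi0 t) = (LINT t|lborel. (Q1 t - q_sep 0 t) * psi0 t - (Q2 t - q_sep 0 t) * psi0 t)"
    by (simp add: v_def left_diff_distrib)
  also have "\<dots> = 0"
    using Bochner_Integration.integral_diff[OF integ[OF Qc(1) s1(3)] integ[OF Qc(2) s2(3)]] s1(4) s2(4) by simp
  finally have orth: "(LINT t|lborel. v t * psi0 t) = 0" .
  note LB = linearized_bound[OF dv dv' ec eb vB orth]
  have "B \<le> 500 * (1 / 1000 * B)" unfolding B_def by (rule cSUP_least) (use LB(2) in \<open>auto simp: B_def\<close>)
  hence "B = 0" using B0 by linarith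
  hence "v t = 0" for t using vB[of t] by simp
  moreover have "\<alpha>1 = \<alpha>2" using LB(1) \<open>B = 0\<close> by simp
  ultimately show ?thesis by (auto simp: v_def fun_eq_iff)
qed

section \<open>Fourier coefficients of holomorphic functions on a strip\<close>

text \<open>
  If \<open>K\<close> is a primitive of \<open>k\<close>, the integral at height \<open>y\<close> is \<open>K (\<pi> + i y) - K (- \<pi> + i y)\<close>, whose
  derivative in \<open>y\<close> vanishes by periodicity. The bound \<open>4\<close> is only a number beyond \<open>\<pi>\<close> that leaves
  room on both sides of one period.
\<close>

lemma integral_line_shift:
  fixes k :: "complex \<Rightarrow> complex"
  assumes hol: "k holomorphic_on {z. \<bar>Re z\<bar> < 4 \<and> \<bar>Im z\<bar> < S}"
    and per: "\<And>y. \<bar>y\<bar> < S \<Longrightarrow> k (Complex pi y) = k (Complex (- pi) y)" and y: "\<bar>y\<bar> < S"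
  shows "integral {-pi..pi} (\<lambda>x. k (Complex x y)) = integral {-pi..pi} (\<lambda>x. k (of_real x))"
    "(\<lambda>x. k (Complex x y)) integrable_on {-pi..pi}" "continuous_on {-pi..pi} (\<lambda>x. k (Complex x y))"
proof -
  define T where "T = {z :: complex. \<bar>Re z\<bar> < 4 \<and> \<bar>Im z\<bar> < S}"
  have T: "T = {z. -4 < Re z} \<inter> {z. Re z < 4} \<inter> ({z. -S < Im z} \<inter> {z. Im z < S})" by (auto simp: T_def)
  have opn: "open T" unfolding T by (intro open_Int open_halfspace_Re_gt open_halfspace_Re_lt open_halfspace_Im_gt open_halfspace_Im_lt)
  have cvx: "convex T" unfolding T by (intro convex_Int convex_halfspace_Re_gt convex_halfspace_Re_lt convex_halfspace_Im_gt convex_halfspace_Im_lt)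
  obtain K where K: "\<And>z. z \<in> T \<Longrightarrow> (K has_field_derivative k z) (at z)"
    using holomorphic_convex_primitive'[OF cvx opn, of k] hol unfolding T_def[symmetric]
    by (metis at_within_open opn)
  have pi4: "pi < 4" by (rule pi_less_4)
  have inT: "Complex x y \<in> T" if "x \<in> {-pi..pi}" "\<bar>y\<bar> < S" for x y using that pi4 by (auto simp: T_def)
  have hi: "((\<lambda>x. k (Complex x y)) has_integral K (Complex pi y) - K (Complex (- pi) y)) {-pi..pi}" if y: "\<bar>y\<bar> < S" for y
  proof (rule fundamental_theorem_of_calculus)
    fix x assume x: "x \<in> {-pi..pi}"
    have "((\<lambda>x. Complex x y) has_vector_derivative 1) (at x)"
    proof -
      have "((\<lambda>x. of_real x + \<i> * of_real y) has_vector_derivative 1) (at x)" by (auto intro!: derivative_eq_intros)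
      thus ?thesis by (simp add: Complex_eq)
    qed
    from field_vector_diff_chain_at[OF this K[OF inT[OF x y]]]
    show "((\<lambda>x. K (Complex x y)) has_vector_derivative k (Complex x y)) (at x within {-pi..pi})"
      by (simp add: o_def has_vector_derivative_at_within)
  qed simp
  define D where "D y = K (Complex pi y) - K (Complex (- pi) y)" for y
  have "D y = D 0"
  proof -
    have dD: "(D has_vector_derivative 0) (at y within {-S<..<S})" if y: "y \<in> {-S<..<S}" for y
    proof -
      have dC: "((\<lambda>y. Complex x y) has_vector_derivative \<i>) (at y)" for x
      proof -
        have "((\<lambda>y. of_real x + \<i> * of_real y) has_vector_derivative \<i>) (at y)" by (auto intro!: derivative_eq_intros)
        thus ?thesis by (simp add: Complex_eq)
      qed
      have "(D has_vector_derivative \<i> * k (Complex pi y) - \<i> * k (Complex (- pi) y)) (at y)"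
        unfolding D_def
        using field_vector_diff_chain_at[OF dC K[OF inT[of pi y]]] field_vector_diff_chain_at[OF dC K[OF inT[of "- pi" y]]] y
        by (intro has_vector_derivative_diff) (auto simp: o_def)
      thus ?thesis using per[of y] y by (auto simp: has_vector_derivative_at_within)
    qed
    obtain c where "\<And>y. y \<in> {-S<..<S} \<Longrightarrow> D y = c"
      by (rule has_vector_derivative_zero_constant[OF _ dD]) auto
    from this[of y] this[of 0] show ?thesis using y by (auto simp: abs_less_iff)
  qed
  moreover have "integral {-pi..pi} (\<lambda>x. k (Complex x y)) = D y" using integral_unique[OF hi[OF y]] by (simp add: D_def)
  moreover have "integral {-pi..pi} (\<lambda>x. k (Complex x 0)) = D 0" using integral_unique[OF hi[of 0]] y by (simp add: D_def)
  ultimately show "integral {-pi..pi} (\<lambda>x. k (Complex x y)) = integral {-pi..pi} (\<lambda>x. k (of_real x))"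
    by (simp add: complex_of_real_def)
  show "(\<lambda>x. k (Complex x y)) integrable_on {-pi..pi}" using hi[OF y] by blast
  have "continuous_on T k" using holomorphic_on_imp_continuous_on[OF hol] by (simp add: T_def)
  thus "continuous_on {-pi..pi} (\<lambda>x. k (Complex x y))"
    by (rule continuous_on_compose2) (use inT[OF _ y] in \<open>auto intro!: continuous_intros simp: Complex_eq\<close>)
qed

lemma exp_ii_integral: "integral {-pi..pi} (\<lambda>x. exp (\<i> * of_real x)) = 0" "integral {-pi..pi} (\<lambda>x. exp (- (\<i> * of_real x))) = 0"
proof -
  have "((\<lambda>x. exp (\<i> * of_real x)) has_integral (- \<i> * exp (\<i> * of_real pi)) - (- \<i> * exp (\<i> * of_real (- pi)))) {-pi..pi}"
    by (rule fundamental_theorem_of_calculus)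
       (auto intro!: derivative_eq_intros has_vector_derivative_real_field simp: mult.assoc)
  thus "integral {-pi..pi} (\<lambda>x. exp (\<i> * of_real x)) = 0"
    by (intro integral_unique) (simp add: exp_minus exp_pi_i')
  have "((\<lambda>x. exp (- (\<i> * of_real x))) has_integral (\<i> * exp (- (\<i> * of_real pi))) - (\<i> * exp (- (\<i> * of_real (- pi))))) {-pi..pi}"
    by (rule fundamental_theorem_of_calculus)
       (auto intro!: derivative_eq_intros has_vector_derivative_real_field simp: mult.assoc)
  thus "integral {-pi..pi} (\<lambda>x. exp (- (\<i> * of_real x))) = 0"
    by (intro integral_unique) (simp add: exp_minus exp_pi_i')
qed

definition segment_fourier :: "(complex \<Rightarrow> complex) \<Rightarrow> int \<Rightarrow> complex" where
  "segment_fourier g k = integral {-pi..pi} (\<lambda>x. g (of_real x) * exp (- (\<i> * of_int k * of_real x))) / (2 * pi)"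

text \<open>
  All harmonics of index at least two are treated at once. The quotient
  \<open>m z = (g z - g 0) / (1 - exp (- i z))\<close> is holomorphic and periodic, so it has the same integral
  at the heights \<open>\<sigma>\<close> and \<open>- \<sigma>\<close>. Expanding \<open>1 / (1 - exp (- i z))\<close> into a geometric series at each
  height, with two terms below and one above the axis, produces the coefficients of index \<open>0\<close>, \<open>1\<close>
  and \<open>-1\<close>; the tails of the series are of order \<open>exp (- 2 \<sigma>)\<close>.
\<close>

theorem fourier_strip_remainder:
  fixes g :: "complex \<Rightarrow> complex"
  assumes hol: "g holomorphic_on {z. \<bar>Re z\<bar> < 4 \<and> \<bar>Im z\<bar> < S}"
    and per: "\<And>y. \<bar>y\<bar> < S \<Longrightarrow> g (Complex pi y) = g (Complex (- pi) y)" and S: "1 \<le> \<sigma>" "\<sigma> < S"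
    and B: "\<And>x y. \<bar>x\<bar> \<le> pi \<Longrightarrow> \<bar>y\<bar> = \<sigma> \<Longrightarrow> cmod (g (Complex x y)) \<le> B"
  shows "cmod (segment_fourier g 1) \<le> exp (- \<sigma>) * B"
    "cmod (g 0 - segment_fourier g 0 - segment_fourier g 1 - segment_fourier g (- 1)) \<le> 4 * (B + cmod (g 0)) * exp (- 2 * \<sigma>)"
proof -
  define T where "T = {z :: complex. \<bar>Re z\<bar> < 4 \<and> \<bar>Im z\<bar> < S}"
  have T: "T = {z. -4 < Re z} \<inter> {z. Re z < 4} \<inter> ({z. -S < Im z} \<inter> {z. Im z < S})" by (auto simp: T_def)
  have opn: "open T" unfolding T by (intro open_Int open_halfspace_Re_gt open_halfspace_Re_lt open_halfspace_Im_gt open_halfspace_Im_lt)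
  have holT: "g holomorphic_on T" using hol by (simp add: T_def)
  have eper: "exp (\<i> * Complex pi y) = exp (\<i> * Complex (- pi) y)" "exp (- (\<i> * Complex pi y)) = exp (- (\<i> * Complex (- pi) y))" for y
  proof -
    have "Complex pi y = Complex (- pi) y + 2 * of_real pi" by (simp add: complex_eq_iff)
    hence e: "\<i> * Complex pi y = \<i> * Complex (- pi) y + 2 * of_real pi * \<i>" by (simp add: distrib_left mult_ac)
    show "exp (\<i> * Complex pi y) = exp (\<i> * Complex (- pi) y)" unfolding e exp_add by simp
    thus "exp (- (\<i> * Complex pi y)) = exp (- (\<i> * Complex (- pi) y))" unfolding exp_minus by simp
  qed
  have s0: "\<bar>- \<sigma>\<bar> < S" "\<bar>\<sigma>\<bar> < S" using S by auto
  have ibd: "cmod (integral {-pi..pi} f) \<le> b * (2 * pi)" if "continuous_on {-pi..pi} f" "\<And>x. x \<in> {-pi..pi} \<Longrightarrow> cmod (f x) \<le> b" for f :: "real \<Rightarrow> complex" and b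
    using integral_bound[of "-pi" pi f b] that by simp
  define q where "q z = exp (- (\<i> * z))" for z
  define q' where "q' z = exp (\<i> * z)" for z
  have nq: "cmod (q (Complex x (- \<sigma>))) = exp (- \<sigma>)" "cmod (q' (Complex x \<sigma>)) = exp (- \<sigma>)" for x
    by (simp_all add: q_def q'_def norm_exp_eq_Re)
  have qhol: "q holomorphic_on A" "q' holomorphic_on A" for A unfolding q_def q'_def by (intro holomorphic_intros)+
  have qper: "q (Complex pi y) = q (Complex (- pi) y)" "q' (Complex pi y) = q' (Complex (- pi) y)" for y
    using eper by (auto simp: q_def q'_def)
  show "cmod (segment_fourier g 1) \<le> exp (- \<sigma>) * B"
  proof -
    have h: "(\<lambda>z. g z * q z) holomorphic_on {z. \<bar>Re z\<bar> < 4 \<and> \<bar>Im z\<bar> < S}" by (intro holomorphic_intros hol qhol)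
    note sh = integral_line_shift[OF h _ s0(1), simplified per qper]
    have 1: "integral {-pi..pi} (\<lambda>x. g (of_real x) * q (of_real x)) = integral {-pi..pi} (\<lambda>x. g (Complex x (- \<sigma>)) * q (Complex x (- \<sigma>)))"
      using sh(1) per qper by simp
    have "cmod (integral {-pi..pi} (\<lambda>x. g (Complex x (- \<sigma>)) * q (Complex x (- \<sigma>)))) \<le> (exp (- \<sigma>) * B) * (2 * pi)"
    proof (rule ibd)
      show "continuous_on {-pi..pi} (\<lambda>x. g (Complex x (- \<sigma>)) * q (Complex x (- \<sigma>)))" using sh(3) per qper by simp
      show "cmod (g (Complex x (- \<sigma>)) * q (Complex x (- \<sigma>))) \<le> exp (- \<sigma>) * B" if "x \<in> {-pi..pi}" for x
        using B[of x "- \<sigma>"] that S by (simp add: norm_mult nq mult.commute abs_le_iff)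
    qed
    thus ?thesis unfolding 1[symmetric] by (simp add: segment_fourier_def q_def norm_divide divide_le_eq)
  qed
  define G where "G z = g z - g 0" for z
  define E where "E z = 1 - q z" for z
  \<comment> \<open>\<open>m\<close> as a quotient of two difference quotients, which removes the singularity at \<open>0\<close>.\<close>
  define p where "p z = (if z = 0 then deriv g 0 else (g z - g 0) / (z - 0))" for z
  define e where "e z = (if z = 0 then deriv E 0 else (E z - E 0) / (z - 0))" for z
  have z0: "0 \<in> T" using S by (simp add: T_def)
  have ph: "p holomorphic_on T" unfolding p_def by (rule pole_lemma_open[OF holT opn])
  have Eh: "E holomorphic_on T" unfolding E_def by (intro holomorphic_intros qhol)
  have eh: "e holomorphic_on T" unfolding e_def by (rule pole_lemma_open[OF Eh opn])
  have E0: "E 0 = 0" by (simp add: E_def q_def)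
  have dE: "deriv E 0 = \<i>"
  proof (rule DERIV_imp_deriv)
    show "(E has_field_derivative \<i>) (at 0)" unfolding E_def q_def by (auto intro!: derivative_eq_intros)
  qed
  have Enz: "E z \<noteq> 0" if "z \<in> T" "z \<noteq> 0" for z
  proof
    assume "E z = 0"
    hence "exp (- (\<i> * z)) = 1" by (simp add: E_def q_def)
    then obtain n :: int where n: "Im (- (\<i> * z)) = of_int (2 * n) * pi" "Re (- (\<i> * z)) = 0" by (auto simp: exp_eq_1)
    have "Re z = - (of_int (2 * n) * pi)" "Im z = 0" using n by simp_all
    moreover have "n = 0"
    proof (rule ccontr)
      assume "n \<noteq> 0"
      hence "1 \<le> \<bar>of_int n :: real\<bar>" by linarith
      hence "2 * pi * 1 \<le> 2 * pi * \<bar>of_int n\<bar>" by (intro mult_left_mono) auto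
      hence "2 * pi \<le> \<bar>Re z\<bar>" using \<open>Re z = - (of_int (2 * n) * pi)\<close> by (simp add: abs_mult mult_ac)
      moreover have "\<bar>Re z\<bar> < 4" using that by (simp add: T_def)
      ultimately show False using pi_gt3 by linarith
    qed
    ultimately show False using that by (simp add: complex_eq_iff)
  qed
  have enz: "e z \<noteq> 0" if "z \<in> T" for z using Enz[OF that] dE E0 by (auto simp: e_def)
  define m where "m z = p z / e z" for z
  have mh: "m holomorphic_on {z. \<bar>Re z\<bar> < 4 \<and> \<bar>Im z\<bar> < S}"
    unfolding m_def T_def[symmetric] by (intro holomorphic_intros ph eh enz)
  have mz: "m z = G z / (1 - q z)" if "z \<noteq> 0" for z using that E0 by (simp add: m_def p_def e_def G_def E_def[of z])
  have mper: "m (Complex pi y) = m (Complex (- pi) y)" if "\<bar>y\<bar> < S" for y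
  proof -
    have "Complex pi y \<noteq> 0" "Complex (- pi) y \<noteq> 0" by (simp_all add: complex_eq_iff)
    thus ?thesis using per[OF that] qper[of y] by (simp add: mz G_def)
  qed
  note msh = integral_line_shift(1)[OF mh mper]
  have bt: "integral {-pi..pi} (\<lambda>x. m (Complex x (- \<sigma>))) = integral {-pi..pi} (\<lambda>x. m (Complex x \<sigma>))"
    using msh[of "- \<sigma>"] msh[of \<sigma>] s0 by simp
  have Gh: "G holomorphic_on {z. \<bar>Re z\<bar> < 4 \<and> \<bar>Im z\<bar> < S}" unfolding G_def by (intro holomorphic_intros hol)
  have Gper: "G (Complex pi y) = G (Complex (- pi) y)" if "\<bar>y\<bar> < S" for y using per[OF that] by (simp add: G_def)
  have Gqh: "(\<lambda>z. G z * q z) holomorphic_on {z. \<bar>Re z\<bar> < 4 \<and> \<bar>Im z\<bar> < S}" "(\<lambda>z. G z * q' z) holomorphic_on {z. \<bar>Re z\<bar> < 4 \<and> \<bar>Im z\<bar> < S}"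
    by (intro holomorphic_intros Gh qhol)+
  have Gqper: "G (Complex pi y) * q (Complex pi y) = G (Complex (- pi) y) * q (Complex (- pi) y)"
      "G (Complex pi y) * q' (Complex pi y) = G (Complex (- pi) y) * q' (Complex (- pi) y)" if "\<bar>y\<bar> < S" for y
    using Gper[OF that] qper[of y] by auto
  note sG = integral_line_shift[OF Gh Gper s0(1)]
  note sGq = integral_line_shift[OF Gqh(1) Gqper(1) s0(1)]
  note sGq' = integral_line_shift[OF Gqh(2) Gqper(2) s0(2)]
  have x0: "Complex x (- \<sigma>) \<noteq> 0" "Complex x \<sigma> \<noteq> 0" for x using S by (auto simp: complex_eq_iff)
  have es: "exp (- \<sigma>) \<le> 1 / 2"
  proof -
    have "2 \<le> exp \<sigma>" using exp_ge_add_one_self[of \<sigma>] S by linarith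
    thus ?thesis by (simp add: exp_minus field_simps)
  qed
  have n1: "1 / 2 \<le> cmod (1 - q (Complex x (- \<sigma>)))" "1 / 2 \<le> cmod (1 - q' (Complex x \<sigma>))" for x
    using norm_triangle_ineq2[of 1 "q (Complex x (- \<sigma>))"] norm_triangle_ineq2[of 1 "q' (Complex x \<sigma>)"] es nq[of x] by auto
  have nz: "1 - q (Complex x (- \<sigma>)) \<noteq> 0" "1 - q' (Complex x \<sigma>) \<noteq> 0" for x using n1[of x] by auto
  define r1 where "r1 x = G (Complex x (- \<sigma>)) * (q (Complex x (- \<sigma>)))\<^sup>2 / (1 - q (Complex x (- \<sigma>)))" for x
  define r2 where "r2 x = G (Complex x \<sigma>) * (q' (Complex x \<sigma>))\<^sup>2 / (1 - q' (Complex x \<sigma>))" for x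
  have Gb: "cmod (G (Complex x y)) \<le> B + cmod (g 0)" if "\<bar>x\<bar> \<le> pi" "\<bar>y\<bar> = \<sigma>" for x y
    unfolding G_def using B[OF that] norm_triangle_ineq4[of "g (Complex x y)" "g 0"] by linarith
  have Cc: "continuous_on A (\<lambda>x. Complex x y)" for A y unfolding Complex_eq by (intro continuous_intros)
  have r1c: "continuous_on {-pi..pi} r1" "continuous_on {-pi..pi} r2"
    unfolding r1_def r2_def
    using continuous_on_compose2[OF holomorphic_on_imp_continuous_on[OF qhol(1)[of UNIV]] Cc]
      continuous_on_compose2[OF holomorphic_on_imp_continuous_on[OF qhol(2)[of UNIV]] Cc]
      integral_line_shift(3)[OF Gh Gper s0(1)] integral_line_shift(3)[OF Gh Gper s0(2)] nz
    by (auto intro!: continuous_intros)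
  have e2: "(exp (- \<sigma>))\<^sup>2 = exp (- 2 * \<sigma>)" by (simp add: power2_eq_square flip: exp_add)
  have rb: "cmod (r1 x) \<le> 2 * (B + cmod (g 0)) * exp (- 2 * \<sigma>)" "cmod (r2 x) \<le> 2 * (B + cmod (g 0)) * exp (- 2 * \<sigma>)" if "x \<in> {-pi..pi}" for x
  proof -
    have x: "\<bar>x\<bar> \<le> pi" using that by (auto simp: abs_le_iff)
    have half2: "a * c / (1 / 2) = 2 * a * c" for a c :: real by simp
    have b0: "0 \<le> (B + cmod (g 0)) * (exp (- \<sigma>))\<^sup>2"
      using order_trans[OF norm_ge_zero Gb[OF x, of \<sigma>]] S by simp
    have "cmod (r1 x) \<le> (B + cmod (g 0)) * (exp (- \<sigma>))\<^sup>2 / (1 / 2)"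
      unfolding r1_def norm_divide norm_mult norm_power nq
      using Gb[OF x, of "- \<sigma>"] n1[of x] S b0 by (intro frac_le mult_right_mono) auto
    thus "cmod (r1 x) \<le> 2 * (B + cmod (g 0)) * exp (- 2 * \<sigma>)" unfolding e2 half2 .
    have "cmod (r2 x) \<le> (B + cmod (g 0)) * (exp (- \<sigma>))\<^sup>2 / (1 / 2)"
      unfolding r2_def norm_divide norm_mult norm_power nq
      using Gb[OF x, of \<sigma>] n1[of x] S b0 by (intro frac_le mult_right_mono) auto
    thus "cmod (r2 x) \<le> 2 * (B + cmod (g 0)) * exp (- 2 * \<sigma>)" unfolding e2 half2 .
  qed
  have m1: "m (Complex x (- \<sigma>)) = G (Complex x (- \<sigma>)) + G (Complex x (- \<sigma>)) * q (Complex x (- \<sigma>)) + r1 x" for x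
  proof -
    have alg: "a / (1 - c) = a + a * c + a * c\<^sup>2 / (1 - c)" if "1 - c \<noteq> 0" for a c :: complex
    proof -
      have "a + a * c = a * (1 + c) * (1 - c) / (1 - c)" using that by (simp add: distrib_left)
      also have "a * (1 + c) * (1 - c) = a - a * c\<^sup>2" by (simp add: power2_eq_square algebra_simps)
      finally show ?thesis by (simp add: diff_divide_distrib)
    qed
    show ?thesis unfolding mz[OF x0(1)] r1_def by (rule alg[OF nz(1)])
  qed
  have m2: "m (Complex x \<sigma>) = - (G (Complex x \<sigma>) * q' (Complex x \<sigma>) + r2 x)" for x
  proof -
    have qq: "q (Complex x \<sigma>) = 1 / q' (Complex x \<sigma>)" by (simp add: q_def q'_def exp_minus divide_inverse)
    have alg: "a / (1 - 1 / c) = - (a * c + a * c\<^sup>2 / (1 - c))" if "1 - c \<noteq> 0" "c \<noteq> 0" for a c :: complex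
    proof -
      have "1 - 1 / c = - ((1 - c) / c)" using that by (simp add: diff_divide_distrib)
      hence "a / (1 - 1 / c) = - (a * c / (1 - c))" by simp
      also have "a * c / (1 - c) = a * c + a * c\<^sup>2 / (1 - c)"
      proof -
        have "a * c = a * c * (1 - c) / (1 - c)" using that by simp
        also have "a * c * (1 - c) = a * c - a * c\<^sup>2" by (simp add: power2_eq_square algebra_simps)
        finally show ?thesis unfolding diff_divide_distrib by (metis diff_add_cancel)
      qed
      finally show ?thesis .
    qed
    have "q' (Complex x \<sigma>) \<noteq> 0" by (simp add: q'_def)
    thus ?thesis unfolding mz[OF x0(2)] r2_def qq by (rule alg[OF nz(2)])
  qed
  have gc: "continuous_on {-pi..pi} (\<lambda>x. g (of_real x))"
    using integral_line_shift(3)[OF hol per, of 0] S by (simp add: complex_of_real_def)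
  have I0: "integral {-pi..pi} (\<lambda>x. G (of_real x)) = 2 * pi * (segment_fourier g 0 - g 0)"
  proof -
    have "integral {-pi..pi} (\<lambda>x. G (of_real x)) = integral {-pi..pi} (\<lambda>x. g (of_real x)) - integral {-pi..pi} (\<lambda>x. g 0)"
      unfolding G_def by (intro integral_diff integrable_continuous_interval gc continuous_intros)
    also have "integral {-pi..pi} (\<lambda>x. g 0) = 2 * pi * g 0" by (simp add: scaleR_conv_of_real)
    finally show ?thesis by (simp add: segment_fourier_def algebra_simps)
  qed
  have Iq: "integral {-pi..pi} (\<lambda>x. G (of_real x) * exp (c * of_real x)) = 2 * pi * F"
    if "integral {-pi..pi} (\<lambda>x. exp (c * complex_of_real x)) = 0" "integral {-pi..pi} (\<lambda>x. g (of_real x) * exp (c * of_real x)) = 2 * pi * F" for c F :: complex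
  proof -
    have "integral {-pi..pi} (\<lambda>x. G (of_real x) * exp (c * of_real x)) = integral {-pi..pi} (\<lambda>x. g (of_real x) * exp (c * of_real x)) - integral {-pi..pi} (\<lambda>x. g 0 * exp (c * of_real x))"
      unfolding G_def left_diff_distrib by (intro integral_diff integrable_continuous_interval gc continuous_intros)
    thus ?thesis using that by simp
  qed
  have I1: "integral {-pi..pi} (\<lambda>x. G (of_real x) * q (of_real x)) = 2 * pi * segment_fourier g 1"
    using Iq[of "- \<i>" "segment_fourier g 1"] exp_ii_integral(2) by (simp add: q_def segment_fourier_def)
  have I2: "integral {-pi..pi} (\<lambda>x. G (of_real x) * q' (of_real x)) = 2 * pi * segment_fourier g (- 1)"
    using Iq[of "\<i>" "segment_fourier g (- 1)"] exp_ii_integral(1) by (simp add: q'_def segment_fourier_def)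
  have "integral {-pi..pi} (\<lambda>x. m (Complex x (- \<sigma>))) = 2 * pi * (segment_fourier g 0 - g 0) + 2 * pi * segment_fourier g 1 + integral {-pi..pi} r1"
    unfolding m1 I0[symmetric] I1[symmetric]
    using sG(1,2) sGq(1,2) integrable_continuous_interval[OF r1c(1)] by (simp add: integral_add integrable_add)
  moreover have "integral {-pi..pi} (\<lambda>x. m (Complex x \<sigma>)) = - (2 * pi * segment_fourier g (- 1) + integral {-pi..pi} r2)"
    unfolding m2 I2[symmetric]
    using sGq'(1,2) integrable_continuous_interval[OF r1c(2)] by (simp add: integral_diff integrable_neg)
  ultimately have "2 * pi * (g 0 - segment_fourier g 0 - segment_fourier g 1 - segment_fourier g (- 1)) = integral {-pi..pi} r1 + integral {-pi..pi} r2"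
    using bt by (simp add: algebra_simps)
  hence "cmod (2 * pi * (g 0 - segment_fourier g 0 - segment_fourier g 1 - segment_fourier g (- 1))) \<le> 2 * (B + cmod (g 0)) * exp (- 2 * \<sigma>) * (2 * pi) + 2 * (B + cmod (g 0)) * exp (- 2 * \<sigma>) * (2 * pi)"
    using norm_triangle_le[OF add_mono[OF ibd[OF r1c(1) rb(1)] ibd[OF r1c(2) rb(2)]]] by simp
  also have "\<dots> = (2 * pi) * (4 * (B + cmod (g 0)) * exp (- 2 * \<sigma>))" by simp
  finally show "cmod (g 0 - segment_fourier g 0 - segment_fourier g 1 - segment_fourier g (- 1)) \<le> 4 * (B + cmod (g 0)) * exp (- 2 * \<sigma>)"
    by (simp only: norm_mult norm_of_real) simp
qed

text \<open>
  Both sides are holomorphic in the overlap of the rectangle with its translate by \<open>2 \<pi>\<close>, which is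
  nonempty because \<open>\<pi> < 4\<close>; they agree on its real points.
\<close>

lemma periodic_from_reals:
  fixes g :: "complex \<Rightarrow> complex"
  assumes hol: "g holomorphic_on {z. \<bar>Re z\<bar> < 4 \<and> \<bar>Im z\<bar> < S}" and S: "0 < S"
    and per: "\<And>x. \<bar>x\<bar> < 4 \<Longrightarrow> \<bar>x + 2 * pi\<bar> < 4 \<Longrightarrow> g (of_real (x + 2 * pi)) = g (of_real x)" and y: "\<bar>y\<bar> < S"
  shows "g (Complex pi y) = g (Complex (- pi) y)"
proof -
  define E where "E = {z :: complex. -4 < Re z} \<inter> {z. Re z < 4 - 2 * pi} \<inter> ({z. -S < Im z} \<inter> {z. Im z < S})"
  have opn: "open E" unfolding E_def by (intro open_Int open_halfspace_Re_gt open_halfspace_Re_lt open_halfspace_Im_gt open_halfspace_Im_lt)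
  have cvx: "convex E" unfolding E_def by (intro convex_Int convex_halfspace_Re_gt convex_halfspace_Re_lt convex_halfspace_Im_gt convex_halfspace_Im_lt)
  have p3: "3 < pi" "pi < 4" using pi_gt3 pi_less_4 by auto
  define U where "U = complex_of_real ` {-4<..<4 - 2 * pi}"
  have "g (Complex (- pi) y + of_real (2 * pi)) - g (Complex (- pi) y) = 0"
  proof (rule analytic_continuation[of "\<lambda>z. g (z + of_real (2 * pi)) - g z" E U "of_real (- pi)"])
    show "(\<lambda>z. g (z + of_real (2 * pi)) - g z) holomorphic_on E"
      by (intro holomorphic_intros holomorphic_on_compose_gen[OF _ hol, unfolded o_def] holomorphic_on_subset[OF hol])
         (use p3 in \<open>auto simp: E_def abs_less_iff\<close>)
    show "U \<subseteq> E" "of_real (- pi) \<in> E" using p3 S by (auto simp: U_def E_def)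
    show "of_real (- pi) islimpt U"
    proof (unfold islimpt_approachable, intro allI impI)
      fix e :: real assume e: "e > 0"
      define d where "d = min (e / 2) ((4 - pi) / 2)"
      have d: "0 < d" "d < e" "d < 4 - pi" using e p3 by (auto simp: d_def min_less_iff_disj)
      have "- pi + d \<in> {-4<..<4 - 2 * pi}" using d p3 by auto
      moreover have "dist (complex_of_real (- pi + d)) (of_real (- pi)) < e"
        using d by (simp add: dist_norm del: of_real_add of_real_minus flip: of_real_diff)
      moreover have "complex_of_real (- pi + d) \<noteq> of_real (- pi)" using d by (simp only: of_real_eq_iff)
      ultimately show "\<exists>x'\<in>U. x' \<noteq> complex_of_real (- pi) \<and> dist x' (complex_of_real (- pi)) < e"
        unfolding U_def by blast
    qed
    show "g (z + of_real (2 * pi)) - g z = 0" if "z \<in> U" for z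
    proof -
      obtain x where x: "z = of_real x" "-4 < x" "x < 4 - 2 * pi" using \<open>z \<in> U\<close> by (auto simp: U_def)
      have "g (of_real (x + 2 * pi)) = g (of_real x)" by (rule per) (use x p3 in auto)
      thus ?thesis by (simp add: x(1))
    qed
    show "Complex (- pi) y \<in> E" using y p3 by (auto simp: E_def)
  qed (use opn cvx in \<open>auto intro: convex_connected\<close>)
  moreover have "Complex (- pi) y + of_real (2 * pi) = Complex pi y" by (simp add: complex_eq_iff)
  ultimately show ?thesis by simp
qed

section \<open>Fourier coefficients of periodic functions\<close>

definition circle_fourier :: "(real \<Rightarrow> real) \<Rightarrow> int \<Rightarrow> complex" where
  "circle_fourier p k = (LINT x:{0..2 * pi}|lborel. complex_of_real (p x) * cis (- (of_int k * x))) / (2 * pi)"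

lemma periodic_integral_shift:
  fixes p :: "real \<Rightarrow> complex"
  assumes c: "continuous_on UNIV p" and per: "\<And>x. p (x + 2 * pi) = p x"
  shows "integral {a..a + 2 * pi} p = integral {b..b + 2 * pi} p"
proof -
  define K where "K t = (LBINT r=0..t. p r)" for t :: real
  have dK: "(K has_vector_derivative p t) (at t)" for t unfolding K_def by (rule LBINT_vector_derivative[OF c])
  have I: "integral {a..a + 2 * pi} p = K (a + 2 * pi) - K a" for a
    by (intro integral_unique fundamental_theorem_of_calculus) (auto intro: has_vector_derivative_at_within dK)
  have dJ: "((\<lambda>a. K (a + 2 * pi) - K a) has_vector_derivative 0) (at a within UNIV)" for a
  proof -
    have "((\<lambda>a. a + 2 * pi) has_vector_derivative 1) (at a)" by (auto intro!: derivative_eq_intros)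
    from vector_diff_chain_at[OF this dK] have "((\<lambda>a. K (a + 2 * pi)) has_vector_derivative p (a + 2 * pi)) (at a)"
      by (simp add: o_def)
    from has_vector_derivative_diff[OF this dK[of a]] show ?thesis by (simp add: per)
  qed
  obtain c where "\<And>a. a \<in> UNIV \<Longrightarrow> K (a + 2 * pi) - K a = c"
    by (rule has_vector_derivative_zero_constant[OF _ dJ]) auto
  thus ?thesis unfolding I by simp
qed

lemma segment_fourier_eq_circle_fourier:
  assumes pcont: "continuous_on UNIV p" and per: "\<And>x. p (x + 2 * pi) = p x"
    and g: "\<And>x. \<bar>x\<bar> \<le> pi \<Longrightarrow> g (of_real x) = complex_of_real (p (A + x))"
  shows "segment_fourier g k = cis (of_int k * A) * circle_fourier p k"
proof -
  define P where "P x = complex_of_real (p x) * cis (- (of_int k * x))" for x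
  have Pc: "continuous_on A P" for A unfolding P_def by (intro continuous_intros continuous_on_subset[OF pcont]) auto
  have Pper: "P (x + 2 * pi) = P x" for x
  proof -
    have "cis (- (of_int k * (x + 2 * pi))) = cis (- (of_int k * x)) * cis (2 * pi * of_int (- k))"
      by (simp add: cis_mult algebra_simps)
    also have "cis (2 * pi * of_int (- k)) = 1" by (rule cis_multiple_2pi) simp
    finally show ?thesis by (simp add: P_def per)
  qed
  have "integral {-pi..pi} (\<lambda>x. g (of_real x) * exp (- (\<i> * of_int k * of_real x))) = integral {-pi..pi} (\<lambda>x. cis (of_int k * A) * P (A + x))"
  proof (rule integral_cong)
    fix x assume "x \<in> {-pi..pi}"
    hence gx: "g (of_real x) = complex_of_real (p (A + x))" by (intro g) auto
    have "exp (- (\<i> * of_int k * of_real x)) = cis (- (of_int k * x))" by (simp add: cis_conv_exp mult_ac)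
    also have "\<dots> = cis (of_int k * A) * cis (- (of_int k * (A + x)))" by (simp add: cis_mult algebra_simps)
    finally show "g (of_real x) * exp (- (\<i> * of_int k * of_real x)) = cis (of_int k * A) * P (A + x)"
      by (simp add: gx P_def)
  qed
  also have "\<dots> = cis (of_int k * A) * integral {-pi..pi} (\<lambda>x. P (A + x))" by simp
  also have "integral {-pi..pi} (\<lambda>x. P (A + x)) = integral {A - pi..A - pi + 2 * pi} P"
  proof -
    have "((\<lambda>x. P (1 *\<^sub>R x + A)) has_integral integral {A - pi..A - pi + 2 * pi} P) {-pi..pi}"
    proof -
      have hi: "(P has_integral integral {A - pi..A - pi + 2 * pi} P) (cbox (A - pi) (A - pi + 2 * pi))"
        using integrable_integral[OF integrable_continuous_interval[OF Pc]] by (simp add: cbox_interval)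
      have im: "(\<lambda>x. x - A) ` {A - pi..A - pi + 2 * pi} = {-pi..pi}"
        unfolding image_minus_const_atLeastAtMost' by simp
      show ?thesis using has_integral_affinity[OF hi, of 1 A] im by (simp add: cbox_interval)
    qed
    thus ?thesis by (intro integral_unique) (simp add: add.commute)
  qed
  also have "\<dots> = integral {0..0 + 2 * pi} P" by (rule periodic_integral_shift[OF Pc Pper])
  also have "\<dots> = (LINT x:{0..2 * pi}|lborel. P x)"
    using set_borel_integral_eq_integral(2)[OF borel_integrable_atLeastAtMost'[OF Pc, of 0 "2 * pi"]] by simp
  finally show ?thesis by (simp add: segment_fourier_def circle_fourier_def P_def)
qed

lemma circle_fourier_integrable:
  assumes "continuous_on UNIV p"
  shows "set_integrable lborel {0..2 * pi} (\<lambda>x. complex_of_real (p x) * cis (- (of_int k * x)))"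
  by (intro borel_integrable_atLeastAtMost' continuous_intros continuous_on_subset[OF assms]) auto

lemma circle_fourier_diff:
  assumes "continuous_on UNIV p" "continuous_on UNIV q"
  shows "circle_fourier (\<lambda>x. p x - c * q x) k = circle_fourier p k - of_real c * circle_fourier q k"
proof -
  have "(LINT x:{0..2 * pi}|lborel. complex_of_real (p x - c * q x) * cis (- (of_int k * x)))
      = (LINT x:{0..2 * pi}|lborel. complex_of_real (p x) * cis (- (of_int k * x)) - of_real c * (complex_of_real (q x) * cis (- (of_int k * x))))"
    by (simp add: algebra_simps)
  also have "\<dots> = (LINT x:{0..2 * pi}|lborel. complex_of_real (p x) * cis (- (of_int k * x)))
      - (LINT x:{0..2 * pi}|lborel. of_real c * (complex_of_real (q x) * cis (- (of_int k * x))))"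
    by (intro set_integral_diff set_integrable_mult_right circle_fourier_integrable assms)
  also have "(LINT x:{0..2 * pi}|lborel. of_real c * (complex_of_real (q x) * cis (- (of_int k * x))))
      = of_real c * (LINT x:{0..2 * pi}|lborel. complex_of_real (q x) * cis (- (of_int k * x)))"
    by (rule set_integral_mult_right)
  finally show ?thesis by (simp add: circle_fourier_def diff_divide_distrib)
qed

lemma circle_fourier_cnj: "circle_fourier p (- k) = cnj (circle_fourier p k)"
proof -
  have e: "indicator {0..2 * pi} x *\<^sub>R (complex_of_real (p x) * cis (- (of_int (- k) * x)))
      = cnj (indicator {0..2 * pi} x *\<^sub>R (complex_of_real (p x) * cis (- (of_int k * x))))" for x
    by (simp add: cis_cnj)
  have "(LINT x:{0..2 * pi}|lborel. complex_of_real (p x) * cis (- (of_int (- k) * x)))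
      = cnj (LINT x:{0..2 * pi}|lborel. complex_of_real (p x) * cis (- (of_int k * x)))"
    unfolding set_lebesgue_integral_def Bochner_Integration.integral_cnj[symmetric] by (rule Bochner_Integration.integral_cong[OF refl e])
  thus ?thesis by (simp add: circle_fourier_def)
qed

lemma circle_fourier_0_real: "of_real (Re (circle_fourier p 0)) = circle_fourier p 0"
proof -
  have "cnj (circle_fourier p 0) = circle_fourier p 0" using circle_fourier_cnj[of p 0] by simp
  thus ?thesis by (simp add: complex_eq_iff)
qed

lemma circle_fourier_bound:
  assumes "continuous_on UNIV p" "\<And>x. \<bar>p x\<bar> \<le> B"
  shows "cmod (circle_fourier p k) \<le> B"
proof -
  define P where "P x = complex_of_real (p x) * cis (- (of_int k * x))" for x
  have "(LINT x:{0..2 * pi}|lborel. P x) = integral {0..2 * pi} P"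
    using set_borel_integral_eq_integral(2)[OF circle_fourier_integrable[OF assms(1), of k]] by (simp add: P_def[abs_def])
  moreover have "cmod (integral {0..2 * pi} P) \<le> B * (2 * pi - 0)"
    by (rule integral_bound) (auto simp: P_def norm_mult assms intro!: continuous_intros continuous_on_subset[OF assms(1)])
  ultimately show ?thesis by (simp add: circle_fourier_def P_def norm_divide norm_mult divide_le_eq)
qed

section \<open>The analytic extension of the perturbation\<close>

lemma torus_periodic_lattice:
  fixes g :: "'v::euclidean_space \<Rightarrow> 'b"
  assumes "torus_periodic g"
  shows "g (x + (\<Sum>b\<in>Basis. (2 * pi * of_int (n b)) *\<^sub>R b)) = g x"
proof -
  have nat: "g (x + (2 * pi * of_nat m) *\<^sub>R b) = g x" if "b \<in> Basis" for m x b
  proof (induction m arbitrary: x)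
    case (Suc m)
    have "x + (2 * pi * of_nat (Suc m)) *\<^sub>R b = (x + (2 * pi * of_nat m) *\<^sub>R b) + (2 * pi) *\<^sub>R b"
      by (simp add: algebra_simps)
    thus ?case using assms that Suc[of x] unfolding torus_periodic_def by metis
  qed simp
  have int: "g (x + (2 * pi * of_int m) *\<^sub>R b) = g x" if "b \<in> Basis" for m x b
  proof (cases m rule: int_cases2)
    case (nonneg k)
    thus ?thesis using nat[OF that, of x k] by simp
  next
    case (nonpos k)
    thus ?thesis using nat[OF that, of "x + (2 * pi * of_int m) *\<^sub>R b" k] by simp
  qed
  have "g (x + (\<Sum>b\<in>B. (2 * pi * of_int (n b)) *\<^sub>R b)) = g x" if "B \<subseteq> Basis" for B
    using finite_subset[OF that finite_Basis] that
  proof (induction B rule: finite_induct)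
    case (insert b B)
    have "x + (\<Sum>b\<in>insert b B. (2 * pi * of_int (n b)) *\<^sub>R b) = (x + (\<Sum>b\<in>B. (2 * pi * of_int (n b)) *\<^sub>R b)) + (2 * pi * of_int (n b)) *\<^sub>R b"
      unfolding sum.insert[OF insert.hyps(1,2)] by (simp only: add_ac)
    moreover have "g (x + (\<Sum>b\<in>B. (2 * pi * of_int (n b)) *\<^sub>R b)) = g x" using insert.IH insert.prems by blast
    ultimately show ?case using int[of b "x + (\<Sum>b\<in>B. (2 * pi * of_int (n b)) *\<^sub>R b)" "n b"] insert.prems by (simp add: add.assoc)
  qed simp
  thus ?thesis by blast
qed

definition complex_vec :: "real ^ 'm \<Rightarrow> real ^ 'm \<Rightarrow> complex ^ 'm" where
  "complex_vec x y = (\<chi> i. Complex (x $ i) (y $ i))"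

lemma open_strip_interior:
  fixes w :: "real ^ 'm"
  shows "{z :: complex ^ 'm. \<forall>i. \<bar>Im (z $ i)\<bar> < w $ i} \<subseteq> interior (strip w)"
proof (rule interior_maximal)
  show "{z :: complex ^ 'm. \<forall>i. \<bar>Im (z $ i)\<bar> < w $ i} \<subseteq> strip w" by (auto simp: strip_def less_imp_le)
  have "{z :: complex ^ 'm. \<forall>i. \<bar>Im (z $ i)\<bar> < w $ i} = (\<Inter>i\<in>UNIV. {z. \<bar>Im (z $ i)\<bar> < w $ i})" by auto
  also have "open \<dots>" by (intro open_INT ballI open_Collect_less continuous_intros) auto
  finally show "open {z :: complex ^ 'm. \<forall>i. \<bar>Im (z $ i)\<bar> < w $ i}" .
qed

lemma extension_line_holomorphic:
  fixes w :: "real ^ 'm"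
  assumes "analytic_extension w f F" and "open U"
    and in_strip: "\<And>\<zeta> i. \<zeta> \<in> U \<Longrightarrow> \<bar>Im (p $ i + \<zeta> * v $ i)\<bar> < w $ i"
  shows "(\<lambda>\<zeta>. F (x, \<chi> i. p $ i + \<zeta> * v $ i)) holomorphic_on U"
proof (rule holomorphic_onI)
  fix \<zeta> assume z: "\<zeta> \<in> U"
  define l where "l \<zeta> = (\<chi> i. p $ i + \<zeta> * v $ i)" for \<zeta>
  have "l \<zeta> \<in> interior (strip w)" using open_strip_interior[of w] in_strip[OF z] by (auto simp: l_def)
  then obtain L where L: "((\<lambda>z. F (x, z)) has_derivative L) (at (l \<zeta>))" "\<And>c v. L (c *s v) = c * L v"
    using assms(1) unfolding analytic_extension_def holomorphic_vec_on_def by blast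
  have l_eq: "l \<xi> = p + \<xi> *s v" for \<xi> by (simp add: l_def vec_eq_iff)
  have dl: "(l has_derivative (\<lambda>h. h *s v)) (at \<zeta>)"
  proof -
    have bl: "bounded_linear (\<lambda>h::complex. h *s v)"
      unfolding linear_conv_bounded_linear[symmetric]
      by (rule linearI) (simp_all add: vec_eq_iff distrib_right)
    have "((\<lambda>h. p + h *s v) has_derivative (\<lambda>h. h *s v)) (at \<zeta>)"
      using has_derivative_add[OF has_derivative_const[of p] bounded_linear.has_derivative[OF bl has_derivative_ident]] by simp
    moreover have "l = (\<lambda>h. p + h *s v)" by (rule ext, rule l_eq)
    ultimately show ?thesis by (simp only:)
  qed
  have "((\<lambda>\<zeta>. F (x, l \<zeta>)) has_derivative (\<lambda>h. L (h *s v))) (at \<zeta>)"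
    using has_derivative_compose[OF dl L(1)] .
  hence "((\<lambda>\<zeta>. F (x, l \<zeta>)) has_field_derivative L v) (at \<zeta>)"
    unfolding has_field_derivative_def L(2) by (simp only: mult_commute_abs)
  thus "(\<lambda>\<zeta>. F (x, \<chi> i. p $ i + \<zeta> * v $ i)) field_differentiable (at \<zeta> within U)"
    unfolding l_def using field_differentiable_at_within field_differentiable_def by blast
qed

lemma extension_continuous:
  fixes w :: "real ^ 'm"
  assumes "analytic_extension w f F" "continuous_on S a" "continuous_on S c" "\<And>s i. s \<in> S \<Longrightarrow> \<bar>Im (c s $ i)\<bar> \<le> w $ i"
  shows "continuous_on S (\<lambda>s. F (a s, c s))"
proof (rule continuous_on_compose2[of "D_dom w" F])
  show "continuous_on (D_dom w) F" using assms(1) by (simp add: analytic_extension_def)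
  show "continuous_on S (\<lambda>s. (a s, c s))" by (intro continuous_intros assms)
  show "(\<lambda>s. (a s, c s)) ` S \<subseteq> D_dom w" using assms(4) by (auto simp: D_dom_def strip_def)
qed

text \<open>
  Both sides are the values at \<open>\<zeta> = i\<close> of functions that are holomorphic for \<open>|Im \<zeta>| < 1\<close>,
  continuous up to \<open>i\<close>, and equal for real \<open>\<zeta>\<close>.
\<close>

lemma extension_periodic:
  fixes w :: "real ^ 'm"
  assumes ext: "analytic_extension w f F" and w: "\<And>i. w $ i > 0" and y: "\<And>i. \<bar>y $ i\<bar> \<le> w $ i"
    and per: "\<And>X. f (X + P) = f X"
  shows "F (fst (X + P), complex_vec (snd (X + P)) y) = F (fst X, complex_vec (snd X) y)"
proof -
  define U where "U = {\<zeta> :: complex. \<bar>Im \<zeta>\<bar> < 1}"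
  have Ueq: "U = {z. Im z > -1} \<inter> {z. Im z < 1}" by (auto simp: U_def)
  have opn: "open U" unfolding Ueq by (intro open_Int open_halfspace_Im_gt open_halfspace_Im_lt)
  have cvx: "convex U" unfolding Ueq by (intro convex_Int convex_halfspace_Im_gt convex_halfspace_Im_lt)
  define l where "l (X :: real \<times> (real ^ 'm)) \<zeta> = (\<chi> i. complex_of_real (snd X $ i) + \<zeta> * of_real (y $ i))" for X \<zeta>
  have str: "\<bar>Im (complex_of_real (snd X $ i) + \<zeta> * of_real (y $ i))\<bar> < w $ i" if "\<zeta> \<in> U" for X :: "real \<times> (real ^ 'm)" and \<zeta> i
  proof -
    have "\<bar>Im \<zeta>\<bar> * \<bar>y $ i\<bar> \<le> \<bar>Im \<zeta>\<bar> * w $ i" using y[of i] by (intro mult_left_mono) auto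
    also have "\<dots> < 1 * w $ i" using that w[of i] by (intro mult_strict_right_mono) (auto simp: U_def)
    finally show ?thesis by (simp add: abs_mult)
  qed
  have hol: "(\<lambda>\<zeta>. F (fst X, l X \<zeta>)) holomorphic_on U" for X
    using extension_line_holomorphic[OF ext opn, of "\<chi> i. complex_of_real (snd X $ i)" "\<chi> i. complex_of_real (y $ i)" "fst X"] str
    by (simp add: l_def)
  have real_eq: "F (fst X, l X (of_real s)) = complex_of_real (f (fst X, \<chi> i. snd X $ i + s * y $ i))" for X s
  proof -
    have "l X (of_real s) = (\<chi> i. complex_of_real ((\<chi> i. snd X $ i + s * y $ i) $ i))" by (simp add: l_def vec_eq_iff)
    moreover have "F (x, \<chi> i. complex_of_real (y $ i)) = complex_of_real (f (x, y))" for x y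
      using ext by (simp add: analytic_extension_def)
    ultimately show ?thesis by (simp only:)
  qed
  have inner: "F (fst (X + P), l (X + P) \<zeta>) - F (fst X, l X \<zeta>) = 0" if "\<zeta> \<in> U" for \<zeta>
  proof (rule analytic_continuation[of "\<lambda>\<zeta>. F (fst (X + P), l (X + P) \<zeta>) - F (fst X, l X \<zeta>)" U "complex_of_real ` UNIV" 0])
    show "(\<lambda>\<zeta>. F (fst (X + P), l (X + P) \<zeta>) - F (fst X, l X \<zeta>)) holomorphic_on U" by (intro holomorphic_intros hol)
    show "0 islimpt range complex_of_real"
    proof (unfold islimpt_approachable, intro allI impI)
      fix e :: real assume "e > 0"
      thus "\<exists>x'\<in>range complex_of_real. x' \<noteq> 0 \<and> dist x' 0 < e"
        by (intro bexI[of _ "complex_of_real (e / 2)"] rangeI) (simp add: norm_divide)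
    qed
    show "F (fst (X + P), l (X + P) z) - F (fst X, l X z) = 0" if zr: "z \<in> range complex_of_real" for z
    proof -
      obtain s where s: "z = of_real s" using zr by blast
      have "(fst (X + P), \<chi> i. snd (X + P) $ i + s * y $ i) = (fst X, \<chi> i. snd X $ i + s * y $ i) + P"
        by (simp add: prod_eq_iff vec_eq_iff)
      thus ?thesis unfolding s real_eq using per by simp
    qed
  qed (use opn cvx that in \<open>auto simp: U_def intro: convex_connected\<close>)
  define \<phi> where "\<phi> s = F (fst (X + P), l (X + P) (\<i> * of_real s)) - F (fst X, l X (\<i> * of_real s))" for s :: real
  have cont: "continuous_on {0..1} (\<lambda>s. F (fst X, l X (\<i> * complex_of_real s)))" for X
  proof (rule extension_continuous[OF ext])
    show "continuous_on {0..1} (\<lambda>s. l X (\<i> * complex_of_real s))"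
      unfolding l_def by (rule continuous_on_vec_lambda) (intro continuous_intros)
    show "\<bar>Im (l X (\<i> * complex_of_real s) $ i)\<bar> \<le> w $ i" if "s \<in> {0..1}" for s i
      using that y[of i] mult_left_le_one_le[of "\<bar>y $ i\<bar>" "\<bar>s\<bar>"] by (simp add: l_def abs_mult)
  qed (intro continuous_intros)
  have "\<phi> 1 = 0"
  proof (rule continuous_constant_on_closure[of "{0..<1}" \<phi>])
    have "closure {0..<1} = {0..1::real}" by simp
    thus "continuous_on (closure {0..<1}) \<phi>" unfolding \<phi>_def by (simp only:) (intro continuous_intros cont)
    show "\<phi> s = 0" if "s \<in> {0..<1}" for s unfolding \<phi>_def using that by (intro inner) (auto simp: U_def)
  qed simp
  moreover have "l X \<i> = complex_vec (snd X) y" for X by (simp add: l_def complex_vec_def vec_eq_iff complex_eq_iff)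
  ultimately show ?thesis by (simp add: \<phi>_def)
qed

text \<open>
  By periodicity the values on the whole domain are attained over one period cell, which is
  compact together with the closed strip.
\<close>

lemma extension_bounded:
  fixes w :: "real ^ 'm"
  assumes ext: "analytic_extension w f F" and w: "\<And>i. w $ i > 0" and per: "torus_periodic f"
  shows "bdd_above (cmod ` F ` D_dom w)"
proof -
  define K where "K = cbox (0 :: real \<times> (real ^ 'm)) (\<Sum>b\<in>Basis. (2 * pi) *\<^sub>R b) \<times> cbox (- w) w"
  have "compact K" unfolding K_def by (intro compact_Times compact_cbox)
  moreover have "continuous_on K (\<lambda>p. F (fst (fst p), complex_vec (snd (fst p)) (snd p)))"
  proof (rule extension_continuous[OF ext])
    show "continuous_on K (\<lambda>p. complex_vec (snd (fst p)) (snd p))"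
      unfolding complex_vec_def Complex_eq by (rule continuous_on_vec_lambda) (intro continuous_intros)
    show "\<bar>Im (complex_vec (snd (fst p)) (snd p) $ i)\<bar> \<le> w $ i" if "p \<in> K" for p i
    proof -
      have "snd p \<in> cbox (- w) w" using that by (auto simp: K_def)
      hence "- (w $ i) \<le> snd p $ i \<and> snd p $ i \<le> w $ i" unfolding mem_box_cart by simp
      thus ?thesis by (simp add: complex_vec_def abs_le_iff)
    qed
  qed (intro continuous_intros)
  ultimately have "compact ((\<lambda>p. F (fst (fst p), complex_vec (snd (fst p)) (snd p))) ` K)" by (rule compact_continuous_image[rotated])
  from compact_imp_bounded[OF this] obtain B where "\<forall>v\<in>(\<lambda>p. F (fst (fst p), complex_vec (snd (fst p)) (snd p))) ` K. cmod v \<le> B"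
    unfolding bounded_iff by blast
  hence B: "cmod (F (fst (fst p), complex_vec (snd (fst p)) (snd p))) \<le> B" if "p \<in> K" for p using that by blast
  show ?thesis
  proof (rule bdd_aboveI[of _ B])
    fix v assume "v \<in> cmod ` F ` D_dom w"
    then obtain x z where v: "v = cmod (F (x, z))" "z \<in> strip w" by (auto simp: D_dom_def)
    define X :: "real \<times> (real ^ 'm)" where "X = (x, \<chi> i. Re (z $ i))"
    define y :: "real ^ 'm" where "y = (\<chi> i. Im (z $ i))"
    have y: "\<bar>y $ i\<bar> \<le> w $ i" for i using v(2) by (simp add: y_def strip_def)
    have z: "z = complex_vec (snd X) y" by (simp add: X_def y_def complex_vec_def vec_eq_iff complex_eq_iff)
    define n where "n b = - \<lfloor>(X \<bullet> b) / (2 * pi)\<rfloor>" for b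
    define P where "P = (\<Sum>b\<in>Basis. (2 * pi * of_int (n b)) *\<^sub>R b :: real \<times> (real ^ 'm))"
    have perF: "F (fst (X + P), complex_vec (snd (X + P)) y) = F (fst X, complex_vec (snd X) y)"
      by (rule extension_periodic[OF ext w y]) (unfold P_def, rule torus_periodic_lattice[OF per])
    have inK: "(X + P, y) \<in> K"
    proof -
      have box: "0 \<le> (X + P) \<bullet> b \<and> (X + P) \<bullet> b \<le> 2 * pi" if "b \<in> Basis" for b
      proof -
        have "P \<bullet> b = 2 * pi * of_int (n b)" using that by (simp add: P_def inner_sum_left_Basis)
        hence e: "(X + P) \<bullet> b = 2 * pi * ((X \<bullet> b) / (2 * pi) - of_int \<lfloor>(X \<bullet> b) / (2 * pi)\<rfloor>)"
          by (simp add: inner_add_left n_def algebra_simps)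
        have "0 \<le> (X \<bullet> b) / (2 * pi) - of_int \<lfloor>(X \<bullet> b) / (2 * pi)\<rfloor>" "(X \<bullet> b) / (2 * pi) - of_int \<lfloor>(X \<bullet> b) / (2 * pi)\<rfloor> \<le> 1" by linarith+
        thus ?thesis unfolding e using mult_left_mono[of "(X \<bullet> b) / (2 * pi) - of_int \<lfloor>(X \<bullet> b) / (2 * pi)\<rfloor>" 1 "2 * pi"] by simp
      qed
      have ycb: "y \<in> cbox (- w) w"
      proof (unfold mem_box_cart, intro allI)
        fix i show "(- w) $ i \<le> y $ i \<and> y $ i \<le> w $ i" using y[of i] by (simp add: abs_le_iff)
      qed
      have corner: "(\<Sum>b\<in>Basis. (2 * pi) *\<^sub>R b) \<bullet> b = 2 * pi" if "b \<in> Basis" for b :: "real \<times> (real ^ 'm)"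
        using that by (simp add: inner_sum_left_Basis)
      have "X + P \<in> cbox 0 (\<Sum>b\<in>Basis. (2 * pi) *\<^sub>R b)"
        unfolding mem_box(2)
      proof (intro ballI)
        fix b :: "real \<times> (real ^ 'm)" assume b: "b \<in> Basis"
        show "0 \<bullet> b \<le> (X + P) \<bullet> b \<and> (X + P) \<bullet> b \<le> (\<Sum>b\<in>Basis. (2 * pi) *\<^sub>R b) \<bullet> b"
          unfolding corner[OF b] inner_zero_left by (rule box[OF b])
      qed
      thus ?thesis unfolding K_def using ycb by (rule SigmaI)
    qed
    have "v = cmod (F (fst X, complex_vec (snd X) y))" using v(1) unfolding z[symmetric] by (simp add: X_def)
    thus "v \<le> B" using B[OF inK] by (simp only: fst_conv snd_conv perF)
  qed
qed

text \<open>
  Only the forcing depends explicitly on time, and a time shift changes its phase.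
\<close>

lemma perturbed_separatrix_shift:
  assumes "perturbed_separatrix r f \<omega> \<mu> A \<theta> (Q, \<alpha>)" and A': "A' = A + c *\<^sub>R \<omega>"
  shows "perturbed_separatrix r f \<omega> \<mu> A' (\<theta> - c) (\<lambda>t. Q (t + c), \<alpha>)"
proof -
  note p = assms(1)[unfolded perturbed_separatrix_def prod.case]
  have d1: "(Q has_real_derivative deriv Q t) (at t)" "(deriv Q has_real_derivative deriv (deriv Q) t) (at t)" for t
    using p by (auto simp: DERIV_deriv_iff_field_differentiable)
  have s1: "((\<lambda>t. Q (t + c)) has_real_derivative deriv Q (t + c)) (at t)" for t
    using d1(1)[of "t + c"] by (simp add: DERIV_shift)
  have s2: "((\<lambda>t. deriv Q (t + c)) has_real_derivative deriv (deriv Q) (t + c)) (at t)" for t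
    using d1(2)[of "t + c"] by (simp add: DERIV_shift)
  have e1: "deriv (\<lambda>t. Q (t + c)) = (\<lambda>t. deriv Q (t + c))" using s1 by (auto simp: fun_eq_iff intro: DERIV_imp_deriv)
  have e2: "deriv (\<lambda>t. deriv Q (t + c)) = (\<lambda>t. deriv (deriv Q) (t + c))" using s2 by (auto simp: fun_eq_iff intro: DERIV_imp_deriv)
  have arg: "t *\<^sub>R \<omega> + A' = (t + c) *\<^sub>R \<omega> + A" for t by (simp add: A' algebra_simps)
  have ps: "psi (\<theta> - c) t = psi \<theta> (t + c)" "q_sep (\<theta> - c) t = q_sep \<theta> (t + c)" for t
    by (simp_all add: psi_def q_sep_def algebra_simps)
  have "(LINT t|lborel. (Q (t + c) - q_sep \<theta> (t + c)) * psi \<theta> (t + c)) = (LINT t|lborel. (Q t - q_sep \<theta> t) * psi \<theta> t)"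
    using lborel_integral_real_affine[of 1 "\<lambda>t. (Q t - q_sep \<theta> t) * psi \<theta> t" c] by (simp add: add.commute)
  moreover have "((\<lambda>t. Q (t + c)) \<longlongrightarrow> 0) at_bot" "((\<lambda>t. Q (t + c)) \<longlongrightarrow> 2 * pi) at_top"
    using filterlim_compose[OF _ translation_limits(2)[of 0 c], of Q "nhds 0"] filterlim_compose[OF _ translation_limits(1)[of 0 c], of Q "nhds (2 * pi)"] p
    by auto
  moreover have "(\<lambda>t. Q (t + c)) field_differentiable (at t)" "(\<lambda>t. deriv Q (t + c)) field_differentiable (at t)" for t
    using s1 s2 field_differentiable_def by blast+
  ultimately show ?thesis using p unfolding perturbed_separatrix_def prod.case e1 e2 arg ps by auto
qed

section \<open>The rapidly forced pendulum\<close>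

lemma cos_near_right_angle:
  assumes "0 \<le> d" "d \<le> 4/5" "\<bar>y\<bar> \<le> pi / 2 - d"
  shows "5/8 * d \<le> cos y"
proof -
  have "5/8 * d \<le> sin d"
  proof (cases "d = 0")
    case False
    hence d: "0 < d" using assms(1) by simp
    obtain z where z: "0 < z" "z < d" "sin d - sin 0 = (d - 0) * cos z"
      using MVT2[of 0 d sin cos] d by (auto intro: DERIV_sin)
    have "(sin (z / 2))\<^sup>2 \<le> (2/5)\<^sup>2"
      using abs_sin_x_le_abs_x[of "z / 2"] z assms(2) by (intro abs_le_square_iff[THEN iffD1]) auto
    hence "5/8 \<le> cos z" using cos_double_sin[of "z / 2"] by (simp add: power2_eq_square)
    hence "d * (5/8) \<le> d * cos z" using d by (intro mult_left_mono) auto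
    thus ?thesis using z by simp
  qed simp
  also have "sin d = cos (pi / 2 - d)" by (simp add: cos_diff)
  also have "\<dots> \<le> cos \<bar>y\<bar>" by (rule cos_monotone_0_pi_le) (use assms pi_gt3 in auto)
  finally show ?thesis by simp
qed

text \<open>
  Here \<open>M\<close> is any positive bound for \<open>F\<close> rather than its supremum, which may vanish.
\<close>

locale fast_forced_pendulum =
  fixes a :: real and \<beta> w :: "real ^ 'm" and f :: "real \<times> (real ^ 'm) \<Rightarrow> real"
    and F :: "real \<times> (complex ^ 'm) \<Rightarrow> complex" and M \<epsilon> \<mu> r :: real
  assumes ext: "analytic_extension w f F" and per: "torus_periodic f" and wpos: "\<And>i. w $ i > 0"
    and FM: "\<And>p. p \<in> D_dom w \<Longrightarrow> cmod (F p) \<le> M"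
    and eps: "0 < \<epsilon>" "\<epsilon> \<le> 1 / 100" and width: "\<And>i. \<epsilon> powr a * \<bar>\<beta> $ i\<bar> * (pi / 2) < w $ i"
    and mu: "0 < \<mu>" and M: "0 < M" and small: "\<mu> * M \<le> (sqrt \<epsilon>) ^ 3 / 10 ^ 32"
    and r: "\<mu> * M \<le> r / 10 ^ 23" "r \<le> 1 / 2000"
begin

definition "e = sqrt \<epsilon>"
definition "\<omega> = omega a \<beta> \<epsilon>"
definition "forcing A t = f (t *\<^sub>R \<omega> + A)"

lemma e: "0 < e" "e \<le> 1 / 10" "e\<^sup>2 = \<epsilon>" "e ^ 3 \<le> 1" "\<mu> * M \<le> e ^ 3 / 10 ^ 32"
proof -
  show e0: "0 < e" and "e\<^sup>2 = \<epsilon>" using eps by (auto simp: e_def)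
  show e1: "e \<le> 1 / 10" unfolding e_def using eps by (intro real_le_lsqrt) (auto simp: power2_eq_square)
  show "e ^ 3 \<le> 1" using e0 e1 by (intro power_le_one) auto
  show "\<mu> * M \<le> e ^ 3 / 10 ^ 32" using small by (simp add: e_def)
qed

lemma muM: "0 < \<mu> * M" "\<mu> * M \<le> 1 / 10 ^ 32"
  using mu M e(4,5) by auto

lemma f_real: "complex_of_real (f X) = F (fst X, \<chi> i. complex_of_real (snd X $ i))"
proof -
  have "F (x, \<chi> i. complex_of_real (y $ i)) = complex_of_real (f (x, y))" for x y
    using ext by (simp add: analytic_extension_def)
  from this[of "fst X" "snd X"] show ?thesis by simp
qed

lemma f_cont: "continuous_on UNIV f"
proof -
  have "continuous_on UNIV (\<lambda>X. F (fst X, \<chi> i. complex_of_real (snd X $ i)))"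
    by (rule extension_continuous[OF ext])
       (intro continuous_intros continuous_on_vec_lambda, intro continuous_intros continuous_on_vec_lambda, simp add: less_imp_le[OF wpos])
  hence "continuous_on UNIV (\<lambda>X. complex_of_real (f X))" unfolding f_real .
  from continuous_on_Re[OF this] show ?thesis by simp
qed

lemma f_bound: "\<bar>f X\<bar> \<le> M"
proof -
  have "(fst X, \<chi> i. complex_of_real (snd X $ i)) \<in> D_dom w" by (simp add: D_dom_def strip_def less_imp_le[OF wpos])
  from FM[OF this] show ?thesis unfolding f_real[symmetric] by simp
qed

lemma forcing_cont: "continuous_on UNIV (forcing A)"
  unfolding forcing_def by (rule continuous_on_compose2[OF f_cont]) (auto intro!: continuous_intros)

lemma problem_real_centre:
  assumes "\<bar>x\<bar> \<le> 4/5" shows "real_problem x \<mu> M (forcing A)"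
proof (rule real_problem.intro, rule pendulum_problem.intro)
  show "near_axis (complex_of_real x) 0" using assms by (simp add: near_axis_def)
  show "continuous_on UNIV (\<lambda>t. complex_of_real (forcing A t))" by (intro continuous_intros forcing_cont)
  show "cmod (complex_of_real (forcing A t)) \<le> M" for t using f_bound by (simp add: forcing_def)
qed (use mu M muM in auto)

lemma sep_real:
  assumes "\<bar>x\<bar> \<le> 4/5"
  shows "perturbed_separatrix r f \<omega> \<mu> A x (forced_separatrix x \<mu> (forcing A), real_problem.\<alpha> x \<mu> (forcing A))"
proof -
  interpret P: real_problem x \<mu> M "forcing A" by (rule problem_real_centre[OF assms])
  have d2: "deriv (deriv (forced_separatrix x \<mu> (forcing A))) t = sin (forced_separatrix x \<mu> (forcing A) t) * (1 + \<mu> * forcing A t) - P.\<alpha> * psi x t" for t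
    using P.Q_deriv2 by (rule DERIV_imp_deriv)
  have near: "\<bar>forced_separatrix x \<mu> (forcing A) t - q_sep x t\<bar> \<le> r" for t
    using P.Q_near[of t] r(1) muM(1) by (simp add: P.R_def sol_radius_def)
  have diff: "forced_separatrix x \<mu> (forcing A) field_differentiable (at t)" "deriv (forced_separatrix x \<mu> (forcing A)) field_differentiable (at t)" for t
    using P.Q_deriv P.Q_deriv2 field_differentiable_def by blast+
  show ?thesis unfolding perturbed_separatrix_def prod.case
    using diff near P.Q_limits P.Q_orthogonal by (auto simp: d2 forcing_def algebra_simps)
qed

lemma sep_exists: "\<exists>p. perturbed_separatrix r f \<omega> \<mu> A \<theta> p"
proof -
  have "perturbed_separatrix r f \<omega> \<mu> A (0 - (- \<theta>)) (\<lambda>t. forced_separatrix 0 \<mu> (forcing (A + \<theta> *\<^sub>R \<omega>)) (t + (- \<theta>)), real_problem.\<alpha> 0 \<mu> (forcing (A + \<theta> *\<^sub>R \<omega>)))"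
    by (rule perturbed_separatrix_shift[OF sep_real]) auto
  thus ?thesis by auto
qed

lemma sep_unique:
  assumes "perturbed_separatrix r f \<omega> \<mu> A \<theta> p1" "perturbed_separatrix r f \<omega> \<mu> A \<theta> p2"
  shows "p1 = p2"
proof -
  obtain Q1 \<alpha>1 Q2 \<alpha>2 where p: "p1 = (Q1, \<alpha>1)" "p2 = (Q2, \<alpha>2)" by (cases p1, cases p2) auto
  note s1 = perturbed_separatrix_shift[OF assms(1)[unfolded p] refl, of \<theta>]
  note s2 = perturbed_separatrix_shift[OF assms(2)[unfolded p] refl, of \<theta>]
  have rs: "r + \<mu> * M \<le> 1 / 1000" using r(2) muM(2) by auto
  have eq: "(\<lambda>t. Q1 (t + \<theta>)) = (\<lambda>t. Q2 (t + \<theta>)) \<and> \<alpha>1 = \<alpha>2"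
    by (rule perturbed_separatrix_unique[OF s1[simplified] s2[simplified] f_cont f_bound less_imp_le[OF mu] rs])
  have "Q1 t = Q2 t" for t using fun_cong[OF conjunct1[OF eq], of "t - \<theta>"] by simp
  thus ?thesis using eq p by auto
qed

lemma sep_ex1: "\<exists>!p. perturbed_separatrix r f \<omega> \<mu> A \<theta> p"
  using sep_exists sep_unique by blast

lemma Q_pert_eq:
  assumes "\<bar>x\<bar> \<le> 4/5"
  shows "Q_pert r f \<omega> \<mu> A 0 = (\<lambda>t. forced_separatrix x \<mu> (forcing (A - x *\<^sub>R \<omega>)) (t + x))"
proof -
  have "perturbed_separatrix r f \<omega> \<mu> A (x - x) (\<lambda>t. forced_separatrix x \<mu> (forcing (A - x *\<^sub>R \<omega>)) (t + x), real_problem.\<alpha> x \<mu> (forcing (A - x *\<^sub>R \<omega>)))"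
    by (rule perturbed_separatrix_shift[OF sep_real[OF assms]]) simp
  hence "(THE p. perturbed_separatrix r f \<omega> \<mu> A 0 p) = (\<lambda>t. forced_separatrix x \<mu> (forcing (A - x *\<^sub>R \<omega>)) (t + x), real_problem.\<alpha> x \<mu> (forcing (A - x *\<^sub>R \<omega>)))"
    by (intro the1_equality sep_ex1) simp
  thus ?thesis by (simp add: Q_pert_def)
qed

lemma lborel_shift: "(LINT t|lborel. g (t + x)) = (LINT t|lborel. g t)" for g :: "real \<Rightarrow> real" and x :: real
  using lborel_integral_real_affine[of 1 g x] by (simp add: add.commute)

text \<open>
  The solution with centre \<open>0\<close> is a time shift of the one with centre \<open>x\<close>; the freedom in \<open>x\<close> is
  what permits the passage to complex centres.
\<close>

lemma G_tilde_eq_action: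
  assumes "\<bar>x\<bar> \<le> 4/5"
  shows "complex_of_real (G_tilde r f \<omega> \<mu> A) = complex_action (of_real x) \<mu> (\<lambda>t. of_real (forcing (A - x *\<^sub>R \<omega>) t))"
proof -
  define B where "B = A - x *\<^sub>R \<omega>"
  interpret P: real_problem x \<mu> M "forcing B" by (rule problem_real_centre[OF assms])
  define L0 where "L0 t = (deriv (forced_separatrix x \<mu> (forcing B)) t)\<^sup>2 / 2 + (1 - cos (forced_separatrix x \<mu> (forcing B) t)) + \<mu> * (1 - cos (forced_separatrix x \<mu> (forcing B) t)) * forcing B t" for t
  have dQ: "(forced_separatrix x \<mu> (forcing B) has_real_derivative deriv (forced_separatrix x \<mu> (forcing B)) t) (at t)" for t
    using P.Q_deriv[of t] unfolding P.deriv_Q .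
  have "((\<lambda>t. forced_separatrix x \<mu> (forcing B) (t + x)) has_real_derivative deriv (forced_separatrix x \<mu> (forcing B)) (t + x)) (at t)" for t
    using dQ[of "t + x"] by (simp add: DERIV_shift)
  hence d: "deriv (\<lambda>t. forced_separatrix x \<mu> (forcing B) (t + x)) t = deriv (forced_separatrix x \<mu> (forcing B)) (t + x)" for t by (rule DERIV_imp_deriv)
  have arg: "forcing B (t + x) = f (t *\<^sub>R \<omega> + A)" for t by (simp add: forcing_def B_def algebra_simps)
  have "G_tilde r f \<omega> \<mu> A = (LINT t|lborel. L0 (t + x))"
    unfolding G_tilde_def Q_pert_eq[OF assms] B_def[symmetric] lagrangian_def d L0_def arg ..
  also have "\<dots> = (LINT t|lborel. L0 t)" by (rule lborel_shift)
  finally show ?thesis using P.action_real unfolding L0_def B_def by simp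
qed

lemma melnikov_eq_complex_melnikov: "complex_of_real (melnikov f \<omega> A) = complex_melnikov (of_real x) (\<lambda>t. of_real (forcing (A - x *\<^sub>R \<omega>) t))"
proof -
  define m where "m t = 2 * forcing (A - x *\<^sub>R \<omega>) t / (cosh (t - x))\<^sup>2" for t
  have c: "1 - cos (q_sep 0 t) = 2 / (cosh t)\<^sup>2" for t by (simp add: q_sep_def sin_cos_separatrix)
  have "melnikov f \<omega> A = (LINT t|lborel. m (t + x))"
    unfolding melnikov_def c by (simp add: m_def forcing_def algebra_simps)
  also have "\<dots> = (LINT t|lborel. m t)" by (rule lborel_shift)
  finally have 1: "complex_of_real (melnikov f \<omega> A) = (LINT t|lborel. complex_of_real (m t))" by simp
  have 2: "complex_of_real (m t) = 2 * of_real (forcing (A - x *\<^sub>R \<omega>) t) / (cosh (of_real t - of_real x))\<^sup>2" for t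
    using of_real_trig(1)[of "t - x"] by (simp add: m_def)
  show ?thesis unfolding 1 2 complex_melnikov_def ..
qed

text \<open>
  The forcing for the centre \<open>\<eta>\<close>. The centre enters only through the slow angles, in which \<open>F\<close> is
  holomorphic.
\<close>

definition "H A1 A2 \<eta> t = F (t / e + A1, \<chi> i. complex_of_real (A2 $ i) + of_real (\<epsilon> powr a * \<beta> $ i) * (of_real t - \<eta>))"
definition "V = {\<eta>. \<bar>Re \<eta>\<bar> < 4 * e \<and> \<bar>Im \<eta>\<bar> < pi / 2 - 8 * e}"

lemma V_strip: "\<eta> \<in> V \<Longrightarrow> \<bar>Im (complex_of_real (A2 $ i) + of_real (\<epsilon> powr a * \<beta> $ i) * (of_real t - \<eta>))\<bar> < w $ i"
proof -
  assume "\<eta> \<in> V"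
  hence y: "\<bar>Im \<eta>\<bar> \<le> pi / 2" using e by (auto simp: V_def)
  have "\<bar>Im (complex_of_real (A2 $ i) + of_real (\<epsilon> powr a * \<beta> $ i) * (of_real t - \<eta>))\<bar> = \<epsilon> powr a * \<bar>\<beta> $ i\<bar> * \<bar>Im \<eta>\<bar>"
    by (simp add: abs_mult)
  also have "\<dots> \<le> \<epsilon> powr a * \<bar>\<beta> $ i\<bar> * (pi / 2)" using y by (intro mult_left_mono) auto
  also have "\<dots> < w $ i" by (rule width)
  finally show ?thesis .
qed

text \<open>
  The margin \<open>8 \<surd>\<epsilon>\<close> to the height \<open>\<pi> / 2\<close> makes \<open>\<kappa>\<^sup>3\<close> dominate \<open>\<epsilon>\<^sup>3\<^sup>/\<^sup>2\<close>, and with it \<open>\<mu> M\<close>.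
\<close>

lemma V_cos: "\<eta> \<in> V \<Longrightarrow> 5 * e \<le> cos (Im \<eta>)"
  using cos_near_right_angle[of "8 * e" "Im \<eta>"] e by (auto simp: V_def)

lemma open_V: "open V"
proof -
  have V: "V = {z. Re z > - (4 * e)} \<inter> {z. Re z < 4 * e} \<inter> ({z. Im z > - (pi / 2 - 8 * e)} \<inter> {z. Im z < pi / 2 - 8 * e})"
    by (auto simp: V_def)
  show ?thesis unfolding V
    by (intro open_Int open_halfspace_Re_gt open_halfspace_Re_lt open_halfspace_Im_gt open_halfspace_Im_lt)
qed

lemma problem_V: "\<eta> \<in> V \<Longrightarrow> pendulum_problem \<eta> \<mu> M (cos (Im \<eta>)) (H A1 A2 \<eta>)"
proof (rule pendulum_problem.intro)
  assume V: "\<eta> \<in> V"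
  note c = V_cos[OF V]
  show "near_axis \<eta> 0" using V c e(1) by (auto simp: near_axis_def V_def)
  show "continuous_on UNIV (H A1 A2 \<eta>)" unfolding H_def
  proof (rule extension_continuous[OF ext])
    show "continuous_on UNIV (\<lambda>t. \<chi> i. complex_of_real (A2 $ i) + of_real (\<epsilon> powr a * \<beta> $ i) * (of_real t - \<eta>))"
      by (rule continuous_on_vec_lambda) (intro continuous_intros)
    show "continuous_on UNIV (\<lambda>t. t / e + A1)" using e(1) by (intro continuous_intros) auto
    show "\<bar>Im ((\<chi> i. complex_of_real (A2 $ i) + of_real (\<epsilon> powr a * \<beta> $ i) * (of_real t - \<eta>)) $ i)\<bar> \<le> w $ i" for t i
      using less_imp_le[OF V_strip[OF V, of A2 i t]] by (simp only: vec_lambda_beta)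
  qed
  show "cmod (H A1 A2 \<eta> t) \<le> M" for t unfolding H_def
    by (rule FM) (auto simp only: D_dom_def strip_def vec_lambda_beta mem_Collect_eq mem_Sigma_iff intro!: less_imp_le[OF V_strip[OF V]])
  have "\<mu> * M \<le> e ^ 3 / 10 ^ 32" by (rule e)
  also have "e ^ 3 \<le> (cos (Im \<eta>)) ^ 3" using c e(1) by (intro power_mono) auto
  finally show "\<mu> * M \<le> (cos (Im \<eta>)) ^ 3 / 10 ^ 32" by simp
qed (use mu M in auto)

lemma family: "action_family V \<mu> M (5 * e) (H A1 A2)"
proof (rule action_family.intro)
  fix t
  have "(\<lambda>\<eta>. F (t / e + A1, \<chi> i. (\<chi> i. complex_of_real (A2 $ i) + of_real (\<epsilon> powr a * \<beta> $ i) * of_real t) $ i + \<eta> * (\<chi> i. - complex_of_real (\<epsilon> powr a * \<beta> $ i)) $ i)) holomorphic_on V"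
  proof (rule extension_line_holomorphic[OF ext open_V])
    show "\<bar>Im ((\<chi> i. complex_of_real (A2 $ i) + of_real (\<epsilon> powr a * \<beta> $ i) * of_real t) $ i + \<zeta> * (\<chi> i. - complex_of_real (\<epsilon> powr a * \<beta> $ i)) $ i)\<bar> < w $ i" if "\<zeta> \<in> V" for \<zeta> i
      using V_strip[OF that, of A2 i t] by (simp add: algebra_simps)
  qed
  thus "(\<lambda>\<eta>. H A1 A2 \<eta> t) holomorphic_on V" unfolding H_def by (simp add: algebra_simps)
qed (use open_V problem_V V_cos e in auto)

text \<open>
  Moving the centre by \<open>x\<close> is the same as moving the first angle by \<open>x / \<surd>\<epsilon>\<close>.
\<close>

lemma H_real: "H A1 A2 (of_real x) t = of_real (forcing ((A1 + x / e, A2) - x *\<^sub>R \<omega>) t)"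
proof -
  have X: "t *\<^sub>R \<omega> + ((A1 + x / e, A2) - x *\<^sub>R \<omega>) = (t / e + A1, \<chi> i. A2 $ i + \<epsilon> powr a * \<beta> $ i * (t - x))"
    using e(1) by (simp add: \<omega>_def omega_def e_def[symmetric] vec_eq_iff algebra_simps)
  show ?thesis unfolding forcing_def X f_real H_def by simp
qed

end

section \<open>The first two harmonics of the action\<close>

text \<open>
  The action minus its value \<open>8\<close> at \<open>\<mu> = 0\<close> and its first-order term.
\<close>

definition remainder :: "real \<Rightarrow> (real \<times> (real ^ 'm) \<Rightarrow> real) \<Rightarrow> real \<times> (real ^ 'm) \<Rightarrow> real \<Rightarrow> real \<times> (real ^ 'm) \<Rightarrow> real" where
  "remainder r f \<omega> \<mu> A = (G_tilde r f \<omega> \<mu> A - 8) - \<mu> * melnikov f \<omega> A"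

definition remainder_coeff :: "real \<Rightarrow> (real \<times> (real ^ 'm) \<Rightarrow> real) \<Rightarrow> real \<times> (real ^ 'm) \<Rightarrow> real \<Rightarrow> int \<Rightarrow> real ^ 'm \<Rightarrow> complex" where
  "remainder_coeff r f \<omega> \<mu> k A2 = circle_fourier (\<lambda>x. remainder r f \<omega> \<mu> (x, A2)) k"

lemma torus_periodic_action:
  assumes "torus_periodic f" "b \<in> Basis"
  shows "G_tilde r f \<omega> \<mu> (A + (2 * pi) *\<^sub>R b) = G_tilde r f \<omega> \<mu> A" "melnikov f \<omega> (A + (2 * pi) *\<^sub>R b) = melnikov f \<omega> A"
proof -
  have f: "f (t *\<^sub>R \<omega> + (A + (2 * pi) *\<^sub>R b)) = f (t *\<^sub>R \<omega> + A)" for t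
    using assms unfolding torus_periodic_def by (metis add.assoc)
  have "perturbed_separatrix r f \<omega> \<mu> (A + (2 * pi) *\<^sub>R b) 0 = perturbed_separatrix r f \<omega> \<mu> A 0"
    by (simp add: fun_eq_iff perturbed_separatrix_def f)
  hence Q: "Q_pert r f \<omega> \<mu> (A + (2 * pi) *\<^sub>R b) 0 = Q_pert r f \<omega> \<mu> A 0" by (simp add: Q_pert_def)
  show "G_tilde r f \<omega> \<mu> (A + (2 * pi) *\<^sub>R b) = G_tilde r f \<omega> \<mu> A" unfolding G_tilde_def Q lagrangian_def f ..
  show "melnikov f \<omega> (A + (2 * pi) *\<^sub>R b) = melnikov f \<omega> A" unfolding melnikov_def f ..
qed

lemma torus_periodic_remainder_coeff:
  fixes f :: "real \<times> (real ^ 'm) \<Rightarrow> real"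
  assumes "torus_periodic f" shows "torus_periodic (remainder_coeff r f \<omega> \<mu> k)"
  unfolding torus_periodic_def
proof (intro allI ballI)
  fix A2 b :: "real ^ 'm" assume b: "b \<in> Basis"
  have b': "(0 :: real, b) \<in> Basis" using b by (simp add: Basis_prod_def)
  have A: "(x, A2 + (2 * pi) *\<^sub>R b) = (x, A2) + (2 * pi) *\<^sub>R (0, b)" for x :: real by simp
  have "remainder r f \<omega> \<mu> (x, A2 + (2 * pi) *\<^sub>R b) = remainder r f \<omega> \<mu> (x, A2)" for x
    unfolding remainder_def A torus_periodic_action[OF assms b'] ..
  thus "remainder_coeff r f \<omega> \<mu> k (A2 + (2 * pi) *\<^sub>R b) = remainder_coeff r f \<omega> \<mu> k A2" by (simp add: remainder_coeff_def)
qed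

text \<open>
  Around every \<open>A\<close> the function \<open>p\<close> is the restriction of a holomorphic function, which may depend
  on \<open>A\<close>.
\<close>

lemma continuous_real_trace:
  fixes p :: "real \<Rightarrow> real"
  assumes "0 < S" "\<And>A. g A holomorphic_on {z. \<bar>Re z\<bar> < 4 \<and> \<bar>Im z\<bar> < S}"
    and "\<And>A x. \<bar>x\<bar> < 4 \<Longrightarrow> g A (of_real x) = complex_of_real (p (A + x))"
  shows "continuous_on UNIV p"
proof -
  have "isCont p A" for A
  proof -
    have "continuous_on {A - 1<..<A + 1} (\<lambda>y. g A (of_real (y - A)))"
      by (rule continuous_on_compose2[OF holomorphic_on_imp_continuous_on[OF assms(2)[of A]]])
         (use assms(1) in \<open>auto intro!: continuous_intros\<close>)
    hence "continuous_on {A - 1<..<A + 1} (\<lambda>y. Re (g A (of_real (y - A))))" by (intro continuous_intros)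
    moreover have "Re (g A (of_real (y - A))) = p y" if "y \<in> {A - 1<..<A + 1}" for y
      using assms(3)[of "y - A" A] that by auto
    ultimately have "continuous_on {A - 1<..<A + 1} p" by (rule continuous_on_eq)
    thus ?thesis by (simp add: continuous_on_eq_continuous_at)
  qed
  thus ?thesis by (simp add: continuous_on_eq_continuous_at)
qed

context fast_forced_pendulum
begin

text \<open>
  The centre is \<open>\<eta> = \<surd>\<epsilon> z\<close>, so that the action becomes \<open>2 \<pi>\<close>-periodic in \<open>z\<close>. In this variable \<open>V\<close>
  has the half-height \<open>S\<close>; the height \<open>\<sigma>\<close>, at which the bounds are taken, lies inside.
\<close>

definition "S = (pi / 2 - 8 * e) / e"
definition "\<sigma> = (pi / 2 - 9 * e) / e"
definition "g A1 A2 z = complex_action (of_real e * z) \<mu> (H A1 A2 (of_real e * z)) - 8"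
definition "m A1 A2 z = complex_melnikov (of_real e * z) (H A1 A2 (of_real e * z))"

lemma S: "0 < S" "1 \<le> \<sigma>" "\<sigma> < S"
proof -
  have "10 * e \<le> pi / 2" using e(2) pi_gt3 by simp
  thus "1 \<le> \<sigma>" "\<sigma> < S" using e(1) by (simp_all add: S_def \<sigma>_def divide_strict_right_mono)
  thus "0 < S" by linarith
qed

lemma scaled_in_V: "\<bar>Re z\<bar> < 4 \<Longrightarrow> \<bar>Im z\<bar> < S \<Longrightarrow> of_real e * z \<in> V"
  using e(1) by (simp add: V_def S_def abs_mult pos_less_divide_eq mult.commute)

lemma g_m_holomorphic:
  "g A1 A2 holomorphic_on {z. \<bar>Re z\<bar> < 4 \<and> \<bar>Im z\<bar> < S}" "m A1 A2 holomorphic_on {z. \<bar>Re z\<bar> < 4 \<and> \<bar>Im z\<bar> < S}"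
proof -
  interpret fam: action_family V \<mu> M "5 * e" "H A1 A2" by (rule family)
  have "((\<lambda>\<eta>. complex_action \<eta> \<mu> (H A1 A2 \<eta>) - 8) \<circ> (\<lambda>z. of_real e * z)) holomorphic_on {z. \<bar>Re z\<bar> < 4 \<and> \<bar>Im z\<bar> < S}"
    by (rule holomorphic_on_compose_gen[of _ _ _ V]) (auto intro!: holomorphic_intros fam.action_holomorphic scaled_in_V)
  thus "g A1 A2 holomorphic_on {z. \<bar>Re z\<bar> < 4 \<and> \<bar>Im z\<bar> < S}" by (simp add: g_def[abs_def] o_def)
  have "((\<lambda>\<eta>. complex_melnikov \<eta> (H A1 A2 \<eta>)) \<circ> (\<lambda>z. of_real e * z)) holomorphic_on {z. \<bar>Re z\<bar> < 4 \<and> \<bar>Im z\<bar> < S}"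
    by (rule holomorphic_on_compose_gen[of _ _ _ V]) (auto intro!: holomorphic_intros fam.complex_melnikov_holomorphic scaled_in_V)
  thus "m A1 A2 holomorphic_on {z. \<bar>Re z\<bar> < 4 \<and> \<bar>Im z\<bar> < S}" by (simp add: m_def[abs_def] o_def)
qed

lemma g_m_real:
  assumes "\<bar>x\<bar> < 4"
  shows "g A1 A2 (of_real x) = complex_of_real (G_tilde r f \<omega> \<mu> (A1 + x, A2) - 8)" "m A1 A2 (of_real x) = complex_of_real (melnikov f \<omega> (A1 + x, A2))"
proof -
  have x: "\<bar>e * x\<bar> \<le> 4/5"
    using mult_mono[of e "1/10" "\<bar>x\<bar>" 4] assms e by (simp add: abs_mult)
  have H: "H A1 A2 (of_real (e * x)) = (\<lambda>t. of_real (forcing ((A1 + x, A2) - (e * x) *\<^sub>R \<omega>) t))"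
    by (rule HOL.ext) (unfold H_real, use e(1) in simp)
  have ex: "complex_of_real e * of_real x = of_real (e * x)" by simp
  show "g A1 A2 (of_real x) = complex_of_real (G_tilde r f \<omega> \<mu> (A1 + x, A2) - 8)"
    unfolding g_def ex H G_tilde_eq_action[OF x, symmetric] by simp
  show "m A1 A2 (of_real x) = complex_of_real (melnikov f \<omega> (A1 + x, A2))"
    unfolding m_def ex H melnikov_eq_complex_melnikov[of "(A1 + x, A2)" "e * x"] ..
qed

lemma g_m_bounds:
  assumes "\<bar>Re z\<bar> < 4" "\<bar>Im z\<bar> < S"
  shows "cmod (g A1 A2 z) \<le> 10 ^ 14 * (\<mu> * M / e)" "cmod (g A1 A2 z - of_real \<mu> * m A1 A2 z) \<le> 10 ^ 46 * (\<mu> * M / \<epsilon>)\<^sup>2"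
proof -
  let ?\<eta> = "of_real e * z"
  note V = scaled_in_V[OF assms]
  interpret P: pendulum_problem ?\<eta> \<mu> M "cos (Im ?\<eta>)" "H A1 A2 ?\<eta>" by (rule problem_V[OF V])
  have c: "e \<le> cos (Im ?\<eta>)" using V_cos[OF V] e(1) by linarith
  have "\<mu> * M / cos (Im ?\<eta>) \<le> \<mu> * M / e" using c e(1) muM(1) by (intro divide_left_mono) auto
  hence "10 ^ 14 * (\<mu> * M / cos (Im ?\<eta>)) \<le> 10 ^ 14 * (\<mu> * M / e)" by (rule mult_left_mono) simp
  from order_trans[OF P.action_expansion(2) this] show "cmod (g A1 A2 z) \<le> 10 ^ 14 * (\<mu> * M / e)" unfolding g_def .
  have c2: "0 < (cos (Im ?\<eta>))\<^sup>2 * \<epsilon>" by (intro mult_pos_pos zero_less_power less_le_trans[OF e(1) c] eps(1))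
  have "e\<^sup>2 \<le> (cos (Im ?\<eta>))\<^sup>2" using c e(1) by (intro power_mono) auto
  hence "\<mu> * M / (cos (Im ?\<eta>))\<^sup>2 \<le> \<mu> * M / \<epsilon>" unfolding e(3)
    using c2 muM(1) by (intro divide_left_mono) auto
  moreover have "0 \<le> \<mu> * M / (cos (Im ?\<eta>))\<^sup>2" using muM(1) by simp
  ultimately have "(\<mu> * M / (cos (Im ?\<eta>))\<^sup>2)\<^sup>2 \<le> (\<mu> * M / \<epsilon>)\<^sup>2" by (rule power_mono)
  hence "10 ^ 46 * (\<mu> * M / (cos (Im ?\<eta>))\<^sup>2)\<^sup>2 \<le> 10 ^ 46 * (\<mu> * M / \<epsilon>)\<^sup>2" by (rule mult_left_mono) simp
  from order_trans[OF P.action_expansion(1) this]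
  show "cmod (g A1 A2 z - of_real \<mu> * m A1 A2 z) \<le> 10 ^ 46 * (\<mu> * M / \<epsilon>)\<^sup>2" unfolding g_def m_def .
qed

lemma real_bounds:
  "cmod (g A1 A2 0) \<le> 10 ^ 14 * (\<mu> * M)" "\<bar>remainder r f \<omega> \<mu> (x, A2)\<bar> \<le> 10 ^ 46 * (\<mu> * M)\<^sup>2"
proof -
  have z: "of_real e * (0 :: complex) \<in> V" using S(1) by (intro scaled_in_V) auto
  interpret P: pendulum_problem "of_real e * 0" \<mu> M "cos (Im (of_real e * 0))" "H A1 A2 (of_real e * 0)" for A1 by (rule problem_V[OF z])
  show "cmod (g A1 A2 0) \<le> 10 ^ 14 * (\<mu> * M)" using P.action_expansion(2)[of A1] unfolding g_def by simp
  have "cmod (g x A2 0 - of_real \<mu> * m x A2 0) \<le> 10 ^ 46 * (\<mu> * M)\<^sup>2" using P.action_expansion(1)[of x] unfolding g_def m_def by simp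
  moreover have "g x A2 0 - of_real \<mu> * m x A2 0 = of_real (remainder r f \<omega> \<mu> (x, A2))"
    using g_m_real[of 0 x A2] by (simp add: remainder_def)
  ultimately show "\<bar>remainder r f \<omega> \<mu> (x, A2)\<bar> \<le> 10 ^ 46 * (\<mu> * M)\<^sup>2" by simp
qed

lemma real_traces:
  "continuous_on UNIV (\<lambda>x. G_tilde r f \<omega> \<mu> (x, A2) - 8)" "continuous_on UNIV (\<lambda>x. melnikov f \<omega> (x, A2))"
  "G_tilde r f \<omega> \<mu> (x + 2 * pi, A2) = G_tilde r f \<omega> \<mu> (x, A2)" "melnikov f \<omega> (x + 2 * pi, A2) = melnikov f \<omega> (x, A2)"
proof -
  show "continuous_on UNIV (\<lambda>x. G_tilde r f \<omega> \<mu> (x, A2) - 8)"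
    by (rule continuous_real_trace[OF S(1) g_m_holomorphic(1)[of _ A2]]) (rule g_m_real(1))
  show "continuous_on UNIV (\<lambda>x. melnikov f \<omega> (x, A2))"
    by (rule continuous_real_trace[OF S(1) g_m_holomorphic(2)[of _ A2]]) (rule g_m_real(2))
  have b: "(1 :: real, 0 :: real ^ 'm) \<in> Basis" by (simp add: Basis_prod_def)
  have A: "(x + 2 * pi, A2) = (x, A2) + (2 * pi) *\<^sub>R (1, 0)" by simp
  show "G_tilde r f \<omega> \<mu> (x + 2 * pi, A2) = G_tilde r f \<omega> \<mu> (x, A2)" "melnikov f \<omega> (x + 2 * pi, A2) = melnikov f \<omega> (x, A2)"
    unfolding A using torus_periodic_action[OF per b] by blast+
qed

lemma coeff_split:
  "circle_fourier (\<lambda>x. G_tilde r f \<omega> \<mu> (x, A2) - 8) k = of_real \<mu> * melnikov_coeff f \<omega> k A2 + remainder_coeff r f \<omega> \<mu> k A2"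
  unfolding remainder_coeff_def remainder_def circle_fourier_diff[OF real_traces(1,2)] by (simp add: circle_fourier_def melnikov_coeff_def)

lemma exp_sigma: "exp (- \<sigma>) = exp 9 * exp (- pi / (2 * sqrt \<epsilon>))" "exp (- 2 * \<sigma>) = exp 18 * exp (- pi / sqrt \<epsilon>)"
proof -
  have "\<sigma> = pi / (2 * e) - 9" using e(1) by (simp add: \<sigma>_def diff_divide_distrib)
  hence "- \<sigma> = 9 + - pi / (2 * sqrt \<epsilon>)" "- 2 * \<sigma> = 18 + - pi / sqrt \<epsilon>" by (simp_all add: e_def)
  thus "exp (- \<sigma>) = exp 9 * exp (- pi / (2 * sqrt \<epsilon>))" "exp (- 2 * \<sigma>) = exp 18 * exp (- pi / sqrt \<epsilon>)"
    by (simp_all only: exp_add)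
qed

theorem remainder_coeff_0: "cmod (remainder_coeff r f \<omega> \<mu> 0 A2) \<le> 10 ^ 46 * (\<mu> * M)\<^sup>2"
  unfolding remainder_coeff_def
  by (rule circle_fourier_bound) (unfold remainder_def, intro continuous_intros real_traces, fold remainder_def, rule real_bounds)

theorem remainder_coeff_1: "cmod (remainder_coeff r f \<omega> \<mu> 1 A2) \<le> 10 ^ 46 * (\<mu> * M / \<epsilon>)\<^sup>2 * (exp 9 * exp (- pi / (2 * sqrt \<epsilon>)))"
proof -
  define d where "d z = g 0 A2 z - of_real \<mu> * m 0 A2 z" for z
  have hol: "d holomorphic_on {z. \<bar>Re z\<bar> < 4 \<and> \<bar>Im z\<bar> < S}" unfolding d_def by (intro holomorphic_intros g_m_holomorphic)
  have real: "d (of_real x) = complex_of_real (remainder r f \<omega> \<mu> (0 + x, A2))" if "\<bar>x\<bar> < 4" for x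
    using g_m_real[OF that, of 0 A2] by (simp add: d_def remainder_def)
  have rper: "remainder r f \<omega> \<mu> (x + 2 * pi, A2) = remainder r f \<omega> \<mu> (x, A2)" for x by (simp add: remainder_def real_traces)
  have rcont: "continuous_on UNIV (\<lambda>x. remainder r f \<omega> \<mu> (x, A2))" unfolding remainder_def by (intro continuous_intros real_traces)
  have "cmod (segment_fourier d 1) \<le> exp (- \<sigma>) * (10 ^ 46 * (\<mu> * M / \<epsilon>)\<^sup>2)"
  proof (rule fourier_strip_remainder(1)[OF hol _ S(2,3)])
    show "d (Complex pi y) = d (Complex (- pi) y)" if "\<bar>y\<bar> < S" for y
    proof (rule periodic_from_reals[OF hol S(1) _ that])
      fix x :: real assume x: "\<bar>x\<bar> < 4" "\<bar>x + 2 * pi\<bar> < 4"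
      show "d (of_real (x + 2 * pi)) = d (of_real x)" unfolding real[OF x(1)] real[OF x(2)] by (simp add: rper)
    qed
    show "cmod (d (Complex x y)) \<le> 10 ^ 46 * (\<mu> * M / \<epsilon>)\<^sup>2" if "\<bar>x\<bar> \<le> pi" "\<bar>y\<bar> = \<sigma>" for x y
      unfolding d_def by (rule g_m_bounds(2)) (use that S pi_less_4 in auto)
  qed
  moreover have "segment_fourier d 1 = cis (of_int 1 * 0) * circle_fourier (\<lambda>x. remainder r f \<omega> \<mu> (x, A2)) 1"
    by (rule segment_fourier_eq_circle_fourier[OF rcont rper real]) (use pi_less_4 in auto)
  ultimately show ?thesis by (simp add: remainder_coeff_def exp_sigma mult_ac)
qed

text \<open>
  The coefficients of index \<open>1\<close> and \<open>-1\<close> of a real function are conjugate, which is where \<open>2 Re\<close>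
  comes from.
\<close>

theorem two_harmonics:
  "cmod (of_real (G_tilde r f \<omega> \<mu> (A1, A2)) - (8 + (of_real \<mu> * melnikov_coeff f \<omega> 0 A2 + of_real (Re (remainder_coeff r f \<omega> \<mu> 0 A2)))
     + of_real (2 * Re ((of_real \<mu> * melnikov_coeff f \<omega> 1 A2 + remainder_coeff r f \<omega> \<mu> 1 A2) * cis A1))))
    \<le> 8 * 10 ^ 14 * (\<mu> * M / e) * (exp 18 * exp (- pi / sqrt \<epsilon>))"
proof -
  define E where "E x = G_tilde r f \<omega> \<mu> (x, A2) - 8" for x
  have Econt: "continuous_on UNIV E" unfolding E_def by (rule real_traces)
  have Eper: "E (x + 2 * pi) = E x" for x by (simp add: E_def real_traces)
  have real: "g A1 A2 (of_real x) = complex_of_real (E (A1 + x))" if "\<bar>x\<bar> < 4" for x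
    using g_m_real(1)[OF that] by (simp add: E_def)
  have F: "cmod (g A1 A2 0 - segment_fourier (g A1 A2) 0 - segment_fourier (g A1 A2) 1 - segment_fourier (g A1 A2) (- 1)) \<le> 4 * (10 ^ 14 * (\<mu> * M / e) + cmod (g A1 A2 0)) * exp (- 2 * \<sigma>)"
  proof (rule fourier_strip_remainder(2)[OF g_m_holomorphic(1) _ S(2,3)])
    show "g A1 A2 (Complex pi y) = g A1 A2 (Complex (- pi) y)" if "\<bar>y\<bar> < S" for y
    proof (rule periodic_from_reals[OF g_m_holomorphic(1) S(1) _ that])
      fix x :: real assume x: "\<bar>x\<bar> < 4" "\<bar>x + 2 * pi\<bar> < 4"
      show "g A1 A2 (of_real (x + 2 * pi)) = g A1 A2 (of_real x)"
        unfolding real[OF x(1)] real[OF x(2)] add.assoc[symmetric] Eper ..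
    qed
    show "cmod (g A1 A2 (Complex x y)) \<le> 10 ^ 14 * (\<mu> * M / e)" if "\<bar>x\<bar> \<le> pi" "\<bar>y\<bar> = \<sigma>" for x y
      by (rule g_m_bounds(1)) (use that S pi_less_4 in auto)
  qed
  have segment_fourier: "segment_fourier (g A1 A2) k = cis (of_int k * A1) * circle_fourier E k" for k
    by (rule segment_fourier_eq_circle_fourier[OF Econt Eper real]) (use pi_less_4 in auto)
  have mu_e: "\<mu> * M \<le> \<mu> * M / e" using e(1,2) muM(1) by (simp add: pos_le_divide_eq mult_left_le)
  have "10 ^ 14 * (\<mu> * M / e) + cmod (g A1 A2 0) \<le> 10 ^ 14 * (\<mu> * M / e) + 10 ^ 14 * (\<mu> * M / e)"
    by (intro add_left_mono order_trans[OF real_bounds(1)] mult_left_mono mu_e) simp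
  hence "4 * (10 ^ 14 * (\<mu> * M / e) + cmod (g A1 A2 0)) * exp (- 2 * \<sigma>) \<le> 4 * (10 ^ 14 * (\<mu> * M / e) + 10 ^ 14 * (\<mu> * M / e)) * exp (- 2 * \<sigma>)"
    by (intro mult_right_mono mult_left_mono) auto
  also have "\<dots> = 8 * 10 ^ 14 * (\<mu> * M / e) * (exp 18 * exp (- pi / sqrt \<epsilon>))" unfolding exp_sigma by simp
  finally have bound: "cmod (g A1 A2 0 - segment_fourier (g A1 A2) 0 - segment_fourier (g A1 A2) 1 - segment_fourier (g A1 A2) (- 1)) \<le> 8 * 10 ^ 14 * (\<mu> * M / e) * (exp 18 * exp (- pi / sqrt \<epsilon>))"
    using F by linarith
  have e1: "g A1 A2 0 = of_real (G_tilde r f \<omega> \<mu> (A1, A2)) - 8" using real[of 0] by (simp add: E_def)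
  have e2: "segment_fourier (g A1 A2) 0 = of_real \<mu> * melnikov_coeff f \<omega> 0 A2 + of_real (Re (remainder_coeff r f \<omega> \<mu> 0 A2))"
    using segment_fourier[of 0] coeff_split[of A2 0] by (simp add: E_def[abs_def] remainder_coeff_def circle_fourier_0_real)
  have e3: "segment_fourier (g A1 A2) 1 + segment_fourier (g A1 A2) (- 1) = of_real (2 * Re ((of_real \<mu> * melnikov_coeff f \<omega> 1 A2 + remainder_coeff r f \<omega> \<mu> 1 A2) * cis A1))"
  proof -
    have 1: "segment_fourier (g A1 A2) 1 = circle_fourier E 1 * cis A1" using segment_fourier[of 1] by (simp add: mult.commute)
    have 2: "segment_fourier (g A1 A2) (- 1) = cnj (circle_fourier E 1 * cis A1)" using segment_fourier[of "- 1"] by (simp add: circle_fourier_cnj cis_cnj mult.commute)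
    have 3: "circle_fourier E 1 = of_real \<mu> * melnikov_coeff f \<omega> 1 A2 + remainder_coeff r f \<omega> \<mu> 1 A2"
      using coeff_split[of A2 1] by (simp add: E_def[abs_def])
    show ?thesis unfolding 1 2 complex_add_cnj 3 ..
  qed
  have "of_real (G_tilde r f \<omega> \<mu> (A1, A2)) - (8 + (of_real \<mu> * melnikov_coeff f \<omega> 0 A2 + of_real (Re (remainder_coeff r f \<omega> \<mu> 0 A2)))
     + of_real (2 * Re ((of_real \<mu> * melnikov_coeff f \<omega> 1 A2 + remainder_coeff r f \<omega> \<mu> 1 A2) * cis A1)))
     = g A1 A2 0 - segment_fourier (g A1 A2) 0 - segment_fourier (g A1 A2) 1 - segment_fourier (g A1 A2) (- 1)"
    unfolding e1 e2 e3[symmetric] by (simp add: algebra_simps)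
  thus ?thesis using bound by simp
qed

end

text \<open>
  This passes from positive bounds for \<open>F\<close> to its supremum, which may be zero.
\<close>

lemma le_limit_power:
  fixes X c M0 :: real
  assumes "\<And>M'. M0 < M' \<Longrightarrow> M' \<le> M0 + 1 \<Longrightarrow> X \<le> c * M' ^ n"
  shows "X \<le> c * M0 ^ n"
proof (rule tendsto_lowerbound)
  show "((\<lambda>M'. c * M' ^ n) \<longlongrightarrow> c * M0 ^ n) (at_right M0)" by (intro tendsto_intros)
  show "\<forall>\<^sub>F M' in at_right M0. X \<le> c * M' ^ n"
    unfolding eventually_at_right_field by (intro exI[of _ "M0 + 1"]) (auto intro!: assms)
qed simp

text \<open>
  The centre reaches the height \<open>\<pi> / 2\<close> at most, and then the slow angles reach \<open>\<epsilon>\<^sup>a |\<beta>\<^sub>i| \<pi> / 2\<close>.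
  For \<open>a > 0\<close> this tends to zero with \<open>\<epsilon>\<close>.
\<close>

lemma small_frequency_fits_strip:
  fixes \<beta> w :: "real ^ 'm"
  assumes a: "a \<ge> 0" and wpos: "\<And>i. w $ i > 0" and width: "\<And>i. a = 0 \<Longrightarrow> w $ i > \<bar>\<beta> $ i\<bar> * pi / 2"
  obtains \<epsilon>0 :: real where "0 < \<epsilon>0" "\<epsilon>0 \<le> 1 / 100" "\<And>\<epsilon> i. 0 < \<epsilon> \<Longrightarrow> \<epsilon> \<le> \<epsilon>0 \<Longrightarrow> \<epsilon> powr a * \<bar>\<beta> $ i\<bar> * (pi / 2) < w $ i"
proof (cases "a = 0")
  case True
  show ?thesis by (rule that[of "1 / 100"]) (use width True in auto)
next
  case False
  have "\<forall>\<^sub>F \<epsilon> in at_right (0::real). \<epsilon> powr a * \<bar>\<beta> $ i\<bar> * (pi / 2) < w $ i" for i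
  proof -
    have "((\<lambda>\<epsilon>::real. \<epsilon> powr a * \<bar>\<beta> $ i\<bar> * (pi / 2)) \<longlongrightarrow> 0 powr a * \<bar>\<beta> $ i\<bar> * (pi / 2)) (at_right 0)"
      by (intro tendsto_intros tendsto_powr2) (use a False in \<open>auto simp: eventually_at_filter\<close>)
    thus ?thesis by (rule order_tendstoD(2)) (use wpos[of i] in simp)
  qed
  hence "\<forall>\<^sub>F \<epsilon> in at_right (0::real). \<forall>i. \<epsilon> powr a * \<bar>\<beta> $ i\<bar> * (pi / 2) < w $ i"
    by (rule eventually_all_finite)
  then obtain b where b: "0 < b" "\<And>\<epsilon> i. 0 < \<epsilon> \<Longrightarrow> \<epsilon> < b \<Longrightarrow> \<epsilon> powr a * \<bar>\<beta> $ i\<bar> * (pi / 2) < w $ i"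
    unfolding eventually_at_right_field by blast
  show ?thesis by (rule that[of "min (1 / 100) (b / 2)"]) (use b in auto)
qed

theorem theorem3p3:
  fixes a :: real and \<beta> w :: "real ^ 'm"
    and f :: "real \<times> (real ^ 'm) \<Rightarrow> real" and F :: "real \<times> (complex ^ 'm) \<Rightarrow> complex"
  assumes "a \<ge> 0"
    and "CARD('m) = 1 \<Longrightarrow> \<beta> = 1"
    and "\<And>i. w $ i > 0"
    and "\<And>i. a = 0 \<Longrightarrow> w $ i > \<bar>\<beta> $ i\<bar> * pi / 2"
    and "torus_periodic f"
    and "analytic_extension w f F"
    and "fourier_decay w f"
  shows "\<exists>r0>0. \<exists>\<epsilon>0>0. \<exists>C>0. \<exists>Const::real. \<forall>r\<in>{0<..r0}. \<exists>\<delta>>0.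
    \<exists>(R0 :: real \<Rightarrow> real \<Rightarrow> real ^ 'm \<Rightarrow> real) (R1 :: real \<Rightarrow> real \<Rightarrow> real ^ 'm \<Rightarrow> complex).
    \<forall>\<epsilon> \<mu>. 0 < \<epsilon> \<and> \<epsilon> \<le> \<epsilon>0 \<and> 0 < \<mu> \<and> \<mu> * \<epsilon> powr (- 3 / 2) \<le> \<delta> \<longrightarrow>
      (\<forall>A \<theta>. \<exists>!p. perturbed_separatrix r f (omega a \<beta> \<epsilon>) \<mu> A \<theta> p) \<and>
      torus_periodic (R0 \<epsilon> \<mu>) \<and> torus_periodic (R1 \<epsilon> \<mu>) \<and>
      (\<forall>A2. \<bar>R0 \<epsilon> \<mu> A2\<bar> \<le> C * (\<mu>\<^sup>2 * (sup_norm_D w F)\<^sup>2)) \<and>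
      (\<forall>A2. cmod (R1 \<epsilon> \<mu> A2)
          \<le> C * (\<mu>\<^sup>2 * (sup_norm_D w F)\<^sup>2 / \<epsilon>\<^sup>2 * exp (- pi / (2 * sqrt \<epsilon>)))) \<and>
      (\<forall>A1 A2.
        cmod (of_real (G_tilde r f (omega a \<beta> \<epsilon>) \<mu> (A1, A2))
            - (of_real Const
               + (of_real \<mu> * melnikov_coeff f (omega a \<beta> \<epsilon>) 0 A2 + of_real (R0 \<epsilon> \<mu> A2))
               + of_real (2 * Re ((of_real \<mu> * melnikov_coeff f (omega a \<beta> \<epsilon>) 1 A2
                                   + R1 \<epsilon> \<mu> A2) * cis A1))))
          \<le> C * (\<mu> * \<epsilon> powr (- 1 / 2) * sup_norm_D w F * exp (- pi / sqrt \<epsilon>)))"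
proof -
  define M0 where "M0 = sup_norm_D w F"
  have bdd: "bdd_above (cmod ` F ` D_dom w)" by (rule extension_bounded[OF assms(6,3,5)])
  have FM0: "cmod (F p) \<le> M0" if "p \<in> D_dom w" for p
    unfolding M0_def sup_norm_D_def by (rule cSUP_upper[OF that]) (use bdd in \<open>simp add: image_image\<close>)
  have "(0, 0) \<in> D_dom w" using assms(3) by (simp add: D_dom_def strip_def less_imp_le)
  from FM0[OF this] have M0: "0 \<le> M0" using norm_ge_zero order_trans by blast
  obtain \<epsilon>0 where e0: "0 < \<epsilon>0" "\<epsilon>0 \<le> 1 / 100" "\<And>\<epsilon> i. 0 < \<epsilon> \<Longrightarrow> \<epsilon> \<le> \<epsilon>0 \<Longrightarrow> \<epsilon> powr a * \<bar>\<beta> $ i\<bar> * (pi / 2) < w $ i"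
    using small_frequency_fits_strip[OF assms(1,3,4)] by metis
  \<comment> \<open>\<open>exp 18 = exp (2 * 9)\<close> stems from the distance \<open>9 \<surd>\<epsilon>\<close> between the height that is used and \<open>\<pi> / 2\<close>.\<close>
  define C :: real where "C = 10 ^ 46 * exp 18"
  have C: "0 < C" "10 ^ 46 \<le> C" "10 ^ 46 * exp 9 \<le> C" "8 * 10 ^ 14 * exp 18 \<le> C"
    by (simp_all add: C_def)
  have main: "(\<forall>A \<theta>. \<exists>!p. perturbed_separatrix r f (omega a \<beta> \<epsilon>) \<mu> A \<theta> p) \<and>
      torus_periodic (\<lambda>A2. Re (remainder_coeff r f (omega a \<beta> \<epsilon>) \<mu> 0 A2)) \<and> torus_periodic (remainder_coeff r f (omega a \<beta> \<epsilon>) \<mu> 1) \<and>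
      (\<forall>A2. \<bar>Re (remainder_coeff r f (omega a \<beta> \<epsilon>) \<mu> 0 A2)\<bar> \<le> C * (\<mu>\<^sup>2 * M0\<^sup>2)) \<and>
      (\<forall>A2. cmod (remainder_coeff r f (omega a \<beta> \<epsilon>) \<mu> 1 A2) \<le> C * (\<mu>\<^sup>2 * M0\<^sup>2 / \<epsilon>\<^sup>2 * exp (- pi / (2 * sqrt \<epsilon>)))) \<and>
      (\<forall>A1 A2.
        cmod (of_real (G_tilde r f (omega a \<beta> \<epsilon>) \<mu> (A1, A2))
            - (of_real 8 + (of_real \<mu> * melnikov_coeff f (omega a \<beta> \<epsilon>) 0 A2 + of_real (Re (remainder_coeff r f (omega a \<beta> \<epsilon>) \<mu> 0 A2)))
               + of_real (2 * Re ((of_real \<mu> * melnikov_coeff f (omega a \<beta> \<epsilon>) 1 A2 + remainder_coeff r f (omega a \<beta> \<epsilon>) \<mu> 1 A2) * cis A1))))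
          \<le> C * (\<mu> * \<epsilon> powr (- 1 / 2) * M0 * exp (- pi / sqrt \<epsilon>)))"
    if r: "0 < r" "r \<le> 1 / 2000" and eps: "0 < \<epsilon>" "\<epsilon> \<le> \<epsilon>0" and mu: "0 < \<mu>"
      and small: "\<mu> * \<epsilon> powr (- 3 / 2) \<le> min (1 / 10 ^ 32) (r / 10 ^ 23) / (M0 + 1)" for r \<epsilon> \<mu>
  proof -
    define s where "s = sqrt \<epsilon>"
    have s: "0 < s" "s ^ 3 \<le> 1" using eps e0(2) by (auto simp: s_def intro!: power_le_one real_le_lsqrt)
    have pw: "\<epsilon> powr (- 1 / 2) = 1 / s" "\<epsilon> powr (- 3 / 2) = 1 / s ^ 3"
    proof -
      have s2: "s = \<epsilon> powr (1 / 2)" using eps by (simp add: s_def powr_half_sqrt)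
      show "\<epsilon> powr (- 1 / 2) = 1 / s" unfolding s2 using eps by (simp add: powr_minus_divide)
      have "s ^ 3 = \<epsilon> powr (3 / 2)" unfolding s2 using eps by (simp add: powr_power)
      thus "\<epsilon> powr (- 3 / 2) = 1 / s ^ 3" using eps by (simp add: powr_minus_divide)
    qed
    have loc: "fast_forced_pendulum a \<beta> w f F M' \<epsilon> \<mu> r" if M': "M0 < M'" "M' \<le> M0 + 1" for M'
    proof -
      have "\<mu> / s ^ 3 * M' \<le> \<mu> / s ^ 3 * (M0 + 1)" using M' mu s by (intro mult_left_mono) auto
      also have "\<dots> \<le> min (1 / 10 ^ 32) (r / 10 ^ 23)" using small M0 unfolding pw by (simp add: pos_le_divide_eq)
      finally have "\<mu> * M' / s ^ 3 \<le> min (1 / 10 ^ 32) (r / 10 ^ 23)" by simp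
      hence 1: "\<mu> * M' \<le> min (1 / 10 ^ 32) (r / 10 ^ 23) * s ^ 3" by (rule pos_divide_le_eq[OF zero_less_power[OF s(1)], THEN iffD1])
      have "min (1 / 10 ^ 32) (r / 10 ^ 23) * s ^ 3 \<le> 1 / 10 ^ 32 * s ^ 3" using s(1) by (intro mult_right_mono) auto
      hence 2: "\<mu> * M' \<le> s ^ 3 / 10 ^ 32" using 1 by simp
      have "min (1 / 10 ^ 32) (r / 10 ^ 23) * s ^ 3 \<le> r / 10 ^ 23 * 1" using s r by (intro mult_mono) auto
      hence 3: "\<mu> * M' \<le> r / 10 ^ 23" using 1 by simp
      show ?thesis
      proof
        show "cmod (F p) \<le> M'" if "p \<in> D_dom w" for p using FM0[OF that] M'(1) by linarith
        show "\<mu> * M' \<le> sqrt \<epsilon> ^ 3 / 10 ^ 32" using 2 by (simp add: s_def)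
      qed (use assms eps e0 mu M0 M' r 3 in auto)
    qed
    have R0: "\<bar>Re (remainder_coeff r f (omega a \<beta> \<epsilon>) \<mu> 0 A2)\<bar> \<le> C * (\<mu>\<^sup>2 * M0\<^sup>2)" for A2
    proof -
      have "cmod (remainder_coeff r f (omega a \<beta> \<epsilon>) \<mu> 0 A2) \<le> (10 ^ 46 * \<mu>\<^sup>2) * M0\<^sup>2"
      proof (rule le_limit_power)
        fix M' assume "M0 < M'" "M' \<le> M0 + 1"
        then interpret fast_forced_pendulum a \<beta> w f F M' \<epsilon> \<mu> r by (rule loc)
        show "cmod (remainder_coeff r f (omega a \<beta> \<epsilon>) \<mu> 0 A2) \<le> (10 ^ 46 * \<mu>\<^sup>2) * M'\<^sup>2"
          using remainder_coeff_0[of A2] by (simp add: \<omega>_def power_mult_distrib mult_ac)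
      qed
      moreover have "10 ^ 46 * (\<mu>\<^sup>2 * M0\<^sup>2) \<le> C * (\<mu>\<^sup>2 * M0\<^sup>2)" using C(2) by (rule mult_right_mono) simp
      ultimately show ?thesis using abs_Re_le_cmod[of "remainder_coeff r f (omega a \<beta> \<epsilon>) \<mu> 0 A2"] by simp
    qed
    have R1: "cmod (remainder_coeff r f (omega a \<beta> \<epsilon>) \<mu> 1 A2) \<le> C * (\<mu>\<^sup>2 * M0\<^sup>2 / \<epsilon>\<^sup>2 * exp (- pi / (2 * sqrt \<epsilon>)))" for A2
    proof -
      define X where "X = \<mu>\<^sup>2 / \<epsilon>\<^sup>2 * exp (- pi / (2 * sqrt \<epsilon>))"
      have X: "0 \<le> X" by (simp add: X_def)
      have "cmod (remainder_coeff r f (omega a \<beta> \<epsilon>) \<mu> 1 A2) \<le> (10 ^ 46 * exp 9 * X) * M0\<^sup>2"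
      proof (rule le_limit_power)
        fix M' assume "M0 < M'" "M' \<le> M0 + 1"
        then interpret fast_forced_pendulum a \<beta> w f F M' \<epsilon> \<mu> r by (rule loc)
        have eq: "10 ^ 46 * (\<mu> * M' / \<epsilon>)\<^sup>2 * (exp 9 * exp (- pi / (2 * sqrt \<epsilon>))) = (10 ^ 46 * exp 9 * X) * M'\<^sup>2"
          unfolding X_def power_divide power_mult_distrib by simp
        show "cmod (remainder_coeff r f (omega a \<beta> \<epsilon>) \<mu> 1 A2) \<le> (10 ^ 46 * exp 9 * X) * M'\<^sup>2"
          using remainder_coeff_1[of A2] unfolding \<omega>_def eq .
      qed
      also have "\<dots> = 10 ^ 46 * exp 9 * (X * M0\<^sup>2)" by simp
      also have "\<dots> \<le> C * (X * M0\<^sup>2)" using C(3) X by (intro mult_right_mono) auto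
      also have "X * M0\<^sup>2 = \<mu>\<^sup>2 * M0\<^sup>2 / \<epsilon>\<^sup>2 * exp (- pi / (2 * sqrt \<epsilon>))" by (simp add: X_def)
      finally show ?thesis .
    qed
    have expn: "cmod (of_real (G_tilde r f (omega a \<beta> \<epsilon>) \<mu> (A1, A2))
            - (of_real 8 + (of_real \<mu> * melnikov_coeff f (omega a \<beta> \<epsilon>) 0 A2 + of_real (Re (remainder_coeff r f (omega a \<beta> \<epsilon>) \<mu> 0 A2)))
               + of_real (2 * Re ((of_real \<mu> * melnikov_coeff f (omega a \<beta> \<epsilon>) 1 A2 + remainder_coeff r f (omega a \<beta> \<epsilon>) \<mu> 1 A2) * cis A1))))
          \<le> C * (\<mu> * \<epsilon> powr (- 1 / 2) * M0 * exp (- pi / sqrt \<epsilon>))" (is "cmod ?E \<le> _") for A1 A2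
    proof -
      define X where "X = \<mu> / s * exp (- pi / sqrt \<epsilon>)"
      have X: "0 \<le> X" using mu s by (simp add: X_def)
      have "cmod ?E \<le> (8 * 10 ^ 14 * exp 18 * X) * M0 ^ 1"
      proof (rule le_limit_power)
        fix M' assume "M0 < M'" "M' \<le> M0 + 1"
        then interpret fast_forced_pendulum a \<beta> w f F M' \<epsilon> \<mu> r by (rule loc)
        have "8 * 10 ^ 14 * (\<mu> * M' / e) * (exp 18 * exp (- pi / sqrt \<epsilon>)) = (8 * 10 ^ 14 * exp 18 * X) * M' ^ 1"
          unfolding X_def s_def e_def by simp
        thus "cmod ?E \<le> (8 * 10 ^ 14 * exp 18 * X) * M' ^ 1"
          using two_harmonics[of A1 A2] unfolding \<omega>_def by simp
      qed
      also have "\<dots> = 8 * 10 ^ 14 * exp 18 * (X * M0)" by simp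
      also have "\<dots> \<le> C * (X * M0)" using C(4) X M0 by (intro mult_right_mono) auto
      also have "X * M0 = \<mu> * \<epsilon> powr (- 1 / 2) * M0 * exp (- pi / sqrt \<epsilon>)" unfolding pw by (simp add: X_def)
      finally show ?thesis .
    qed
    have ex1: "\<exists>!p. perturbed_separatrix r f (omega a \<beta> \<epsilon>) \<mu> A \<theta> p" for A \<theta>
    proof -
      interpret fast_forced_pendulum a \<beta> w f F "M0 + 1" \<epsilon> \<mu> r by (rule loc) auto
      show ?thesis using sep_ex1 unfolding \<omega>_def .
    qed
    have T: "torus_periodic (remainder_coeff r f (omega a \<beta> \<epsilon>) \<mu> k)" for k by (rule torus_periodic_remainder_coeff[OF assms(5)])
    hence "torus_periodic (\<lambda>A2. Re (remainder_coeff r f (omega a \<beta> \<epsilon>) \<mu> 0 A2))" by (simp add: torus_periodic_def)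
    thus ?thesis using ex1 T R0 R1 expn by (intro conjI allI)
  qed
  show ?thesis unfolding M0_def[symmetric]
  proof (rule exI[of _ "1 / 2000"], rule conjI, simp, rule exI[of _ \<epsilon>0], rule conjI, rule e0(1), rule exI[of _ C], rule conjI, rule C(1),
      rule exI[of _ 8], intro ballI)
    fix r :: real assume r: "r \<in> {0<..1 / 2000}"
    \<comment> \<open>The first term makes the iteration converge, the second keeps its solution within \<open>r\<close> of the separatrix; \<open>M0 + 1\<close> bounds all bounds \<open>M\<close> in use.\<close>
    define \<delta> where "\<delta> = min (1 / 10 ^ 32) (r / 10 ^ 23) / (M0 + 1)"
    have "0 < \<delta>" unfolding \<delta>_def using r M0 by (intro divide_pos_pos) auto
    show "\<exists>\<delta>>0. \<exists>(R0 :: real \<Rightarrow> real \<Rightarrow> real ^ 'm \<Rightarrow> real) (R1 :: real \<Rightarrow> real \<Rightarrow> real ^ 'm \<Rightarrow> complex).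
    \<forall>\<epsilon> \<mu>. 0 < \<epsilon> \<and> \<epsilon> \<le> \<epsilon>0 \<and> 0 < \<mu> \<and> \<mu> * \<epsilon> powr (- 3 / 2) \<le> \<delta> \<longrightarrow>
      (\<forall>A \<theta>. \<exists>!p. perturbed_separatrix r f (omega a \<beta> \<epsilon>) \<mu> A \<theta> p) \<and>
      torus_periodic (R0 \<epsilon> \<mu>) \<and> torus_periodic (R1 \<epsilon> \<mu>) \<and>
      (\<forall>A2. \<bar>R0 \<epsilon> \<mu> A2\<bar> \<le> C * (\<mu>\<^sup>2 * M0\<^sup>2)) \<and>
      (\<forall>A2. cmod (R1 \<epsilon> \<mu> A2) \<le> C * (\<mu>\<^sup>2 * M0\<^sup>2 / \<epsilon>\<^sup>2 * exp (- pi / (2 * sqrt \<epsilon>)))) \<and>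
      (\<forall>A1 A2.
        cmod (of_real (G_tilde r f (omega a \<beta> \<epsilon>) \<mu> (A1, A2))
            - (of_real 8
               + (of_real \<mu> * melnikov_coeff f (omega a \<beta> \<epsilon>) 0 A2 + of_real (R0 \<epsilon> \<mu> A2))
               + of_real (2 * Re ((of_real \<mu> * melnikov_coeff f (omega a \<beta> \<epsilon>) 1 A2
                                   + R1 \<epsilon> \<mu> A2) * cis A1))))
          \<le> C * (\<mu> * \<epsilon> powr (- 1 / 2) * M0 * exp (- pi / sqrt \<epsilon>)))"
      apply (rule exI[of _ \<delta>], rule conjI[OF \<open>0 < \<delta>\<close>])
      apply (rule exI[of _ "\<lambda>\<epsilon> \<mu> A2. Re (remainder_coeff r f (omega a \<beta> \<epsilon>) \<mu> 0 A2)"])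
      apply (rule exI[of _ "\<lambda>\<epsilon> \<mu>. remainder_coeff r f (omega a \<beta> \<epsilon>) \<mu> 1"])
      apply (intro allI impI, rule main)
      using r by (auto simp only: \<delta>_def greaterThanAtMost_iff)
  qed
qed

end
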